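(* Let $$B=\begin{bmatrix}0&1&-1&0&1&-1\\-1&0&1&-1&0&1\\1&-1&0&1&-1&0\\0&1&-1&0&1&-1\\-1&0&1&-1&0&1\\1&-1&0&1&-1&0\end{bmatrix}.$$ Then the $\mathbf g$-vectors of cluster variables associated to the transpose $B^T$ are exactly all coordinate permutations, by elements of the group $\langle(14),(25),(36),(123)(456)\rangle$, of the following vectors, where $b/a$ varies over all standard forms of rational slopes with $0<\frac ba\le\infty$: 1. $\left[-\lfloor\frac{b-1}{2}\rfloor,\ \lfloor\frac a2\rfloor+1,\ \lfloor\frac{b-a}{2}\rfloor,\ -\lfloor\frac b2\rfloor,\ \lfloor\frac{a+1}{2}\rfloor,\ \lfloor\frac{b-a-1}{2}\rfloor\right]$ 2. $\left[-\lfloor\frac a2\rfloor-1,\ \lfloor\frac{b-1}{2}\rfloor,\ \lfloor\frac{a-b+1}{2}\rfloor,\ -\lfloor\frac{a+1}{2}\rfloor,\ \lfloor\frac b2\rfloor,\ \lfloor\frac{a-b}{2}\rfloor+1\right]$ 3. $\left[-\lfloor\frac b2\rfloor,\ \lfloor\frac{a+1}{2}\rfloor,\ \lfloor\frac{b-a+1}{2}\rfloor,\ -\lfloor\frac{b+1}{2}\rfloor,\ \lfloor\frac a2\rfloor,\ \lfloor\frac{b-a}{2}\rfloor\right]$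
   Context: A rational slope is an element of $\mathbb Q\cup\{\infty\}$; its standard form is $b/a$ with $a\ge0$ and $b$ integers, $b=1$ if $a=0$ (slope $\infty$), and $\gcd(a,b)=1$ if $a>0$ (with $\gcd(a,0)=a$). The $\mathbf g$-vectors are in the sense of Fomin-Zelevinsky (Cluster Algebras IV): for an $n\times n$ skew-symmetric integer matrix $C=(c_{ij})$, let $\mathcal A_\bullet(C)$ be the cluster algebra with principal coefficients at an initial seed with exchange matrix $C$, initial cluster variables $x_1,\dots,x_n$ and initial coefficients $y_1,\dots,y_n$ (so the initial extended exchange matrix is $C$ with the $n\times n$ identity matrix placed below it, and exchange relations are $x_kx'_k=(y_k\prod_i x_i^{[c_{ik}]_+}+\prod_i x_i^{[-c_{ik}]_+})/(y_k\oplus 1)$, with the tropical semifield on the initial $y_1,\dots,y_n$). Give $\mathbb Z[x_1^{\pm1},\dots,x_n^{\pm1};y_1,\dots,y_n]$ the $\mathbb Z^n$-grading with $\deg x_i=e_i$ and $\deg y_j=-(j\text{-th column of }C)$. Every cluster variable of $\mathcal A_\bullet(C)$ is homogeneous, and its degree in $\mathbb Z^n$ is its $\mathbf g$-vector. "Cluster variables associated to $B^T$" means $C=B^T$. *)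

theory Defs
  imports
    "HOL-Analysis.Cartesian_Space"
    "HOL-Library.Poly_Mapping"
    "HOL-Library.Numeral_Type"
    "HOL-Computational_Algebra.Fraction_Field"
    "HOL-Combinatorics.Cycles"
    "HOL-Algebra.Bij"
    "HOL-Algebra.Generated_Groups"
begin

section \<open>Cluster algebras with principal coefficients\<close>

text \<open>
  The index set of a cluster is a finite type \<open>'n\<close>.  Its linear order plays no mathematical
  role: it is needed only because the library proves that \<^typ>\<open>'a \<Rightarrow>\<^sub>0 'b\<close> is an integral domain
  for linearly ordered exponents.

  \<open>'n laurent\<close> is $\mathbb{Z}[x_i^{\pm1};\, y_i]$: Laurent polynomials in the \<open>x\<close>'s (outer
  exponents in \<^typ>\<open>int\<close>) whose coefficients are polynomials in the \<open>y\<close>'s (inner exponents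
  in \<^typ>\<open>nat\<close>) over the integers.  Its field of fractions is the ambient field
  $\mathbb{Q}(x_i, y_i)$.
\<close>

type_synonym 'n int_vec = "int ^ 'n"

type_synonym 'n int_mat = "int ^ 'n ^ 'n"

type_synonym 'n laurent = "('n \<Rightarrow>\<^sub>0 int) \<Rightarrow>\<^sub>0 (('n \<Rightarrow>\<^sub>0 nat) \<Rightarrow>\<^sub>0 int)"

type_synonym 'n ambient = "'n laurent fract"

definition of_laurent :: "'n::{finite,linorder} laurent \<Rightarrow> 'n ambient" where
  "of_laurent p = Fract p 1"

definition x_var :: "'n::{finite,linorder} \<Rightarrow> 'n ambient" where
  "x_var i = of_laurent (Poly_Mapping.single (Poly_Mapping.single i 1) 1)"

definition y_var :: "'n::{finite,linorder} \<Rightarrow> 'n ambient" where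
  "y_var j = of_laurent (Poly_Mapping.single 0 (Poly_Mapping.single (Poly_Mapping.single j 1) 1))"

text \<open>
  An element $\prod_j y_j^{u_j}$ of the tropical semifield on the initial \<open>y\<close>'s is represented by
  its exponent vector \<open>u\<close>.  So the semifield product is vector addition, the unit is \<open>0\<close>, the
  \<open>k\<close>-th power is \<open>k *s u\<close>, and the semifield addition is the componentwise minimum.
\<close>

type_synonym 'n trop = "'n int_vec"

definition trop_add :: "'n::finite trop \<Rightarrow> 'n trop \<Rightarrow> 'n trop" (infixl \<open>\<oplus>\<^sub>T\<close> 65) where
  "u \<oplus>\<^sub>T v = (\<chi> j. min (u $ j) (v $ j))"

definition trop_monom :: "'n::{finite,linorder} trop \<Rightarrow> 'n ambient" where
  "trop_monom u = (\<Prod>j\<in>UNIV. y_var j powi (u $ j))"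

definition pos_part :: "int \<Rightarrow> int" (\<open>[_]\<^sub>+\<close>) where
  "[c]\<^sub>+ = max c 0"

record 'n seed =
  cluster :: "'n \<Rightarrow> 'n ambient"
  coeffs :: "'n \<Rightarrow> 'n trop"
  exch_mat :: "'n int_mat"

definition initial_seed :: "'n int_mat \<Rightarrow> 'n::{finite,linorder} seed" where
  "initial_seed C = \<lparr>cluster = x_var, coeffs = (\<lambda>j. axis j 1), exch_mat = C\<rparr>"

definition mutate_mat :: "'n::finite \<Rightarrow> 'n int_mat \<Rightarrow> 'n int_mat" where
  "mutate_mat k b = (\<chi> i j.
     if i = k \<or> j = k then - (b $ i $ j)
     else b $ i $ j + sgn (b $ i $ k) * [b $ i $ k * b $ k $ j]\<^sub>+)"

text \<open>
  Coefficients mutate by $y_k' = y_k^{-1}$ and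
  $y_j' = y_j\, y_k^{[b_{kj}]_+} (y_k \oplus 1)^{-b_{kj}}$ for $j \neq k$.  In terms of exponent
  vectors this is the mutation of the lower half of the extended exchange matrix, the
  \<open>j\<close>-th column of which is the exponent vector of $y_j$.
\<close>

definition mutate_coeffs ::
    "'n::finite \<Rightarrow> 'n int_mat \<Rightarrow> ('n \<Rightarrow> 'n trop) \<Rightarrow> 'n \<Rightarrow> 'n trop" where
  "mutate_coeffs k b y = (\<lambda>j.
     if j = k then - y k
     else y j + [b $ k $ j]\<^sub>+ *s y k + (- (b $ k $ j)) *s (y k \<oplus>\<^sub>T 0))"

definition mutate_cluster ::
    "'n::{finite,linorder} \<Rightarrow> 'n int_mat \<Rightarrow> ('n \<Rightarrow> 'n trop) \<Rightarrow> ('n \<Rightarrow> 'n ambient) \<Rightarrow> 'n \<Rightarrow> 'n ambient"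
  where
  "mutate_cluster k b y x = x(k :=
     (trop_monom (y k) * (\<Prod>i\<in>UNIV. x i powi [b $ i $ k]\<^sub>+) + (\<Prod>i\<in>UNIV. x i powi [- (b $ i $ k)]\<^sub>+))
       / (trop_monom (y k \<oplus>\<^sub>T 0) * x k))"

definition mutate :: "'n::{finite,linorder} \<Rightarrow> 'n seed \<Rightarrow> 'n seed" where
  "mutate k s =
     \<lparr>cluster = mutate_cluster k (exch_mat s) (coeffs s) (cluster s),
      coeffs = mutate_coeffs k (exch_mat s) (coeffs s),
      exch_mat = mutate_mat k (exch_mat s)\<rparr>"

inductive_set seeds :: "'n int_mat \<Rightarrow> 'n::{finite,linorder} seed set"
  for C :: "'n int_mat" where
  initial: "initial_seed C \<in> seeds C"
| mutation: "s \<in> seeds C \<Longrightarrow> mutate k s \<in> seeds C"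

definition cluster_variables :: "'n int_mat \<Rightarrow> 'n::{finite,linorder} ambient set" where
  "cluster_variables C = {cluster s i | s i. s \<in> seeds C}"

section \<open>g-vectors\<close>

text \<open>The degree of the monomial $x^m y^q$, where $\deg x_i = e_i$ and $\deg y_j$ is minus the
  \<open>j\<close>-th column of \<open>C\<close>.\<close>

definition monom_degree ::
    "'n int_mat \<Rightarrow> ('n::finite \<Rightarrow>\<^sub>0 int) \<Rightarrow> ('n \<Rightarrow>\<^sub>0 nat) \<Rightarrow> 'n int_vec" where
  "monom_degree C m q =
     (\<Sum>i\<in>UNIV. Poly_Mapping.lookup m i *s axis i 1) + (\<Sum>j\<in>UNIV. int (Poly_Mapping.lookup q j) *s (- column j C))"

definition homogeneous ::
    "'n int_mat \<Rightarrow> 'n::{finite,linorder} laurent \<Rightarrow> 'n int_vec \<Rightarrow> bool" where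
  "homogeneous C p d \<longleftrightarrow>
     (\<forall>m \<in> Poly_Mapping.keys p. \<forall>q \<in> Poly_Mapping.keys (Poly_Mapping.lookup p m). monom_degree C m q = d)"

text \<open>The degree is unique because \<open>z\<close> is required to be nonzero.\<close>

definition has_degree ::
    "'n int_mat \<Rightarrow> 'n::{finite,linorder} ambient \<Rightarrow> 'n int_vec \<Rightarrow> bool" where
  "has_degree C z d \<longleftrightarrow> z \<noteq> 0 \<and> (\<exists>p. z = of_laurent p \<and> homogeneous C p d)"

definition g_vector :: "'n int_mat \<Rightarrow> 'n::{finite,linorder} ambient \<Rightarrow> 'n int_vec" where
  "g_vector C z = (THE g. has_degree C z g)"

section \<open>Rational slopes, the matrix and the permutation group\<close>

definition standard_form :: "int \<Rightarrow> int \<Rightarrow> bool" where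
  "standard_form b a \<longleftrightarrow> a \<ge> 0 \<and> (if a = 0 then b = 1 else gcd a b = 1)"

text \<open>The slope $b/a$ satisfies $0 < b/a \le \infty$, where $1/0 = \infty$.\<close>

definition positive_slope :: "int \<Rightarrow> int \<Rightarrow> bool" where
  "positive_slope b a \<longleftrightarrow> a = 0 \<or> 0 < rat_of_int b / rat_of_int a"

text \<open>
  In the type \<^typ>\<open>6\<close> the numerals \<open>1, \<dots>, 6\<close> are the six distinct elements (with \<open>6 = 0\<close>), and
  \<^const>\<open>vector\<close> puts the entries of a list at the indices \<open>1, 2, \<dots>, 6\<close> in this order.
\<close>

definition B_mat :: "int ^ 6 ^ 6" where
  "B_mat = vector
    [vector [ 0,  1, -1,  0,  1, -1],
     vector [-1,  0,  1, -1,  0,  1],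
     vector [ 1, -1,  0,  1, -1,  0],
     vector [ 0,  1, -1,  0,  1, -1],
     vector [-1,  0,  1, -1,  0,  1],
     vector [ 1, -1,  0,  1, -1,  0]]"

definition perm_group :: "(6 \<Rightarrow> 6) set" where
  "perm_group = generate (BijGroup UNIV)
     {cycle_of_list [1, 4], cycle_of_list [2, 5], cycle_of_list [3, 6],
      cycle_of_list [1, 2, 3] \<circ> cycle_of_list [4, 5, 6]}"

text \<open>Using \<open>\<sigma>\<close> or its inverse here makes no difference when \<open>\<sigma>\<close> ranges over a group.\<close>

definition permute_coords :: "('n::finite \<Rightarrow> 'n) \<Rightarrow> 'n int_vec \<Rightarrow> 'n int_vec" where
  "permute_coords \<sigma> v = (\<chi> i. v $ \<sigma> i)"

end

theory Submission
  imports Defs "HOL-Computational_Algebra.Polynomial" "HOL-Library.Multiset"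
begin

text \<open>
  The degree of a cluster variable is governed by integer vectors alone.  Besides the exchange
  matrix \<open>b\<close>, keep for every seed the exponent vectors \<open>c\<^sub>i\<close> of its coefficients and the degrees
  \<open>g\<^sub>i\<close> of its cluster variables.  If the entries of \<open>c\<^sub>k\<close> all have the sign \<open>e\<close>, then mutation at
  \<open>k\<close> replaces \<open>c\<^sub>j\<close> by \<open>c\<^sub>j + [e b\<^sub>k\<^sub>j]\<^sub>+ c\<^sub>k\<close>, \<open>c\<^sub>k\<close> by \<open>- c\<^sub>k\<close> and \<open>g\<^sub>k\<close> by
  \<open>\<Sum>\<^sub>i [e b\<^sub>k\<^sub>i]\<^sub>+ g\<^sub>i - g\<^sub>k\<close> (\<open>graded_mutate\<close>).  This holds because \<open>y\<^sub>k \<Prod>\<^sub>i x\<^sub>i\<^bsup>b\<^sub>i\<^sub>k\<^esup>\<close> has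
  degree \<open>0\<close> in every seed.  The degree is defined only for Laurent polynomials, polynomial in the
  initial coefficients, so the Laurent phenomenon (\<open>laurent_run\<close>, \<open>cluster_variable_laurent\<close>) is
  part of the argument.

  For the matrix at hand, \<open>b\<^sub>i\<^sub>j = \<omega>(c\<^sub>i, c\<^sub>j)\<close> with a fixed alternating form \<open>\<omega>\<close> of rank two.  This
  holds initially and persists under mutation, so a seed may be replaced by the multiset of its
  six pairs \<open>(c\<^sub>i, g\<^sub>i)\<close>, and the rule above becomes a mutation rule for such multisets.

  There are infinitely many of these multisets, but they have a self-similar structure.  Linear
  maps \<open>La\<close> and \<open>Ra\<close> commute with mutation; they act on slopes by \<open>(a, b) \<mapsto> (a + b, b)\<close> and
  \<open>(a, b) \<mapsto> (a, a + b)\<close>.  Up to permutations of the coordinates and one reversal, every multiset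
  that occurs is the image under a word in \<open>La\<close> and \<open>Ra\<close> of one of 126 multisets.  The words that
  may be applied to a given one form one of six simple languages, and each language comes with a
  cone of vectors that its words make nonnegative.  That the resulting collection is closed under
  mutation is a finite check (the \<open>closed_certs\<close> lemmas).  It yields two things at once: sign-coherence
  (\<open>patterned_mutation\<close>), and the fact that every degree has the right shape, which only has to be
  read off the 126 multisets (\<open>patterned_gvec\<close>).

  Conversely, one multiset is joined to its images under \<open>La\<close> and \<open>Ra\<close> by walks that stay valid
  after the application of further letters (\<open>reach_hub\<close>).  As Euclid's algorithm reduces every
  positive slope to \<open>1/1\<close> by undoing \<open>La\<close> and \<open>Ra\<close>, all vectors of the right shape occur
  (\<open>reach_g_eq_gvec\<close>).

  Finally, the right shape is the one in the three formulas.  The sum \<open>h\<close> of the six coordinates is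
  \<open>1\<close>, \<open>-1\<close> or \<open>0\<close> in the first, second and third formula.  Together with \<open>a\<close> and \<open>b\<close> it determines
  the sums of opposite coordinates \<open>g\<^sub>1 + g\<^sub>4\<close>, \<open>g\<^sub>2 + g\<^sub>5\<close>, \<open>g\<^sub>3 + g\<^sub>6\<close>; opposite coordinates differ by at
  most \<open>1\<close>, so they are known up to the swaps \<open>(14)\<close>, \<open>(25)\<close>, \<open>(36)\<close> (\<open>listed6_eq_gvec\<close>).
\<close>

section \<open>Laurent functions on positive points\<close>

text \<open>
  The Laurent phenomenon is proved for functions rather than for rational expressions: a Laurent
  polynomial is identified with the function that it defines on assignments \<open>p\<close> of field elements
  to the variables.  This keeps substitution of one cluster into another an ordinary composition.
\<close>

inductive_set laurent_fun :: "(('v \<Rightarrow> 'a::field) \<Rightarrow> 'a) set" where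
  const: "(\<lambda>p. of_int n) \<in> laurent_fun"
| var: "(\<lambda>p. p v) \<in> laurent_fun"
| inverse_var: "(\<lambda>p. inverse (p v)) \<in> laurent_fun"
| add: "f \<in> laurent_fun \<Longrightarrow> g \<in> laurent_fun \<Longrightarrow> (\<lambda>p. f p + g p) \<in> laurent_fun"
| mult: "f \<in> laurent_fun \<Longrightarrow> g \<in> laurent_fun \<Longrightarrow> (\<lambda>p. f p * g p) \<in> laurent_fun"

text \<open>
  Subtraction-free expressions never vanish on a semifield such as \<open>Pos\<close>.  Functions are compared
  only at points with coordinates in \<open>Pos\<close>, so that all clusters can be formed there without
  division by zero; infinity of \<open>Pos\<close> makes identities between polynomials hold everywhere.
\<close>

locale positive_part =
  fixes Pos :: "'a::field set"
  assumes one_pos: "1 \<in> Pos"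
    and add_pos: "a \<in> Pos \<Longrightarrow> b \<in> Pos \<Longrightarrow> a + b \<in> Pos"
    and mult_pos: "a \<in> Pos \<Longrightarrow> b \<in> Pos \<Longrightarrow> a * b \<in> Pos"
    and inverse_pos: "a \<in> Pos \<Longrightarrow> inverse a \<in> Pos"
    and zero_not_pos: "0 \<notin> Pos"
    and infinite_pos: "infinite Pos"
begin

lemma pos_nonzero: "a \<in> Pos \<Longrightarrow> a \<noteq> 0"
  using zero_not_pos by auto

lemma divide_pos: "a \<in> Pos \<Longrightarrow> b \<in> Pos \<Longrightarrow> a / b \<in> Pos"
  by (simp add: divide_inverse mult_pos inverse_pos)

lemma power_pos: "a \<in> Pos \<Longrightarrow> a ^ n \<in> Pos"
  by (induction n) (auto intro: one_pos mult_pos)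

lemma power_int_pos: "a \<in> Pos \<Longrightarrow> a powi n \<in> Pos"
  by (auto simp: power_int_def intro: power_pos inverse_pos)

lemma prod_pos: "(\<And>i. i \<in> I \<Longrightarrow> f i \<in> Pos) \<Longrightarrow> (\<Prod>i\<in>I. f i) \<in> Pos"
  by (induction I rule: infinite_finite_induct) (auto intro: one_pos mult_pos)

definition points :: "('v \<Rightarrow> 'a) set" where
  "points = {p. \<forall>v. p v \<in> Pos}"

lemma pointsD: "p \<in> points \<Longrightarrow> p v \<in> Pos"
  by (simp add: points_def)

definition laurent :: "(('v \<Rightarrow> 'a) \<Rightarrow> 'a) \<Rightarrow> bool" where
  "laurent f \<longleftrightarrow> (\<exists>F\<in>laurent_fun. \<forall>p\<in>points. f p = F p)"

lemma laurent_cong: "laurent f \<Longrightarrow> (\<And>p. p \<in> points \<Longrightarrow> g p = f p) \<Longrightarrow> laurent g"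
  unfolding laurent_def by fastforce

lemma laurent_of_int: "laurent (\<lambda>p. of_int n)"
  unfolding laurent_def by (rule bexI[of _ "\<lambda>p. of_int n"]) (simp_all add: laurent_fun.const)

lemma laurent_1: "laurent (\<lambda>p. 1)"
  using laurent_of_int[of 1] by simp

lemma laurent_var: "laurent (\<lambda>p. p v)"
  unfolding laurent_def by (rule bexI[of _ "\<lambda>p. p v"]) (simp_all add: laurent_fun.var)

lemma laurent_inverse_var: "laurent (\<lambda>p. inverse (p v))"
  unfolding laurent_def by (rule bexI[of _ "\<lambda>p. inverse (p v)"]) (simp_all add: laurent_fun.inverse_var)

lemma laurent_add: "laurent f \<Longrightarrow> laurent g \<Longrightarrow> laurent (\<lambda>p. f p + g p)"
  unfolding laurent_def using laurent_fun.add by fastforce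

lemma laurent_mult: "laurent f \<Longrightarrow> laurent g \<Longrightarrow> laurent (\<lambda>p. f p * g p)"
  unfolding laurent_def using laurent_fun.mult by fastforce

lemma laurent_minus: "laurent f \<Longrightarrow> laurent (\<lambda>p. - f p)"
  using laurent_mult[OF laurent_of_int[of "-1"]] by simp

lemma laurent_diff: "laurent f \<Longrightarrow> laurent g \<Longrightarrow> laurent (\<lambda>p. f p - g p)"
  using laurent_add[OF _ laurent_minus] by fastforce

lemma laurent_power: "laurent f \<Longrightarrow> laurent (\<lambda>p. f p ^ n)"
  by (induction n) (auto intro: laurent_1 laurent_mult)

text \<open>
  These are the functions that may be inverted freely; in applications they are Laurent monomials
  (in variables with values in \<open>Pos\<close>) or products of such.
\<close>

definition unit :: "(('v \<Rightarrow> 'a) \<Rightarrow> 'a) \<Rightarrow> bool" where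
  "unit f \<longleftrightarrow> laurent f \<and> laurent (\<lambda>p. inverse (f p)) \<and> (\<forall>p\<in>points. f p \<in> Pos)"

lemma unit_laurent: "unit f \<Longrightarrow> laurent f"
  and unit_pos: "unit f \<Longrightarrow> p \<in> points \<Longrightarrow> f p \<in> Pos"
  by (auto simp: unit_def)

lemma unit_nonzero: "unit f \<Longrightarrow> p \<in> points \<Longrightarrow> f p \<noteq> 0"
  using unit_pos pos_nonzero by blast

lemma unit_1: "unit (\<lambda>p. 1)"
  by (simp add: unit_def laurent_1 one_pos)

lemma unit_var: "unit (\<lambda>p. p v)"
  by (simp add: unit_def laurent_var laurent_inverse_var pointsD)

lemma unit_mult: "unit f \<Longrightarrow> unit g \<Longrightarrow> unit (\<lambda>p. f p * g p)"
  by (simp add: unit_def laurent_mult mult_pos)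

lemma unit_inverse: "unit f \<Longrightarrow> unit (\<lambda>p. inverse (f p))"
  by (simp add: unit_def inverse_pos)

lemma unit_divide: "unit f \<Longrightarrow> unit g \<Longrightarrow> unit (\<lambda>p. f p / g p)"
  by (simp add: divide_inverse unit_mult unit_inverse)

lemma unit_power: "unit f \<Longrightarrow> unit (\<lambda>p. f p ^ n)"
  by (induction n) (auto intro: unit_1 unit_mult)

lemma unit_power_int: "unit f \<Longrightarrow> unit (\<lambda>p. f p powi n)"
  unfolding power_int_def by (cases "n \<ge> 0") (auto intro: unit_power unit_inverse)

lemma unit_prod: "(\<And>i. i \<in> I \<Longrightarrow> unit (f i)) \<Longrightarrow> unit (\<lambda>p. \<Prod>i\<in>I. f i p)"
  by (induction I rule: infinite_finite_induct) (auto intro: unit_1 unit_mult)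

lemmas unit_intros = unit_1 unit_var unit_mult unit_inverse unit_divide unit_power unit_power_int unit_prod

section \<open>Localisation and coprimality\<close>

text \<open>The localisation of the Laurent ring at the powers of \<open>U\<close>.\<close>

definition laurent_over :: "(('v \<Rightarrow> 'a) \<Rightarrow> 'a) \<Rightarrow> (('v \<Rightarrow> 'a) \<Rightarrow> 'a) \<Rightarrow> bool" where
  "laurent_over U f \<longleftrightarrow> (\<exists>n. laurent (\<lambda>p. f p * U p ^ n))"

lemma laurent_over_laurent: "laurent f \<Longrightarrow> laurent_over U f"
  unfolding laurent_over_def by (rule exI[of _ 0]) simp

lemma laurent_over_mult:
  assumes "laurent_over U f" "laurent_over U g"
  shows "laurent_over U (\<lambda>p. f p * g p)"
proof -
  obtain m n where "laurent (\<lambda>p. f p * U p ^ m)" "laurent (\<lambda>p. g p * U p ^ n)"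
    using assms unfolding laurent_over_def by blast
  then have "laurent (\<lambda>p. (f p * U p ^ m) * (g p * U p ^ n))"
    by (rule laurent_mult)
  then show ?thesis
    unfolding laurent_over_def by (intro exI[of _ "m + n"]) (simp add: power_add ac_simps)
qed

lemma laurent_over_add:
  assumes U: "laurent U" and f: "laurent_over U f" and g: "laurent_over U g"
  shows "laurent_over U (\<lambda>p. f p + g p)"
proof -
  obtain m n where m: "laurent (\<lambda>p. f p * U p ^ m)" and n: "laurent (\<lambda>p. g p * U p ^ n)"
    using f g unfolding laurent_over_def by blast
  have "laurent (\<lambda>p. (f p * U p ^ m) * U p ^ n + (g p * U p ^ n) * U p ^ m)"
    by (intro laurent_add laurent_mult laurent_power m n U)
  then show ?thesis
    unfolding laurent_over_def
    by (intro exI[of _ "m + n"]) (simp add: power_add ac_simps ring_distribs)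
qed

text \<open>
  Substituting elements of the localisation, invertible in it, into a Laurent polynomial gives an
  element of the localisation.  With \<open>\<Phi>\<close> a change of clusters, this moves the Laurent property from
  one cluster to a neighbouring one at the price of the denominator \<open>U\<close>.
\<close>

lemma laurent_over_comp:
  assumes f: "laurent f" and U: "laurent U"
    and \<Phi>: "\<And>p. p \<in> points \<Longrightarrow> \<Phi> p \<in> points"
    and coord: "\<And>v. laurent_over U (\<lambda>p. \<Phi> p v)" "\<And>v. laurent_over U (\<lambda>p. inverse (\<Phi> p v))"
  shows "laurent_over U (\<lambda>p. f (\<Phi> p))"
proof -
  obtain F where F: "F \<in> laurent_fun" "\<forall>p\<in>points. f p = F p"
    using f unfolding laurent_def by blast
  from F(1) have "laurent_over U (\<lambda>p. F (\<Phi> p))"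
  proof induction
    case (const n)
    show ?case by (rule laurent_over_laurent[OF laurent_of_int])
  next
    case (var v)
    show ?case by (rule coord)
  next
    case (inverse_var v)
    show ?case by (rule coord)
  next
    case (add f g)
    show ?case by (rule laurent_over_add[OF U add.IH])
  next
    case (mult f g)
    show ?case by (rule laurent_over_mult[OF mult.IH])
  qed
  then obtain n where n: "laurent (\<lambda>p. F (\<Phi> p) * U p ^ n)"
    unfolding laurent_over_def by blast
  have "laurent (\<lambda>p. f (\<Phi> p) * U p ^ n)"
    by (rule laurent_cong[OF n]) (use F(2) \<Phi> in auto)
  then show ?thesis
    unfolding laurent_over_def by blast
qed

text \<open>
  This is the only consequence of coprimality that is used: a Laurent function \<open>P\<close> with \<open>P V\<close>
  divisible by \<open>U\<close> is itself divisible by \<open>U\<close>.  So no factorisation theory of the Laurent ring is needed.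
\<close>

definition coprime_to :: "(('v \<Rightarrow> 'a) \<Rightarrow> 'a) \<Rightarrow> (('v \<Rightarrow> 'a) \<Rightarrow> 'a) \<Rightarrow> bool" where
  "coprime_to U V \<longleftrightarrow> (\<forall>P Q. laurent P \<longrightarrow> laurent Q \<longrightarrow> (\<forall>p\<in>points. P p * V p = Q p * U p) \<longrightarrow>
     (\<exists>R. laurent R \<and> (\<forall>p\<in>points. P p = R p * U p)))"

lemma coprime_toD:
  assumes "coprime_to U V" "laurent P" "laurent Q" "\<And>p. p \<in> points \<Longrightarrow> P p * V p = Q p * U p"
  obtains R where "laurent R" "\<And>p. p \<in> points \<Longrightarrow> P p = R p * U p"
  using assms unfolding coprime_to_def by metis

lemma coprime_to_mult:
  assumes U: "\<And>p. p \<in> points \<Longrightarrow> U p \<noteq> 0" and V: "laurent V" and W: "laurent W"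
    and UV: "coprime_to U V" and UW: "coprime_to U W"
  shows "coprime_to U (\<lambda>p. V p * W p)"
  unfolding coprime_to_def
proof (intro allI impI)
  fix P Q assume P: "laurent P" and Q: "laurent Q" and eq: "\<forall>p\<in>points. P p * (V p * W p) = Q p * U p"
  obtain R where R: "laurent R" "\<And>p. p \<in> points \<Longrightarrow> P p * V p = R p * U p"
    by (rule coprime_toD[OF UW laurent_mult[OF P V] Q]) (use eq in \<open>auto simp: mult.assoc\<close>)
  show "\<exists>R. laurent R \<and> (\<forall>p\<in>points. P p = R p * U p)"
    using coprime_toD[OF UV P R(1)] R(2) by metis
qed

lemma coprime_to_power:
  assumes U: "\<And>p. p \<in> points \<Longrightarrow> U p \<noteq> 0" and V: "laurent V" and UV: "coprime_to U V"
  shows "coprime_to U (\<lambda>p. V p ^ n)"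
proof (induction n)
  case 0
  show ?case by (auto simp: coprime_to_def)
next
  case (Suc n)
  show ?case
    using coprime_to_mult[OF U V laurent_power[OF V] UV Suc] by simp
qed

lemma coprime_to_cancel:
  assumes U: "laurent U" "\<And>p. p \<in> points \<Longrightarrow> U p \<noteq> 0" and V: "laurent V" and UV: "coprime_to U V"
    and P: "laurent P" and Q: "laurent Q"
    and eq: "\<And>p. p \<in> points \<Longrightarrow> P p * V p ^ n = Q p * U p ^ m"
  shows "\<exists>R. laurent R \<and> (\<forall>p\<in>points. P p = R p * U p ^ m)"
  using P eq
proof (induction m arbitrary: P)
  case 0
  then show ?case by auto
next
  case (Suc m)
  have QU: "laurent (\<lambda>p. Q p * U p ^ m)"
    by (intro laurent_mult laurent_power Q U)
  obtain R where R: "laurent R" "\<And>p. p \<in> points \<Longrightarrow> P p = R p * U p"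
    by (rule coprime_toD[OF coprime_to_power[OF U(2) V UV] Suc.prems(1) QU])
      (use Suc.prems(2) in \<open>auto simp: ac_simps\<close>)
  have "R p * V p ^ n = Q p * U p ^ m" if "p \<in> points" for p
    using Suc.prems(2)[OF that] R(2)[OF that] U(2)[OF that] by (simp add: field_simps)
  from Suc.IH[OF R(1) this] show ?case
    using R(2) by (auto simp: ac_simps)
qed

text \<open>
  If \<open>f = P / U\<^sup>m = Q / V\<^sup>n\<close>, then \<open>P V\<^sup>n = Q U\<^sup>m\<close>, and coprimality lets \<open>U\<^sup>m\<close> be cancelled from \<open>P\<close>.
\<close>

lemma laurent_if_laurent_over:
  assumes U: "laurent U" "\<And>p. p \<in> points \<Longrightarrow> U p \<noteq> 0"
    and V: "laurent V" and UV: "coprime_to U V"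
    and f: "laurent_over U f" "laurent_over V f"
  shows "laurent f"
proof -
  obtain m n where mn: "laurent (\<lambda>p. f p * U p ^ m)" "laurent (\<lambda>p. f p * V p ^ n)"
    using f unfolding laurent_over_def by blast
  obtain R where R: "laurent R" "\<forall>p\<in>points. f p * U p ^ m = R p * U p ^ m"
    using coprime_to_cancel[OF U V UV mn, of n m] by (auto simp: ac_simps)
  show ?thesis
    by (rule laurent_cong[OF R(1)]) (use R(2) U(2) in auto)
qed

text \<open>If \<open>V\<close> is a unit modulo \<open>U\<close>, then \<open>P V = Q U\<close> can be solved for \<open>P\<close> as a multiple of \<open>U\<close>.\<close>

lemma comaximal_coprime_to:
  fixes U :: "('v \<Rightarrow> 'a) \<Rightarrow> 'a"
  assumes "laurent F" "laurent U" "unit E" and V: "\<And>p. p \<in> points \<Longrightarrow> V p = E p + F p * U p"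
  shows "coprime_to U V"
  unfolding coprime_to_def
proof (intro allI impI)
  fix P Q :: "('v \<Rightarrow> 'a) \<Rightarrow> 'a"
  assume P: "laurent P" and Q: "laurent Q" and eq: "\<forall>p\<in>points. P p * V p = Q p * U p"
  show "\<exists>R. laurent R \<and> (\<forall>p\<in>points. P p = R p * U p)"
  proof (intro exI conjI ballI)
    show "laurent (\<lambda>p. (Q p - P p * F p) * inverse (E p))"
      using assms P Q by (intro laurent_mult laurent_diff) (auto simp: unit_def)
    fix p :: "'v \<Rightarrow> 'a" assume p: "p \<in> points"
    have "P p * E p = (Q p - P p * F p) * U p"
      using eq[rule_format, OF p] V[OF p] by (simp add: algebra_simps)
    then show "P p = (Q p - P p * F p) * inverse (E p) * U p"
      using unit_nonzero[OF assms(3) p] by (simp add: field_simps)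
  qed
qed

text \<open>
  The next three lemmas prepare the substitution \<open>p\<^sub>v = - 1 / m\<close>, which annihilates the binomial
  \<open>1 + p\<^sub>v m\<close>.  The value \<open>- 1 / m\<close> lies outside \<open>Pos\<close>, so identities have to be carried from \<open>Pos\<close> to
  all nonzero values of one variable, as identities of polynomials.
\<close>

lemma laurent_fun_one_variable:
  assumes "F \<in> laurent_fun"
  shows "\<exists>n f. \<forall>t. t \<noteq> 0 \<longrightarrow> F (p(v := t)) * t ^ n = poly f t"
  using assms
proof induction
  case (const n)
  show ?case by (intro exI[of _ 0] exI[of _ "[:of_int n:]"]) simp
next
  case (var w)
  show ?case
    by (intro exI[of _ 0] exI[of _ "if w = v then [:0, 1:] else [:p w:]"]) simp
next
  case (inverse_var w)
  show ?case
    by (intro exI[of _ 1] exI[of _ "if w = v then [:1:] else [:0, inverse (p w):]"]) simp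
next
  case (add f g)
  from add.IH obtain m a where f: "\<And>t. t \<noteq> 0 \<Longrightarrow> f (p(v := t)) * t ^ m = poly a t" by blast
  from add.IH obtain n b where g: "\<And>t. t \<noteq> 0 \<Longrightarrow> g (p(v := t)) * t ^ n = poly b t" by blast
  have "(f (p(v := t)) + g (p(v := t))) * t ^ (m + n) = poly (a * monom 1 n + b * monom 1 m) t" if "t \<noteq> 0" for t
  proof -
    have "(f (p(v := t)) + g (p(v := t))) * t ^ (m + n) = (f (p(v := t)) * t ^ m) * t ^ n + (g (p(v := t)) * t ^ n) * t ^ m"
      by (simp only: power_add ring_distribs ac_simps)
    then show ?thesis
      by (simp only: f[OF that] g[OF that] poly_add poly_mult poly_monom mult_1_left)
  qed
  then show ?case by blast
next
  case (mult f g)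
  from mult.IH obtain m a where f: "\<And>t. t \<noteq> 0 \<Longrightarrow> f (p(v := t)) * t ^ m = poly a t" by blast
  from mult.IH obtain n b where g: "\<And>t. t \<noteq> 0 \<Longrightarrow> g (p(v := t)) * t ^ n = poly b t" by blast
  have "(f (p(v := t)) * g (p(v := t))) * t ^ (m + n) = poly (a * b) t" if "t \<noteq> 0" for t
  proof -
    have "(f (p(v := t)) * g (p(v := t))) * t ^ (m + n) = (f (p(v := t)) * t ^ m) * (g (p(v := t)) * t ^ n)"
      by (simp only: power_add ac_simps)
    then show ?thesis
      by (simp only: f[OF that] g[OF that] poly_mult)
  qed
  then show ?case by blast
qed

lemma laurent_fun_vanish:
  assumes "F \<in> laurent_fun" and "\<And>t. t \<in> Pos \<Longrightarrow> F (p(v := t)) = 0" and "t \<noteq> 0"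
  shows "F (p(v := t)) = 0"
proof -
  obtain n f where f: "\<And>t. t \<noteq> 0 \<Longrightarrow> F (p(v := t)) * t ^ n = poly f t"
    using laurent_fun_one_variable[OF assms(1)] by blast
  have "poly f t = 0" if "t \<in> Pos" for t
    using f[of t] assms(2)[OF that] pos_nonzero[OF that] by simp
  then have "Pos \<subseteq> {t. poly f t = 0}" by blast
  then have "f = 0"
    using infinite_pos poly_roots_finite finite_subset by blast
  then show ?thesis
    using f[OF assms(3)] assms(3) by simp
qed

text \<open>
  A Laurent function differs from its value at \<open>p\<^sub>v = - 1 / m\<close> by a multiple of \<open>1 + p\<^sub>v m\<close>, the
  analogue of the factor theorem.
\<close>

lemma laurent_fun_substitute:
  fixes m :: "('v \<Rightarrow> 'a) \<Rightarrow> 'a"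
  assumes "F \<in> laurent_fun" and m: "laurent m" "laurent (\<lambda>p. inverse (m p))" "\<And>p. p \<in> points \<Longrightarrow> m p \<noteq> 0"
  shows "\<exists>R. laurent R \<and> (\<forall>p\<in>points. F p - F (p(v := - inverse (m p))) = R p * (1 + p v * m p))"
    (is "\<exists>R. ?P F R")
  using assms(1)
proof induction
  case (const n)
  show ?case using laurent_of_int[of 0] by force
next
  case (var w)
  show ?case
  proof (cases "w = v")
    case True
    show ?thesis
      by (rule exI[of _ "\<lambda>p. inverse (m p)"]) (use m True in \<open>auto simp: field_simps\<close>)
  next
    case False
    then show ?thesis using laurent_of_int[of 0] by force
  qed
next
  case (inverse_var w)
  show ?case
  proof (cases "w = v")
    case True
    show ?thesis
      by (rule exI[of _ "\<lambda>p. inverse (p v)"])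
        (use m True laurent_inverse_var pointsD pos_nonzero in \<open>fastforce simp: field_simps\<close>)
  next
    case False
    then show ?thesis using laurent_of_int[of 0] by force
  qed
next
  case (add f g)
  then obtain R S where RS: "?P f R" "?P g S" by blast
  then show ?case
    by (intro exI[of _ "\<lambda>p. R p + S p"]) (auto intro: laurent_add simp: algebra_simps)
next
  case (mult f g)
  then obtain R S where RS: "?P f R" "?P g S" by blast
  let ?s = "\<lambda>p. p(v := - inverse (m p))"
  have g: "laurent g" using mult.hyps unfolding laurent_def by blast
  have f: "laurent f" using mult.hyps unfolding laurent_def by blast
  have fs: "f (?s p) = f p - R p * (1 + p v * m p)" if "p \<in> points" for p
    using RS(1) that by (simp add: algebra_simps fun_upd_def)
  have gs: "g (?s p) = g p - S p * (1 + p v * m p)" if "p \<in> points" for p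
    using RS(2) that by (simp add: algebra_simps fun_upd_def)
  show ?case
  proof (intro exI conjI ballI)
    show "laurent (\<lambda>p. R p * g p + f p * S p - R p * S p * (1 + p v * m p))"
      using RS f g m by (intro laurent_add laurent_mult laurent_diff laurent_1 laurent_var) auto
    fix p :: "'v \<Rightarrow> 'a" assume p: "p \<in> points"
    show "f p * g p - f (?s p) * g (?s p) = (R p * g p + f p * S p - R p * S p * (1 + p v * m p)) * (1 + p v * m p)"
      unfolding fs[OF p] gs[OF p] by (simp add: algebra_simps)
  qed
qed

lemma laurent_fun_laurent: "f \<in> laurent_fun \<Longrightarrow> laurent f"
  unfolding laurent_def by blast

text \<open>
  Substituting \<open>p\<^sub>v = - 1 / m\<close> in \<open>P W = Q (1 + p\<^sub>v m)\<close> kills the right-hand side but leaves \<open>W\<close>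
  unchanged, so \<open>P\<close> vanishes there and is a multiple of the binomial.
\<close>

lemma coprime_to_binomials:
  assumes m: "m \<in> laurent_fun" "(\<lambda>p. inverse (m p)) \<in> laurent_fun" "\<And>p t. m (p(v := t)) = m p"
      "\<And>p. p \<in> points \<Longrightarrow> m p \<in> Pos"
    and W: "W \<in> laurent_fun" "\<And>p t. W (p(v := t)) = W p" "\<And>p. p \<in> points \<Longrightarrow> W p \<noteq> 0"
  shows "coprime_to (\<lambda>p. 1 + p v * m p) W"
  unfolding coprime_to_def
proof (intro allI impI)
  fix P Q assume "laurent P" "laurent Q" and eq: "\<forall>p\<in>points. P p * W p = Q p * (1 + p v * m p)"
  then obtain F G where F: "F \<in> laurent_fun" "\<forall>p\<in>points. P p = F p" and G: "G \<in> laurent_fun" "\<forall>p\<in>points. Q p = G p"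
    unfolding laurent_def by blast
  let ?H = "\<lambda>p. F p * W p + of_int (-1) * (G p * (of_int 1 + p v * m p))"
  have H: "?H \<in> laurent_fun"
    by (intro laurent_fun.intros F G W m)
  have sub: "F (p(v := - inverse (m p))) = 0" if p: "p \<in> points" for p
  proof -
    have mp: "m p \<noteq> 0" using m(4)[OF p] pos_nonzero by blast
    have "?H (p(v := - inverse (m p))) = 0"
    proof (rule laurent_fun_vanish[OF H])
      fix t assume "t \<in> Pos"
      then have "p(v := t) \<in> points"
        using p by (auto simp: points_def)
      then show "?H (p(v := t)) = 0"
        using eq F(2) G(2) by force
    qed (use mp in simp)
    then show ?thesis
      using mp W(3)[OF p] by (simp add: m(3) W(2))
  qed
  obtain R where R: "laurent R" "\<And>p. p \<in> points \<Longrightarrow> F p - F (p(v := - inverse (m p))) = R p * (1 + p v * m p)"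
    using laurent_fun_substitute[OF F(1), of m v] m pos_nonzero laurent_fun_laurent by metis
  show "\<exists>R. laurent R \<and> (\<forall>p\<in>points. P p = R p * (1 + p v * m p))"
    using R F(2) sub by force
qed

end

section \<open>Mutation with arbitrary normalisation\<close>

text \<open>
  The elements usually written $\hat y_k$.  They mutate like coefficients without normalisation,
  whatever the normalisation of the \<open>y\<close>'s is, and this is what makes them useful.
\<close>

definition yhat :: "'n::finite int_mat \<Rightarrow> ('n \<Rightarrow> 'a::field) \<Rightarrow> ('n \<Rightarrow> 'a) \<Rightarrow> 'n \<Rightarrow> 'a" where
  "yhat b x y k = y k * (\<Prod>i\<in>UNIV. x i powi (b $ i $ k))"

text \<open>
  The exchange relation, with an arbitrary factor \<open>\<mu>\<close> in place of $y_k \oplus 1$.  The Laurent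
  phenomenon holds for any choice of these factors among Laurent monomials in the coefficients, and
  the freedom of choice is needed in its proof to mutate back to the starting seed.
\<close>

definition mut_x :: "'n::finite int_mat \<Rightarrow> 'a::field \<Rightarrow> 'n \<Rightarrow> ('n \<Rightarrow> 'a) \<Rightarrow> ('n \<Rightarrow> 'a) \<Rightarrow> 'n \<Rightarrow> 'a" where
  "mut_x b \<mu> k x y = x(k :=
     (y k * (\<Prod>i\<in>UNIV. x i powi [b $ i $ k]\<^sub>+) + (\<Prod>i\<in>UNIV. x i powi [- (b $ i $ k)]\<^sub>+)) / (\<mu> * x k))"

definition mut_y :: "'n::finite int_mat \<Rightarrow> 'a::field \<Rightarrow> 'n \<Rightarrow> ('n \<Rightarrow> 'a) \<Rightarrow> 'n \<Rightarrow> 'a" where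
  "mut_y b \<mu> k y = (\<lambda>j. if j = k then inverse (y k)
     else y j * y k powi [b $ k $ j]\<^sub>+ * \<mu> powi (- (b $ k $ j)))"

definition skew :: "'n::finite int_mat \<Rightarrow> bool" where
  "skew b \<longleftrightarrow> (\<forall>i j. b $ j $ i = - (b $ i $ j))"

lemma skewD: "skew b \<Longrightarrow> b $ j $ i = - (b $ i $ j)"
  unfolding skew_def by blast

lemma skew_diag: "skew b \<Longrightarrow> b $ k $ k = 0"
  by (rule equal_neg_zero[THEN iffD1, OF skewD])

lemma mutate_mat_nth:
  "mutate_mat k b $ i $ j = (if i = k \<or> j = k then - (b $ i $ j)
     else b $ i $ j + sgn (b $ i $ k) * [b $ i $ k * b $ k $ j]\<^sub>+)"
  by (simp add: mutate_mat_def)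

lemma pos_part_diff: "[c]\<^sub>+ = c + [- c]\<^sub>+"
  by (simp add: pos_part_def max_def)

text \<open>The two customary forms of matrix mutation agree.\<close>

lemma mutate_mat_entry_eq:
  "sgn (a::int) * [a * c]\<^sub>+ = a * [c]\<^sub>+ + c * [- a]\<^sub>+"
proof -
  consider "0 < a" "0 \<le> c" | "0 < a" "c < 0" | "a = 0" | "a < 0" "0 \<le> c" | "a < 0" "c < 0" by linarith
  then show ?thesis
  proof cases
    case 1
    then show ?thesis using mult_nonneg_nonneg[of a c] by (simp add: pos_part_def)
  next
    case 2
    then show ?thesis using mult_pos_neg[of a c] by (simp add: pos_part_def)
  next
    case 4
    then show ?thesis using mult_nonpos_nonneg[of a c] by (simp add: pos_part_def)
  next
    case 5
    then show ?thesis using mult_neg_neg[of a c] by (simp add: pos_part_def)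
  qed (simp add: pos_part_def)
qed

lemma skew_mutate_mat:
  assumes "skew b"
  shows "skew (mutate_mat k b)"
proof -
  have "mutate_mat k b $ j $ i = - (mutate_mat k b $ i $ j)" for i j
  proof (cases "i = k \<or> j = k")
    case True
    then have "mutate_mat k b $ j $ i = - (b $ j $ i)" "mutate_mat k b $ i $ j = - (b $ i $ j)"
      by (auto simp: mutate_mat_nth)
    then show ?thesis
      by (simp only: skewD[OF assms, of j i])
  next
    case False
    then have 1: "mutate_mat k b $ j $ i = b $ j $ i + (b $ j $ k * [b $ k $ i]\<^sub>+ + b $ k $ i * [- (b $ j $ k)]\<^sub>+)"
      and 2: "mutate_mat k b $ i $ j = b $ i $ j + (b $ i $ k * [b $ k $ j]\<^sub>+ + b $ k $ j * [- (b $ i $ k)]\<^sub>+)"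
      by (simp_all add: mutate_mat_nth mutate_mat_entry_eq)
    show ?thesis
      unfolding 1 2 skewD[OF assms, of j i] skewD[OF assms, of j k] skewD[OF assms, of k i]
      using pos_part_diff[of "b $ i $ k"] pos_part_diff[of "b $ k $ j"]
      by (simp add: algebra_simps)
  qed
  then show ?thesis
    unfolding skew_def by blast
qed

lemma mutate_mat_involution: "mutate_mat k (mutate_mat k b) = b"
proof -
  have "mutate_mat k (mutate_mat k b) $ i $ j = b $ i $ j" for i j
    by (cases "i = k \<or> j = k") (simp_all add: mutate_mat_nth sgn_minus)
  then show ?thesis
    by (simp add: vec_eq_iff)
qed

lemma power_int_prod: "(\<Prod>i\<in>I. f i) powi n = (\<Prod>i\<in>I. f i powi n)" for f :: "'i \<Rightarrow> 'a::field"
  by (induction I rule: infinite_finite_induct) (simp_all add: power_int_mult_distrib)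

lemma prod_UNIV_remove:
  fixes f :: "'n::finite \<Rightarrow> 'a::comm_monoid_mult"
  shows "(\<Prod>i\<in>UNIV. f i) = f k * (\<Prod>i\<in>-{k}. f i)"
  by (subst prod.remove[of _ k]) (auto simp: Compl_eq_Diff_UNIV)

context
  fixes b :: "'n::finite int_mat" and x y :: "'n \<Rightarrow> 'a::field"
  assumes skew: "skew b" and x: "\<And>i. x i \<noteq> 0" and y: "\<And>i. y i \<noteq> 0"
begin

lemma yhat_remove: "yhat b x y k = y k * (\<Prod>i\<in>-{k}. x i powi (b $ i $ k))"
  by (simp add: yhat_def prod_UNIV_remove[of _ k] skew_diag[OF skew])

lemma yhat_nonzero: "yhat b x y k \<noteq> 0"
  by (simp add: yhat_def x y)

lemma mut_x_same:
  "mut_x b \<mu> k x y k = (1 + yhat b x y k) * (\<Prod>i\<in>-{k}. x i powi [- (b $ i $ k)]\<^sub>+) / (\<mu> * x k)"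
proof -
  have "x i powi [b $ i $ k]\<^sub>+ = x i powi (b $ i $ k) * x i powi [- (b $ i $ k)]\<^sub>+" for i
    by (subst pos_part_diff) (simp add: power_int_add x)
  then have "(\<Prod>i\<in>UNIV. x i powi [b $ i $ k]\<^sub>+) =
      (\<Prod>i\<in>UNIV. x i powi (b $ i $ k)) * (\<Prod>i\<in>UNIV. x i powi [- (b $ i $ k)]\<^sub>+)"
    by (simp add: prod.distrib)
  moreover have "(\<Prod>i\<in>UNIV. x i powi [- (b $ i $ k)]\<^sub>+) = (\<Prod>i\<in>-{k}. x i powi [- (b $ i $ k)]\<^sub>+)"
    by (simp add: prod_UNIV_remove[of _ k] skew_diag[OF skew] pos_part_def)
  ultimately show ?thesis
    by (simp add: mut_x_def yhat_def algebra_simps)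
qed

lemma mut_x_other: "j \<noteq> k \<Longrightarrow> mut_x b \<mu> k x y j = x j"
  by (simp add: mut_x_def)

lemma yhat_mutate_same:
  "yhat (mutate_mat k b) (mut_x b \<mu> k x y) (mut_y b \<mu> k y) k = inverse (yhat b x y k)"
proof -
  have "(\<Prod>i\<in>-{k}. mut_x b \<mu> k x y i powi (mutate_mat k b $ i $ k)) = (\<Prod>i\<in>-{k}. inverse (x i powi (b $ i $ k)))"
    by (intro prod.cong) (auto simp: mut_x_other mutate_mat_nth power_int_minus)
  then show ?thesis
    by (simp add: yhat_def prod_UNIV_remove[of _ k] mutate_mat_nth skew_diag[OF skew] mut_y_def
        prod_inversef[unfolded o_def])
qed

text \<open>
  The factor \<open>x\<^sub>k'\<close> contributes a power of \<open>\<mu>\<close> that cancels the one in the new \<open>y\<^sub>j\<close>, and a monomial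
  in the other variables that turns the power of \<open>y\<^sub>k\<close> into a power of \<open>yhat\<close> at \<open>k\<close>.
\<close>

lemma yhat_mutate_other:
  assumes \<mu>: "\<mu> \<noteq> 0" and one: "1 + yhat b x y k \<noteq> 0" and jk: "j \<noteq> k"
  shows "yhat (mutate_mat k b) (mut_x b \<mu> k x y) (mut_y b \<mu> k y) j =
    yhat b x y j * yhat b x y k powi [b $ k $ j]\<^sub>+ * (1 + yhat b x y k) powi (- (b $ k $ j))"
proof -
  let ?c = "b $ k $ j" and ?h = "yhat b x y k"
  define A where "A = (\<Prod>i\<in>-{k}. x i powi (b $ i $ j))"
  define B where "B = (\<Prod>i\<in>-{k}. x i powi (b $ i $ k))"
  define C where "C = (\<Prod>i\<in>-{k}. x i powi [- (b $ i $ k)]\<^sub>+)"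
  have nz: "A \<noteq> 0" "B \<noteq> 0" "C \<noteq> 0" by (auto simp: A_def B_def C_def x)
  have "mut_x b \<mu> k x y i powi (mutate_mat k b $ i $ j) =
      x i powi (b $ i $ j) * (x i powi (b $ i $ k)) powi [?c]\<^sub>+ * (x i powi [- (b $ i $ k)]\<^sub>+) powi ?c"
    if "i \<in> -{k}" for i
    using that jk x by (simp add: mut_x_other mutate_mat_nth mutate_mat_entry_eq power_int_add
        mult.commute[of ?c] flip: power_int_mult)
  then have 1: "(\<Prod>i\<in>-{k}. mut_x b \<mu> k x y i powi (mutate_mat k b $ i $ j)) = A * B powi [?c]\<^sub>+ * C powi ?c"
    by (simp add: A_def B_def C_def prod.distrib power_int_prod)
  have h: "?h = y k * B" by (simp add: yhat_remove B_def)
  have 2: "yhat b x y j = y j * (x k powi ?c * A)"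
    by (simp add: yhat_def prod_UNIV_remove[of _ k] A_def)
  have 3: "mut_x b \<mu> k x y k powi (mutate_mat k b $ k $ j) =
      (1 + ?h) powi (- ?c) * C powi (- ?c) * \<mu> powi ?c * x k powi ?c"
    unfolding mut_x_same C_def[symmetric]
    by (simp add: mutate_mat_nth power_int_divide_distrib power_int_mult_distrib power_int_minus
        divide_inverse power_int_inverse)
  have 4: "mut_y b \<mu> k y j = y j * y k powi [?c]\<^sub>+ * \<mu> powi (- ?c)"
    using jk by (simp add: mut_y_def)
  have 5: "\<mu> powi (- ?c) * \<mu> powi ?c = 1" "C powi (- ?c) * C powi ?c = 1"
    using \<mu> nz by (simp_all add: power_int_minus)
  have "yhat (mutate_mat k b) (mut_x b \<mu> k x y) (mut_y b \<mu> k y) j =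
     (y j * y k powi [?c]\<^sub>+ * \<mu> powi (- ?c)) *
     (((1 + ?h) powi (- ?c) * C powi (- ?c) * \<mu> powi ?c * x k powi ?c) * (A * B powi [?c]\<^sub>+ * C powi ?c))"
    unfolding yhat_def[of "mutate_mat k b"] prod_UNIV_remove[of _ k] 1 3 4 ..
  also have "\<dots> = (y j * (x k powi ?c * A)) * (y k powi [?c]\<^sub>+ * B powi [?c]\<^sub>+) * (1 + ?h) powi (- ?c) *
      (\<mu> powi (- ?c) * \<mu> powi ?c) * (C powi (- ?c) * C powi ?c)"
    by (simp only: ac_simps)
  also have "\<dots> = yhat b x y j * ?h powi [?c]\<^sub>+ * (1 + ?h) powi (- ?c)"
    unfolding 5 2[symmetric] by (simp add: h power_int_mult_distrib)
  finally show ?thesis .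
qed

end

section \<open>The Laurent phenomenon\<close>

text \<open>
  Besides the cluster \<open>X\<close> and the coefficients \<open>Y\<close> there is a block \<open>Z\<close> of variables that do not
  mutate.  Normalising factors may involve them; for principal coefficients they are specialised to
  the initial coefficients, while the \<open>Y\<close>'s stay independent during the induction.
\<close>

datatype 'n var = XV 'n | YV 'n | ZV 'n

type_synonym 'n step = "'n \<times> int \<times> ('n \<Rightarrow> int)"

text \<open>
  A step \<open>(k, i, u)\<close> mutates at \<open>k\<close> with the normalising factor \<open>y\<^sub>k\<^sup>i \<Prod>\<^sub>j z\<^sub>j\<^bsup>u j\<^esup>\<close>.  The first exponent is
  there for the steps with \<open>i = 1\<close> and \<open>u = 0\<close>, which undo a mutation with factor \<open>1\<close>.
\<close>

definition normaliser :: "'n::finite step \<Rightarrow> ('n \<Rightarrow> 'a::field) \<Rightarrow> ('n \<Rightarrow> 'a) \<Rightarrow> 'a" where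
  "normaliser st z y = y (fst st) powi fst (snd st) * (\<Prod>j\<in>UNIV. z j powi snd (snd st) j)"

fun run :: "'n::finite step list \<Rightarrow> ('n \<Rightarrow> 'a::field) \<Rightarrow> 'n int_mat \<Rightarrow> ('n \<Rightarrow> 'a) \<Rightarrow> ('n \<Rightarrow> 'a) \<Rightarrow> 'n \<Rightarrow> 'a" where
  "run [] z b x y = x"
| "run (st # ps) z b x y =
     run ps z (mutate_mat (fst st) b) (mut_x b (normaliser st z y) (fst st) x y) (mut_y b (normaliser st z y) (fst st) y)"

lemma mutate_back:
  fixes x y :: "'n::finite \<Rightarrow> 'a::field"
  assumes b: "skew b" and x: "\<And>i. x i \<noteq> 0" and y: "\<And>i. y i \<noteq> 0" and h: "1 + yhat b x y k \<noteq> 0"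
  shows "mut_x (mutate_mat k b) (inverse (y k)) k (mut_x b 1 k x y) (mut_y b 1 k y) = x" (is "?x = x")
    and "mut_y (mutate_mat k b) (inverse (y k)) k (mut_y b 1 k y) = y" (is "?y = y")
proof -
  let ?M = "\<Prod>i\<in>UNIV. x i powi [b $ i $ k]\<^sub>+" and ?N = "\<Prod>i\<in>UNIV. x i powi [- (b $ i $ k)]\<^sub>+"
  have N: "?N \<noteq> 0" by (simp add: x)
  have "?M = (\<Prod>i\<in>UNIV. x i powi (b $ i $ k)) * ?N"
    by (subst pos_part_diff) (simp add: power_int_add x prod.distrib)
  then have "y k * ?M + ?N = (1 + yhat b x y k) * ?N"
    by (simp add: yhat_def algebra_simps)
  then have nz: "y k * ?M + ?N \<noteq> 0" using h N by simp
  have "(\<Prod>i\<in>UNIV. mut_x b 1 k x y i powi [mutate_mat k b $ i $ k]\<^sub>+) = ?N"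
    by (simp add: prod_UNIV_remove[of _ k] mutate_mat_nth skew_diag[OF b] mut_x_def pos_part_def
        cong: prod.cong_simp)
  moreover have "(\<Prod>i\<in>UNIV. mut_x b 1 k x y i powi [- (mutate_mat k b $ i $ k)]\<^sub>+) = ?M"
    by (simp add: prod_UNIV_remove[of _ k] mutate_mat_nth skew_diag[OF b] mut_x_def pos_part_def
        cong: prod.cong_simp)
  moreover have "(inverse (y k) * ?N + ?M) / (inverse (y k) * ((y k * ?M + ?N) / (1 * x k))) = x k"
  proof -
    have "inverse (y k) * ?N + ?M = inverse (y k) * (y k * ?M + ?N)"
      using y[of k] by (simp add: ring_distribs)
    then show ?thesis
      using nz y[of k] by simp
  qed
  ultimately have "?x k = x k"
    by (simp add: mut_x_def mut_y_def)
  then show "?x = x"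
    by (auto simp: mut_x_def fun_eq_iff)
  have "y j * y k powi [b $ k $ j]\<^sub>+ * inverse (y k) powi [- (b $ k $ j)]\<^sub>+ * inverse (y k) powi (b $ k $ j) = y j" for j
  proof -
    have "y k powi [b $ k $ j]\<^sub>+ = y k powi (b $ k $ j) * y k powi [- (b $ k $ j)]\<^sub>+"
      by (subst pos_part_diff) (simp add: power_int_add y)
    then show ?thesis using y[of k] by (simp add: power_int_inverse field_simps)
  qed
  then show "?y = y"
    by (auto simp: mut_y_def fun_eq_iff mutate_mat_nth)
qed

context positive_part
begin

lemma yhat_pos: "(\<And>i. x i \<in> Pos) \<Longrightarrow> (\<And>i. y i \<in> Pos) \<Longrightarrow> yhat b x y k \<in> Pos"
  unfolding yhat_def by (intro mult_pos prod_pos power_int_pos)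

lemma mut_x_pos: "(\<And>i. x i \<in> Pos) \<Longrightarrow> (\<And>i. y i \<in> Pos) \<Longrightarrow> \<mu> \<in> Pos \<Longrightarrow> mut_x b \<mu> k x y i \<in> Pos"
  unfolding mut_x_def by (simp add: divide_pos mult_pos add_pos prod_pos power_int_pos)

lemma unit_yhat: "(\<And>i. unit (\<lambda>p. x p i)) \<Longrightarrow> (\<And>i. unit (\<lambda>p. y p i)) \<Longrightarrow> unit (\<lambda>p. yhat b (x p) (y p) k)"
  unfolding yhat_def by (intro unit_intros)

lemma unit_normaliser: "(\<And>i. unit (\<lambda>p. z p i)) \<Longrightarrow> (\<And>i. unit (\<lambda>p. y p i)) \<Longrightarrow> unit (\<lambda>p. normaliser st (z p) (y p))"
  unfolding normaliser_def by (intro unit_intros)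

lemma unit_mut_y: "(\<And>i. unit (\<lambda>p. y p i)) \<Longrightarrow> unit \<mu> \<Longrightarrow> unit (\<lambda>p. mut_y b (\<mu> p) k (y p) j)"
  unfolding mut_y_def by (cases "j = k") (simp_all add: unit_inverse unit_mult unit_power_int)

text \<open>A power is determined modulo \<open>U\<^sup>2\<close> by its base modulo \<open>U\<^sup>2\<close>.\<close>

lemma power_mod_square:
  assumes "laurent g" "laurent U" "laurent T"
  shows "\<exists>S. laurent S \<and> (\<forall>p. (g p + U p ^ 2 * T p) ^ j = g p ^ j + U p ^ 2 * S p)"
proof (induction j)
  case 0
  show ?case using laurent_of_int[of 0] by (intro exI[of _ "\<lambda>p. 0"]) simp
next
  case (Suc j)
  then obtain S where S: "laurent S" "\<forall>p. (g p + U p ^ 2 * T p) ^ j = g p ^ j + U p ^ 2 * S p" by blast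
  have "laurent (\<lambda>p. T p * (g p ^ j + U p ^ 2 * S p) + g p * S p)"
    by (intro laurent_add laurent_mult laurent_power assms S)
  moreover have "(g p + U p ^ 2 * T p) ^ Suc j = g p ^ Suc j + U p ^ 2 * (T p * (g p ^ j + U p ^ 2 * S p) + g p * S p)" for p
    by (simp add: S(2)) (simp add: algebra_simps)
  ultimately show ?case by blast
qed

lemma coprime_to_unit_mult:
  assumes "coprime_to U V" "unit E" "\<And>p. p \<in> points \<Longrightarrow> W p = E p * V p"
  shows "coprime_to U W"
  unfolding coprime_to_def
proof (intro allI impI)
  fix P Q assume P: "laurent P" and Q: "laurent Q" and eq: "\<forall>p\<in>points. P p * W p = Q p * U p"
  have Q': "laurent (\<lambda>p. Q p * inverse (E p))"
    using Q assms(2) by (intro laurent_mult) (auto simp: unit_def)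
  have "P p * V p = Q p * inverse (E p) * U p" if "p \<in> points" for p
    using eq assms(3) unit_nonzero[OF assms(2) that] that by (auto simp: field_simps)
  then show "\<exists>R. laurent R \<and> (\<forall>p\<in>points. P p = R p * U p)"
    using coprime_toD[OF assms(1) P Q'] by metis
qed

text \<open>
  The computation in rank two behind the Laurent phenomenon.  Here \<open>\<alpha>\<close> and \<open>\<beta>\<close> are the elements
  \<open>yhat\<close> at two indices \<open>k\<close> and \<open>l\<close> with \<open>c = b\<^sub>k\<^sub>l\<close>, and \<open>\<beta>1\<close> is the element at \<open>l\<close> after mutation at
  \<open>k\<close>.  Up to units, \<open>U\<close>, \<open>v\<close> and \<open>w\<close> are the new cluster variables that arise from mutating at \<open>k\<close>, \<open>l\<close>
  and \<open>k\<close> again.  The variable \<open>w\<close> is defined by a quotient by \<open>U\<close>; it is Laurent since the numerator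
  is divisible by \<open>U\<close>.  Each of \<open>v\<close> and \<open>w\<close> is a unit modulo \<open>U\<close>, or a unit times \<open>1 + \<beta>\<close>; the
  latter can happen only for \<open>\<bar>c\<bar> \<le> 1\<close>.
\<close>

lemma rank_two:
  fixes \<alpha> \<beta> :: "('v \<Rightarrow> 'a) \<Rightarrow> 'a" and c :: int
  defines "U \<equiv> \<lambda>p. 1 + \<alpha> p" and "m \<equiv> nat c" and "n \<equiv> nat (- c)"
  defines "v \<equiv> \<lambda>p. U p ^ m + \<beta> p * \<alpha> p ^ m * U p ^ n"
  assumes \<alpha>: "unit \<alpha>" and \<beta>: "unit \<beta>" and cop: "coprime_to U (\<lambda>p. 1 + \<beta> p)"
  shows "coprime_to U v"
    and "\<exists>w. laurent w \<and> coprime_to U w \<and> (\<forall>p\<in>points. \<forall>\<beta>1. \<beta>1 = \<beta> p * \<alpha> p ^ m * U p powi (- c) \<longrightarrow>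
          \<alpha> p * (1 + inverse (\<alpha> p) * \<beta>1 ^ m * (1 + \<beta>1) powi (- c)) * v p ^ m = w p * U p)"
proof -
  have U: "laurent U" unfolding U_def by (intro laurent_add laurent_1 unit_laurent \<alpha>)
  have Upos: "U p \<in> Pos" if "p \<in> points" for p
    using that unfolding U_def by (intro add_pos one_pos unit_pos \<alpha>)
  have U0: "U p \<noteq> 0" if "p \<in> points" for p using Upos[OF that] pos_nonzero by blast
  note [intro] = laurent_add laurent_mult laurent_power laurent_1 unit_laurent[OF \<alpha>] unit_laurent[OF \<beta>] U
  have a0: "\<alpha> p \<noteq> 0" if "p \<in> points" for p using unit_nonzero[OF \<alpha> that] .
  consider "c = 0" | "c > 0" | "c < 0" by linarith
  then have "coprime_to U v \<and> (\<exists>w. laurent w \<and> coprime_to U w \<and> (\<forall>p\<in>points. \<forall>\<beta>1. \<beta>1 = \<beta> p * \<alpha> p ^ m * U p powi (- c) \<longrightarrow>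
          \<alpha> p * (1 + inverse (\<alpha> p) * \<beta>1 ^ m * (1 + \<beta>1) powi (- c)) * v p ^ m = w p * U p))"
  proof cases
    case 1
    then have mn: "m = 0" "n = 0" by (simp_all add: m_def n_def)
    have "coprime_to U (\<lambda>p. 1)"
      by (rule comaximal_coprime_to[of "\<lambda>p. 0" _ "\<lambda>p. 1"]) (use laurent_of_int[of 0] unit_1 U in auto)
    moreover have "\<alpha> p * (1 + inverse (\<alpha> p)) = 1 * U p" if "p \<in> points" for p
      using a0[OF that] by (simp add: U_def field_simps)
    ultimately show ?thesis
      using cop 1 laurent_1 by (auto simp: v_def mn intro!: exI[of _ "\<lambda>p. 1"])
  next
    case 2
    then obtain m' where m': "m = Suc m'" by (cases m) (auto simp: m_def)
    have n0: "n = 0" and cm: "c = int m" using 2 by (simp_all add: n_def m_def)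
    define \<gamma> where "\<gamma> = (\<lambda>p. \<beta> p * \<alpha> p ^ m)"
    have \<gamma>: "unit \<gamma>" unfolding \<gamma>_def by (intro unit_intros \<alpha> \<beta>)
    have v: "v p = \<gamma> p + U p ^ m' * U p" for p by (simp add: v_def n0 \<gamma>_def m')
    have copv: "coprime_to U v"
      by (rule comaximal_coprime_to[OF _ U \<gamma> v]) auto
    have key: "\<alpha> p * (1 + inverse (\<alpha> p) * \<beta>1 ^ m * (1 + \<beta>1) powi (- c)) * v p ^ m = \<alpha> p * v p ^ m + \<gamma> p ^ m"
      if p: "p \<in> points" and b1: "\<beta>1 = \<beta> p * \<alpha> p ^ m * U p powi (- c)" for p \<beta>1
    proof -
      have 1: "\<beta>1 = \<gamma> p / U p ^ m" by (simp add: b1 \<gamma>_def cm power_int_minus field_simps)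
      have vp: "v p \<in> Pos"
        unfolding v_def using p by (intro add_pos mult_pos power_pos Upos unit_pos[OF \<alpha>] unit_pos[OF \<beta>])
      have 2: "1 + \<beta>1 = v p / U p ^ m"
        using U0[OF p] by (simp add: 1 v m' field_simps)
      have "(1 + \<beta>1) powi (- c) = (U p ^ m) ^ m / v p ^ m"
        by (simp add: 2 cm power_int_minus power_divide)
      moreover have "\<beta>1 ^ m = \<gamma> p ^ m / (U p ^ m) ^ m"
        by (simp add: 1 power_divide)
      moreover have "(U p ^ m) ^ m \<noteq> 0" "v p ^ m \<noteq> 0" using U0[OF p] vp pos_nonzero by auto
      ultimately show ?thesis
        using a0[OF p] by (simp add: field_simps)
    qed
    show ?thesis
    proof (cases "m' = 0")
      case True
      then have m1: "m = 1" by (simp add: m')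
      have "coprime_to U (\<lambda>p. \<alpha> p * (1 + \<beta> p))"
        by (rule coprime_to_unit_mult[OF cop \<alpha>]) simp
      moreover have "\<alpha> p * v p ^ m + \<gamma> p ^ m = \<alpha> p * (1 + \<beta> p) * U p" for p
        by (simp add: m1 v_def n0 \<gamma>_def U_def algebra_simps)
      moreover have "laurent (\<lambda>p. \<alpha> p * (1 + \<beta> p))"
        by (intro laurent_mult laurent_add laurent_1 unit_laurent \<alpha> \<beta>)
      ultimately show ?thesis
        using copv key by (intro conjI exI[of _ "\<lambda>p. \<alpha> p * (1 + \<beta> p)"]) auto
    next
      case False
      then obtain m'' where m'': "m = Suc (Suc m'')" using m' by (cases m') auto
      have v2: "v p = \<gamma> p + U p ^ 2 * U p ^ m''" for p
        by (simp add: v_def n0 \<gamma>_def m'' power2_eq_square)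
      obtain S where S: "laurent S" "\<And>p. v p ^ m = \<gamma> p ^ m + U p ^ 2 * S p"
        using power_mod_square[OF unit_laurent[OF \<gamma>] U laurent_power[OF U], of m'' m] unfolding v2 by blast
      have eq: "\<alpha> p * v p ^ m + \<gamma> p ^ m = (\<gamma> p ^ m + \<alpha> p * S p * U p) * U p" for p
        unfolding S(2) by (simp add: U_def power2_eq_square algebra_simps)
      have S': "laurent (\<lambda>p. \<alpha> p * S p)" by (intro laurent_mult S unit_laurent \<alpha>)
      have "coprime_to U (\<lambda>p. \<gamma> p ^ m + \<alpha> p * S p * U p)"
        by (rule comaximal_coprime_to[OF S' U unit_power[OF \<gamma>]]) simp
      moreover have "laurent (\<lambda>p. \<gamma> p ^ m + \<alpha> p * S p * U p)"
        by (intro laurent_add laurent_power laurent_mult U S unit_laurent \<gamma> \<alpha>)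
      ultimately show ?thesis
        using copv key eq by (intro conjI exI[of _ "\<lambda>p. \<gamma> p ^ m + \<alpha> p * S p * U p"]) auto
    qed
  next
    case 3
    then obtain n' where n': "n = Suc n'" by (cases n) (auto simp: n_def)
    have m0: "m = 0" and cn: "c = - int n" using 3 by (simp_all add: n_def m_def)
    have v: "v p = 1 + \<beta> p * U p ^ n' * U p" for p by (simp add: v_def m0 n')
    have copv: "coprime_to U v"
      by (rule comaximal_coprime_to[OF _ U unit_1 v]) (intro laurent_mult laurent_power U unit_laurent \<beta>)
    have key: "\<alpha> p * (1 + inverse (\<alpha> p) * \<beta>1 ^ m * (1 + \<beta>1) powi (- c)) * v p ^ m = \<alpha> p + v p ^ n"
      if p: "p \<in> points" and b1: "\<beta>1 = \<beta> p * \<alpha> p ^ m * U p powi (- c)" for p \<beta>1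
    proof -
      have "1 + \<beta>1 = v p" by (simp add: b1 m0 cn v_def)
      then show ?thesis using a0[OF p] by (simp add: m0 cn field_simps)
    qed
    show ?thesis
    proof (cases "n' = 0")
      case True
      then have n1: "n = 1" by (simp add: n')
      have "\<alpha> p + v p ^ n = (1 + \<beta> p) * U p" for p
        by (simp add: n1 v_def m0 U_def algebra_simps)
      moreover have "laurent (\<lambda>p. 1 + \<beta> p)" by auto
      ultimately show ?thesis
        using copv key cop by (intro conjI exI[of _ "\<lambda>p. 1 + \<beta> p"]) auto
    next
      case False
      then obtain n'' where n'': "n = Suc (Suc n'')" using n' by (cases n') auto
      have v2: "v p = 1 + U p ^ 2 * (\<beta> p * U p ^ n'')" for p
        by (simp add: v_def m0 n'' power2_eq_square)
      have T: "laurent (\<lambda>p. \<beta> p * U p ^ n'')"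
        by (intro laurent_mult laurent_power U unit_laurent \<beta>)
      obtain S where S: "laurent S" "\<And>p. v p ^ n = 1 + U p ^ 2 * S p"
        using power_mod_square[OF laurent_1 U T, of n] unfolding v2 by auto
      have eq: "\<alpha> p + v p ^ n = (1 + S p * U p) * U p" for p
        unfolding S(2) by (simp add: U_def power2_eq_square algebra_simps)
      have "coprime_to U (\<lambda>p. 1 + S p * U p)"
        by (rule comaximal_coprime_to[OF S(1) U unit_1]) simp
      moreover have "laurent (\<lambda>p. 1 + S p * U p)"
        by (intro laurent_add laurent_mult laurent_1 S U)
      ultimately show ?thesis
        using copv key eq by (intro conjI exI[of _ "\<lambda>p. 1 + S p * U p"]) auto
    qed
  qed
  then show "coprime_to U v"
    and "\<exists>w. laurent w \<and> coprime_to U w \<and> (\<forall>p\<in>points. \<forall>\<beta>1. \<beta>1 = \<beta> p * \<alpha> p ^ m * U p powi (- c) \<longrightarrow>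
          \<alpha> p * (1 + inverse (\<alpha> p) * \<beta>1 ^ m * (1 + \<beta>1) powi (- c)) * v p ^ m = w p * U p)"
    by blast+
qed

lemma laurent_fun_power: "f \<in> laurent_fun \<Longrightarrow> (\<lambda>p. f p ^ n) \<in> laurent_fun"
proof (induction n)
  case 0
  show ?case using laurent_fun.const[of 1] by simp
next
  case (Suc n)
  then show ?case by (simp add: laurent_fun.mult)
qed

lemma laurent_fun_prod: "(\<And>i. i \<in> I \<Longrightarrow> f i \<in> laurent_fun) \<Longrightarrow> (\<lambda>p. \<Prod>i\<in>I. f i p) \<in> laurent_fun"
proof (induction I rule: infinite_finite_induct)
  case (insert i I)
  then show ?case by (simp add: laurent_fun.mult)
qed (use laurent_fun.const[of 1] in simp_all)

lemma laurent_fun_power_int_var: "(\<lambda>p. p v powi n) \<in> laurent_fun"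
  unfolding power_int_def
  by (cases "n \<ge> 0") (simp_all add: laurent_fun_power laurent_fun.var laurent_fun.inverse_var)

text \<open>
  If \<open>f\<close> is a unit times \<open>W\<close>, then \<open>f\<close> becomes invertible in the localisation at any multiple of \<open>W\<close>.
\<close>

lemma laurent_over_unit_multiple:
  assumes E: "unit E" and W: "laurent W" "\<And>p. p \<in> points \<Longrightarrow> W p \<noteq> 0" and V: "laurent V"
    and D: "\<And>p. p \<in> points \<Longrightarrow> D p = W p * V p"
    and f: "\<And>p. p \<in> points \<Longrightarrow> f p = E p * W p"
  shows "laurent_over D f" "laurent_over D (\<lambda>p. inverse (f p))"
proof -
  have "laurent (\<lambda>p. E p * W p)" by (intro laurent_mult W unit_laurent E)
  then have "laurent f" by (rule laurent_cong) (rule f)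
  then show "laurent_over D f" by (rule laurent_over_laurent)
  have "laurent (\<lambda>p. inverse (E p) * V p)" by (intro laurent_mult V unit_laurent unit_inverse E)
  then have "laurent (\<lambda>p. inverse (f p) * D p ^ 1)"
    by (rule laurent_cong) (use W(2) in \<open>auto simp: f D\<close>)
  then show "laurent_over D (\<lambda>p. inverse (f p))"
    unfolding laurent_over_def by blast
qed

lemma laurent_over_unit:
  assumes "unit f"
  shows "laurent_over D f" "laurent_over D (\<lambda>p. inverse (f p))"
  using assms by (auto intro: laurent_over_laurent simp: unit_def)

definition Xs :: "('n var \<Rightarrow> 'a) \<Rightarrow> 'n \<Rightarrow> 'a" where "Xs p i = p (XV i)"
definition Ys :: "('n var \<Rightarrow> 'a) \<Rightarrow> 'n \<Rightarrow> 'a" where "Ys p i = p (YV i)"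
definition Zs :: "('n var \<Rightarrow> 'a) \<Rightarrow> 'n \<Rightarrow> 'a" where "Zs p i = p (ZV i)"
definition point_of :: "('n \<Rightarrow> 'a) \<Rightarrow> ('n \<Rightarrow> 'a) \<Rightarrow> ('n \<Rightarrow> 'a) \<Rightarrow> 'n var \<Rightarrow> 'a" where
  "point_of x y z v = (case v of XV i \<Rightarrow> x i | YV i \<Rightarrow> y i | ZV i \<Rightarrow> z i)"

lemma point_of_simps [simp]: "Xs (point_of x y z) = x" "Ys (point_of x y z) = y" "Zs (point_of x y z) = z"
  by (simp_all add: Xs_def Ys_def Zs_def point_of_def fun_eq_iff)

lemma unit_Xs: "unit (\<lambda>p. Xs p i)" and unit_Ys: "unit (\<lambda>p. Ys p i)" and unit_Zs: "unit (\<lambda>p. Zs p i)"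
  by (simp_all add: Xs_def Ys_def Zs_def unit_var)

text \<open>Composition with a change of clusters, applied to the end result of a path of mutations.\<close>

lemma laurent_over_run:
  fixes b :: "'n::finite int_mat"
  assumes IH: "laurent (\<lambda>p. run ps (Zs p) b (Xs p) (Ys p) i)" and D: "laurent D"
    and pos: "\<And>p i. p \<in> points \<Longrightarrow> x p i \<in> Pos"
    and x: "\<And>i. laurent_over D (\<lambda>p. x p i)" "\<And>i. laurent_over D (\<lambda>p. inverse (x p i))"
    and y: "\<And>i. unit (\<lambda>p. y p i)"
  shows "laurent_over D (\<lambda>p. run ps (Zs p) b (x p) (y p) i)"
proof -
  have "laurent_over D (\<lambda>p. (\<lambda>q. run ps (Zs q) b (Xs q) (Ys q) i) (point_of (x p) (y p) (Zs p)))"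
  proof (rule laurent_over_comp[OF IH D])
    show "point_of (x p) (y p) (Zs p) \<in> points" if "p \<in> points" for p
      using that pos[OF that] unit_pos[OF y that] pointsD[OF that]
      by (auto simp: points_def point_of_def Zs_def split: var.split)
    show "laurent_over D (\<lambda>p. point_of (x p) (y p) (Zs p) v)" "laurent_over D (\<lambda>p. inverse (point_of (x p) (y p) (Zs p) v))" for v
      by (cases v; simp add: point_of_def x laurent_over_unit[OF y] laurent_over_unit[OF unit_Zs])+
  qed
  then show ?thesis by simp
qed

text \<open>
  The inductive step of the Laurent phenomenon for a path that starts in the distinct directions
  \<open>k\<close> and \<open>l\<close>.  The final variable \<open>f\<close> is Laurent in the cluster after the first mutation, since the
  remaining path is shorter.  Mutating the cluster after the second step once more at \<open>k\<close> gives a third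
  cluster; mutating back at \<open>k\<close> and following the rest of the path is again a shorter path, so \<open>f\<close>
  is Laurent in the third cluster as well.  In terms of the initial cluster the first denominator
  is \<open>U\<close>, the second one \<open>v w\<close>, and these are coprime by \<open>rank_two\<close>.
\<close>

lemma laurent_run_Cons_Cons:
  fixes b :: "'n::finite int_mat"
  assumes b: "skew b" and kl: "fst s1 \<noteq> fst s2"
    and IH1: "laurent (\<lambda>p. run (s2 # ps) (Zs p) (mutate_mat (fst s1) b) (Xs p) (Ys p) i)"
    and IH3: "laurent (\<lambda>p. run ((fst s1, 1, \<lambda>_. 0) # ps) (Zs p)
        (mutate_mat (fst s1) (mutate_mat (fst s2) (mutate_mat (fst s1) b))) (Xs p) (Ys p) i)"
  shows "laurent (\<lambda>p. run (s1 # s2 # ps) (Zs p) b (Xs p) (Ys p) i)"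
proof -
  define k l where "k = fst s1" and "l = fst s2"
  have kl: "k \<noteq> l" using kl by (simp add: k_def l_def)
  define b1 b2 b3 where "b1 = mutate_mat k b" and "b2 = mutate_mat l b1" and "b3 = mutate_mat k b2"
  define c where "c = b $ k $ l"
  define m n where "m = nat c" and "n = nat (- c)"
  define \<mu>1 where "\<mu>1 = (\<lambda>p. normaliser s1 (Zs p) (Ys p :: 'n \<Rightarrow> 'a))"
  define x1 where "x1 = (\<lambda>p. mut_x b (\<mu>1 p) k (Xs p) (Ys p))"
  define y1 where "y1 = (\<lambda>p. mut_y b (\<mu>1 p) k (Ys p))"
  define \<mu>2 where "\<mu>2 = (\<lambda>p. normaliser s2 (Zs p) (y1 p))"
  define x2 where "x2 = (\<lambda>p. mut_x b1 (\<mu>2 p) l (x1 p) (y1 p))"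
  define y2 where "y2 = (\<lambda>p. mut_y b1 (\<mu>2 p) l (y1 p))"
  define x3 where "x3 = (\<lambda>p. mut_x b2 1 k (x2 p) (y2 p))"
  define y3 where "y3 = (\<lambda>p. mut_y b2 1 k (y2 p))"
  define f where "f = (\<lambda>p. run (s1 # s2 # ps) (Zs p) b (Xs p) (Ys p) i)"
  have skew: "skew b1" "skew b2"
    by (simp_all add: b1_def b2_def skew_mutate_mat b)
  have unit\<mu>1: "unit \<mu>1" unfolding \<mu>1_def by (intro unit_normaliser unit_Zs unit_Ys)
  have unity1: "unit (\<lambda>p. y1 p j)" for j unfolding y1_def by (intro unit_mut_y unit_Ys unit\<mu>1)
  have unit\<mu>2: "unit \<mu>2" unfolding \<mu>2_def by (intro unit_normaliser unit_Zs unity1)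
  have unity2: "unit (\<lambda>p. y2 p j)" for j unfolding y2_def by (intro unit_mut_y unity1 unit\<mu>2)
  have unity3: "unit (\<lambda>p. y3 p j)" for j unfolding y3_def by (intro unit_mut_y unity2 unit_1)
  note ypos = unit_pos[OF unit_Ys] unit_pos[OF unity1] unit_pos[OF unity2]
  have xpos: "Xs p j \<in> Pos" if "p \<in> points" for p j using unit_pos[OF unit_Xs that] .
  have x1pos: "x1 p j \<in> Pos" if "p \<in> points" for p j
    unfolding x1_def using that by (intro mut_x_pos xpos ypos unit_pos[OF unit\<mu>1])
  have x2pos: "x2 p j \<in> Pos" if "p \<in> points" for p j
    unfolding x2_def using that by (intro mut_x_pos x1pos ypos unit_pos[OF unit\<mu>2])
  have x3pos: "x3 p j \<in> Pos" if "p \<in> points" for p j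
    unfolding x3_def using that by (intro mut_x_pos x2pos ypos one_pos)
  define \<alpha> \<beta> where "\<alpha> = (\<lambda>p. yhat b (Xs p) (Ys p) k)" and "\<beta> = (\<lambda>p. yhat b (Xs p) (Ys p) l)"
  have \<alpha>: "unit \<alpha>" and \<beta>: "unit \<beta>" unfolding \<alpha>_def \<beta>_def by (intro unit_yhat unit_Xs unit_Ys)+
  define U where "U = (\<lambda>p. 1 + \<alpha> p)"
  have U: "laurent U" unfolding U_def by (intro laurent_add laurent_1 unit_laurent \<alpha>)
  have Upos: "U p \<in> Pos" if "p \<in> points" for p
    unfolding U_def using that by (intro add_pos one_pos unit_pos \<alpha>)
  have U0: "U p \<noteq> 0" if "p \<in> points" for p using Upos[OF that] pos_nonzero by blast
  define \<beta>1 where "\<beta>1 = (\<lambda>p. yhat b1 (x1 p) (y1 p) l)"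
  have \<beta>1pos: "1 + \<beta>1 p \<in> Pos" if "p \<in> points" for p
    unfolding \<beta>1_def using that by (intro add_pos one_pos yhat_pos x1pos ypos)

  \<comment> \<open>\<open>\<alpha>\<close> is linear in the variable \<open>y\<^sub>k\<close>, which \<open>\<beta>\<close> does not involve\<close>
  have binomials: "coprime_to U (\<lambda>p. 1 + \<beta> p)"
  proof -
    define M where "M = (\<lambda>p :: 'n var \<Rightarrow> 'a. \<Prod>i\<in>UNIV. p (XV i) powi (b $ i $ k))"
    have eq: "U = (\<lambda>p. 1 + p (YV k) * M p)"
      by (simp add: U_def \<alpha>_def yhat_def M_def Xs_def Ys_def)
    show ?thesis
      unfolding eq
    proof (rule coprime_to_binomials)
      show "M \<in> laurent_fun"
        unfolding M_def by (intro laurent_fun_prod laurent_fun_power_int_var)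
      have "(\<lambda>p. \<Prod>i\<in>UNIV. p (XV i) powi (- (b $ i $ k))) \<in> laurent_fun"
        by (intro laurent_fun_prod laurent_fun_power_int_var)
      then show "(\<lambda>p. inverse (M p)) \<in> laurent_fun"
        by (simp add: M_def power_int_minus prod_inversef[unfolded o_def])
      show "M (p(YV k := t)) = M p" for p t by (simp add: M_def)
      show "M p \<in> Pos" if "p \<in> points" for p
        unfolding M_def using that by (intro prod_pos power_int_pos pointsD)
      have "(\<lambda>p. of_int 1 + p (YV l) * (\<Prod>i\<in>UNIV. p (XV i) powi (b $ i $ l))) \<in> laurent_fun"
        by (intro laurent_fun.intros laurent_fun_prod laurent_fun_power_int_var)
      then show "(\<lambda>p. 1 + \<beta> p) \<in> laurent_fun"
        by (simp add: \<beta>_def yhat_def Xs_def Ys_def)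
      show "1 + \<beta> (p(YV k := t)) = 1 + \<beta> p" for p t
        using kl by (simp add: \<beta>_def yhat_def Xs_def Ys_def)
      show "1 + \<beta> p \<noteq> 0" if "p \<in> points" for p
        using add_pos[OF one_pos unit_pos[OF \<beta> that]] pos_nonzero by blast
    qed
  qed
  define v where "v = (\<lambda>p. U p ^ m + \<beta> p * \<alpha> p ^ m * U p ^ n)"
  have copv: "coprime_to U v"
    using rank_two(1)[OF \<alpha> \<beta> binomials[unfolded U_def], of c] by (simp add: v_def U_def m_def n_def)
  obtain w where w: "laurent w" "coprime_to U w"
    and weq: "\<And>p b1. p \<in> points \<Longrightarrow> b1 = \<beta> p * \<alpha> p ^ m * U p powi (- c) \<Longrightarrow>
          \<alpha> p * (1 + inverse (\<alpha> p) * b1 ^ m * (1 + b1) powi (- c)) * v p ^ m = w p * U p"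
    using rank_two(2)[OF \<alpha> \<beta> binomials[unfolded U_def], of c] unfolding v_def U_def m_def n_def by blast
  have v: "laurent v" unfolding v_def by (intro laurent_add laurent_mult laurent_power U unit_laurent \<alpha> \<beta>)
  have vpos: "v p \<in> Pos" if "p \<in> points" for p
    unfolding v_def using that by (intro add_pos mult_pos power_pos Upos unit_pos[OF \<alpha>] unit_pos[OF \<beta>])

  have cp: "[c]\<^sub>+ = int m" "c = int m - int n" by (simp_all add: pos_part_def m_def n_def)
  have b1kl: "b1 $ k $ l = - c" "b1 $ l $ k = c" and b2lk: "b2 $ l $ k = - c"
    using skewD[OF b, of k l] kl by (simp_all add: b1_def b2_def mutate_mat_nth c_def)
  define \<pi>1 where "\<pi>1 = (\<lambda>p. \<Prod>i\<in>-{k}. Xs p i powi [- (b $ i $ k)]\<^sub>+ :: 'a)"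
  define \<pi>2 where "\<pi>2 = (\<lambda>p. \<Prod>i\<in>-{k, l}. Xs p i powi [- (b1 $ i $ l)]\<^sub>+ :: 'a)"
  define \<pi>3 where "\<pi>3 = (\<lambda>p. \<Prod>i\<in>-{k, l}. Xs p i powi [- (b2 $ i $ k)]\<^sub>+ :: 'a)"
  \<comment> \<open>the unit factors by which the new cluster variables differ from \<open>U\<close>, \<open>v\<close> and \<open>w\<close>\<close>
  define E1 where "E1 = (\<lambda>p. \<pi>1 p / (\<mu>1 p * Xs p k))"
  define E2 where "E2 = (\<lambda>p. E1 p ^ m * \<pi>2 p / (\<mu>2 p * Xs p l))"
  define E3 where "E3 = (\<lambda>p. E2 p ^ m * \<pi>3 p / (E1 p * \<alpha> p))"
  have unitE: "unit E1" "unit E2" "unit E3"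
    unfolding E1_def E2_def E3_def \<pi>1_def \<pi>2_def \<pi>3_def
    by (intro unit_intros unit\<mu>1 unit\<mu>2 unit_Xs \<alpha>)+
  have prod_remove2: "(\<Prod>i\<in>-{k}. g i) = g l * (\<Prod>i\<in>-{k, l}. g i)" "(\<Prod>i\<in>-{l}. g i) = g k * (\<Prod>i\<in>-{k, l}. g i)" for g :: "'n \<Rightarrow> 'a"
  proof -
    have "-{k} - {l} = -{k, l}" "-{l} - {k} = -{k, l}" by auto
    then show "(\<Prod>i\<in>-{k}. g i) = g l * (\<Prod>i\<in>-{k, l}. g i)" "(\<Prod>i\<in>-{l}. g i) = g k * (\<Prod>i\<in>-{k, l}. g i)"
      using kl prod.remove[of "-{k}" l g] prod.remove[of "-{l}" k g] by simp_all
  qed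
  have x1k: "x1 p k = E1 p * U p" and x1o: "\<And>j. j \<noteq> k \<Longrightarrow> x1 p j = Xs p j"
    and x2l: "x2 p l = E2 p * v p" and x2o: "\<And>j. j \<noteq> l \<Longrightarrow> x2 p j = x1 p j"
    and x3k: "x3 p k = E3 p * w p" and x3o: "\<And>j. j \<noteq> k \<Longrightarrow> x3 p j = x2 p j"
    and fp: "f p = run ((k, 1, \<lambda>_. 0) # ps) (Zs p) b3 (x3 p) (y3 p) i"
    if p: "p \<in> points" for p
  proof -
    note nz = pos_nonzero[OF xpos[OF p]] pos_nonzero[OF ypos(1)[OF p]] pos_nonzero[OF x1pos[OF p]]
      pos_nonzero[OF ypos(2)[OF p]] pos_nonzero[OF x2pos[OF p]] pos_nonzero[OF ypos(3)[OF p]]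
    have \<mu>0: "\<mu>1 p \<noteq> 0" "\<mu>2 p \<noteq> 0" using unit_nonzero[OF unit\<mu>1 p] unit_nonzero[OF unit\<mu>2 p] by auto
    show x1k: "x1 p k = E1 p * U p"
      unfolding x1_def by (subst mut_x_same[OF b nz(1,2)]) (simp add: E1_def U_def \<alpha>_def \<pi>1_def)
    show x1o: "x1 p j = Xs p j" if "j \<noteq> k" for j using that by (simp add: x1_def mut_x_def)
    show x2o: "x2 p j = x1 p j" if "j \<noteq> l" for j using that by (simp add: x2_def mut_x_def)
    show x3o: "x3 p j = x2 p j" if "j \<noteq> k" for j using that by (simp add: x3_def mut_x_def)
    have b1p: "\<beta>1 p = \<beta> p * \<alpha> p ^ m * U p powi (- c)"
      unfolding \<beta>1_def b1_def x1_def y1_def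
      using yhat_mutate_other[OF b nz(1,2) \<mu>0(1) _ not_sym[OF kl]] U0[OF p]
      by (simp add: U_def \<alpha>_def \<beta>_def cp(1) flip: c_def)
    have Upow: "U p powi (- c) * U p ^ m = U p ^ n"
    proof -
      have "U p powi (- c) * U p powi (int m) = U p powi (int n)"
        using U0[OF p] by (subst power_int_add[symmetric]) (simp_all add: cp(2))
      then show ?thesis by simp
    qed
    have vb: "(1 + \<beta>1 p) * U p ^ m = v p"
      using Upow by (simp add: b1p v_def ring_distribs mult.assoc)
    show x2l: "x2 p l = E2 p * v p"
    proof -
      have "x2 p l = (1 + \<beta>1 p) * (\<Prod>i\<in>-{l}. x1 p i powi [- (b1 $ i $ l)]\<^sub>+) / (\<mu>2 p * x1 p l)"
        unfolding x2_def \<beta>1_def by (rule mut_x_same[OF skew(1) nz(3,4)])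
      also have "(\<Prod>i\<in>-{l}. x1 p i powi [- (b1 $ i $ l)]\<^sub>+) = (E1 p * U p) ^ m * \<pi>2 p"
        unfolding prod_remove2 \<pi>2_def by (simp add: x1k x1o b1kl cp(1) cong: prod.cong_simp)
      also have "(1 + \<beta>1 p) * ((E1 p * U p) ^ m * \<pi>2 p) = ((1 + \<beta>1 p) * U p ^ m) * (E1 p ^ m * \<pi>2 p)"
        by (simp add: power_mult_distrib)
      finally show ?thesis
        unfolding vb using kl by (simp add: x1o E2_def)
    qed
    have b2p: "yhat b2 (x2 p) (y2 p) k = inverse (\<alpha> p) * \<beta>1 p ^ m * (1 + \<beta>1 p) powi (- c)"
    proof -
      have "1 + yhat b1 (x1 p) (y1 p) l \<noteq> 0"
        using \<beta>1pos[OF p] pos_nonzero unfolding \<beta>1_def by blast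
      moreover have "yhat b1 (x1 p) (y1 p) k = inverse (\<alpha> p)"
        unfolding b1_def x1_def y1_def \<alpha>_def by (rule yhat_mutate_same[OF b nz(1,2)])
      ultimately show ?thesis
        unfolding b2_def x2_def y2_def
        using yhat_mutate_other[OF skew(1) nz(3,4) \<mu>0(2) _ kl] by (simp add: \<beta>1_def b1kl cp(1))
    qed
    show "x3 p k = E3 p * w p"
    proof -
      have "x3 p k = (1 + yhat b2 (x2 p) (y2 p) k) * (\<Prod>i\<in>-{k}. x2 p i powi [- (b2 $ i $ k)]\<^sub>+) / (1 * x2 p k)"
        unfolding x3_def by (rule mut_x_same[OF skew(2) nz(5,6)])
      also have "(\<Prod>i\<in>-{k}. x2 p i powi [- (b2 $ i $ k)]\<^sub>+) = (E2 p * v p) ^ m * \<pi>3 p"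
        unfolding prod_remove2 \<pi>3_def by (simp add: x2l x2o x1o b2lk cp(1) cong: prod.cong_simp)
      also have "1 * x2 p k = E1 p * U p" using kl by (simp add: x2o x1k)
      also have "(1 + yhat b2 (x2 p) (y2 p) k) * ((E2 p * v p) ^ m * \<pi>3 p) / (E1 p * U p) =
          (\<alpha> p * (1 + yhat b2 (x2 p) (y2 p) k) * v p ^ m) * (E2 p ^ m * \<pi>3 p) / (E1 p * \<alpha> p * U p)"
        using unit_nonzero[OF \<alpha> p] by (simp add: power_mult_distrib)
      also have "\<dots> = E3 p * w p"
        unfolding b2p weq[OF p b1p] using U0[OF p] by (simp add: E3_def)
      finally show ?thesis .
    qed
    have h: "1 + yhat b2 (x2 p) (y2 p) k \<noteq> 0"
    proof -
      have "yhat b2 (x2 p) (y2 p) k \<in> Pos"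
        using p by (intro yhat_pos x2pos ypos(3))
      then show ?thesis using add_pos[OF one_pos] pos_nonzero by blast
    qed
    have "normaliser (k, 1, \<lambda>_. 0) (Zs p) (y3 p) = inverse (y2 p k)"
      by (simp add: normaliser_def y3_def mut_y_def)
    then show "f p = run ((k, 1, \<lambda>_. 0) # ps) (Zs p) b3 (x3 p) (y3 p) i"
      using mutate_back[OF skew(2) nz(5,6) h]
      by (simp add: f_def b3_def mutate_mat_involution x3_def y3_def)
        (simp add: x2_def y2_def x1_def y1_def b2_def b1_def \<mu>1_def \<mu>2_def k_def l_def)
  qed
  have wnz: "w p \<noteq> 0" if "p \<in> points" for p
    using x3k[OF that] pos_nonzero[OF x3pos[OF that, of k]] by auto
  have vnz: "v p \<noteq> 0" if "p \<in> points" for p using vpos[OF that] pos_nonzero by blast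
  have over1: "laurent_over U f"
  proof -
    have "laurent_over U (\<lambda>p. run (s2 # ps) (Zs p) b1 (x1 p) (y1 p) i)"
    proof (rule laurent_over_run[OF _ U x1pos _ _ unity1])
      show "laurent (\<lambda>p. run (s2 # ps) (Zs p) b1 (Xs p) (Ys p) i)"
        using IH1 by (simp add: b1_def k_def)
      show "laurent_over U (\<lambda>p. x1 p j)" "laurent_over U (\<lambda>p. inverse (x1 p j))" for j
      proof -
        have "laurent_over U (\<lambda>p. x1 p j) \<and> laurent_over U (\<lambda>p. inverse (x1 p j))"
        proof (cases "j = k")
          case True
          show ?thesis
            unfolding True
            by (intro conjI laurent_over_unit_multiple[OF unitE(1) U U0 laurent_1]) (auto simp: x1k)
        next
          case False
          then have "x1 p j = Xs p j" for p by (simp add: x1_def mut_x_def)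
          then show ?thesis by (simp add: laurent_over_unit[OF unit_Xs])
        qed
        then show "laurent_over U (\<lambda>p. x1 p j)" "laurent_over U (\<lambda>p. inverse (x1 p j))" by auto
      qed
    qed
    then show ?thesis
      by (simp add: f_def b1_def x1_def y1_def \<mu>1_def k_def)
  qed
  define D where "D = (\<lambda>p. v p * w p)"
  have D: "laurent D" unfolding D_def by (intro laurent_mult v w)
  have over3: "laurent_over D f"
  proof -
    have "laurent_over D (\<lambda>p. run ((k, 1, \<lambda>_. 0) # ps) (Zs p) b3 (x3 p) (y3 p) i)"
    proof (rule laurent_over_run[OF _ D x3pos _ _ unity3])
      show "laurent (\<lambda>p. run ((k, 1, \<lambda>_. 0) # ps) (Zs p) b3 (Xs p) (Ys p) i)"
        using IH3 by (simp add: b1_def b2_def b3_def k_def l_def)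
      show "laurent_over D (\<lambda>p. x3 p j)" "laurent_over D (\<lambda>p. inverse (x3 p j))" for j
      proof -
        consider "j = k" | "j = l" | "j \<noteq> k" "j \<noteq> l" by blast
        then have "laurent_over D (\<lambda>p. x3 p j) \<and> laurent_over D (\<lambda>p. inverse (x3 p j))"
        proof cases
          case 1
          show ?thesis
            unfolding 1
            by (intro conjI laurent_over_unit_multiple[OF unitE(3) w(1) wnz v]) (auto simp: x3k D_def)
        next
          case 2
          show ?thesis
            unfolding 2 using kl
            by (intro conjI laurent_over_unit_multiple[OF unitE(2) v vnz w(1)]) (auto simp: x3o x2l D_def)
        next
          case 3
          then have "x3 p j = Xs p j" for p by (simp add: x3_def x2_def x1_def mut_x_def)
          then show ?thesis by (simp add: laurent_over_unit[OF unit_Xs])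
        qed
        then show "laurent_over D (\<lambda>p. x3 p j)" "laurent_over D (\<lambda>p. inverse (x3 p j))" by auto
      qed
    qed
    then obtain N where "laurent (\<lambda>p. run ((k, 1, \<lambda>_. 0) # ps) (Zs p) b3 (x3 p) (y3 p) i * D p ^ N)"
      unfolding laurent_over_def by blast
    then have "laurent (\<lambda>p. f p * D p ^ N)"
      by (rule laurent_cong) (simp add: fp)
    then show ?thesis unfolding laurent_over_def by blast
  qed
  have "coprime_to U D"
    unfolding D_def by (rule coprime_to_mult[OF U0 v w(1) copv w(2)])
  from laurent_if_laurent_over[OF U U0 D this over1 over3] show ?thesis
    by (simp add: f_def)
qed

text \<open>
  Two consecutive mutations in the same direction restore the cluster up to a unit, so that they
  can be dropped from the path.
\<close>

lemma laurent_run_same: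
  fixes b :: "'n::finite int_mat"
  assumes b: "skew b" and kl: "fst s1 = fst s2"
    and IH: "laurent (\<lambda>p. run ps (Zs p) b (Xs p) (Ys p) i)"
  shows "laurent (\<lambda>p. run (s1 # s2 # ps) (Zs p) b (Xs p) (Ys p) i)"
proof -
  define k where "k = fst s1"
  define \<mu>1 where "\<mu>1 = (\<lambda>p. normaliser s1 (Zs p) (Ys p :: 'n \<Rightarrow> 'a))"
  define x1 where "x1 = (\<lambda>p. mut_x b (\<mu>1 p) k (Xs p) (Ys p))"
  define y1 where "y1 = (\<lambda>p. mut_y b (\<mu>1 p) k (Ys p))"
  define \<mu>2 where "\<mu>2 = (\<lambda>p. normaliser s2 (Zs p) (y1 p))"
  define x2 where "x2 = (\<lambda>p. mut_x (mutate_mat k b) (\<mu>2 p) k (x1 p) (y1 p))"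
  define y2 where "y2 = (\<lambda>p. mut_y (mutate_mat k b) (\<mu>2 p) k (y1 p))"
  have unit\<mu>1: "unit \<mu>1" unfolding \<mu>1_def by (intro unit_normaliser unit_Zs unit_Ys)
  have unity1: "unit (\<lambda>p. y1 p j)" for j unfolding y1_def by (intro unit_mut_y unit_Ys unit\<mu>1)
  have unit\<mu>2: "unit \<mu>2" unfolding \<mu>2_def by (intro unit_normaliser unit_Zs unity1)
  have unity2: "unit (\<lambda>p. y2 p j)" for j unfolding y2_def by (intro unit_mut_y unity1 unit\<mu>2)
  define E where "E = (\<lambda>p. inverse (yhat b (Xs p) (Ys p) k) * (\<Prod>i\<in>-{k}. Xs p i powi [b $ i $ k]\<^sub>+) *
    \<mu>1 p * Xs p k / (\<mu>2 p * (\<Prod>i\<in>-{k}. Xs p i powi [- (b $ i $ k)]\<^sub>+)))"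
  have unitE: "unit E"
    unfolding E_def by (intro unit_intros unit_yhat unit_Xs unit_Ys unit\<mu>1 unit\<mu>2)
  have x2k: "x2 p k = E p" if p: "p \<in> points" for p
  proof -
    let ?h = "yhat b (Xs p) (Ys p) k"
    have nz: "Xs p j \<noteq> 0" "Ys p j \<noteq> 0" "y1 p j \<noteq> 0" for j
      using unit_nonzero[OF unit_Xs p] unit_nonzero[OF unit_Ys p] unit_nonzero[OF unity1 p] by auto
    have \<mu>0: "\<mu>1 p \<noteq> 0" "\<mu>2 p \<noteq> 0" using unit_nonzero[OF unit\<mu>1 p] unit_nonzero[OF unit\<mu>2 p] by auto
    have hpos: "?h \<in> Pos" by (rule unit_pos[OF unit_yhat[OF unit_Xs unit_Ys] p])
    then have h: "?h \<noteq> 0" "1 + ?h \<noteq> 0"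
      using pos_nonzero add_pos[OF one_pos] by blast+
    have x1: "x1 p j \<noteq> 0" for j
      using unit_pos[OF unit_Xs p] unit_pos[OF unit_Ys p] unit_pos[OF unit\<mu>1 p]
      unfolding x1_def by (intro pos_nonzero mut_x_pos) auto
    have "x2 p k = (1 + yhat (mutate_mat k b) (x1 p) (y1 p) k) *
        (\<Prod>i\<in>-{k}. x1 p i powi [- (mutate_mat k b $ i $ k)]\<^sub>+) / (\<mu>2 p * x1 p k)"
      unfolding x2_def by (rule mut_x_same[OF skew_mutate_mat[OF b] x1 nz(3)])
    also have "yhat (mutate_mat k b) (x1 p) (y1 p) k = inverse ?h"
      unfolding x1_def y1_def by (rule yhat_mutate_same[OF b nz(1,2)])
    also have "(\<Prod>i\<in>-{k}. x1 p i powi [- (mutate_mat k b $ i $ k)]\<^sub>+) = (\<Prod>i\<in>-{k}. Xs p i powi [b $ i $ k]\<^sub>+)"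
      by (simp add: mutate_mat_nth x1_def mut_x_def cong: prod.cong_simp)
    also have "x1 p k = (1 + ?h) * (\<Prod>i\<in>-{k}. Xs p i powi [- (b $ i $ k)]\<^sub>+) / (\<mu>1 p * Xs p k)"
      unfolding x1_def by (rule mut_x_same[OF b nz(1,2)])
    also have "1 + inverse ?h = (1 + ?h) * inverse ?h"
      using h by (simp add: field_simps)
    finally show ?thesis
      using h \<mu>0 nz by (simp add: E_def)
  qed
  have over: "laurent_over (\<lambda>p. 1) (\<lambda>p. run ps (Zs p) b (x2 p) (y2 p) i)"
  proof (rule laurent_over_run[OF IH laurent_1 _ _ _ unity2])
    have "laurent_over (\<lambda>p. 1) (\<lambda>p. x2 p j) \<and> laurent_over (\<lambda>p. 1) (\<lambda>p. inverse (x2 p j)) \<and> (\<forall>p\<in>points. x2 p j \<in> Pos)" for j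
    proof (cases "j = k")
      case True
      show ?thesis
        unfolding True
        by (intro conjI laurent_over_unit_multiple[OF unitE laurent_1 _ laurent_1])
          (use unit_pos[OF unitE] in \<open>auto simp: x2k\<close>)
    next
      case False
      then have "x2 p j = Xs p j" for p by (simp add: x2_def x1_def mut_x_def)
      then show ?thesis by (simp add: laurent_over_unit[OF unit_Xs] unit_pos[OF unit_Xs])
    qed
    then show "laurent_over (\<lambda>p. 1) (\<lambda>p. x2 p j)" "laurent_over (\<lambda>p. 1) (\<lambda>p. inverse (x2 p j))"
        "p \<in> points \<Longrightarrow> x2 p j \<in> Pos" for j p by auto
  qed
  then show ?thesis
    using kl by (simp add: laurent_over_def k_def mutate_mat_involution x2_def x1_def y2_def y1_def \<mu>1_def \<mu>2_def)
qed

theorem laurent_run: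
  fixes b :: "'n::finite int_mat"
  assumes "skew b"
  shows "laurent (\<lambda>p. run ps (Zs p) b (Xs p) (Ys p) i)"
  using assms
proof (induction ps arbitrary: b rule: measure_induct_rule[of length])
  case (less ps)
  show ?case
  proof (cases ps)
    case Nil
    then show ?thesis using unit_laurent[OF unit_Xs] by simp
  next
    case (Cons s1 qs)
    show ?thesis
    proof (cases qs)
      case Nil
      define k where "k = fst s1"
      define \<mu> where "\<mu> = (\<lambda>p. normaliser s1 (Zs p) (Ys p :: 'n \<Rightarrow> 'a))"
      have \<mu>: "unit \<mu>" unfolding \<mu>_def by (intro unit_normaliser unit_Zs unit_Ys)
      have M: "laurent (\<lambda>p. (Ys p k * (\<Prod>i\<in>UNIV. Xs p i powi [b $ i $ k]\<^sub>+) + (\<Prod>i\<in>UNIV. Xs p i powi [- (b $ i $ k)]\<^sub>+)) *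
          inverse (\<mu> p * Xs p k))"
        by (intro laurent_mult laurent_add unit_laurent unit_intros unit_Xs unit_Ys \<mu>)
      have "laurent (\<lambda>p. mut_x b (\<mu> p) k (Xs p) (Ys p) i)"
        using M unit_laurent[OF unit_Xs] by (cases "i = k") (simp_all add: mut_x_def divide_inverse)
      then show ?thesis
        by (simp add: Cons Nil \<mu>_def k_def)
    next
      case (Cons s2 rs)
      note ps = \<open>ps = s1 # qs\<close>[unfolded \<open>qs = s2 # rs\<close>]
      show ?thesis
      proof (cases "fst s1 = fst s2")
        case True
        show ?thesis
          unfolding ps by (rule laurent_run_same[OF less.prems True less.IH]) (simp_all add: ps less.prems)
      next
        case False
        show ?thesis
          unfolding ps
          by (rule laurent_run_Cons_Cons[OF less.prems False less.IH less.IH])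
            (simp_all add: ps less.prems skew_mutate_mat)
      qed
    qed
  qed
qed

end

section \<open>Evaluation, positivity and degree of Laurent polynomials\<close>

definition ring_hom_on :: "('a::comm_ring_1 \<Rightarrow> 'b::comm_ring_1) \<Rightarrow> bool" where
  "ring_hom_on f \<longleftrightarrow> f 0 = 0 \<and> f 1 = 1 \<and> (\<forall>a b. f (a + b) = f a + f b) \<and> (\<forall>a b. f (a * b) = f a * f b)"

lemma ring_hom_onD:
  assumes "ring_hom_on f"
  shows "f 0 = 0" "f 1 = 1" "f (a + b) = f a + f b" "f (a * b) = f a * f b"
  using assms by (auto simp: ring_hom_on_def)

definition pm_eval :: "('c::comm_ring_1 \<Rightarrow> 'b::comm_ring_1) \<Rightarrow> ('a \<Rightarrow> 'b) \<Rightarrow> ('a \<Rightarrow>\<^sub>0 'c) \<Rightarrow> 'b" where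
  "pm_eval f \<phi> p = (\<Sum>k\<in>Poly_Mapping.keys p. f (Poly_Mapping.lookup p k) * \<phi> k)"

lemma pm_eval_superset:
  assumes "f 0 = 0" "finite S" "Poly_Mapping.keys p \<subseteq> S"
  shows "pm_eval f \<phi> p = (\<Sum>k\<in>S. f (Poly_Mapping.lookup p k) * \<phi> k)"
  unfolding pm_eval_def using assms
  by (intro sum.mono_neutral_left) (auto simp: in_keys_iff)

lemma pm_eval_single: "f 0 = 0 \<Longrightarrow> pm_eval f \<phi> (Poly_Mapping.single k c) = f c * \<phi> k"
  by (subst pm_eval_superset[of _ "{k}"]) auto

lemma pm_eval_add:
  assumes "ring_hom_on f"
  shows "pm_eval f \<phi> (p + q) = pm_eval f \<phi> p + pm_eval f \<phi> q"
proof -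
  let ?S = "Poly_Mapping.keys p \<union> Poly_Mapping.keys q"
  have "Poly_Mapping.keys (p + q) \<subseteq> ?S" by (rule keys_add)
  then show ?thesis
    by (simp add: pm_eval_superset[of f ?S] ring_hom_onD[OF assms] lookup_add ring_distribs sum.distrib)
qed

lemma poly_mapping_sum_single: "(\<Sum>k\<in>Poly_Mapping.keys p. Poly_Mapping.single k (Poly_Mapping.lookup p k)) = p"
proof (rule poly_mapping_eqI)
  fix l
  have "(\<Sum>k\<in>Poly_Mapping.keys p. Poly_Mapping.lookup (Poly_Mapping.single k (Poly_Mapping.lookup p k)) l) =
      (\<Sum>k\<in>Poly_Mapping.keys p. if k = l then Poly_Mapping.lookup p l else 0)"
    by (intro sum.cong) (auto simp: lookup_single)
  then show "Poly_Mapping.lookup (\<Sum>k\<in>Poly_Mapping.keys p. Poly_Mapping.single k (Poly_Mapping.lookup p k)) l = Poly_Mapping.lookup p l"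
    by (simp add: lookup_sum in_keys_iff)
qed

lemma pm_induct [case_names zero single add]:
  fixes p :: "'a \<Rightarrow>\<^sub>0 'b::comm_monoid_add"
  assumes "P 0" and "\<And>k c. P (Poly_Mapping.single k c)" and "\<And>p q. P p \<Longrightarrow> P q \<Longrightarrow> P (p + q)"
  shows "P p"
proof -
  have "P (\<Sum>k\<in>S. Poly_Mapping.single k (Poly_Mapping.lookup p k))" if "finite S" for S
    using that by (induction S) (simp_all add: assms)
  from this[OF finite_keys[of p]] show ?thesis
    by (simp add: poly_mapping_sum_single)
qed

lemma pm_eval_ring_hom:
  fixes \<phi> :: "'a::comm_monoid_add \<Rightarrow> 'b::comm_ring_1"
  assumes f: "ring_hom_on f" and \<phi>: "\<phi> 0 = 1" "\<And>a b. \<phi> (a + b) = \<phi> a * \<phi> b"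
  shows "ring_hom_on (pm_eval f \<phi>)"
proof -
  note s = pm_eval_single[of f, OF ring_hom_onD(1)[OF f]]
  have 0: "pm_eval f \<phi> 0 = 0" by (simp add: pm_eval_def)
  have mult: "pm_eval f \<phi> (p * q) = pm_eval f \<phi> p * pm_eval f \<phi> q" for p q
  proof (induction p rule: pm_induct)
    case (single k c)
    show ?case
    proof (induction q rule: pm_induct)
      case (single l d)
      show ?case by (simp add: mult_single s ring_hom_onD[OF f] \<phi> ac_simps)
    qed (simp_all add: 0 ring_distribs pm_eval_add[OF f])
  qed (simp_all add: 0 ring_distribs pm_eval_add[OF f])
  have "pm_eval f \<phi> 1 = 1"
    using s[of \<phi> 0 1] by (simp add: ring_hom_onD[OF f] \<phi>)
  then show ?thesis
    unfolding ring_hom_on_def using 0 mult pm_eval_add[OF f] by blast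
qed

definition monomial :: "('n \<Rightarrow>\<^sub>0 int) \<Rightarrow> ('n \<Rightarrow>\<^sub>0 nat) \<Rightarrow> int \<Rightarrow> 'n::{finite,linorder} laurent" where
  "monomial m q c = Poly_Mapping.single m (Poly_Mapping.single q c)"

lemma laurent_induct [case_names zero monomial add]:
  fixes p :: "'n::{finite,linorder} laurent"
  assumes "P 0" and "\<And>m q c. P (monomial m q c)" and "\<And>p q. P p \<Longrightarrow> P q \<Longrightarrow> P (p + q)"
  shows "P p"
proof (induction p rule: pm_induct)
  case (single m r)
  show ?case
    by (induction r rule: pm_induct) (simp_all add: assms single_add flip: monomial_def)
qed (use assms in auto)

definition laurent_eval :: "(('n \<Rightarrow>\<^sub>0 int) \<Rightarrow> 'b) \<Rightarrow> (('n \<Rightarrow>\<^sub>0 nat) \<Rightarrow> 'b) \<Rightarrow> 'n::{finite,linorder} laurent \<Rightarrow> 'b::comm_ring_1" where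
  "laurent_eval \<phi> \<psi> = pm_eval (pm_eval of_int \<psi>) \<phi>"

lemma laurent_eval_hom:
  assumes "\<phi> 0 = 1" "\<And>a b. \<phi> (a + b) = \<phi> a * \<phi> b" "\<psi> 0 = 1" "\<And>a b. \<psi> (a + b) = \<psi> a * \<psi> b"
  shows "ring_hom_on (laurent_eval \<phi> \<psi>)"
  unfolding laurent_eval_def
  by (intro pm_eval_ring_hom assms) (simp add: ring_hom_on_def)

lemma laurent_eval_monomial: "laurent_eval \<phi> \<psi> (monomial m q c) = of_int c * \<psi> q * \<phi> m"
  unfolding laurent_eval_def monomial_def
  by (simp add: pm_eval_single pm_eval_def[of _ _ 0] del: keys_single)

lemma monomial_mult: "monomial m q c * monomial m' q' c' = monomial (m + m') (q + q') (c * c')"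
  by (simp add: monomial_def mult_single)

lemma monomial_1: "monomial 0 0 1 = 1"
  by (simp add: monomial_def)

lemma of_laurent_simps:
  "of_laurent (p + q) = of_laurent p + of_laurent q" "of_laurent (p * q) = of_laurent p * of_laurent q"
  "of_laurent 0 = 0" "of_laurent 1 = 1" "of_laurent (- p) = - of_laurent p"
  by (simp_all add: of_laurent_def Zero_fract_def One_fract_def)

lemma of_laurent_inject: "of_laurent p = of_laurent q \<longleftrightarrow> p = q"
  by (simp add: of_laurent_def eq_fract)

lemma of_laurent_eq_0: "of_laurent p = 0 \<longleftrightarrow> p = 0"
  using of_laurent_inject[of p 0] by (simp add: of_laurent_simps)

text \<open>
  Quotients of Laurent polynomials with a positive value under a ring homomorphism \<open>e\<close> to the
  integers.  With \<open>e\<close> the sum of the coefficients this serves as a substitute for the semifield of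
  subtraction-free expressions.
\<close>

definition pos_of :: "('n::{finite,linorder} laurent \<Rightarrow> int) \<Rightarrow> 'n ambient set" where
  "pos_of e = {of_laurent P / of_laurent Q | P Q. 0 < e P \<and> 0 < e Q}"

lemma pos_ofI: "0 < e P \<Longrightarrow> 0 < e Q \<Longrightarrow> z = of_laurent P / of_laurent Q \<Longrightarrow> z \<in> pos_of e"
  by (auto simp: pos_of_def)

lemma positive_part_pos_of:
  fixes e :: "'n::{finite,linorder} laurent \<Rightarrow> int"
  assumes e: "ring_hom_on e"
  shows "positive_part (pos_of e)"
proof
  have nz: "of_laurent P \<noteq> 0" if "0 < e P" for P
    using that ring_hom_onD(1)[OF e] by (auto simp: of_laurent_eq_0)
  show "1 \<in> pos_of e"
    by (rule pos_ofI[of e 1 1]) (simp_all add: ring_hom_onD[OF e] of_laurent_simps)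
  show "0 \<notin> pos_of e"
    using nz by (auto simp: pos_of_def)
  fix a b assume "a \<in> pos_of e"
  then obtain P Q where a: "0 < e P" "0 < e Q" "a = of_laurent P / of_laurent Q" by (auto simp: pos_of_def)
  show "inverse a \<in> pos_of e"
    by (rule pos_ofI[of e Q P]) (simp_all add: a)
  assume "b \<in> pos_of e"
  then obtain R S where b: "0 < e R" "0 < e S" "b = of_laurent R / of_laurent S" by (auto simp: pos_of_def)
  show "a * b \<in> pos_of e"
    by (rule pos_ofI[of e "P * R" "Q * S"]) (simp_all add: a b ring_hom_onD[OF e] of_laurent_simps)
  show "a + b \<in> pos_of e"
    by (rule pos_ofI[of e "P * S + R * Q" "Q * S"])
      (use a b nz[of Q] nz[of S] in \<open>simp_all add: ring_hom_onD[OF e] of_laurent_simps add_pos_pos field_simps\<close>)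
next
  have nat: "e (of_nat n) = int n" for n
    by (induction n) (simp_all add: ring_hom_onD[OF e])
  have "of_laurent (of_nat (Suc n)) \<in> pos_of e" for n
    by (rule pos_ofI[of e "of_nat (Suc n)" 1]) (simp_all only: nat ring_hom_onD[OF e] of_laurent_simps, simp_all)
  moreover have "inj (\<lambda>n. of_laurent (of_nat (Suc n)) :: 'n ambient)"
    by (auto simp: inj_def of_laurent_inject simp del: of_nat_Suc)
  ultimately show "infinite (pos_of e)"
    using range_inj_infinite finite_subset by (metis image_subsetI)
qed

lemma x_var_monomial: "x_var i = of_laurent (monomial (Poly_Mapping.single i 1) 0 1)"
  by (simp add: x_var_def monomial_def)

lemma y_var_monomial: "y_var i = of_laurent (monomial 0 (Poly_Mapping.single i 1) 1)"
  by (simp add: y_var_def monomial_def)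

lemma x_var_nonzero: "x_var i \<noteq> 0" and y_var_nonzero: "y_var i \<noteq> 0"
  by (simp_all add: x_var_def y_var_def of_laurent_eq_0)
    (metis lookup_single_eq lookup_zero one_neq_zero)+

lemma inverse_x_var: "inverse (x_var i) = of_laurent (monomial (Poly_Mapping.single i (- 1)) 0 1)"
proof -
  have "x_var i * of_laurent (monomial (Poly_Mapping.single i (- 1)) 0 1) = 1"
    by (simp add: x_var_monomial monomial_mult monomial_1 single_add[symmetric] of_laurent_simps
        flip: of_laurent_simps(2))
  then show ?thesis by (rule inverse_unique)
qed

text \<open>
  Setting \<open>y\<^sub>j\<close> to zero.  Its kernel consists of the multiples of \<open>y\<^sub>j\<close> (\<open>drop_y_decomposition\<close>), so
  it detects divisibility by \<open>y\<^sub>j\<close>.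
\<close>

definition drop_y :: "'n \<Rightarrow> 'n::{finite,linorder} laurent \<Rightarrow> 'n laurent" where
  "drop_y j = laurent_eval (\<lambda>m. monomial m 0 1)
     (\<lambda>q. if Poly_Mapping.lookup q j = 0 then monomial 0 q 1 else 0)"

definition coeff_sum :: "'n::{finite,linorder} laurent \<Rightarrow> int" where
  "coeff_sum = laurent_eval (\<lambda>m. 1) (\<lambda>q. 1)"

lemma drop_y_hom: "ring_hom_on (drop_y j)"
  unfolding drop_y_def
  by (rule laurent_eval_hom) (auto simp: monomial_mult monomial_1 lookup_add)

lemma coeff_sum_hom: "ring_hom_on coeff_sum"
  unfolding coeff_sum_def by (rule laurent_eval_hom) auto

lemma of_int_monomial: "of_int c = monomial 0 0 c"
proof -
  have "Poly_Mapping.single 0 c = (of_int c :: ('a \<Rightarrow>\<^sub>0 nat) \<Rightarrow>\<^sub>0 int)"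
    using single_of_int[of c, where 'b = int] by simp
  then show ?thesis
    unfolding monomial_def by (simp only: single_of_int)
qed

lemma drop_y_monomial: "drop_y j (monomial m q c) = (if Poly_Mapping.lookup q j = 0 then monomial m q c else 0)"
  by (simp add: drop_y_def laurent_eval_monomial of_int_monomial monomial_mult)

lemma coeff_sum_monomial: "coeff_sum (monomial m q c) = c"
  by (simp add: coeff_sum_def laurent_eval_monomial)

lemma drop_y_decomposition: "\<exists>p'. p = drop_y j p + monomial 0 (Poly_Mapping.single j 1) 1 * p'"
proof (induction p rule: laurent_induct)
  case zero
  show ?case by (rule exI[of _ 0]) (simp add: ring_hom_onD[OF drop_y_hom])
next
  case (monomial m q c)
  show ?case
  proof (cases "Poly_Mapping.lookup q j = 0")
    case True
    then show ?thesis by (intro exI[of _ 0]) (simp add: drop_y_monomial)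
  next
    case False
    define q' where "q' = q - Poly_Mapping.single j 1"
    have "q = Poly_Mapping.single j 1 + q'"
      using False by (intro poly_mapping_eqI) (auto simp: q'_def lookup_add lookup_minus lookup_single when_def)
    then show ?thesis
      using False by (intro exI[of _ "monomial m q' c"]) (simp add: drop_y_monomial monomial_mult)
  qed
next
  case (add p q)
  then obtain p' q' where "p = drop_y j p + monomial 0 (Poly_Mapping.single j 1) 1 * p'"
    "q = drop_y j q + monomial 0 (Poly_Mapping.single j 1) 1 * q'" by blast
  then have "p + q = (drop_y j p + monomial 0 (Poly_Mapping.single j 1) 1 * p') +
      (drop_y j q + monomial 0 (Poly_Mapping.single j 1) 1 * q')"
    by (rule arg_cong2)
  also have "\<dots> = drop_y j (p + q) + monomial 0 (Poly_Mapping.single j 1) 1 * (p' + q')"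
    by (simp only: ring_hom_onD[OF drop_y_hom] ring_distribs ac_simps)
  finally show ?case by blast
qed

text \<open>
  Tagging every monomial with its degree is a ring homomorphism into the group ring of the degree
  group.  Being homogeneous of degree \<open>d\<close> then means \<open>grade p = d \<otimes> p\<close> (\<open>homogeneous_grade\<close>), and the
  closure of homogeneous elements under ring operations is immediate.
\<close>

definition grade :: "'n int_mat \<Rightarrow> 'n::{finite,linorder} laurent \<Rightarrow> ('n int_vec \<Rightarrow>\<^sub>0 'n laurent)" where
  "grade C = laurent_eval (\<lambda>m. Poly_Mapping.single (monom_degree C m 0) (monomial m 0 1))
     (\<lambda>q. Poly_Mapping.single (monom_degree C 0 q) (monomial 0 q 1))"

lemma monom_degree_nth:
  "monom_degree C m q $ k = Poly_Mapping.lookup m k - (\<Sum>j\<in>UNIV. int (Poly_Mapping.lookup q j) * C $ k $ j)"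
proof -
  have "(\<Sum>i\<in>UNIV. Poly_Mapping.lookup m i * axis i 1 $ k) = (\<Sum>i\<in>UNIV. if i = k then Poly_Mapping.lookup m k else 0)"
    by (intro sum.cong) (auto simp: axis_def)
  then show ?thesis
    by (simp add: monom_degree_def column_def sum_negf)
qed

lemma monom_degree_add: "monom_degree C (m + m') (q + q') = monom_degree C m q + monom_degree C m' q'"
  by (simp add: vec_eq_iff monom_degree_nth lookup_add sum.distrib algebra_simps)

lemma monom_degree_0: "monom_degree C 0 0 = 0"
  by (simp add: vec_eq_iff monom_degree_nth)

lemma grade_hom: "ring_hom_on (grade C)"
  unfolding grade_def
proof (rule laurent_eval_hom)
  show "Poly_Mapping.single (monom_degree C (a + b) 0) (monomial (a + b) 0 1) =
      Poly_Mapping.single (monom_degree C a 0) (monomial a 0 1) * Poly_Mapping.single (monom_degree C b 0) (monomial b 0 1)" for a b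
    using monom_degree_add[of C a b 0 0] by (simp add: mult_single monomial_mult)
  show "Poly_Mapping.single (monom_degree C 0 (a + b)) (monomial 0 (a + b) 1) =
      Poly_Mapping.single (monom_degree C 0 a) (monomial 0 a 1) * Poly_Mapping.single (monom_degree C 0 b) (monomial 0 b 1)" for a b
    using monom_degree_add[of C 0 0 a b] by (simp add: mult_single monomial_mult)
qed (simp_all add: monom_degree_0 monomial_1)

lemma grade_monomial: "grade C (monomial m q c) = Poly_Mapping.single (monom_degree C m q) (monomial m q c)"
proof -
  have "(of_int c :: 'a int_vec \<Rightarrow>\<^sub>0 'a laurent) = Poly_Mapping.single 0 (monomial 0 0 c)"
    by (metis of_int_monomial single_of_int)
  then show ?thesis
    using monom_degree_add[of C 0 m q 0]
    by (simp add: grade_def laurent_eval_monomial mult_single monomial_mult)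
qed

lemma lookup_grade:
  "Poly_Mapping.lookup (Poly_Mapping.lookup (Poly_Mapping.lookup (grade C p) d) m) q =
     (if monom_degree C m q = d then Poly_Mapping.lookup (Poly_Mapping.lookup p m) q else 0)"
proof (induction p rule: laurent_induct)
  case (monomial m' q' c)
  show ?case unfolding grade_monomial by (auto simp: monomial_def lookup_single when_def)
qed (simp_all add: ring_hom_onD[OF grade_hom] lookup_add)

lemma homogeneous_grade: "homogeneous C p d \<longleftrightarrow> grade C p = Poly_Mapping.single d p"
proof
  assume h: "homogeneous C p d"
  show "grade C p = Poly_Mapping.single d p"
  proof (intro poly_mapping_eqI)
    fix e m q
    show "Poly_Mapping.lookup (Poly_Mapping.lookup (Poly_Mapping.lookup (grade C p) e) m) q =
        Poly_Mapping.lookup (Poly_Mapping.lookup (Poly_Mapping.lookup (Poly_Mapping.single d p) e) m) q"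
    proof (cases "Poly_Mapping.lookup (Poly_Mapping.lookup p m) q = 0")
      case True
      then show ?thesis by (simp add: lookup_grade lookup_single when_def)
    next
      case False
      then have "q \<in> Poly_Mapping.keys (Poly_Mapping.lookup p m)" by (simp add: in_keys_iff)
      moreover from this have "m \<in> Poly_Mapping.keys p" by (auto simp: in_keys_iff)
      ultimately have "monom_degree C m q = d" using h unfolding homogeneous_def by blast
      then show ?thesis by (simp add: lookup_grade lookup_single when_def)
    qed
  qed
next
  assume g: "grade C p = Poly_Mapping.single d p"
  show "homogeneous C p d"
    unfolding homogeneous_def
  proof (intro ballI)
    fix m q assume "m \<in> Poly_Mapping.keys p" and q: "q \<in> Poly_Mapping.keys (Poly_Mapping.lookup p m)"
    have "Poly_Mapping.lookup (Poly_Mapping.lookup (Poly_Mapping.lookup (grade C p) d) m) q \<noteq> 0"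
      using q by (simp add: g in_keys_iff)
    then show "monom_degree C m q = d" by (auto simp: lookup_grade split: if_splits)
  qed
qed

text \<open>
  Homogeneity in the ambient field, as a quotient of homogeneous Laurent polynomials.  It is closed
  under division, in contrast to homogeneity in the Laurent ring.
\<close>

definition homog :: "'n int_mat \<Rightarrow> 'n::{finite,linorder} ambient \<Rightarrow> 'n int_vec \<Rightarrow> bool" where
  "homog C z d \<longleftrightarrow> (\<exists>P Q d1 d2. Q \<noteq> 0 \<and> homogeneous C P d1 \<and> homogeneous C Q d2 \<and>
     z = of_laurent P / of_laurent Q \<and> d = d1 - d2)"

lemma homogeneous_mult: "homogeneous C P d \<Longrightarrow> homogeneous C Q e \<Longrightarrow> homogeneous C (P * Q) (d + e)"
  by (simp add: homogeneous_grade ring_hom_onD[OF grade_hom] mult_single)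

lemma homogeneous_add: "homogeneous C P d \<Longrightarrow> homogeneous C Q d \<Longrightarrow> homogeneous C (P + Q) d"
  by (simp add: homogeneous_grade ring_hom_onD[OF grade_hom] single_add)

lemma homogeneous_monomial: "homogeneous C (monomial m q c) (monom_degree C m q)"
  by (simp add: homogeneous_grade grade_monomial)

lemma homog_of_laurent: "homogeneous C p d \<Longrightarrow> homog C (of_laurent p) d"
  unfolding homog_def
  by (intro exI[of _ p] exI[of _ 1] exI[of _ d] exI[of _ 0])
    (use homogeneous_monomial[of C 0 0 1] in \<open>simp add: monomial_1 monom_degree_0 of_laurent_simps\<close>)

lemma homog_1: "homog C 1 0"
  using homog_of_laurent[OF homogeneous_monomial[of C 0 0 1]] by (simp add: monomial_1 monom_degree_0 of_laurent_simps)

lemma homog_mult: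
  assumes "homog C z d" "homog C w e"
  shows "homog C (z * w) (d + e)"
proof -
  obtain P Q d1 d2 where 1: "Q \<noteq> 0" "homogeneous C P d1" "homogeneous C Q d2" "z = of_laurent P / of_laurent Q" "d = d1 - d2"
    using assms(1) unfolding homog_def by blast
  obtain R S e1 e2 where 2: "S \<noteq> 0" "homogeneous C R e1" "homogeneous C S e2" "w = of_laurent R / of_laurent S" "e = e1 - e2"
    using assms(2) unfolding homog_def by blast
  show ?thesis
    unfolding homog_def
    by (intro exI[of _ "P * R"] exI[of _ "Q * S"] exI[of _ "d1 + e1"] exI[of _ "d2 + e2"])
      (use 1 2 in \<open>simp add: homogeneous_mult of_laurent_simps\<close>)
qed

lemma homog_add:
  assumes "homog C z d" "homog C w d"
  shows "homog C (z + w) d"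
proof -
  obtain P Q d1 d2 where 1: "Q \<noteq> 0" "homogeneous C P d1" "homogeneous C Q d2" "z = of_laurent P / of_laurent Q" "d = d1 - d2"
    using assms(1) unfolding homog_def by blast
  obtain R S e1 e2 where 2: "S \<noteq> 0" "homogeneous C R e1" "homogeneous C S e2" "w = of_laurent R / of_laurent S" "d = e1 - e2"
    using assms(2) unfolding homog_def by blast
  have eq: "e1 + d2 = d1 + e2" using 1(5) 2(5) by (simp add: algebra_simps)
  have "homogeneous C (P * S + R * Q) (d1 + e2)"
    using homogeneous_add[OF homogeneous_mult[OF 1(2) 2(3)]] homogeneous_mult[OF 2(2) 1(3)] eq by metis
  moreover have "homogeneous C (Q * S) (d2 + e2)" by (rule homogeneous_mult[OF 1(3) 2(3)])
  moreover have "z + w = of_laurent (P * S + R * Q) / of_laurent (Q * S)"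
    using 1(1,4) 2(1,4) by (simp add: of_laurent_simps of_laurent_eq_0 field_simps)
  ultimately show ?thesis
    unfolding homog_def using 1(1,5) 2(1)
    by (intro exI[of _ "P * S + R * Q"] exI[of _ "Q * S"] exI[of _ "d1 + e2"] exI[of _ "d2 + e2"]) simp
qed

lemma homog_inverse:
  assumes "homog C z d" "z \<noteq> 0"
  shows "homog C (inverse z) (- d)"
proof -
  obtain P Q d1 d2 where 1: "Q \<noteq> 0" "homogeneous C P d1" "homogeneous C Q d2" "z = of_laurent P / of_laurent Q" "d = d1 - d2"
    using assms(1) unfolding homog_def by blast
  have "P \<noteq> 0" using 1(4) assms(2) by (auto simp: of_laurent_simps)
  then show ?thesis
    unfolding homog_def
    by (intro exI[of _ Q] exI[of _ P] exI[of _ d2] exI[of _ d1]) (use 1 in simp)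
qed

lemma homog_power: "homog C z d \<Longrightarrow> homog C (z ^ n) (int n *s d)"
proof (induction n)
  case 0
  then show ?case using homog_1 by simp
next
  case (Suc n)
  have "int (Suc n) *s d = d + int n *s d" by (simp add: vec_eq_iff algebra_simps)
  then show ?case using homog_mult[OF Suc.prems Suc.IH[OF Suc.prems]] by simp
qed

lemma homog_power_int:
  assumes "homog C z d" "z \<noteq> 0"
  shows "homog C (z powi n) (n *s d)"
proof (cases "n \<ge> 0")
  case True
  then show ?thesis using homog_power[OF assms(1), of "nat n"] by (simp add: power_int_def)
next
  case False
  then have "n *s d = int (nat (- n)) *s (- d)" by (simp add: vec_eq_iff)
  then show ?thesis using False homog_power[OF homog_inverse[OF assms], of "nat (- n)"] by (simp add: power_int_def)
qed

lemma homog_prod: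
  "(\<And>i. i \<in> I \<Longrightarrow> homog C (f i) (d i)) \<Longrightarrow> homog C (\<Prod>i\<in>I. f i) (\<Sum>i\<in>I. d i)"
  by (induction I rule: infinite_finite_induct) (simp_all add: homog_1 homog_mult)

lemma homog_x_var: "homog C (x_var i) (axis i 1)"
proof -
  have "monom_degree C (Poly_Mapping.single i 1) 0 = axis i 1"
    by (auto simp: vec_eq_iff monom_degree_nth lookup_single when_def axis_def)
  then show ?thesis
    using homog_of_laurent[OF homogeneous_monomial[of C "Poly_Mapping.single i 1" 0 1]]
    by (simp add: x_var_monomial)
qed

lemma homog_y_var: "homog C (y_var j) (- column j C)"
proof -
  have "(\<Sum>l\<in>UNIV. int (Poly_Mapping.lookup (Poly_Mapping.single j 1) l) * C $ k $ l) = (\<Sum>l\<in>UNIV. if l = j then C $ k $ j else 0)" for k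
    by (intro sum.cong) (auto simp: lookup_single when_def)
  then have "monom_degree C 0 (Poly_Mapping.single j 1) = - column j C"
    by (simp add: vec_eq_iff monom_degree_nth column_def)
  then show ?thesis
    using homog_of_laurent[OF homogeneous_monomial[of C 0 "Poly_Mapping.single j 1" 1]]
    by (simp add: y_var_monomial)
qed

text \<open>
  A Laurent polynomial that is a quotient of homogeneous ones is homogeneous: from \<open>P = p Q\<close> and
  \<open>grade P = grade p * grade Q\<close> the factor \<open>Q\<close> can be cancelled, as the Laurent ring is a domain.
\<close>

lemma homog_of_laurentD:
  assumes "homog C (of_laurent p) d"
  shows "homogeneous C p d"
proof -
  obtain P Q d1 d2 where 1: "Q \<noteq> 0" "homogeneous C P d1" "homogeneous C Q d2" "of_laurent p = of_laurent P / of_laurent Q" "d = d1 - d2"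
    using assms(1) unfolding homog_def by blast
  have "of_laurent (p * Q) = of_laurent P"
    using 1(1,4) by (simp add: of_laurent_simps of_laurent_eq_0 field_simps)
  then have P: "P = p * Q" by (simp add: of_laurent_inject)
  have "grade C p * Poly_Mapping.single d2 Q = Poly_Mapping.single d1 (p * Q)"
    using 1(2,3) by (simp add: homogeneous_grade ring_hom_onD[OF grade_hom] P)
  then have eq: "grade C p * Poly_Mapping.single d2 Q * Poly_Mapping.single (- d2) 1 = Poly_Mapping.single d1 (p * Q) * Poly_Mapping.single (- d2) 1"
    by simp
  have "grade C p * Poly_Mapping.single 0 Q = Poly_Mapping.single d p * Poly_Mapping.single 0 Q"
    using eq by (simp add: mult.assoc mult_single 1(5))
  moreover have "a = b" if "a * Poly_Mapping.single 0 Q = b * Poly_Mapping.single 0 Q" for a b :: "'a int_vec \<Rightarrow>\<^sub>0 'a laurent"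
  proof (rule poly_mapping_eqI)
    fix e
    have "Poly_Mapping.map ((*) Q) a = Poly_Mapping.map ((*) Q) b"
      using that by (simp add: mult_map_scale_conv_mult mult.commute)
    then have "Poly_Mapping.lookup (Poly_Mapping.map ((*) Q) a) e = Poly_Mapping.lookup (Poly_Mapping.map ((*) Q) b) e"
      by simp
    then show "Poly_Mapping.lookup a e = Poly_Mapping.lookup b e"
      using 1(1) by (simp add: map.rep_eq when_def split: if_splits)
  qed
  ultimately have "grade C p = Poly_Mapping.single d p" by blast
  then show ?thesis by (simp add: homogeneous_grade)
qed

lemma g_vector_of_homog:
  assumes "z \<noteq> 0" "z = of_laurent p" "homog C z d"
  shows "g_vector C z = d"
proof -
  have unique: "d' = d''" if "has_degree C z d'" "has_degree C z d''" for d' d''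
  proof -
    from that obtain p where p: "z = of_laurent p" "homogeneous C p d'" "homogeneous C p d''"
      unfolding has_degree_def by (auto simp: of_laurent_inject)
    have "p \<noteq> 0" using assms(1) p(1) by (auto simp: of_laurent_simps)
    moreover have "Poly_Mapping.single d' p = Poly_Mapping.single d'' p"
      using p by (simp add: homogeneous_grade)
    ultimately show ?thesis
      by (metis lookup_single_eq lookup_single_not_eq)
  qed
  have "has_degree C z d"
    using assms homog_of_laurentD unfolding has_degree_def by blast
  then show ?thesis
    unfolding g_vector_def using unique by blast
qed

hide_const (open) Polynomial.coeffs

section \<open>Seeds with principal coefficients\<close>

abbreviation trop_vals :: "('n::{finite,linorder} \<Rightarrow> 'n trop) \<Rightarrow> 'n \<Rightarrow> 'n ambient" where
  "trop_vals c \<equiv> \<lambda>j. trop_monom (c j)"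

lemma trop_monom_nonzero: "trop_monom u \<noteq> 0"
  by (simp add: trop_monom_def y_var_nonzero)

lemma trop_monom_0: "trop_monom 0 = 1"
  by (simp add: trop_monom_def)

lemma trop_monom_axis: "trop_monom (axis j 1) = y_var j"
proof -
  have "trop_monom (axis j 1) = (\<Prod>i\<in>UNIV. if i = j then y_var j else 1)"
    unfolding trop_monom_def by (intro prod.cong) (auto simp: axis_def)
  then show ?thesis by simp
qed

lemma trop_monom_add: "trop_monom (u + v) = trop_monom u * trop_monom v"
  by (simp add: trop_monom_def power_int_add y_var_nonzero prod.distrib)

lemma trop_monom_smult: "trop_monom (m *s u) = trop_monom u powi m"
  by (simp add: trop_monom_def power_int_prod power_int_mult mult.commute[of m])

lemma trop_monom_minus: "trop_monom (- u) = inverse (trop_monom u)"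
proof -
  have "- u = (- 1) *s u" by (simp add: vec_eq_iff)
  then show ?thesis using trop_monom_smult[of "-1" u] by (simp add: power_int_minus)
qed

lemma mutate_cluster_eq:
  "mutate_cluster k b c x = mut_x b (trop_monom (c k \<oplus>\<^sub>T 0)) k x (trop_vals c)"
  by (simp add: mutate_cluster_def mut_x_def)

lemma trop_vals_mutate_coeffs:
  "trop_vals (mutate_coeffs k b c) = mut_y b (trop_monom (c k \<oplus>\<^sub>T 0)) k (trop_vals c)"
proof
  fix j
  show "trop_monom (mutate_coeffs k b c j) = mut_y b (trop_monom (c k \<oplus>\<^sub>T 0)) k (trop_vals c) j"
    by (cases "j = k") (simp_all only: mutate_coeffs_def mut_y_def if_True if_False trop_monom_add trop_monom_smult trop_monom_minus
      refl simp_thms)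
qed

lemma mutate_simps:
  "exch_mat (mutate k s) = mutate_mat k (exch_mat s)"
  "cluster (mutate k s) = mut_x (exch_mat s) (trop_monom (coeffs s k \<oplus>\<^sub>T 0)) k (cluster s) (trop_vals (coeffs s))"
  "coeffs (mutate k s) = mutate_coeffs k (exch_mat s) (coeffs s)"
  by (simp_all add: mutate_def mutate_cluster_eq)

lemma initial_seed_simps:
  "exch_mat (initial_seed C) = C" "cluster (initial_seed C) = x_var" "coeffs (initial_seed C) = (\<lambda>j. axis j 1)"
  by (simp_all add: initial_seed_def)

lemma seeds_skew: "s \<in> seeds C \<Longrightarrow> skew C \<Longrightarrow> skew (exch_mat s)"
  by (induction rule: seeds.induct) (simp_all add: initial_seed_simps mutate_simps skew_mutate_mat)

interpretation ambient_pos: positive_part "pos_of coeff_sum"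
  by (rule positive_part_pos_of[OF coeff_sum_hom])

lemma x_var_pos: "x_var i \<in> pos_of coeff_sum" and y_var_pos: "y_var i \<in> pos_of coeff_sum"
  by (rule pos_ofI[of coeff_sum _ 1],
      simp_all add: x_var_monomial y_var_monomial coeff_sum_monomial ring_hom_onD[OF coeff_sum_hom] of_laurent_simps)+

lemma trop_monom_pos: "trop_monom u \<in> pos_of coeff_sum"
  unfolding trop_monom_def by (intro ambient_pos.prod_pos ambient_pos.power_int_pos y_var_pos)

lemma cluster_pos: "s \<in> seeds C \<Longrightarrow> cluster s i \<in> pos_of coeff_sum"
proof (induction arbitrary: i rule: seeds.induct)
  case initial
  show ?case by (simp add: initial_seed_simps x_var_pos)
next
  case (mutation s k)
  show ?case
    unfolding mutate_simps by (intro ambient_pos.mut_x_pos mutation.IH trop_monom_pos)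
qed

lemma cluster_nonzero: "s \<in> seeds C \<Longrightarrow> cluster s i \<noteq> 0"
  using cluster_pos ambient_pos.pos_nonzero by blast

lemma one_plus_yhat_nonzero: "s \<in> seeds C \<Longrightarrow> 1 + yhat (exch_mat s) (cluster s) (trop_vals (coeffs s)) k \<noteq> 0"
  using ambient_pos.add_pos[OF ambient_pos.one_pos ambient_pos.yhat_pos] cluster_pos trop_monom_pos ambient_pos.pos_nonzero
  by metis

text \<open>
  Every seed is the end of a path of mutations.  The normalising factor of a step is a monomial in
  the initial coefficients, the exponents being those of $y_k \oplus 1$.
\<close>

lemma seeds_run:
  assumes "s \<in> seeds C"
  shows "\<exists>ps. \<forall>qs. run (ps @ qs) y_var C x_var y_var = run qs y_var (exch_mat s) (cluster s) (trop_vals (coeffs s))"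
  using assms
proof induction
  case initial
  show ?case
    by (rule exI[of _ "[]"]) (simp add: initial_seed_simps trop_monom_axis)
next
  case (mutation s k)
  then obtain ps where ps: "\<And>qs. run (ps @ qs) y_var C x_var y_var = run qs y_var (exch_mat s) (cluster s) (trop_vals (coeffs s))"
    by blast
  let ?st = "(k, 0, \<lambda>j. (coeffs s k \<oplus>\<^sub>T 0) $ j)"
  have "normaliser ?st y_var (trop_vals (coeffs s)) = trop_monom (coeffs s k \<oplus>\<^sub>T 0)"
    by (simp add: normaliser_def trop_monom_def)
  then have "run ((ps @ [?st]) @ qs) y_var C x_var y_var =
      run qs y_var (exch_mat (mutate k s)) (cluster (mutate k s)) (trop_vals (coeffs (mutate k s)))" for qs
    by (simp add: ps mutate_simps trop_vals_mutate_coeffs)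
  then show ?case by blast
qed

text \<open>
  At the point where the initial variables are assigned to themselves, a Laurent function has a
  value in the Laurent ring, except that the initial coefficients may occur in the denominator.
\<close>

lemma laurent_fun_at_generic_point:
  assumes "F \<in> laurent_fun"
  shows "\<exists>u p. F (ambient_pos.point_of x_var y_var y_var) * of_laurent (monomial 0 u 1) = of_laurent p"
  using assms
proof induction
  case (const n)
  have "of_int n = of_laurent (of_int n)"
    by (cases n rule: int_diff_cases) (simp add: of_laurent_def of_nat_fract)
  then show ?case
    by (intro exI[of _ 0] exI[of _ "of_int n"]) (simp add: monomial_1 of_laurent_simps)
next
  case (var v)
  have "\<exists>p. ambient_pos.point_of x_var y_var y_var v = of_laurent p"
    by (cases v) (auto simp: ambient_pos.point_of_def x_var_monomial y_var_monomial)
  then show ?case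
    by (rule_tac exI[of _ 0]) (simp add: monomial_1 of_laurent_simps)
next
  case (inverse_var v)
  have "\<exists>u p. inverse (y_var j) * of_laurent (monomial 0 u 1) = of_laurent p" for j :: 'a
    by (rule exI[of _ "Poly_Mapping.single j 1"], rule exI[of _ 1])
      (use y_var_nonzero[of j] in \<open>simp add: of_laurent_simps flip: y_var_monomial[unfolded One_nat_def]\<close>)
  moreover have "\<exists>u p. inverse (x_var j) * of_laurent (monomial 0 u 1) = of_laurent p" for j :: 'a
    by (rule exI[of _ 0]) (auto simp: inverse_x_var monomial_1 of_laurent_simps)
  ultimately show ?case
    by (cases v) (simp_all add: ambient_pos.point_of_def)
next
  case (add f g)
  then obtain u p v q where "f (ambient_pos.point_of x_var y_var y_var) * of_laurent (monomial 0 u 1) = of_laurent p"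
      "g (ambient_pos.point_of x_var y_var y_var) * of_laurent (monomial 0 v 1) = of_laurent q" by blast
  moreover have "of_laurent (monomial 0 (u + v) 1) = of_laurent (monomial 0 u 1) * of_laurent (monomial 0 v 1)"
    by (simp add: monomial_mult flip: of_laurent_simps)
  ultimately have "(f (ambient_pos.point_of x_var y_var y_var) + g (ambient_pos.point_of x_var y_var y_var)) * of_laurent (monomial 0 (u + v) 1)
      = of_laurent (p * monomial 0 v 1 + q * monomial 0 u 1)"
    by (simp add: of_laurent_simps ring_distribs flip: mult.assoc)
  then show ?case by blast
next
  case (mult f g)
  then obtain u p v q where "f (ambient_pos.point_of x_var y_var y_var) * of_laurent (monomial 0 u 1) = of_laurent p"
      "g (ambient_pos.point_of x_var y_var y_var) * of_laurent (monomial 0 v 1) = of_laurent q" by blast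
  moreover have "of_laurent (monomial 0 (u + v) 1) = of_laurent (monomial 0 u 1) * of_laurent (monomial 0 v 1)"
    by (simp add: monomial_mult flip: of_laurent_simps)
  ultimately have "(f (ambient_pos.point_of x_var y_var y_var) * g (ambient_pos.point_of x_var y_var y_var)) * of_laurent (monomial 0 (u + v) 1)
      = of_laurent (p * q)"
    by (simp add: of_laurent_simps) (metis (no_types, lifting) mult.assoc mult.commute)
  then show ?case by blast
qed

abbreviation drop_sum :: "'n \<Rightarrow> 'n::{finite,linorder} laurent \<Rightarrow> int" where
  "drop_sum j p \<equiv> coeff_sum (drop_y j p)"

lemma drop_sum_hom: "ring_hom_on (drop_sum j)"
  by (simp add: ring_hom_on_def ring_hom_onD[OF coeff_sum_hom] ring_hom_onD[OF drop_y_hom])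

lemma trop_monom_nonneg:
  assumes "\<And>i. 0 \<le> u $ i"
  shows "\<exists>q. trop_monom u = of_laurent (monomial 0 q 1) \<and> (\<forall>j. Poly_Mapping.lookup q j = nat (u $ j))"
proof -
  have "\<exists>q. (\<Prod>i\<in>I. y_var i powi (u $ i)) = of_laurent (monomial 0 q 1) \<and>
      (\<forall>j. Poly_Mapping.lookup q j = (if j \<in> I then nat (u $ j) else 0))" if "finite I" for I
    using that
  proof (induction I)
    case empty
    show ?case by (rule exI[of _ 0]) (simp add: monomial_1 of_laurent_simps)
  next
    case (insert i I)
    then obtain q where q: "(\<Prod>i\<in>I. y_var i powi (u $ i)) = of_laurent (monomial 0 q 1)"
      "\<And>j. Poly_Mapping.lookup q j = (if j \<in> I then nat (u $ j) else 0)" by blast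
    have pow: "y_var i ^ n = of_laurent (monomial 0 (Poly_Mapping.single i n) 1)" for n
      by (induction n) (simp_all add: monomial_1 of_laurent_simps y_var_monomial monomial_mult flip: of_laurent_simps(2) single_add)
    have "(\<Prod>i\<in>insert i I. y_var i powi (u $ i)) = of_laurent (monomial 0 (Poly_Mapping.single i (nat (u $ i)) + q) 1)"
      using insert.hyps assms[of i] by (simp add: q pow power_int_nonneg_exp monomial_mult flip: of_laurent_simps(2))
    then show ?case
      using insert.hyps by (intro exI[of _ "Poly_Mapping.single i (nat (u $ i)) + q"])
        (auto simp: lookup_add q lookup_single when_def)
  qed
  from this[OF finite[of UNIV]] show ?thesis by (simp add: trop_monom_def)
qed

lemma pos_of_combination:
  assumes e: "ring_hom_on e" and M: "M \<in> pos_of e" "N \<in> pos_of e"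
    and ab: "0 \<le> e a" "0 \<le> e b" "0 < e a + e b"
  shows "of_laurent a * M + of_laurent b * N \<in> pos_of e"
proof -
  obtain P Q where 1: "0 < e P" "0 < e Q" "M = of_laurent P / of_laurent Q" using M(1) by (auto simp: pos_of_def)
  obtain R S where 2: "0 < e R" "0 < e S" "N = of_laurent R / of_laurent S" using M(2) by (auto simp: pos_of_def)
  have nz: "of_laurent Q \<noteq> 0" "of_laurent S \<noteq> 0"
    using 1(2) 2(2) ring_hom_onD(1)[OF e] by (auto simp: of_laurent_eq_0)
  have "0 < e a * (e P * e S) + e b * (e R * e Q)"
    using ab 1(1,2) 2(1,2) by (cases "e a = 0") (auto intro!: add_pos_nonneg mult_nonneg_nonneg mult_pos_pos)
  moreover have "of_laurent a * M + of_laurent b * N = of_laurent (a * (P * S) + b * (R * Q)) / of_laurent (Q * S)"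
    unfolding 1(3) 2(3) using nz by (simp add: of_laurent_simps field_simps)
  ultimately show ?thesis
    using 1(1,2) 2(1,2)
    by (intro pos_ofI[of e "a * (P * S) + b * (R * Q)" "Q * S"]) (simp_all add: ring_hom_onD[OF e] ac_simps)
qed

text \<open>
  Cluster variables are not divisible by \<open>y\<^sub>j\<close>, and \<open>y\<^sub>j\<close> does not divide their denominator, because
  they are positive even after setting \<open>y\<^sub>j\<close> to zero.  For the exchange relation, division by
  $y_k \oplus 1$ leaves two terms with coefficient monomials \<open>u\<close> and \<open>v\<close> without common factor, so at
  least one of them survives.
\<close>

lemma cluster_pos_drop: "s \<in> seeds C \<Longrightarrow> cluster s i \<in> pos_of (drop_sum j)"
proof (induction arbitrary: i rule: seeds.induct)
  interpret positive_part "pos_of (drop_sum j)" by (rule positive_part_pos_of[OF drop_sum_hom])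
  {
    case initial
    show ?case
      unfolding initial_seed_simps
      by (rule pos_ofI[of "drop_sum j" _ 1])
        (simp_all add: x_var_monomial drop_y_monomial coeff_sum_monomial ring_hom_onD[OF drop_sum_hom] of_laurent_simps)
  next
    case (mutation s k)
    let ?c = "coeffs s k" and ?x = "cluster s" and ?b = "exch_mat s"
    define u where "u = ?c - (?c \<oplus>\<^sub>T 0)"
    define v where "v = - (?c \<oplus>\<^sub>T 0)"
    define M where "M = (\<Prod>i\<in>UNIV. ?x i powi [?b $ i $ k]\<^sub>+)"
    define N where "N = (\<Prod>i\<in>UNIV. ?x i powi [- (?b $ i $ k)]\<^sub>+)"
    have MN: "M \<in> pos_of (drop_sum j)" "N \<in> pos_of (drop_sum j)"
      unfolding M_def N_def by (intro prod_pos power_int_pos mutation.IH)+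
    have uv: "0 \<le> u $ i" "0 \<le> v $ i" "u $ i = 0 \<or> v $ i = 0" for i
      by (auto simp: u_def v_def trop_add_def min_def)
    obtain q where q: "trop_monom u = of_laurent (monomial 0 q 1)" "Poly_Mapping.lookup q j = nat (u $ j)"
      using trop_monom_nonneg[OF uv(1)] by blast
    obtain r where r: "trop_monom v = of_laurent (monomial 0 r 1)" "Poly_Mapping.lookup r j = nat (v $ j)"
      using trop_monom_nonneg[OF uv(2)] by blast
    have "trop_monom u * M + trop_monom v * N \<in> pos_of (drop_sum j)"
      unfolding q(1) r(1)
      by (rule pos_of_combination[OF drop_sum_hom MN])
        (use uv(3)[of j] in \<open>auto simp: drop_y_monomial coeff_sum_monomial q(2) r(2) ring_hom_onD[OF coeff_sum_hom]\<close>)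
    moreover have "cluster (mutate k s) k = (trop_monom u * M + trop_monom v * N) / ?x k"
    proof -
      have "trop_monom ?c = trop_monom u * trop_monom (?c \<oplus>\<^sub>T 0)" "1 = trop_monom v * trop_monom (?c \<oplus>\<^sub>T 0)"
        by (simp_all add: u_def v_def trop_monom_0 flip: trop_monom_add)
      then have "trop_monom ?c * M + N = (trop_monom u * M + trop_monom v * N) * trop_monom (?c \<oplus>\<^sub>T 0)"
        by (metis (no_types, lifting) mult.assoc mult.commute mult_1_left ring_class.ring_distribs(2))
      then show ?thesis
        unfolding mutate_simps mut_x_def M_def[symmetric] N_def[symmetric]
        using trop_monom_nonzero[of "?c \<oplus>\<^sub>T 0"] by simp
    qed
    ultimately have "cluster (mutate k s) k \<in> pos_of (drop_sum j)"
      using divide_pos mutation.IH by metis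
    then show ?case
      using mutation.IH[of i] by (cases "i = k") (simp_all add: mutate_simps mut_x_def)
  }
qed

text \<open>
  By the Laurent phenomenon only powers of the \<open>y\<^sub>j\<close> could occur in the denominator.  They are removed
  one factor at a time: \<open>drop_y\<close> shows that the numerator is divisible by \<open>y\<^sub>j\<close> as well.
\<close>

theorem cluster_variable_laurent:
  fixes C :: "'n::{finite,linorder} int_mat"
  assumes s: "s \<in> seeds C" and C: "skew C"
  shows "\<exists>p. cluster s i = of_laurent p"
proof -
  obtain ps where "\<And>qs. run (ps @ qs) y_var C x_var y_var = run qs y_var (exch_mat s) (cluster s) (trop_vals (coeffs s))"
    using seeds_run[OF s] by blast
  from this[of "[]"] have ps: "run ps y_var C x_var y_var = cluster s" by simp
  obtain F :: "('n var \<Rightarrow> 'n ambient) \<Rightarrow> 'n ambient"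
    where F: "F \<in> laurent_fun" "\<And>p. p \<in> ambient_pos.points \<Longrightarrow>
      run ps (ambient_pos.Zs p) C (ambient_pos.Xs p) (ambient_pos.Ys p) i = F p"
    using ambient_pos.laurent_run[OF C, of ps i] unfolding ambient_pos.laurent_def by blast
  have "ambient_pos.point_of x_var y_var (y_var :: 'n \<Rightarrow> _) \<in> ambient_pos.points"
    by (auto simp: ambient_pos.points_def ambient_pos.point_of_def x_var_pos y_var_pos split: var.split)
  from F(2)[OF this] have "cluster s i = F (ambient_pos.point_of x_var y_var y_var)"
    by (simp add: ps)
  then obtain u p where "cluster s i * of_laurent (monomial 0 u 1) = of_laurent p"
    using laurent_fun_at_generic_point[OF F(1)] by metis
  then show ?thesis
  proof (induction "\<Sum>j\<in>UNIV. Poly_Mapping.lookup u j" arbitrary: u p)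
    case 0
    then have "u = 0" by (intro poly_mapping_eqI) auto
    then show ?case using 0 by (auto simp: monomial_1 of_laurent_simps)
  next
    case (Suc n)
    then obtain j where j: "Poly_Mapping.lookup u j \<noteq> 0"
      by (metis (no_types, lifting) nat.distinct(1) sum.neutral)
    let ?y = "monomial 0 (Poly_Mapping.single j 1) 1"
    define u' where "u' = u - Poly_Mapping.single j 1"
    have u: "u = Poly_Mapping.single j 1 + u'"
      using j by (intro poly_mapping_eqI) (auto simp: u'_def lookup_add lookup_minus lookup_single when_def)
    obtain P Q where PQ: "0 < drop_sum j P" "0 < drop_sum j Q" "cluster s i = of_laurent P / of_laurent Q"
      using cluster_pos_drop[OF s, of i j] by (auto simp: pos_of_def)
    have Q: "drop_y j Q \<noteq> 0" using PQ(2) by (auto simp: ring_hom_onD[OF coeff_sum_hom])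
    then have "Q \<noteq> 0" by (auto simp: ring_hom_onD[OF drop_y_hom])
    then have "of_laurent (P * monomial 0 u 1) = of_laurent (p * Q)"
      using Suc.prems PQ(3) by (simp add: of_laurent_simps of_laurent_eq_0 field_simps)
    then have "P * monomial 0 u 1 = p * Q" by (simp add: of_laurent_inject)
    then have "drop_y j (P * monomial 0 u 1) = drop_y j (p * Q)" by simp
    then have "drop_y j p = 0" using j Q by (simp add: ring_hom_onD[OF drop_y_hom] drop_y_monomial)
    then obtain p' where p': "p = ?y * p'" using drop_y_decomposition[of p j] by auto
    have "of_laurent ?y * (cluster s i * of_laurent (monomial 0 u' 1)) = of_laurent ?y * of_laurent p'"
      using Suc.prems unfolding u p' by (simp add: of_laurent_simps ac_simps monomial_mult flip: of_laurent_simps(2))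
    then have "cluster s i * of_laurent (monomial 0 u' 1) = of_laurent p'"
      using y_var_nonzero[of j] by (simp flip: y_var_monomial[unfolded One_nat_def])
    moreover have "n = (\<Sum>j\<in>UNIV. Poly_Mapping.lookup u' j)"
    proof -
      have "(\<Sum>l\<in>UNIV. Poly_Mapping.lookup (Poly_Mapping.single j 1) l) = (\<Sum>l\<in>UNIV. if l = j then 1 else (0::nat))"
        by (intro sum.cong) (auto simp: lookup_single when_def)
      then show ?thesis using Suc.hyps(2) unfolding u by (simp add: lookup_add sum.distrib)
    qed
    ultimately show ?case using Suc.hyps(1) by blast
  qed
qed

section \<open>Degrees of the cluster variables\<close>

text \<open>
  That the elements \<open>yhat\<close> have degree \<open>0\<close> is part of the invariant: it makes \<open>1 + yhat\<close> homogeneous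
  and thereby the exchange relation.
\<close>

definition graded_seed :: "'n int_mat \<Rightarrow> 'n::{finite,linorder} seed \<Rightarrow> ('n \<Rightarrow> 'n int_vec) \<Rightarrow> bool" where
  "graded_seed C s G \<longleftrightarrow> (\<forall>i. homog C (cluster s i) (G i)) \<and>
     (\<forall>j. homog C (yhat (exch_mat s) (cluster s) (trop_vals (coeffs s)) j) 0)"

lemma homog_divide: "homog C z d \<Longrightarrow> homog C w e \<Longrightarrow> w \<noteq> 0 \<Longrightarrow> homog C (z / w) (d - e)"
  using homog_mult[OF _ homog_inverse] by (simp add: divide_inverse)

lemma graded_initial_seed: "graded_seed C (initial_seed C) (\<lambda>i. axis i 1)"
proof -
  have "homog C (yhat C x_var y_var j) 0" for j
  proof -
    have "homog C (yhat C x_var y_var j) (- column j C + (\<Sum>i\<in>UNIV. C $ i $ j *s axis i 1))"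
      unfolding yhat_def by (intro homog_mult homog_y_var homog_prod homog_power_int homog_x_var x_var_nonzero)
    moreover have "(\<Sum>i\<in>UNIV. C $ i $ j *s axis i (1::int)) = column j C"
    proof -
      have "(\<Sum>i\<in>UNIV. C $ i $ j * axis i 1 $ k) = (\<Sum>i\<in>UNIV. if i = k then C $ k $ j else 0)" for k
        by (intro sum.cong) (auto simp: axis_def)
      then show ?thesis by (simp add: vec_eq_iff column_def)
    qed
    ultimately show ?thesis by simp
  qed
  then show ?thesis
    by (simp add: graded_seed_def initial_seed_simps homog_x_var trop_monom_axis)
qed

text \<open>
  In the form of \<open>mut_x_same\<close>, the new variable is a homogeneous monomial times \<open>1 + yhat\<close>, divided by
  $y_k \oplus 1$.  By sign-coherence, $y_k \oplus 1$ is either \<open>1\<close> or \<open>y\<^sub>k\<close>, whose degree is known from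
  \<open>yhat\<close>; this gives the two cases of the formula.
\<close>

lemma graded_mutate:
  fixes C :: "'n::{finite,linorder} int_mat" and e :: int
  assumes s: "s \<in> seeds C" and C: "skew C" and G: "graded_seed C s G"
    and e: "e = 1 \<or> e = -1" and sign: "\<And>j. 0 \<le> e * coeffs s k $ j"
  shows "graded_seed C (mutate k s) (G(k := (\<Sum>i\<in>UNIV. [e * exch_mat s $ k $ i]\<^sub>+ *s G i) - G k))"
    and "coeffs (mutate k s) = (\<lambda>j. if j = k then - coeffs s k
           else coeffs s j + [e * exch_mat s $ k $ j]\<^sub>+ *s coeffs s k)"
proof -
  let ?b = "exch_mat s" and ?x = "cluster s" and ?y = "trop_vals (coeffs s)"
  let ?\<mu> = "trop_monom (coeffs s k \<oplus>\<^sub>T 0)"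
  have b: "skew ?b" by (rule seeds_skew[OF s C])
  note nz = cluster_nonzero[OF s] trop_monom_nonzero
  have h: "1 + yhat ?b ?x ?y k \<noteq> 0" by (rule one_plus_yhat_nonzero[OF s])
  have x: "homog C (?x i) (G i)" and y0: "homog C (yhat ?b ?x ?y i) 0" for i
    using G by (auto simp: graded_seed_def)
  have one: "homog C (1 + yhat ?b ?x ?y k) 0" by (rule homog_add[OF homog_1 y0])
  have tr: "coeffs s k \<oplus>\<^sub>T 0 = (if e = 1 then 0 else coeffs s k)"
    using e sign by (auto simp: trop_add_def vec_eq_iff min_def intro: antisym)
  have yk: "homog C (?y k) (- (\<Sum>i\<in>UNIV. ?b $ i $ k *s G i))"
  proof -
    have "homog C (yhat ?b ?x ?y k / (\<Prod>i\<in>UNIV. ?x i powi (?b $ i $ k))) (0 - (\<Sum>i\<in>UNIV. ?b $ i $ k *s G i))"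
      by (intro homog_divide y0 homog_prod homog_power_int x nz) (simp add: nz)
    then show ?thesis by (simp add: yhat_def nz)
  qed
  have \<mu>: "homog C ?\<mu> (if e = 1 then 0 else - (\<Sum>i\<in>UNIV. ?b $ i $ k *s G i))"
    unfolding tr by (simp add: trop_monom_0 yk homog_1)
  have xk: "homog C (mut_x ?b ?\<mu> k ?x ?y k) ((\<Sum>i\<in>UNIV. [e * ?b $ k $ i]\<^sub>+ *s G i) - G k)"
  proof -
    have "homog C (mut_x ?b ?\<mu> k ?x ?y k)
        (0 + (\<Sum>i\<in>-{k}. [- (?b $ i $ k)]\<^sub>+ *s G i) - ((if e = 1 then 0 else - (\<Sum>i\<in>UNIV. ?b $ i $ k *s G i)) + G k))"
      unfolding mut_x_same[OF b nz]
      by (intro homog_divide homog_mult one homog_prod homog_power_int x \<mu> nz) (simp add: nz)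
    moreover have "(\<Sum>i\<in>-{k}. [- (?b $ i $ k)]\<^sub>+ *s G i) = (\<Sum>i\<in>UNIV. [?b $ k $ i]\<^sub>+ *s G i)"
    proof (rule sum.mono_neutral_cong_left)
      show "\<forall>i\<in>UNIV - - {k}. [?b $ k $ i]\<^sub>+ *s G i = 0"
        by (simp add: skew_diag[OF b] pos_part_def)
      show "[- (?b $ i $ k)]\<^sub>+ *s G i = [?b $ k $ i]\<^sub>+ *s G i" for i
        by (simp add: skewD[OF b, of k i])
    qed auto
    moreover have "(\<Sum>i\<in>UNIV. [?b $ k $ i]\<^sub>+ *s G i) + (\<Sum>i\<in>UNIV. ?b $ i $ k *s G i) = (\<Sum>i\<in>UNIV. [- ?b $ k $ i]\<^sub>+ *s G i)"
      unfolding sum.distrib[symmetric]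
    proof (rule sum.cong[OF refl])
      fix i
      show "[?b $ k $ i]\<^sub>+ *s G i + ?b $ i $ k *s G i = [- ?b $ k $ i]\<^sub>+ *s G i"
        using pos_part_diff[of "?b $ k $ i"] skewD[OF b, of k i]
        by (simp add: vec_eq_iff flip: distrib_right)
    qed
    ultimately show ?thesis
      using e by (auto simp: algebra_simps)
  qed
  have "homog C (yhat (mutate_mat k ?b) (mut_x ?b ?\<mu> k ?x ?y) (mut_y ?b ?\<mu> k ?y) j) 0" for j
  proof (cases "j = k")
    case True
    then show ?thesis
      using homog_inverse[OF y0[of k] yhat_nonzero[OF b nz]] by (simp add: yhat_mutate_same[OF b nz])
  next
    case False
    have "homog C (yhat ?b ?x ?y j * yhat ?b ?x ?y k powi [?b $ k $ j]\<^sub>+ * (1 + yhat ?b ?x ?y k) powi (- (?b $ k $ j)))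
        (0 + [?b $ k $ j]\<^sub>+ *s 0 + (- (?b $ k $ j)) *s 0)"
      by (intro homog_mult homog_power_int y0 one h yhat_nonzero[OF b nz])
    then show ?thesis
      by (simp add: yhat_mutate_other[OF b nz trop_monom_nonzero h False])
  qed
  then show "graded_seed C (mutate k s) (G(k := (\<Sum>i\<in>UNIV. [e * ?b $ k $ i]\<^sub>+ *s G i) - G k))"
    using xk x unfolding graded_seed_def mutate_simps trop_vals_mutate_coeffs by (simp add: mut_x_def)
  show "coeffs (mutate k s) = (\<lambda>j. if j = k then - coeffs s k
           else coeffs s j + [e * ?b $ k $ j]\<^sub>+ *s coeffs s k)"
  proof
    fix j
    show "coeffs (mutate k s) j = (if j = k then - coeffs s k
           else coeffs s j + [e * ?b $ k $ j]\<^sub>+ *s coeffs s k)"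
      using e by (auto simp: mutate_simps mutate_coeffs_def tr vec_eq_iff pos_part_diff[of "?b $ k $ j"] algebra_simps)
  qed
qed

theorem g_vector_graded_seed:
  assumes "s \<in> seeds C" "skew C" "graded_seed C s G"
  shows "g_vector C (cluster s i) = G i"
  using cluster_variable_laurent[OF assms(1,2), of i] g_vector_of_homog[OF cluster_nonzero[OF assms(1), of i]] assms(3)
  unfolding graded_seed_def by blast

section \<open>Pairs of vectors and their symmetries\<close>

text \<open>
  A datatype rather than the vector type, so that rewriting can compute with concrete vectors.
\<close>

datatype v6 = V (cp1: int) (cp2: int) (cp3: int) (cp4: int) (cp5: int) (cp6: int)

instantiation v6 :: ab_group_add
begin
definition zero_v6 :: v6 where "0 = V 0 0 0 0 0 0"
fun plus_v6 :: "v6 \<Rightarrow> v6 \<Rightarrow> v6" where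
  "V a1 a2 a3 a4 a5 a6 + V b1 b2 b3 b4 b5 b6 = V (a1 + b1) (a2 + b2) (a3 + b3) (a4 + b4) (a5 + b5) (a6 + b6)"
fun uminus_v6 :: "v6 \<Rightarrow> v6" where
  "- V a1 a2 a3 a4 a5 a6 = V (- a1) (- a2) (- a3) (- a4) (- a5) (- a6)"
definition minus_v6 :: "v6 \<Rightarrow> v6 \<Rightarrow> v6" where "minus_v6 a b = a + - b"
instance
proof
  fix a b c :: v6
  show "a + b + c = a + (b + c)" by (cases a; cases b; cases c) simp
  show "a + b = b + a" by (cases a; cases b) simp
  show "0 + a = a" by (cases a) (simp add: zero_v6_def)
  show "- a + a = 0" by (cases a) (simp add: zero_v6_def)
  show "a - b = a + - b" by (simp add: minus_v6_def)
qed
end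

fun smul :: "int \<Rightarrow> v6 \<Rightarrow> v6" where
  "smul m (V a1 a2 a3 a4 a5 a6) = V (m * a1) (m * a2) (m * a3) (m * a4) (m * a5) (m * a6)"

text \<open>The form is alternating and factors through \<open>(c\<^sub>1 + c\<^sub>4 - c\<^sub>3 - c\<^sub>6, c\<^sub>2 + c\<^sub>5 - c\<^sub>3 - c\<^sub>6)\<close>.\<close>

fun omega :: "v6 \<Rightarrow> v6 \<Rightarrow> int" where
  "omega (V a1 a2 a3 a4 a5 a6) (V b1 b2 b3 b4 b5 b6) =
     (a2 + a5 - a3 - a6) * (b1 + b4 - b3 - b6) - (a1 + a4 - a3 - a6) * (b2 + b5 - b3 - b6)"

fun nonneg :: "v6 \<Rightarrow> bool" where
  "nonneg (V a1 a2 a3 a4 a5 a6) \<longleftrightarrow> 0 \<le> a1 \<and> 0 \<le> a2 \<and> 0 \<le> a3 \<and> 0 \<le> a4 \<and> 0 \<le> a5 \<and> 0 \<le> a6"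

text \<open>
  \<open>La\<close> and \<open>Ra\<close> generate the self-similarity.  \<open>Ro\<close>, \<open>S1\<close>, \<open>S2\<close>, \<open>S3\<close> permute coordinates as the
  given group does: rotation and the three swaps of opposite coordinates.  \<open>Re\<close> combines a permutation
  that reverses the sign of \<open>omega\<close> with a sign change, and it exchanges the roles of \<open>La\<close> and \<open>Ra\<close>.
\<close>

datatype letter = La | Ra | Ro | S1 | S2 | S3 | Re

fun actc :: "letter \<Rightarrow> v6 \<Rightarrow> v6" where
  "actc La (V a1 a2 a3 a4 a5 a6) = V a1 a3 (a3 + a6 - a5) a4 a6 (a3 + a6 - a2)"
| "actc Ra (V a1 a2 a3 a4 a5 a6) = V a3 a2 (a3 + a6 - a4) a6 a5 (a3 + a6 - a1)"
| "actc Ro (V a1 a2 a3 a4 a5 a6) = V a2 a3 a1 a5 a6 a4"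
| "actc S1 (V a1 a2 a3 a4 a5 a6) = V a4 a2 a3 a1 a5 a6"
| "actc S2 (V a1 a2 a3 a4 a5 a6) = V a1 a5 a3 a4 a2 a6"
| "actc S3 (V a1 a2 a3 a4 a5 a6) = V a1 a2 a6 a4 a5 a3"
| "actc Re (V a1 a2 a3 a4 a5 a6) = V (- a2) (- a1) (- a3) (- a5) (- a4) (- a6)"

text \<open>On the second components \<open>La\<close> and \<open>Ra\<close> act by different matrices.\<close>

fun actg :: "letter \<Rightarrow> v6 \<Rightarrow> v6" where
  "actg La (V a1 a2 a3 a4 a5 a6) = V a1 (a2 + a3 + a5) (- a5) a4 (a2 + a5 + a6) (- a2)"
| "actg Ra (V a1 a2 a3 a4 a5 a6) = V (a1 + a3 + a4) a2 (- a4) (a1 + a4 + a6) a5 (- a1)"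
| "actg x a = actc x a"

definition act_letter :: "letter \<Rightarrow> v6 \<times> v6 \<Rightarrow> v6 \<times> v6" where
  "act_letter x p = (actc x (fst p), actg x (snd p))"

definition act :: "letter list \<Rightarrow> v6 \<times> v6 \<Rightarrow> v6 \<times> v6" where
  "act w p = foldr act_letter w p"

text \<open>
  Mutation at position \<open>k\<close> of a list of pairs, where \<open>e\<close> is the sign of the vector at that position.
  The list keeps its order, so that positions can serve as names in walks.
\<close>

definition mutate_list :: "int \<Rightarrow> nat \<Rightarrow> (v6 \<times> v6) list \<Rightarrow> (v6 \<times> v6) list" where
  "mutate_list e k ps = (let (c, g) = ps ! k; ms = map (\<lambda>q. (max (e * omega c (fst q)) 0, q)) ps in
     (map (\<lambda>(m, c', g'). (c' + smul m c, g')) ms)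
       [k := (- c, sum_list (map (\<lambda>(m, c', g'). smul m g') ms) - g)])"

section \<open>Families of multisets\<close>

text \<open>
  A kind names a language of words in \<open>La\<close> and \<open>Ra\<close>: the empty word only (\<open>K0\<close>), powers of \<open>La\<close> (\<open>KL\<close>),
  powers of \<open>Ra\<close> (\<open>KR\<close>), words containing \<open>Ra\<close> (\<open>KM\<close>), words containing \<open>La\<close> (\<open>KN\<close>), all words (\<open>KF\<close>).
  A kind together with a list of pairs stands for all images of the list under the words of the
  language.
\<close>

datatype kind = K0 | KL | KR | KM | KN | KF

text \<open>
  Every word of the language maps the cone into the vectors with nonnegative entries.  In the cone of
  \<open>KM\<close> the first and fourth entry may be negative, since \<open>Ra\<close>, which occurs in the word, uses them only
  with a negative sign; \<open>KN\<close> is the mirror image of \<open>KM\<close>.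
\<close>

fun cone :: "kind \<Rightarrow> v6 \<Rightarrow> bool" where
  "cone K0 c = nonneg c"
| "cone KL (V a1 a2 a3 a4 a5 a6) \<longleftrightarrow> nonneg (V a1 a2 a3 a4 a5 a6) \<and> a2 + a5 \<le> a3 + a6"
| "cone KR (V a1 a2 a3 a4 a5 a6) \<longleftrightarrow> nonneg (V a1 a2 a3 a4 a5 a6) \<and> a1 + a4 \<le> a3 + a6"
| "cone KF (V a1 a2 a3 a4 a5 a6) \<longleftrightarrow> nonneg (V a1 a2 a3 a4 a5 a6) \<and> a1 + a4 \<le> a3 + a6 \<and> a2 + a5 \<le> a3 + a6"
| "cone KM (V a1 a2 a3 a4 a5 a6) \<longleftrightarrow> 0 \<le> a2 \<and> 0 \<le> a3 \<and> 0 \<le> a5 \<and> 0 \<le> a6 \<and> a1 \<le> a3 + a6 \<and> a4 \<le> a3 + a6 \<and>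
     a1 + a4 \<le> a3 + a6 \<and> a2 + a5 \<le> a3 + a6"
| "cone KN (V a1 a2 a3 a4 a5 a6) \<longleftrightarrow> 0 \<le> a1 \<and> 0 \<le> a3 \<and> 0 \<le> a4 \<and> 0 \<le> a6 \<and> a2 \<le> a3 + a6 \<and> a5 \<le> a3 + a6 \<and>
     a1 + a4 \<le> a3 + a6 \<and> a2 + a5 \<le> a3 + a6"

definition cone_sign :: "kind \<Rightarrow> v6 \<Rightarrow> int" where
  "cone_sign k c = (if cone k c then 1 else if cone k (- c) then -1 else 0)"

type_synonym family = "kind \<times> (v6 \<times> v6) list"

text \<open>
  A certificate shows that all members of a family belong to known families.  \<open>Ref t w\<close> names the
  family \<open>t\<close>, up to the letters \<open>w\<close>.  The splits divide the language of the given family, either by the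
  presence of a letter or by the innermost letter of the word, which is then absorbed into the list.
  The families are functions on a one-element type in order that rewriting unfolds them only when they
  are used.
\<close>

datatype cert = Ref "unit \<Rightarrow> family" "letter list" | SplitL cert cert | SplitR cert cert

fun subkind :: "kind \<Rightarrow> kind \<Rightarrow> bool" where
  "subkind k k' \<longleftrightarrow> k = k' \<or> k' = KF \<or> (k = K0 \<and> (k' = KL \<or> k' = KR))"

fun rev_kind :: "kind \<Rightarrow> kind" where
  "rev_kind K0 = K0" | "rev_kind KL = KR" | "rev_kind KR = KL" | "rev_kind KM = KN" | "rev_kind KN = KM" | "rev_kind KF = KF"

text \<open>
  Whether a word of the first language, followed by the letters given, can be rearranged to a
  symmetry after a word of the second language: \<open>La\<close> and \<open>Ra\<close> lengthen the word, the swaps and \<open>Re\<close> move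
  to the front, and \<open>Ro\<close> can be dealt with only if the word is empty.
\<close>

fun word_ok :: "kind \<Rightarrow> letter list \<Rightarrow> kind \<Rightarrow> bool" where
  "word_ok k [] k' = subkind k k'"
| "word_ok k (La # w) k' \<longleftrightarrow> word_ok KN w k' \<or> (k = K0 \<or> k = KL) \<and> word_ok KL w k' \<or> k = KM \<and> word_ok KM w k'"
| "word_ok k (Ra # w) k' \<longleftrightarrow> word_ok KM w k' \<or> (k = K0 \<or> k = KR) \<and> word_ok KR w k' \<or> k = KN \<and> word_ok KN w k'"
| "word_ok k (S1 # w) k' = word_ok k w k'"
| "word_ok k (S2 # w) k' = word_ok k w k'"
| "word_ok k (S3 # w) k' = word_ok k w k'"
| "word_ok k (Re # w) k' = word_ok (rev_kind k) w k'"
| "word_ok k (Ro # w) k' \<longleftrightarrow> k = K0 \<and> word_ok k w k'"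

fun perm_eq :: "'a list \<Rightarrow> 'a list \<Rightarrow> bool" where
  "perm_eq [] ys \<longleftrightarrow> ys = []"
| "perm_eq (x # xs) ys \<longleftrightarrow> x \<in> set ys \<and> perm_eq xs (remove1 x ys)"

fun covers :: "cert \<Rightarrow> kind \<Rightarrow> (v6 \<times> v6) list \<Rightarrow> bool" where
  "covers (Ref t w) k X = (case t () of (k', s) \<Rightarrow> word_ok k w k' \<and> perm_eq X (map (act w) s))"
| "covers (SplitL a b) k X = (case k of
     KL \<Rightarrow> covers a K0 X \<and> covers b KL (map (act_letter La) X)
   | KR \<Rightarrow> covers a K0 X \<and> covers b KR (map (act_letter Ra) X)
   | KF \<Rightarrow> covers a KL X \<and> covers b KM X
   | KM \<Rightarrow> covers a KF (map (act_letter Ra) X) \<and> covers b KM (map (act_letter La) X)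
   | KN \<Rightarrow> covers a KF (map (act_letter La) X) \<and> covers b KN (map (act_letter Ra) X)
   | K0 \<Rightarrow> False)"
| "covers (SplitR a b) k X \<longleftrightarrow> k = KF \<and> covers a KR X \<and> covers b KN X"

fun covers_from :: "cert list \<Rightarrow> nat \<Rightarrow> family \<Rightarrow> bool" where
  "covers_from [] j f \<longleftrightarrow> True"
| "covers_from (c # cs) j (k, s) \<longleftrightarrow> (let e = cone_sign k (fst (s ! j)) in e \<noteq> 0 \<and> covers c k (mutate_list e j s)) \<and>
     covers_from cs (Suc j) (k, s)"

text \<open>
  The shape of a degree vector, in its standard position.  The slope \<open>b / a\<close> is recovered from the sums
  of opposite coordinates and the sum \<open>h\<close> of all of them.  The two exclusions concern the boundary
  slopes \<open>0\<close> and \<open>\<infinity>\<close>, where one of the three values of \<open>h\<close> does not occur.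
\<close>

fun std_gvec :: "v6 \<Rightarrow> bool" where
  "std_gvec (V g1 g2 g3 g4 g5 g6) = (let h = g1 + g2 + g3 + g4 + g5 + g6; a = g2 + g5 - h; b = h - (g1 + g4) in
     \<bar>h\<bar> \<le> 1 \<and> \<bar>g1 - g4\<bar> \<le> 1 \<and> \<bar>g2 - g5\<bar> \<le> 1 \<and> \<bar>g3 - g6\<bar> \<le> 1 \<and> coprime a b \<and> 0 \<le> a \<and> 0 \<le> b \<and>
     \<not> (b = 0 \<and> h = 1) \<and> \<not> (a = 0 \<and> h = -1))"

text \<open>The rotations of the standard position account for the three-cycles of the group.\<close>

definition gvec :: "v6 \<Rightarrow> bool" where
  "gvec g \<longleftrightarrow> std_gvec g \<or> std_gvec (actg Ro g) \<or> std_gvec (actg Ro (actg Ro g))"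

text \<open>
  The boundary vectors excluded in the standard shape at slope \<open>0\<close> are admitted here, since they
  become standard as soon as \<open>Ra\<close> is applied.
\<close>

fun weak_gvec :: "v6 \<Rightarrow> bool" where
  "weak_gvec (V g1 g2 g3 g4 g5 g6) = (let h = g1 + g2 + g3 + g4 + g5 + g6; a = g2 + g5 - h; b = h - (g1 + g4) in
     \<bar>h\<bar> \<le> 1 \<and> \<bar>g1 - g4\<bar> \<le> 1 \<and> \<bar>g2 - g5\<bar> \<le> 1 \<and> \<bar>g3 - g6\<bar> \<le> 1 \<and> coprime a b \<and> 0 \<le> a \<and> 0 \<le> b \<and>
     \<not> (a = 0 \<and> h = -1))"

text \<open>
  What the second components of a family must satisfy in order that all their images under the
  language have the right shape.  Families of the kinds \<open>KR\<close> and \<open>KN\<close> do not occur in the table: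
  \<open>Re\<close> turns them into the kinds \<open>KL\<close> and \<open>KM\<close>.
\<close>

fun gvec_kind :: "kind \<Rightarrow> v6 \<Rightarrow> bool" where
  "gvec_kind K0 g = gvec g"
| "gvec_kind KL g \<longleftrightarrow> std_gvec g \<or> g \<in> {V 1 0 0 0 0 0, V 0 0 0 1 0 0, V 0 0 1 0 0 0, V 0 0 0 0 0 1}"
| "gvec_kind KM g = weak_gvec g"
| "gvec_kind KF g = std_gvec g"
| "gvec_kind _ g = False"

definition closed_family :: "(unit \<Rightarrow> family) \<times> cert list \<Rightarrow> bool" where
  "closed_family tc = (case tc of (t, cs) \<Rightarrow> (case t () of (k, s) \<Rightarrow>
     length s = 6 \<and> length cs = 6 \<and> list_all (\<lambda>p. gvec_kind k (snd p)) s \<and> covers_from cs 0 (k, s)))"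

section \<open>The families and their certificates\<close>

text \<open>
  The family \<open>T0\<close> is the initial seed.  The others arise from it by repeated mutation, each time
  writing the result as a word applied to a list as simple as possible.
\<close>

definition "T0 (u::unit) = (K0, [(V 1 0 0 0 0 0, V 1 0 0 0 0 0), (V 0 1 0 0 0 0, V 0 1 0 0 0 0), (V 0 0 1 0 0 0, V 0 0 1 0 0 0), (V 0 0 0 1 0 0, V 0 0 0 1 0 0), (V 0 0 0 0 1 0, V 0 0 0 0 1 0), (V 0 0 0 0 0 1, V 0 0 0 0 0 1)])"
definition "T1 (u::unit) = (KL, [(V 0 0 (-1) 0 0 0, V 0 1 (-1) 0 1 0), (V 1 0 0 0 0 0, V 1 0 0 0 0 0), (V 0 1 1 0 0 0, V 0 1 0 0 0 0), (V 0 0 0 0 0 1, V 0 0 0 0 0 1), (V 0 0 0 1 0 0, V 0 0 0 1 0 0), (V 0 0 1 0 1 0, V 0 0 0 0 1 0)])"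
definition "T2 (u::unit) = (KL, [(V 0 1 1 0 0 1, V 0 1 0 0 0 0), (V 1 0 0 0 0 0, V 1 0 0 0 0 0), (V 0 0 0 0 0 (-1), V 0 1 0 0 1 (-1)), (V 0 0 1 0 1 1, V 0 0 0 0 1 0), (V 0 0 0 1 0 0, V 0 0 0 1 0 0), (V 0 0 (-1) 0 0 0, V 0 1 (-1) 0 1 0)])"
definition "T3 (u::unit) = (KL, [(V 0 0 (-1) 0 0 0, V 0 1 (-1) 0 1 0), (V (-1) 0 0 0 0 0, V (-1) 0 0 0 0 1), (V 0 1 1 0 0 0, V 0 1 0 0 0 0), (V 1 0 0 0 0 1, V 0 0 0 0 0 1), (V 0 0 0 1 0 0, V 0 0 0 1 0 0), (V 0 0 1 0 1 0, V 0 0 0 0 1 0)])"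
definition "T4 (u::unit) = (K0, [(V 0 1 0 0 0 0, V 0 1 (-1) 0 1 0), (V 1 0 0 0 0 0, V 1 0 0 0 0 0), (V 0 (-1) (-1) 0 0 0, V 0 0 (-1) 0 1 0), (V 0 0 0 0 0 1, V 0 0 0 0 0 1), (V 0 0 0 1 0 0, V 0 0 0 1 0 0), (V 0 0 1 0 1 0, V 0 0 0 0 1 0)])"
definition "T5 (u::unit) = (KL, [(V 0 0 0 0 0 (-1), V 0 1 (-1) 0 2 (-1)), (V 1 0 0 0 0 0, V 1 0 0 0 0 0), (V 0 (-1) (-1) 0 0 0, V 0 0 (-1) 0 1 0), (V 0 0 1 0 1 1, V 0 0 0 0 1 0), (V 0 0 0 1 0 0, V 0 0 0 1 0 0), (V 0 1 0 0 0 1, V 0 1 (-1) 0 1 0)])"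
definition "T6 (u::unit) = (KL, [(V 1 1 1 0 0 1, V 0 1 0 0 0 0), (V (-1) 0 0 0 0 0, V (-1) 1 0 0 1 0), (V 0 0 0 0 0 (-1), V 0 1 0 0 1 (-1)), (V 1 0 1 0 1 1, V 0 0 0 0 1 0), (V 0 0 0 1 0 0, V 0 0 0 1 0 0), (V 0 0 (-1) 0 0 0, V 0 1 (-1) 0 1 0)])"
definition "T7 (u::unit) = (KL, [(V 0 1 1 0 0 1, V (-1) 1 0 0 1 0), (V (-1) (-1) (-1) 0 0 (-1), V (-1) 0 0 0 1 0), (V 0 0 0 0 0 (-1), V 0 1 0 0 1 (-1)), (V 1 0 1 0 1 1, V 0 0 0 0 1 0), (V 0 0 0 1 0 0, V 0 0 0 1 0 0), (V 0 0 (-1) 0 0 0, V 0 1 (-1) 0 1 0)])"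
definition "T8 (u::unit) = (K0, [(V 0 1 0 0 0 0, V 0 1 (-1) 0 1 0), (V (-1) 0 0 0 0 0, V (-1) 0 0 0 0 1), (V 0 (-1) (-1) 0 0 0, V 0 0 (-1) 0 1 0), (V 1 0 0 0 0 1, V 0 0 0 0 0 1), (V 0 0 0 1 0 0, V 0 0 0 1 0 0), (V 0 0 1 0 1 0, V 0 0 0 0 1 0)])"
definition "T9 (u::unit) = (KL, [(V 0 0 0 0 0 (-1), V 0 1 (-1) 0 2 (-1)), (V (-1) 0 0 0 0 0, V (-1) 0 0 0 1 0), (V 0 (-1) (-1) 0 0 0, V 0 0 (-1) 0 1 0), (V 1 0 1 0 1 1, V 0 0 0 0 1 0), (V 0 0 0 1 0 0, V 0 0 0 1 0 0), (V 0 1 0 0 0 1, V 0 1 (-1) 0 1 0)])"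
definition "T10 (u::unit) = (KL, [(V 0 0 (-1) 0 0 0, V 0 1 (-1) 0 1 0), (V 0 0 0 0 0 1, V (-1) 0 0 0 0 1), (V 1 1 1 0 0 1, V 0 1 0 0 0 0), (V (-1) 0 0 0 0 (-1), V (-1) 1 0 0 1 0), (V 0 0 0 1 0 0, V 0 0 0 1 0 0), (V 1 0 1 0 1 1, V 0 0 0 0 1 0)])"
definition "T11 (u::unit) = (KL, [(V 0 0 (-1) 0 0 0, V 0 1 (-1) 0 1 0), (V (-1) 0 0 0 0 0, V (-1) 0 0 0 0 1), (V 0 1 1 0 0 0, V 0 1 0 0 0 0), (V 1 0 0 1 0 1, V 0 0 0 0 0 1), (V 0 0 0 (-1) 0 0, V 0 0 0 (-1) 0 1), (V 0 0 1 0 1 0, V 0 0 0 0 1 0)])"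
definition "T12 (u::unit) = (K0, [(V 0 1 1 0 1 0, V 0 1 (-1) 0 1 0), (V 1 0 0 0 0 0, V 1 0 0 0 0 0), (V 0 (-1) (-1) 0 0 0, V 0 0 (-1) 0 1 0), (V 0 0 0 0 0 1, V 0 0 0 0 0 1), (V 0 0 0 1 0 0, V 0 0 0 1 0 0), (V 0 0 (-1) 0 (-1) 0, V 0 1 (-1) 0 0 0)])"
definition "T13 (u::unit) = (K0, [(V 0 1 0 0 0 0, V 0 1 (-1) 0 2 (-1)), (V 1 0 0 0 0 0, V 1 0 0 0 0 0), (V 0 (-1) (-1) 0 0 0, V 0 0 (-1) 0 1 0), (V 0 0 1 0 1 1, V 0 0 0 0 1 0), (V 0 0 0 1 0 0, V 0 0 0 1 0 0), (V 0 (-1) 0 0 0 (-1), V 0 0 0 0 1 (-1))])"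
definition "T14 (u::unit) = (KL, [(V 0 0 0 0 0 (-1), V 0 2 (-2) 0 2 (-1)), (V 1 0 0 0 0 0, V 1 0 0 0 0 0), (V 0 (-1) (-1) 0 0 0, V 0 0 (-1) 0 1 0), (V 0 1 1 0 1 2, V 0 1 (-1) 0 1 0), (V 0 0 0 1 0 0, V 0 0 0 1 0 0), (V 0 0 (-1) 0 (-1) 0, V 0 1 (-1) 0 0 0)])"
definition "T15 (u::unit) = (KL, [(V 1 1 1 1 0 1, V 0 1 0 0 0 0), (V (-1) 0 0 0 0 0, V (-1) 1 0 0 1 0), (V 0 0 0 0 0 (-1), V 0 1 0 0 1 (-1)), (V 1 0 1 1 1 1, V 0 0 0 0 1 0), (V 0 0 0 (-1) 0 0, V 0 1 0 (-1) 1 0), (V 0 0 (-1) 0 0 0, V 0 1 (-1) 0 1 0)])"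
definition "T16 (u::unit) = (KL, [(V 0 1 1 0 0 0, V (-1) 1 0 0 1 0), (V (-1) (-1) (-1) 0 0 (-1), V (-1) 0 0 0 1 0), (V 0 0 0 0 0 1, V (-1) 0 0 0 0 1), (V 1 0 1 0 1 1, V 0 0 0 0 1 0), (V 0 0 0 1 0 0, V 0 0 0 1 0 0), (V 0 0 (-1) 0 0 0, V 0 1 (-1) 0 1 0)])"
definition "T17 (u::unit) = (KL, [(V 1 1 2 0 1 2, V (-1) 1 0 0 1 0), (V (-1) (-1) (-1) 0 0 (-1), V (-1) 0 0 0 1 0), (V 0 0 0 0 0 (-1), V 0 1 0 0 1 (-1)), (V (-1) 0 (-1) 0 (-1) (-1), V (-1) 1 0 0 0 0), (V 0 0 0 1 0 0, V 0 0 0 1 0 0), (V 0 0 (-1) 0 0 0, V 0 1 (-1) 0 1 0)])"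
definition "T18 (u::unit) = (KL, [(V 0 1 1 1 0 1, V (-1) 1 0 0 1 0), (V (-1) (-1) (-1) 0 0 (-1), V (-1) 0 0 0 1 0), (V 0 0 0 0 0 (-1), V 0 1 0 0 1 (-1)), (V 1 0 1 1 1 1, V 0 0 0 0 1 0), (V 0 0 0 (-1) 0 0, V (-1) 1 0 (-1) 2 0), (V 0 0 (-1) 0 0 0, V 0 1 (-1) 0 1 0)])"
definition "T19 (u::unit) = (K0, [(V 0 (-1) 0 0 0 0, V 0 (-1) 0 1 0 0), (V (-1) 0 0 0 0 0, V (-1) 0 0 0 0 1), (V 0 0 (-1) 0 0 0, V 0 0 (-1) 0 1 0), (V 1 0 0 0 0 1, V 0 0 0 0 0 1), (V 0 1 0 1 0 0, V 0 0 0 1 0 0), (V 0 0 1 0 1 0, V 0 0 0 0 1 0)])"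
definition "T20 (u::unit) = (K0, [(V 0 1 0 0 0 0, V 0 1 (-1) 0 1 0), (V 0 0 0 0 0 1, V (-1) 0 0 0 0 1), (V 0 (-1) (-1) 0 0 0, V 0 0 (-1) 0 1 0), (V (-1) 0 0 0 0 (-1), V (-1) 0 0 0 1 0), (V 0 0 0 1 0 0, V 0 0 0 1 0 0), (V 1 0 1 0 1 1, V 0 0 0 0 1 0)])"
definition "T21 (u::unit) = (K0, [(V 0 1 0 0 0 0, V 0 1 (-1) 0 1 0), (V (-1) 0 0 0 0 0, V (-1) 0 0 0 0 1), (V 0 (-1) (-1) 0 0 0, V 0 0 (-1) 0 1 0), (V 1 0 0 1 0 1, V 0 0 0 0 0 1), (V 0 0 0 (-1) 0 0, V 0 0 0 (-1) 0 1), (V 0 0 1 0 1 0, V 0 0 0 0 1 0)])"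
definition "T22 (u::unit) = (K0, [(V 0 1 1 0 1 0, V 0 1 (-1) 0 1 0), (V (-1) 0 0 0 0 0, V (-1) 0 0 0 0 1), (V 0 (-1) (-1) 0 0 0, V 0 0 (-1) 0 1 0), (V 1 0 0 0 0 1, V 0 0 0 0 0 1), (V 0 0 0 1 0 0, V 0 0 0 1 0 0), (V 0 0 (-1) 0 (-1) 0, V 0 1 (-1) 0 0 0)])"
definition "T23 (u::unit) = (KL, [(V 0 0 1 0 1 1, V (-1) 0 0 0 1 0), (V (-1) 0 (-1) 0 (-1) (-1), V (-1) 1 (-1) 0 1 0), (V 0 (-1) (-1) 0 0 0, V 0 0 (-1) 0 1 0), (V 1 1 1 0 1 2, V 0 1 (-1) 0 1 0), (V 0 0 0 1 0 0, V 0 0 0 1 0 0), (V 0 0 0 0 0 (-1), V 0 1 (-1) 0 2 (-1))])"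
definition "T24 (u::unit) = (KL, [(V 0 0 0 0 0 (-1), V 0 1 (-1) 0 2 (-1)), (V (-1) 0 0 0 0 0, V (-1) 0 0 0 1 0), (V 0 (-1) (-1) 0 0 0, V 0 0 (-1) 0 1 0), (V 1 0 1 1 1 1, V 0 0 0 0 1 0), (V 0 0 0 (-1) 0 0, V 0 0 0 (-1) 1 0), (V 0 1 0 0 0 1, V 0 1 (-1) 0 1 0)])"
definition "T25 (u::unit) = (K0, [(V 0 1 0 0 0 0, V 0 1 (-1) 0 2 (-1)), (V (-1) 0 0 0 0 0, V (-1) 0 0 0 1 0), (V 0 (-1) (-1) 0 0 0, V 0 0 (-1) 0 1 0), (V 1 0 1 0 1 1, V 0 0 0 0 1 0), (V 0 0 0 1 0 0, V 0 0 0 1 0 0), (V 0 (-1) 0 0 0 (-1), V 0 0 0 0 1 (-1))])"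
definition "T26 (u::unit) = (KL, [(V 0 0 0 0 0 (-1), V 0 2 (-2) 0 2 (-1)), (V (-1) 0 0 0 0 0, V (-1) 1 (-1) 0 1 0), (V 0 (-1) (-1) 0 0 0, V 0 0 (-1) 0 1 0), (V 1 1 1 0 1 2, V 0 1 (-1) 0 1 0), (V 0 0 0 1 0 0, V 0 0 0 1 0 0), (V 0 0 (-1) 0 (-1) 0, V 0 1 (-1) 0 0 0)])"
definition "T27 (u::unit) = (KL, [(V 0 0 1 0 0 0, V (-1) 0 1 0 0 0), (V 0 0 0 0 0 1, V (-1) 0 0 0 0 1), (V 1 1 1 0 0 1, V 0 1 0 0 0 0), (V (-1) 0 (-1) 0 0 (-1), V (-1) 1 0 0 1 0), (V 0 0 0 1 0 0, V 0 0 0 1 0 0), (V 1 0 1 0 1 1, V 0 0 0 0 1 0)])"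
definition "T28 (u::unit) = (KL, [(V 0 0 (-1) 0 0 0, V 0 1 (-1) 0 1 0), (V 0 0 0 1 0 1, V (-1) 0 0 0 0 1), (V 1 1 1 1 0 1, V 0 1 0 0 0 0), (V (-1) 0 0 0 0 (-1), V (-1) 1 0 0 1 0), (V 0 0 0 (-1) 0 0, V (-1) 1 0 (-1) 1 1), (V 1 0 1 1 1 1, V 0 0 0 0 1 0)])"
definition "T29 (u::unit) = (KF, [(V 0 1 1 0 0 1, V (-1) 1 0 (-1) 2 0), (V (-1) (-1) (-1) 0 0 (-1), V (-1) 0 0 0 1 0), (V 0 0 0 0 0 (-1), V 0 1 0 0 1 (-1)), (V 1 0 1 1 1 1, V 0 0 0 0 1 0), (V 0 (-1) (-1) (-1) 0 (-1), V 0 0 0 (-1) 1 0), (V 0 0 (-1) 0 0 0, V 0 1 (-1) 0 1 0)])"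
definition "T30 (u::unit) = (KL, [(V 0 0 (-1) 0 0 0, V 0 1 (-1) 0 1 0), (V 0 0 0 1 0 1, V (-1) 0 0 0 0 1), (V 1 1 1 1 0 1, V 0 1 0 0 0 0), (V (-1) 0 0 (-1) 0 (-1), V (-1) 1 0 (-1) 1 1), (V 1 0 0 0 0 1, V 0 0 0 (-1) 0 1), (V 1 0 1 1 1 1, V 0 0 0 0 1 0)])"
definition "T31 (u::unit) = (KM, [(V (-1) (-1) (-1) (-1) 0 (-1), V 0 1 (-1) 0 2 (-1)), (V 0 1 0 0 0 1, V 0 1 (-1) 0 1 0), (V 1 0 0 0 0 0, V 1 1 (-1) 0 1 (-1)), (V 1 0 1 1 1 1, V 0 0 0 0 1 0), (V 0 1 1 0 0 0, V 0 1 0 0 1 (-1)), (V 0 0 0 1 0 0, V 0 1 (-1) 1 1 (-1))])"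
definition "T32 (u::unit) = (KM, [(V 1 1 1 1 0 1, V 0 1 0 0 0 0), (V 0 0 (-1) (-1) 0 0, V 0 1 (-1) 0 1 0), (V (-1) 0 0 0 0 0, V (-1) 1 0 0 1 0), (V 1 0 1 1 1 1, V 0 0 0 0 1 0), (V 0 0 0 (-1) 0 (-1), V 0 1 0 0 1 (-1)), (V 0 0 0 1 0 0, V 0 1 (-1) 1 1 (-1))])"
definition "T33 (u::unit) = (KL, [(V 1 1 2 0 1 1, V (-1) 1 0 0 1 0), (V (-1) (-1) (-1) 0 0 (-1), V (-1) 0 0 0 1 0), (V 0 0 0 0 0 1, V (-1) 0 0 0 0 1), (V (-1) 0 (-1) 0 (-1) (-1), V (-1) 1 0 0 0 0), (V 0 0 0 1 0 0, V 0 0 0 1 0 0), (V 0 0 (-1) 0 0 0, V 0 1 (-1) 0 1 0)])"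
definition "T34 (u::unit) = (KL, [(V 0 1 1 0 0 0, V (-1) 1 0 0 1 0), (V (-1) (-1) (-1) 0 0 (-1), V (-1) 0 0 0 1 0), (V 0 0 0 1 0 1, V (-1) 0 0 0 0 1), (V 1 0 1 1 1 1, V 0 0 0 0 1 0), (V 0 0 0 (-1) 0 0, V (-1) 0 0 (-1) 1 1), (V 0 0 (-1) 0 0 0, V 0 1 (-1) 0 1 0)])"
definition "T35 (u::unit) = (K0, [(V 0 1 0 0 0 0, V (-1) 1 0 0 1 0), (V (-1) (-1) (-1) 0 0 (-1), V (-1) 0 0 0 1 0), (V 0 0 0 0 0 1, V (-1) 0 0 0 0 1), (V 1 0 1 0 1 1, V 0 0 0 0 1 0), (V 0 0 0 1 0 0, V 0 0 0 1 0 0), (V 0 0 1 0 0 0, V (-1) 0 1 0 0 0)])"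
definition "T36 (u::unit) = (KL, [(V 0 0 0 0 0 (-1), V (-1) 2 (-1) 0 2 (-1)), (V (-1) (-1) (-2) 0 (-1) (-1), V (-1) 1 (-1) 0 1 0), (V 0 0 1 0 1 1, V (-1) 0 0 0 1 0), (V 1 1 1 0 1 2, V 0 1 (-1) 0 1 0), (V 0 0 0 1 0 0, V 0 0 0 1 0 0), (V 0 1 1 0 0 1, V (-1) 1 0 0 0 0)])"
definition "T37 (u::unit) = (KL, [(V 1 1 2 2 1 2, V (-1) 1 0 0 1 0), (V (-1) (-1) (-1) 0 0 (-1), V (-1) 0 0 0 1 0), (V 0 0 0 0 0 (-1), V 0 1 0 0 1 (-1)), (V (-1) 0 (-1) 0 (-1) (-1), V (-1) 1 0 0 0 0), (V 0 0 0 (-1) 0 0, V (-2) 2 0 (-1) 2 0), (V 0 0 (-1) 0 0 0, V 0 1 (-1) 0 1 0)])"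
definition "T38 (u::unit) = (KM, [(V 0 1 0 0 0 1, V 0 1 (-1) 0 1 0), (V 0 (-1) (-1) 0 0 0, V 0 0 (-1) 0 1 0), (V (-1) 0 0 0 0 0, V (-1) 0 0 0 1 0), (V 1 0 1 1 1 1, V 0 0 0 0 1 0), (V 0 0 0 (-1) 0 (-1), V 0 1 (-1) 0 2 (-1)), (V 0 0 0 1 0 0, V 0 1 (-1) 1 1 (-1))])"
definition "T39 (u::unit) = (KM, [(V 1 1 1 1 1 2, V 0 1 (-1) 0 1 0), (V 0 (-1) (-1) 0 0 0, V 0 0 (-1) 0 1 0), (V 1 0 0 0 0 0, V 1 1 (-1) 0 1 (-1)), (V (-1) 0 (-1) (-1) (-1) (-1), V 0 2 (-2) 0 2 (-1)), (V 0 0 1 0 1 0, V 0 1 (-1) 0 2 (-1)), (V 0 0 0 1 0 0, V 0 1 (-1) 1 1 (-1))])"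
definition "T40 (u::unit) = (K0, [(V 0 (-1) 0 0 0 0, V 0 (-1) 0 1 0 0), (V 0 0 0 0 0 1, V (-1) 0 0 0 0 1), (V 0 0 (-1) 0 0 0, V 0 0 (-1) 0 1 0), (V (-1) 0 0 0 0 (-1), V (-1) 0 0 0 1 0), (V 0 1 0 1 0 0, V 0 0 0 1 0 0), (V 1 0 1 0 1 1, V 0 0 0 0 1 0)])"
definition "T41 (u::unit) = (K0, [(V 0 1 0 0 0 0, V 0 1 (-1) 0 1 0), (V 0 0 0 1 0 1, V (-1) 0 0 0 0 1), (V 0 (-1) (-1) 0 0 0, V 0 0 (-1) 0 1 0), (V (-1) 0 0 0 0 (-1), V (-1) 0 0 0 1 0), (V 0 0 0 (-1) 0 0, V (-1) 0 0 (-1) 1 1), (V 1 0 1 1 1 1, V 0 0 0 0 1 0)])"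
definition "T42 (u::unit) = (KL, [(V 1 1 1 0 1 1, V 0 1 (-1) 0 1 0), (V 0 0 0 0 0 1, V (-1) 0 0 0 0 1), (V 0 (-1) (-1) 0 0 0, V 0 0 (-1) 0 1 0), (V 0 0 1 0 1 0, V (-1) 0 0 0 1 0), (V 0 0 0 1 0 0, V 0 0 0 1 0 0), (V (-1) 0 (-1) 0 (-1) (-1), V (-1) 1 (-1) 0 1 0)])"
definition "T43 (u::unit) = (K0, [(V 0 (-1) 0 0 0 0, V 0 (-1) 0 0 0 1), (V (-1) 0 0 0 0 0, V (-1) 0 0 0 0 1), (V 0 0 (-1) 0 0 0, V 0 0 (-1) 0 1 0), (V 1 1 0 1 0 1, V 0 0 0 0 0 1), (V 0 0 0 (-1) 0 0, V 0 0 0 (-1) 0 1), (V 0 0 1 0 1 0, V 0 0 0 0 1 0)])"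
definition "T44 (u::unit) = (K0, [(V 0 1 0 0 0 0, V 0 1 (-1) 0 1 0), (V 0 0 0 1 0 1, V (-1) 0 0 0 0 1), (V 0 (-1) (-1) 0 0 0, V 0 0 (-1) 0 1 0), (V (-1) 0 0 (-1) 0 (-1), V (-1) 0 0 (-1) 1 1), (V 1 0 0 0 0 1, V 0 0 0 (-1) 0 1), (V 1 0 1 1 1 1, V 0 0 0 0 1 0)])"
definition "T45 (u::unit) = (K0, [(V 0 1 1 0 1 0, V 0 1 (-1) 0 1 0), (V (-1) 0 0 0 0 0, V (-1) 0 0 0 0 1), (V 0 (-1) (-1) 0 0 0, V 0 0 (-1) 0 1 0), (V 1 0 0 1 0 1, V 0 0 0 0 0 1), (V 0 0 0 (-1) 0 0, V 0 0 0 (-1) 0 1), (V 0 0 (-1) 0 (-1) 0, V 0 1 (-1) 0 0 0)])"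
definition "T46 (u::unit) = (K0, [(V 0 (-1) (-1) 0 (-1) 0, V 0 0 (-1) 1 0 0), (V (-1) 0 0 0 0 0, V (-1) 0 0 0 0 1), (V 0 0 0 0 1 0, V 0 0 (-1) 0 1 0), (V 1 0 0 0 0 1, V 0 0 0 0 0 1), (V 0 1 1 1 1 0, V 0 0 0 1 0 0), (V 0 1 0 0 0 0, V 0 1 (-1) 0 0 0)])"
definition "T47 (u::unit) = (KL, [(V 1 1 1 0 1 1, V 0 1 (-1) 0 1 0), (V 0 0 0 0 0 1, V (-1) 0 0 0 0 1), (V 0 (-1) (-1) 0 0 0, V 0 0 (-1) 0 1 0), (V (-1) 0 0 0 0 (-1), V (-1) 1 (-1) 0 1 0), (V 0 0 0 1 0 0, V 0 0 0 1 0 0), (V 0 0 (-1) 0 (-1) 0, V 0 1 (-1) 0 0 0)])"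
definition "T48 (u::unit) = (KL, [(V 0 0 1 1 1 1, V (-1) 0 0 0 1 0), (V (-1) 0 (-1) 0 (-1) (-1), V (-1) 1 (-1) 0 1 0), (V 0 (-1) (-1) 0 0 0, V 0 0 (-1) 0 1 0), (V 1 1 1 1 1 2, V 0 1 (-1) 0 1 0), (V 0 0 0 (-1) 0 0, V (-1) 1 (-1) (-1) 2 0), (V 0 0 0 0 0 (-1), V 0 1 (-1) 0 2 (-1))])"
definition "T49 (u::unit) = (KL, [(V 0 0 0 0 0 (-1), V 0 1 0 (-1) 1 (-1)), (V 0 1 0 0 0 1, V 0 1 0 (-1) 0 0), (V 1 0 1 0 0 0, V 0 0 1 (-1) 0 0), (V 0 (-1) (-1) (-1) (-1) (-1), V 0 0 0 (-1) 0 0), (V 0 0 0 0 1 1, V 0 0 0 (-1) 1 0), (V (-1) 0 0 0 0 0, V (-1) 0 1 (-1) 0 0)])"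
definition "T50 (u::unit) = (KM, [(V 0 0 0 0 0 (-1), V 0 1 0 (-1) 1 (-1)), (V 0 1 0 0 0 1, V 0 1 0 (-1) 0 0), (V 1 0 1 0 0 0, V 0 0 1 (-1) 0 0), (V 0 (-1) (-1) (-1) (-1) (-1), V 0 0 0 (-1) 0 0), (V 0 0 0 0 1 1, V 0 0 0 (-1) 1 0), (V (-1) 0 0 0 0 0, V (-1) 0 1 (-1) 0 0)])"
definition "T51 (u::unit) = (KF, [(V 0 0 0 0 0 (-1), V 0 1 (-1) 0 2 (-1)), (V 0 0 1 1 1 1, V (-1) 0 0 0 1 0), (V 0 (-1) (-1) 0 0 0, V 0 0 (-1) 0 1 0), (V (-1) 0 (-1) (-1) (-1) (-1), V (-1) 1 (-1) (-1) 2 0), (V 1 0 1 0 1 1, V 0 0 0 (-1) 1 0), (V 1 1 1 1 1 2, V 0 1 (-1) 0 1 0)])"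
definition "T52 (u::unit) = (K0, [(V 0 1 0 0 0 0, V 0 1 (-1) 0 2 (-1)), (V (-1) 0 0 0 0 0, V (-1) 0 0 0 1 0), (V 0 (-1) (-1) 0 0 0, V 0 0 (-1) 0 1 0), (V 1 0 1 1 1 1, V 0 0 0 0 1 0), (V 0 0 0 (-1) 0 0, V 0 0 0 (-1) 1 0), (V 0 (-1) 0 0 0 (-1), V 0 0 0 0 1 (-1))])"
definition "T53 (u::unit) = (KL, [(V 0 0 0 0 0 (-1), V 0 2 (-2) 0 2 (-1)), (V (-1) 0 0 0 0 0, V (-1) 1 (-1) 0 1 0), (V 0 (-1) (-1) 0 0 0, V 0 0 (-1) 0 1 0), (V 1 1 1 1 1 2, V 0 1 (-1) 0 1 0), (V 0 0 0 (-1) 0 0, V 0 1 (-1) (-1) 1 0), (V 0 0 (-1) 0 (-1) 0, V 0 1 (-1) 0 0 0)])"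
definition "T54 (u::unit) = (KL, [(V 0 0 1 1 0 0, V (-1) 0 1 0 0 0), (V 0 0 0 1 0 1, V (-1) 0 0 0 0 1), (V 1 1 1 1 0 1, V 0 1 0 0 0 0), (V (-1) 0 (-1) 0 0 (-1), V (-1) 1 0 0 1 0), (V 0 0 0 (-1) 0 0, V (-2) 1 1 (-1) 1 1), (V 1 0 1 1 1 1, V 0 0 0 0 1 0)])"
definition "T55 (u::unit) = (KM, [(V 0 0 0 (-1) 0 0, V (-1) 1 0 (-1) 1 1), (V 0 0 0 1 0 1, V (-1) 0 0 0 0 1), (V 1 1 1 1 0 1, V 0 1 0 0 0 0), (V 0 0 (-1) 0 0 0, V 0 1 (-1) 0 1 0), (V (-1) 0 0 0 0 (-1), V (-1) 1 0 0 1 0), (V 1 0 1 1 1 1, V 0 0 0 0 1 0)])"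
definition "T56 (u::unit) = (KM, [(V 0 0 0 1 0 0, V 0 1 (-1) 1 1 (-1)), (V 0 0 0 1 0 1, V (-1) 0 0 0 0 1), (V (-1) (-1) (-1) (-1) 0 (-1), V (-1) 0 0 0 1 0), (V 0 0 (-1) (-1) 0 0, V 0 1 (-1) 0 1 0), (V 0 1 1 0 0 0, V (-1) 1 0 0 1 0), (V 1 0 1 1 1 1, V 0 0 0 0 1 0)])"
definition "T57 (u::unit) = (KM, [(V 0 (-1) (-1) 0 0 (-1), V 0 1 (-1) 0 2 (-1)), (V (-1) 0 0 0 0 0, V (-1) 0 0 0 1 0), (V 0 1 1 0 0 0, V 0 1 0 0 1 (-1)), (V 1 0 1 1 1 1, V 0 0 0 0 1 0), (V 0 0 0 (-1) 0 0, V 0 0 0 (-1) 1 0), (V 0 1 0 0 0 1, V 0 1 (-1) 0 1 0)])"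
definition "T58 (u::unit) = (KM, [(V (-1) 0 0 0 0 0, V (-1) 1 0 (-1) 2 0), (V 1 1 1 0 0 1, V 0 1 0 (-1) 1 0), (V 0 0 0 0 0 (-1), V 0 1 0 0 1 (-1)), (V 1 0 1 1 1 1, V 0 0 0 0 1 0), (V 0 (-1) (-1) (-1) 0 (-1), V 0 0 0 (-1) 1 0), (V 0 0 (-1) 0 0 0, V 0 1 (-1) 0 1 0)])"
definition "T59 (u::unit) = (KF, [(V 0 1 1 0 0 0, V (-1) 1 0 (-1) 2 0), (V (-1) (-1) (-1) 0 0 (-1), V (-1) 0 0 0 1 0), (V 0 0 0 0 0 1, V (-1) 0 0 (-1) 1 1), (V 1 0 1 1 1 1, V 0 0 0 0 1 0), (V 0 (-1) (-1) (-1) 0 (-1), V 0 0 0 (-1) 1 0), (V 0 0 (-1) 0 0 0, V 0 1 (-1) 0 1 0)])"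
definition "T60 (u::unit) = (KM, [(V 1 1 2 1 2 2, V 0 1 (-1) 0 2 (-1)), (V 0 (-1) (-1) 0 0 0, V 0 0 (-1) 0 1 0), (V 1 0 0 0 0 0, V 1 1 (-1) 0 1 (-1)), (V (-1) 0 (-1) (-1) (-1) (-1), V 0 2 (-2) 0 3 (-2)), (V 0 (-1) 0 0 0 (-1), V 0 0 0 0 1 (-1)), (V 0 0 0 1 0 0, V 0 1 (-1) 1 1 (-1))])"
definition "T61 (u::unit) = (KM, [(V 0 0 0 (-1) 0 0, V (-2) 1 1 (-1) 1 1), (V 0 0 0 1 0 1, V (-1) 0 0 0 0 1), (V 1 1 1 1 0 1, V 0 1 0 0 0 0), (V (-1) 0 (-1) 0 0 (-1), V (-1) 1 0 0 1 0), (V 0 0 1 1 0 0, V (-1) 0 1 0 0 0), (V 1 0 1 1 1 1, V 0 0 0 0 1 0)])"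
definition "T62 (u::unit) = (KF, [(V 0 0 (-1) 0 0 0, V 0 1 (-1) 0 1 0), (V 0 0 0 1 0 1, V (-1) 0 0 0 0 1), (V (-1) (-1) (-1) (-1) 0 (-1), V (-1) 0 0 (-1) 1 1), (V 0 1 1 0 0 0, V (-1) 1 0 (-1) 1 1), (V 1 0 0 0 0 1, V 0 0 0 (-1) 0 1), (V 1 0 1 1 1 1, V 0 0 0 0 1 0)])"
definition "T63 (u::unit) = (KM, [(V 1 1 1 1 0 1, V 0 1 0 0 0 0), (V (-1) 0 0 0 0 0, V (-1) 1 0 0 1 0), (V 0 0 0 0 0 (-1), V 0 1 0 0 1 (-1)), (V 1 0 1 1 1 1, V 0 0 0 0 1 0), (V 0 0 0 (-1) 0 0, V 0 1 0 (-1) 1 0), (V 0 0 (-1) 0 0 0, V 0 1 (-1) 0 1 0)])"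
definition "T64 (u::unit) = (KM, [(V 1 1 2 1 1 1, V 0 1 0 0 1 (-1)), (V (-1) (-1) (-1) (-1) 0 (-1), V 0 1 (-1) 0 2 (-1)), (V 1 0 0 0 0 0, V 1 1 (-1) 0 1 (-1)), (V 1 1 1 1 1 2, V 0 1 (-1) 0 1 0), (V (-1) 0 (-1) (-1) (-1) (-1), V 0 2 (-1) 0 1 (-1)), (V 0 0 0 1 0 0, V 0 1 (-1) 1 1 (-1))])"
definition "T65 (u::unit) = (KM, [(V 0 (-1) (-1) (-1) 0 (-1), V 0 1 (-1) 0 2 (-1)), (V 0 1 0 0 0 1, V 0 1 (-1) 0 1 0), (V (-1) 0 0 0 0 0, V (-1) 0 0 0 1 0), (V 1 0 1 1 1 1, V 0 0 0 0 1 0), (V 0 1 1 0 0 0, V 0 1 0 0 1 (-1)), (V 0 0 0 1 0 0, V 0 1 (-1) 1 1 (-1))])"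
definition "T66 (u::unit) = (KM, [(V (-1) (-1) (-1) (-1) 0 (-1), V (-1) 0 0 0 1 0), (V 0 0 (-1) (-1) 0 0, V 0 1 (-1) 0 1 0), (V 0 1 1 1 0 1, V (-1) 1 0 0 1 0), (V 1 0 1 1 1 1, V 0 0 0 0 1 0), (V 0 0 0 (-1) 0 (-1), V 0 1 0 0 1 (-1)), (V 0 0 0 1 0 0, V 0 1 (-1) 1 1 (-1))])"
definition "T67 (u::unit) = (KM, [(V 1 1 2 1 1 1, V 0 1 0 0 1 (-1)), (V 0 1 1 1 0 1, V (-1) 1 0 0 0 0), (V (-1) (-1) (-1) (-1) 0 (-1), V (-1) 2 (-1) 0 2 (-1)), (V 1 1 1 1 1 2, V 0 1 (-1) 0 1 0), (V 0 0 (-1) (-1) (-1) (-1), V 0 2 (-1) 0 1 (-1)), (V 0 0 0 1 0 0, V 0 1 (-1) 1 1 (-1))])"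
definition "T68 (u::unit) = (KL, [(V (-1) (-1) (-2) 0 (-1) (-1), V (-1) 1 (-1) 0 1 0), (V 0 0 1 0 1 0, V (-1) 0 0 0 1 0), (V 0 0 0 0 0 1, V (-1) 0 0 0 0 1), (V 0 1 1 0 0 0, V (-1) 1 0 0 0 0), (V 0 0 0 1 0 0, V 0 0 0 1 0 0), (V 1 1 1 0 1 1, V 0 1 (-1) 0 1 0)])"
definition "T69 (u::unit) = (KL, [(V 1 1 2 1 1 1, V (-1) 1 0 0 1 0), (V (-1) (-1) (-1) 0 0 (-1), V (-1) 0 0 0 1 0), (V 0 0 0 1 0 1, V (-1) 0 0 0 0 1), (V (-1) 0 (-1) 0 (-1) (-1), V (-1) 1 0 0 0 0), (V 0 0 0 (-1) 0 0, V (-2) 1 0 (-1) 1 1), (V 0 0 (-1) 0 0 0, V 0 1 (-1) 0 1 0)])"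
definition "T70 (u::unit) = (KL, [(V 1 1 1 0 1 1, V (-1) 1 0 0 1 0), (V (-1) (-1) (-1) 0 0 (-1), V (-1) 0 0 0 1 0), (V 0 0 0 0 0 1, V (-1) 0 0 0 0 1), (V (-1) 0 (-1) 0 (-1) (-1), V (-1) 1 0 0 0 0), (V 0 0 0 1 0 0, V 0 0 0 1 0 0), (V 0 0 1 0 0 0, V (-1) 0 1 0 0 0)])"
definition "T71 (u::unit) = (KM, [(V 1 1 1 0 1 1, V 0 1 (-1) 0 1 0), (V 0 (-1) (-1) 0 0 0, V 0 0 (-1) 0 1 0), (V 0 0 0 1 0 1, V (-1) 0 0 0 0 1), (V (-1) 0 (-1) (-1) (-1) (-1), V (-1) 1 (-1) 0 1 0), (V 0 0 1 0 1 0, V (-1) 0 0 0 1 0), (V 0 0 0 1 0 0, V 0 1 (-1) 1 1 (-1))])"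
definition "T72 (u::unit) = (KL, [(V (-1) 0 0 0 0 0, V (-1) 1 0 (-1) 0 0), (V 1 1 1 0 0 1, V 0 1 0 (-1) 0 0), (V 0 0 0 0 (-1) (-1), V 0 1 0 0 0 (-1)), (V 0 (-1) (-1) (-1) (-1) (-1), V 0 0 0 (-1) 0 0), (V 0 0 1 0 1 0, V 0 1 0 (-1) 1 (-1)), (V 0 0 (-1) 0 0 0, V 0 2 (-1) (-1) 1 (-1))])"
definition "T73 (u::unit) = (KM, [(V (-1) 0 0 0 0 0, V (-1) 1 0 (-1) 0 0), (V 1 1 1 0 0 1, V 0 1 0 (-1) 0 0), (V 0 0 0 0 (-1) (-1), V 0 1 0 0 0 (-1)), (V 0 (-1) (-1) (-1) (-1) (-1), V 0 0 0 (-1) 0 0), (V 0 0 1 0 1 0, V 0 1 0 (-1) 1 (-1)), (V 0 0 (-1) 0 0 0, V 0 2 (-1) (-1) 1 (-1))])"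
definition "T74 (u::unit) = (K0, [(V 0 1 0 0 0 0, V (-1) 1 0 0 1 0), (V (-1) (-1) (-1) 0 0 (-1), V (-1) 0 0 0 1 0), (V 0 0 0 1 0 1, V (-1) 0 0 0 0 1), (V 1 0 1 1 1 1, V 0 0 0 0 1 0), (V 0 0 0 (-1) 0 0, V (-2) 0 1 (-1) 1 1), (V 0 0 1 1 0 0, V (-1) 0 1 0 0 0)])"
definition "T75 (u::unit) = (KL, [(V 0 0 0 0 0 (-1), V (-1) 2 (-1) 0 2 (-1)), (V (-1) (-1) (-2) 0 (-1) (-1), V (-1) 1 (-1) 0 1 0), (V 0 0 1 1 1 1, V (-1) 0 0 0 1 0), (V 1 1 1 1 1 2, V 0 1 (-1) 0 1 0), (V 0 0 0 (-1) 0 0, V (-2) 2 (-1) (-1) 2 0), (V 0 1 1 1 0 1, V (-1) 1 0 0 0 0)])"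
definition "T76 (u::unit) = (KM, [(V 1 1 1 1 1 2, V 0 1 (-1) 0 1 0), (V 0 (-1) (-1) 0 0 0, V 0 0 (-1) 0 1 0), (V (-1) 0 0 0 0 0, V (-1) 1 (-1) 0 1 0), (V 0 0 (-1) 0 (-1) 0, V 0 1 (-1) 0 0 0), (V 0 0 0 (-1) 0 (-1), V 0 2 (-2) 0 2 (-1)), (V 0 0 0 1 0 0, V 0 1 (-1) 1 1 (-1))])"
definition "T77 (u::unit) = (KM, [(V 1 1 1 1 1 2, V 0 1 (-1) 0 1 0), (V 0 (-1) (-1) 0 0 0, V 0 0 (-1) 0 1 0), (V 0 0 1 1 1 1, V (-1) 0 0 0 1 0), (V (-1) 0 (-1) (-1) (-1) (-1), V (-1) 1 (-1) 0 1 0), (V 0 0 0 (-1) 0 (-1), V 0 1 (-1) 0 2 (-1)), (V 0 0 0 1 0 0, V 0 1 (-1) 1 1 (-1))])"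
definition "T78 (u::unit) = (KM, [(V 0 1 1 0 0 0, V (-1) 1 0 0 1 0), (V (-1) (-1) (-1) 0 0 (-1), V (-1) 0 0 0 1 0), (V 0 0 0 (-1) 0 0, V (-1) 0 0 (-1) 1 1), (V 1 0 1 1 1 1, V 0 0 0 0 1 0), (V 0 0 0 1 0 1, V (-1) 0 0 0 0 1), (V 0 0 (-1) 0 0 0, V 0 1 (-1) 0 1 0)])"
definition "T79 (u::unit) = (KM, [(V 0 1 0 0 0 1, V 0 1 (-1) 0 1 0), (V 0 (-1) (-1) 0 0 0, V 0 0 (-1) 0 1 0), (V (-1) 0 0 0 0 0, V (-1) 0 0 0 1 0), (V 1 0 1 1 1 1, V 0 0 0 0 1 0), (V 0 0 0 0 0 (-1), V 0 1 (-1) 0 2 (-1)), (V 0 0 0 (-1) 0 0, V 0 0 0 (-1) 1 0)])"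
definition "T80 (u::unit) = (KM, [(V 1 1 2 2 1 2, V (-1) 1 0 0 1 0), (V (-1) (-1) (-1) 0 0 (-1), V (-1) 0 0 0 1 0), (V 0 0 0 0 0 (-1), V 0 1 0 0 1 (-1)), (V 0 0 0 (-1) 0 0, V (-2) 2 0 (-1) 2 0), (V (-1) 0 (-1) 0 (-1) (-1), V (-1) 1 0 0 0 0), (V 0 0 (-1) 0 0 0, V 0 1 (-1) 0 1 0)])"
definition "T81 (u::unit) = (K0, [(V 0 0 0 1 0 0, V 0 (-1) 0 1 0 0), (V 0 0 0 0 0 1, V (-1) 0 0 0 0 1), (V 0 0 (-1) 0 0 0, V 0 0 (-1) 0 1 0), (V (-1) 0 0 0 0 (-1), V (-1) 0 0 0 1 0), (V 0 (-1) 0 (-1) 0 0, V 0 (-1) 0 0 0 0), (V 1 0 1 0 1 1, V 0 0 0 0 1 0)])"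
definition "T82 (u::unit) = (K0, [(V 0 (-1) 0 0 0 0, V 0 (-1) 0 0 0 0), (V 0 0 0 1 0 1, V (-1) 0 0 0 0 1), (V 0 0 (-1) 0 0 0, V 0 0 (-1) 0 1 0), (V (-1) 0 0 0 0 (-1), V (-1) 0 0 0 1 0), (V 0 0 0 (-1) 0 0, V (-1) 0 0 (-1) 1 1), (V 1 0 1 1 1 1, V 0 0 0 0 1 0)])"
definition "T83 (u::unit) = (KL, [(V (-1) 0 0 0 0 0, V (-1) 0 1 (-1) 0 0), (V 0 0 0 0 (-1) (-1), V 0 1 0 0 0 (-1)), (V 1 0 1 0 0 0, V 0 0 1 (-1) 0 0), (V 0 1 0 0 0 1, V 0 1 0 (-1) 0 0), (V 0 (-1) (-1) (-1) 0 (-1), V 0 1 0 (-1) 1 (-1)), (V 0 1 1 1 1 1, V 0 1 0 0 1 (-1))])"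
definition "T84 (u::unit) = (KL, [(V (-1) (-1) (-1) 0 (-1) (-1), V (-1) 0 0 0 0 0), (V 0 0 1 0 1 1, V (-1) 0 0 0 1 0), (V 0 (-1) (-1) 0 0 0, V 0 0 (-1) 0 1 0), (V 0 1 0 0 0 1, V (-1) 1 (-1) 0 1 0), (V 0 0 0 1 0 0, V 0 0 0 1 0 0), (V 0 0 0 0 0 (-1), V (-1) 1 (-1) 0 2 (-1))])"
definition "T85 (u::unit) = (K0, [(V 1 0 0 1 0 1, V 0 (-1) 0 0 0 1), (V (-1) 0 0 0 0 0, V (-1) 0 0 0 0 1), (V 0 0 (-1) 0 0 0, V 0 0 (-1) 0 1 0), (V (-1) (-1) 0 (-1) 0 (-1), V 0 (-1) 0 0 0 0), (V 0 0 0 (-1) 0 0, V 0 0 0 (-1) 0 1), (V 0 0 1 0 1 0, V 0 0 0 0 1 0)])"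
definition "T86 (u::unit) = (K0, [(V 0 (-1) 0 0 0 0, V 0 (-1) 0 0 0 1), (V (-1) 0 0 0 0 0, V (-1) 0 0 0 0 1), (V 0 0 0 0 1 0, V 0 0 (-1) 0 1 0), (V 1 1 0 1 0 1, V 0 0 0 0 0 1), (V 0 0 0 (-1) 0 0, V 0 0 0 (-1) 0 1), (V 0 0 (-1) 0 (-1) 0, V 0 0 (-1) 0 0 0)])"
definition "T87 (u::unit) = (K0, [(V 0 (-1) 0 0 0 0, V 0 (-1) 0 0 0 0), (V 0 0 0 1 0 1, V (-1) 0 0 0 0 1), (V 0 0 (-1) 0 0 0, V 0 0 (-1) 0 1 0), (V (-1) 0 0 (-1) 0 (-1), V (-1) 0 0 (-1) 1 1), (V 1 0 0 0 0 1, V 0 0 0 (-1) 0 1), (V 1 0 1 1 1 1, V 0 0 0 0 1 0)])"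
definition "T88 (u::unit) = (KL, [(V (-1) 0 0 0 0 0, V (-1) 0 1 (-1) 0 0), (V 0 0 0 0 (-1) (-1), V 0 1 0 0 0 (-1)), (V 1 0 1 0 0 0, V 0 0 1 (-1) 0 0), (V 0 0 (-1) (-1) 0 0, V 0 1 0 (-1) 1 (-1)), (V 0 (-1) 0 0 0 (-1), V 0 0 0 0 1 (-1)), (V 0 1 1 1 1 1, V 0 1 0 0 1 (-1))])"
definition "T89 (u::unit) = (K0, [(V 0 (-1) (-1) 0 (-1) 0, V 0 0 (-1) 0 0 0), (V (-1) 0 0 0 0 0, V (-1) 0 0 0 0 1), (V 0 0 0 0 1 0, V 0 0 (-1) 0 1 0), (V 1 0 0 1 0 1, V 0 0 0 0 0 1), (V 0 0 0 (-1) 0 0, V 0 0 0 (-1) 0 1), (V 0 1 0 0 0 0, V 0 1 (-1) 0 0 0)])"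
definition "T90 (u::unit) = (K0, [(V 0 1 1 0 1 0, V 0 1 (-1) 0 1 0), (V 0 0 0 1 0 1, V (-1) 0 0 0 0 1), (V 0 (-1) (-1) 0 0 0, V 0 0 (-1) 0 1 0), (V (-1) 0 0 (-1) 0 (-1), V (-1) 0 0 (-1) 0 1), (V 1 0 0 0 0 1, V 0 0 0 (-1) 0 1), (V 0 0 (-1) 0 (-1) 0, V 0 1 (-1) 0 0 0)])"
definition "T91 (u::unit) = (K0, [(V (-1) (-1) (-1) 0 (-1) (-1), V (-1) 0 0 0 0 0), (V 0 0 1 0 1 1, V (-1) 0 0 0 1 0), (V 0 (-1) (-1) 0 0 0, V 0 0 (-1) 0 1 0), (V 0 1 0 0 0 0, V (-1) 1 (-1) 0 2 (-1)), (V 0 0 0 1 0 0, V 0 0 0 1 0 0), (V 0 (-1) 0 0 0 (-1), V 0 0 0 0 1 (-1))])"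
definition "T92 (u::unit) = (KL, [(V (-1) (-1) (-1) 0 (-1) (-1), V (-1) 0 0 0 0 0), (V 0 1 1 0 1 2, V (-1) 1 (-1) 0 1 0), (V 0 (-1) (-1) 0 0 0, V 0 0 (-1) 0 1 0), (V 0 0 0 0 0 (-1), V (-1) 2 (-2) 0 2 (-1)), (V 0 0 0 1 0 0, V 0 0 0 1 0 0), (V 0 0 (-1) 0 (-1) 0, V 0 1 (-1) 0 0 0)])"
definition "T93 (u::unit) = (KM, [(V 0 0 0 0 (-1) (-1), V 0 1 0 0 0 (-1)), (V 0 1 0 0 0 1, V 0 1 0 (-1) 0 0), (V 1 0 1 0 0 0, V 0 0 1 (-1) 0 0), (V 0 1 1 1 1 1, V 0 1 0 0 1 (-1)), (V 0 (-1) (-1) (-1) 0 (-1), V 0 1 0 (-1) 1 (-1)), (V (-1) 0 0 0 0 0, V (-1) 0 1 (-1) 0 0)])"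
definition "T94 (u::unit) = (KF, [(V 0 0 1 1 1 1, V (-1) 0 0 0 1 0), (V (-1) 0 (-1) 0 (-1) (-1), V (-1) 1 (-1) 0 1 0), (V 0 (-1) (-1) 0 0 0, V 0 0 (-1) 0 1 0), (V 1 1 1 1 1 2, V 0 1 (-1) 0 1 0), (V 0 0 0 (-1) 0 (-1), V (-1) 1 (-1) (-1) 2 0), (V 0 0 0 0 0 1, V (-1) 0 0 (-1) 0 1)])"
definition "T95 (u::unit) = (KL, [(V 0 (-1) (-1) (-1) (-1) (-2), V 0 1 0 (-1) 1 (-1)), (V 0 1 0 0 0 1, V 0 1 0 (-1) 0 0), (V 1 0 1 0 0 0, V 0 0 1 (-1) 0 0), (V 0 1 1 1 1 1, V 0 1 0 0 1 (-1)), (V 0 0 0 0 1 1, V 0 0 0 (-1) 1 0), (V (-1) 0 0 0 0 0, V (-1) 0 1 (-1) 0 0)])"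
definition "T96 (u::unit) = (KL, [(V 0 0 0 0 0 (-1), V 0 1 0 (-1) 1 (-1)), (V 0 1 0 0 0 1, V 0 1 0 (-1) 0 0), (V 0 0 1 0 0 0, V 0 0 1 (-1) 0 0), (V 0 (-1) (-1) (-1) (-1) (-1), V 0 0 0 (-1) 0 0), (V 0 0 0 0 1 1, V 0 0 0 (-1) 1 0), (V 1 0 0 0 0 0, V 1 0 0 0 0 0)])"
definition "T97 (u::unit) = (KM, [(V (-1) 0 0 0 0 0, V (-1) 1 (-1) (-1) 2 0), (V 1 0 1 0 1 1, V 0 0 0 (-1) 1 0), (V 0 (-1) (-1) 0 0 0, V 0 0 (-1) 0 1 0), (V 1 1 1 1 1 2, V 0 1 (-1) 0 1 0), (V 0 0 (-1) (-1) (-1) (-1), V 0 1 (-1) (-1) 1 0), (V 0 0 0 0 0 (-1), V 0 1 (-1) 0 2 (-1))])"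
definition "T98 (u::unit) = (KM, [(V 0 (-1) (-1) (-1) (-1) (-2), V 0 1 0 (-1) 1 (-1)), (V 0 1 0 0 0 1, V 0 1 0 (-1) 0 0), (V 1 0 1 0 0 0, V 0 0 1 (-1) 0 0), (V 0 1 1 1 1 1, V 0 1 0 0 1 (-1)), (V 0 0 0 0 1 1, V 0 0 0 (-1) 1 0), (V (-1) 0 0 0 0 0, V (-1) 0 1 (-1) 0 0)])"
definition "T99 (u::unit) = (KM, [(V (-1) 0 0 0 0 (-1), V 0 1 0 (-1) 1 (-1)), (V 0 1 0 0 0 1, V 0 1 0 (-1) 0 0), (V 1 0 1 0 0 0, V 0 0 1 (-1) 0 0), (V 0 (-1) (-1) (-1) (-1) (-1), V 0 0 0 (-1) 0 0), (V 0 0 0 0 1 1, V 0 0 0 (-1) 1 0), (V 1 0 0 0 0 0, V 1 1 (-1) 0 1 (-1))])"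
definition "T100 (u::unit) = (KF, [(V 0 0 0 0 0 1, V (-1) 0 0 (-1) 0 1), (V 0 0 1 1 1 1, V (-1) 0 0 0 1 0), (V 0 (-1) (-1) 0 0 0, V 0 0 (-1) 0 1 0), (V (-1) 0 (-1) (-1) (-1) (-2), V (-1) 1 (-1) (-1) 2 0), (V 1 0 1 0 1 1, V 0 0 0 (-1) 1 0), (V 1 1 1 1 1 2, V 0 1 (-1) 0 1 0)])"
definition "T101 (u::unit) = (KM, [(V (-1) 0 0 0 0 0, V (-1) 0 1 (-1) 0 0), (V 0 0 0 0 (-1) (-1), V 0 1 0 0 0 (-1)), (V 1 0 1 0 0 0, V 0 0 1 (-1) 0 0), (V 0 0 (-1) (-1) 0 0, V 0 1 0 (-1) 1 (-1)), (V 0 (-1) 0 0 0 (-1), V 0 0 0 0 1 (-1)), (V 0 1 1 1 1 1, V 0 1 0 0 1 (-1))])"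
definition "T102 (u::unit) = (K0, [(V 0 (-1) 0 0 0 0, V 0 (-1) 0 0 0 0), (V (-1) 0 0 0 0 0, V (-1) 0 0 0 1 0), (V 0 0 (-1) 0 0 0, V 0 0 (-1) 0 1 0), (V 1 0 1 1 1 1, V 0 0 0 0 1 0), (V 0 0 0 (-1) 0 0, V 0 0 0 (-1) 1 0), (V 0 0 0 0 0 (-1), V 0 0 0 0 1 (-1))])"
definition "T103 (u::unit) = (KL, [(V (-1) 0 0 0 0 0, V (-1) 0 1 (-2) 0 1), (V 0 0 (-1) (-1) (-1) (-1), V 0 1 0 (-1) 0 0), (V 1 0 1 0 0 0, V 0 0 1 (-1) 0 0), (V 0 1 1 1 1 1, V 0 1 0 (-1) 1 0), (V 0 (-1) (-1) (-1) 0 (-1), V 0 0 0 (-1) 1 0), (V 1 0 0 0 0 1, V 0 0 0 (-1) 0 1)])"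
definition "T104 (u::unit) = (KF, [(V 0 0 0 0 0 1, V (-1) 0 0 (-1) 0 1), (V (-1) 0 0 0 0 (-1), V (-1) 1 (-1) 0 1 0), (V 0 (-1) (-1) 0 0 0, V 0 0 (-1) 0 1 0), (V 1 1 1 1 1 2, V 0 1 (-1) 0 1 0), (V 0 0 0 (-1) 0 (-1), V 0 1 (-1) (-1) 1 0), (V 0 0 (-1) 0 (-1) 0, V 0 1 (-1) 0 0 0)])"
definition "T105 (u::unit) = (KM, [(V (-1) 0 0 0 0 0, V (-1) 0 1 (-2) 0 1), (V 0 0 (-1) (-1) (-1) (-1), V 0 1 0 (-1) 0 0), (V 1 0 1 0 0 0, V 0 0 1 (-1) 0 0), (V 0 1 1 1 1 1, V 0 1 0 (-1) 1 0), (V 0 (-1) (-1) (-1) 0 (-1), V 0 0 0 (-1) 1 0), (V 1 0 0 0 0 1, V 0 0 0 (-1) 0 1)])"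
definition "T106 (u::unit) = (KF, [(V (-1) 0 (-1) (-1) (-1) (-1), V (-1) 2 (-1) (-1) 3 (-1)), (V 0 0 1 1 1 1, V (-1) 0 0 0 1 0), (V 1 1 2 1 1 1, V 0 1 0 0 1 (-1)), (V 0 (-1) (-1) 0 0 (-1), V 0 1 (-1) 0 2 (-1)), (V 1 0 1 0 1 1, V 0 0 0 (-1) 1 0), (V 1 1 1 1 1 2, V 0 1 (-1) 0 1 0)])"
definition "T107 (u::unit) = (KM, [(V 0 0 0 1 0 0, V 0 1 (-1) 1 1 (-1)), (V 0 0 1 1 1 1, V (-1) 0 0 0 1 0), (V (-1) (-1) (-2) (-1) (-1) (-1), V (-1) 1 (-1) 0 1 0), (V 0 1 1 1 0 1, V (-1) 1 0 0 0 0), (V 0 0 0 (-1) 0 (-1), V (-1) 2 (-1) 0 2 (-1)), (V 1 1 1 1 1 2, V 0 1 (-1) 0 1 0)])"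
definition "T108 (u::unit) = (KM, [(V 0 0 0 1 0 0, V 0 1 (-1) 1 1 (-1)), (V 0 0 0 1 0 1, V (-1) 0 0 0 0 1), (V (-1) (-1) (-1) (-1) 0 (-1), V (-1) 0 0 0 1 0), (V 0 0 (-1) (-1) 0 0, V 0 1 (-1) 0 1 0), (V 1 1 2 1 1 1, V (-1) 1 0 0 1 0), (V (-1) 0 (-1) (-1) (-1) (-1), V (-1) 1 0 0 0 0)])"
definition "T109 (u::unit) = (KM, [(V 1 1 1 0 1 1, V 0 1 (-1) 0 2 (-1)), (V 0 (-1) (-1) 0 0 0, V 0 0 (-1) 0 1 0), (V 0 0 1 1 1 1, V (-1) 0 0 0 1 0), (V (-1) 0 (-1) (-1) (-1) (-1), V (-1) 1 (-1) 0 2 (-1)), (V 0 (-1) 0 0 0 (-1), V 0 0 0 0 1 (-1)), (V 0 0 0 1 0 0, V 0 1 (-1) 1 1 (-1))])"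
definition "T110 (u::unit) = (KL, [(V (-1) 0 0 0 0 0, V (-1) 1 0 (-2) 1 0), (V 1 1 1 0 0 1, V 0 1 0 (-1) 0 0), (V 0 0 0 0 0 (-1), V 0 1 0 (-1) 1 (-1)), (V 0 (-1) (-1) (-1) (-1) (-1), V 0 0 0 (-1) 0 0), (V 1 0 1 0 1 1, V 0 0 0 (-1) 1 0), (V 0 0 (-1) 0 0 0, V 0 1 (-1) (-1) 1 0)])"
definition "T111 (u::unit) = (KM, [(V (-1) 0 0 0 0 0, V (-1) 1 0 (-2) 1 0), (V 1 1 1 0 0 1, V 0 1 0 (-1) 0 0), (V 0 0 0 0 0 (-1), V 0 1 0 (-1) 1 (-1)), (V 0 (-1) (-1) (-1) (-1) (-1), V 0 0 0 (-1) 0 0), (V 1 0 1 0 1 1, V 0 0 0 (-1) 1 0), (V 0 0 (-1) 0 0 0, V 0 1 (-1) (-1) 1 0)])"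
definition "T112 (u::unit) = (KM, [(V 0 0 0 1 0 0, V 0 1 (-1) 1 1 (-1)), (V 0 0 1 1 1 1, V (-1) 0 0 0 1 0), (V 1 1 2 1 1 1, V 0 1 0 0 1 (-1)), (V (-1) (-1) (-2) (-2) (-1) (-2), V (-1) 2 (-1) 0 2 (-1)), (V 0 1 1 1 0 1, V (-1) 1 0 0 0 0), (V 1 1 1 1 1 2, V 0 1 (-1) 0 1 0)])"
definition "T113 (u::unit) = (KL, [(V 0 0 (-1) 0 0 0, V 0 2 (-1) (-1) 2 (-2)), (V 0 0 0 0 (-1) (-1), V 0 1 0 0 0 (-1)), (V 1 1 2 0 1 1, V 0 1 0 (-1) 1 (-1)), (V (-1) 0 0 0 0 0, V (-1) 1 0 (-1) 1 (-1)), (V 0 (-1) 0 0 0 (-1), V 0 0 0 0 1 (-1)), (V 0 (-1) (-1) (-1) (-1) (-1), V 0 0 0 (-1) 0 0)])"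
definition "T114 (u::unit) = (KM, [(V 0 0 (-1) 0 0 0, V 0 2 (-1) (-1) 2 (-2)), (V 0 0 0 0 (-1) (-1), V 0 1 0 0 0 (-1)), (V 1 1 2 0 1 1, V 0 1 0 (-1) 1 (-1)), (V (-1) 0 0 0 0 0, V (-1) 1 0 (-1) 1 (-1)), (V 0 (-1) 0 0 0 (-1), V 0 0 0 0 1 (-1)), (V 0 (-1) (-1) (-1) (-1) (-1), V 0 0 0 (-1) 0 0)])"
definition "T115 (u::unit) = (KM, [(V 0 0 0 0 0 (-1), V (-1) 2 (-1) 0 2 (-1)), (V 0 0 1 1 1 1, V (-1) 0 0 0 1 0), (V 0 0 0 (-1) 0 0, V (-2) 2 (-1) (-1) 2 0), (V (-1) (-1) (-2) 0 (-1) (-1), V (-1) 1 (-1) 0 1 0), (V 0 1 1 1 0 1, V (-1) 1 0 0 0 0), (V 1 1 1 1 1 2, V 0 1 (-1) 0 1 0)])"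
definition "T116 (u::unit) = (KM, [(V 0 0 0 1 0 0, V 0 1 (-1) 1 1 (-1)), (V 0 0 0 1 0 1, V (-1) 0 0 0 0 1), (V (-1) (-1) (-1) (-1) 0 (-1), V (-1) 0 0 0 1 0), (V 1 1 1 0 1 1, V (-1) 1 0 0 1 0), (V 0 0 1 1 0 0, V (-1) 0 1 0 0 0), (V (-1) 0 (-1) (-1) (-1) (-1), V (-1) 1 0 0 0 0)])"
definition "T117 (u::unit) = (KM, [(V (-1) (-1) (-1) (-1) 0 (-1), V (-1) 0 0 0 1 0), (V 0 0 (-1) (-1) 0 0, V 0 1 (-1) 0 1 0), (V 1 1 2 2 1 2, V (-1) 1 0 0 1 0), (V (-1) 0 (-1) (-1) (-1) (-1), V (-1) 1 0 0 0 0), (V 0 0 0 (-1) 0 (-1), V 0 1 0 0 1 (-1)), (V 0 0 0 1 0 0, V 0 1 (-1) 1 1 (-1))])"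
definition "T118 (u::unit) = (KL, [(V (-1) (-1) (-1) 0 (-1) (-1), V (-1) 0 0 0 0 0), (V 0 0 (-1) 0 0 0, V (-1) 1 (-1) 0 1 0), (V 0 0 1 0 1 1, V (-1) 0 0 0 1 0), (V 0 0 0 0 0 (-1), V (-1) 1 0 0 1 (-1)), (V 0 0 0 1 0 0, V 0 0 0 1 0 0), (V 0 1 1 0 0 1, V (-1) 1 0 0 0 0)])"
definition "T119 (u::unit) = (KM, [(V (-1) (-1) (-1) 0 (-1) (-1), V (-1) 0 0 0 0 0), (V 0 (-1) (-1) 0 0 0, V 0 0 (-1) 0 1 0), (V 0 0 1 1 1 1, V (-1) 0 0 0 1 0), (V 0 0 0 (-1) 0 (-1), V (-1) 1 (-1) 0 2 (-1)), (V 0 1 0 0 0 1, V (-1) 1 (-1) 0 1 0), (V 0 0 0 1 0 0, V 0 1 (-1) 1 1 (-1))])"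
definition "T120 (u::unit) = (KM, [(V 1 1 1 0 1 1, V 0 1 (-1) 0 1 0), (V 0 1 1 0 0 0, V (-1) 1 0 0 0 0), (V 0 0 0 1 0 1, V (-1) 0 0 0 0 1), (V (-1) (-1) (-2) (-1) (-1) (-1), V (-1) 1 (-1) 0 1 0), (V 0 0 1 0 1 0, V (-1) 0 0 0 1 0), (V 0 0 0 1 0 0, V 0 1 (-1) 1 1 (-1))])"
definition "T121 (u::unit) = (KM, [(V 1 1 2 1 1 1, V (-1) 1 0 0 1 0), (V (-1) (-1) (-1) 0 0 (-1), V (-1) 0 0 0 1 0), (V 0 0 0 1 0 1, V (-1) 0 0 0 0 1), (V 0 0 0 (-1) 0 0, V (-2) 1 0 (-1) 1 1), (V (-1) 0 (-1) 0 (-1) (-1), V (-1) 1 0 0 0 0), (V 0 0 (-1) 0 0 0, V 0 1 (-1) 0 1 0)])"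
definition "T122 (u::unit) = (KF, [(V 0 0 0 0 0 1, V (-1) 0 0 (-1) 0 1), (V (-1) (-1) (-2) 0 (-1) (-1), V (-1) 1 (-1) 0 1 0), (V 0 0 1 1 1 1, V (-1) 0 0 0 1 0), (V 1 1 1 1 1 2, V 0 1 (-1) 0 1 0), (V 0 0 0 (-1) 0 (-1), V (-2) 2 (-1) (-1) 2 0), (V 0 1 1 1 0 1, V (-1) 1 0 0 0 0)])"
definition "T123 (u::unit) = (KM, [(V 1 1 1 1 1 2, V 0 1 (-1) 0 1 0), (V 0 (-1) (-1) 0 0 0, V 0 0 (-1) 0 1 0), (V (-1) 0 0 0 0 0, V (-1) 1 (-1) 0 1 0), (V 0 0 (-1) 0 (-1) 0, V 0 1 (-1) 0 0 0), (V 0 0 0 0 0 (-1), V 0 2 (-2) 0 2 (-1)), (V 0 0 0 (-1) 0 0, V 0 1 (-1) (-1) 1 0)])"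
definition "T124 (u::unit) = (KM, [(V 1 0 1 0 1 1, V 0 0 0 (-1) 1 0), (V (-1) 0 0 0 0 (-1), V 0 1 0 (-1) 1 (-1)), (V 1 1 1 0 0 1, V 0 1 0 (-1) 0 0), (V 0 (-1) (-1) (-1) (-1) (-1), V 0 0 0 (-1) 0 0), (V (-1) 0 (-1) 0 0 0, V 0 1 (-1) (-1) 1 0), (V 1 0 0 0 0 0, V 1 1 (-1) 0 1 (-1))])"
definition "T125 (u::unit) = (KM, [(V 1 0 0 0 0 0, V 1 1 (-1) 0 1 (-1)), (V 0 0 0 0 (-1) (-1), V 0 1 0 0 0 (-1)), (V (-1) 0 (-1) 0 0 0, V 0 2 (-1) (-1) 2 (-2)), (V 1 1 2 0 1 1, V 0 1 0 (-1) 1 (-1)), (V 0 (-1) 0 0 0 (-1), V 0 0 0 0 1 (-1)), (V 0 (-1) (-1) (-1) (-1) (-1), V 0 0 0 (-1) 0 0)])"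

text \<open>One certificate for each of the six positions at which a family can be mutated.\<close>

definition "certs0 = [
  (T0, [
    Ref T1 [Ro,Ro], Ref T1 [Ro], Ref T1 [], Ref T1 [Ro,Ro,S3], Ref T1 [Ro,S3], Ref T1 [S3]]),
  (T1, [
    SplitL (Ref T0 []) (Ref T2 []), Ref T3 [], SplitL (Ref T4 []) (Ref T5 []), Ref T2 [], Ref T3 [S1],
    SplitL (Ref T4 [S2]) (Ref T5 [S3])]),
  (T2, [
    Ref T1 [La], Ref T6 [], Ref T1 [], Ref T1 [La,S3], Ref T6 [S1], Ref T1 [S3]]),
  (T3, [
    SplitL (Ref T4 [Ro,Ro]) (Ref T7 []), Ref T1 [], SplitL (Ref T8 []) (Ref T9 []), Ref T10 [], Ref T11 [],
    SplitL (Ref T8 [S2]) (Ref T9 [S3])]),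
  (T4, [
    Ref T3 [Ro], Ref T8 [], Ref T1 [], Ref T5 [], Ref T8 [S1], Ref T12 []]),
  (T5, [
    SplitL (Ref T4 []) (Ref T5 []), Ref T9 [], Ref T1 [La], Ref T5 [La], Ref T9 [S1],
    SplitL (Ref T13 []) (Ref T14 [])]),
  (T6, [
    Ref T7 [], Ref T2 [], Ref T10 [], Ref T7 [S2], Ref T15 [], Ref T10 [S3]]),
  (T7, [
    Ref T3 [La], Ref T6 [], Ref T16 [], Ref T17 [], Ref T18 [], Ref T16 [S3]]),
  (T8, [
    Ref T19 [], Ref T4 [], Ref T3 [], Ref T20 [], Ref T21 [], Ref T22 []])]"

definition "certs1 = [
  (T9, [
    SplitL (Ref T20 []) (Ref T23 []), Ref T5 [], Ref T3 [La], Ref T23 [], Ref T24 [],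
    SplitL (Ref T25 []) (Ref T26 [])]),
  (T10, [
    Ref T27 [], Ref T6 [], Ref T16 [], Ref T3 [], Ref T28 [], Ref T16 [S2]]),
  (T11, [
    SplitL (Ref T13 [Ro,Ro]) (Ref T29 []), Ref T3 [S1], SplitL (Ref T21 []) (Ref T24 []), Ref T30 [],
    Ref T3 [], SplitL (Ref T21 [S2]) (Ref T24 [S3])]),
  (T12, [
    Ref T27 [Ro], Ref T22 [], Ref T4 [S2], Ref T14 [], Ref T22 [S1], Ref T4 []]),
  (T13, [
    Ref T11 [Ro], Ref T25 [], Ref T5 [S3], Ref T14 [La], Ref T25 [S1], Ref T5 []]),
  (T14, [
    SplitL (Ref T12 []) (SplitL (Ref T13 []) (Ref T14 [])), Ref T26 [], Ref T5 [La,S3], Ref T14 [La,La],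
    Ref T26 [S1], Ref T5 [La]]),
  (T15, [
    Ref T31 [Ra], Ref T6 [S1], Ref T32 [Ra], Ref T31 [Ra,S2], Ref T6 [], Ref T32 [Ra,S1]]),
  (T16, [
    SplitL (Ref T20 []) (Ref T23 []), Ref T10 [], Ref T7 [], Ref T33 [], Ref T34 [],
    SplitL (Ref T35 []) (Ref T36 [])]),
  (T17, [
    Ref T27 [La], Ref T7 [S2], Ref T33 [], Ref T7 [], Ref T37 [], Ref T33 [S3]])]"

definition "certs2 = [
  (T18, [
    Ref T29 [], Ref T31 [Ra], Ref T38 [Ra], Ref T39 [Ra], Ref T7 [], Ref T38 [Ra,S1]]),
  (T19, [
    Ref T8 [], Ref T8 [Ro], Ref T8 [Ro,Ro], Ref T40 [], Ref T40 [Ro,Ro], Ref T40 [Ro]]),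
  (T20, [
    Ref T40 [], Ref T9 [], Ref T16 [], Ref T8 [], Ref T41 [], Ref T42 []]),
  (T21, [
    Ref T43 [], Ref T8 [S1], Ref T11 [], Ref T44 [], Ref T8 [], Ref T45 []]),
  (T22, [
    Ref T46 [], Ref T12 [], Ref T8 [S2], Ref T47 [], Ref T45 [], Ref T8 []]),
  (T23, [
    Ref T9 [La], Ref T9 [], Ref T16 [La], Ref T42 [La], Ref T48 [], Ref T42 []]),
  (T24, [
    SplitL (Ref T49 [Re]) (Ref T50 [La,Re]), Ref T9 [S1], Ref T11 [La], Ref T51 [], Ref T9 [],
    SplitL (Ref T52 []) (Ref T53 [])]),
  (T25, [
    Ref T43 [Ro], Ref T13 [], Ref T9 [S3], Ref T47 [La], Ref T52 [], Ref T9 []]),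
  (T26, [
    Ref T47 [], Ref T14 [], Ref T9 [La,S3], Ref T47 [La,La], Ref T53 [], Ref T9 [La]])]"

definition "certs3 = [
  (T27, [
    Ref T10 [], Ref T10 [S3], SplitL (Ref T35 []) (Ref T36 []), SplitL (Ref T12 [Ro,Ro]) (Ref T17 []),
    Ref T54 [], SplitL (Ref T35 [S2]) (Ref T36 [S3])]),
  (T28, [
    Ref T55 [Ra], Ref T32 [Ra], Ref T56 [Ra], Ref T30 [], Ref T10 [], Ref T56 [Ra,S2]]),
  (T29, [
    SplitL (Ref T11 [La]) (Ref T57 []), SplitL (Ref T18 [S1]) (Ref T58 []), Ref T59 [], Ref T60 [Ra],
    SplitL (Ref T18 []) (Ref T58 [S1]), Ref T59 [S3]]),
  (T30, [
    Ref T61 [Ra], Ref T28 [S1], Ref T62 [], Ref T11 [], Ref T28 [], Ref T62 [S2]]),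
  (T31, [
    SplitL (SplitL (Ref T15 []) (Ref T63 [])) (Ref T64 []),
    SplitL (SplitL (Ref T18 [S1]) (Ref T58 [])) (Ref T39 [S2]), Ref T65 [], Ref T64 [],
    SplitL (SplitL (Ref T18 []) (Ref T58 [S1])) (Ref T39 []), Ref T65 [S1]]),
  (T32, [
    Ref T66 [], SplitL (SplitL (Ref T28 [S1]) (Ref T55 [S1])) (Ref T67 []),
    SplitL (SplitL (Ref T15 []) (Ref T63 [])) (Ref T64 []), Ref T66 [S2],
    SplitL (SplitL (Ref T28 []) (Ref T55 [])) (Ref T67 [S2]), Ref T63 []]),
  (T33, [
    Ref T68 [], Ref T16 [S2], Ref T17 [], Ref T16 [], Ref T69 [], Ref T70 []]),
  (T34, [
    SplitL (Ref T41 []) (Ref T48 []), Ref T56 [Ra], Ref T38 [Ra], Ref T71 [Ra], Ref T16 [],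
    SplitL (Ref T72 [Re]) (Ref T73 [La,Re])]),
  (T35, [
    Ref T46 [Ro,Ro], Ref T27 [], Ref T16 [S3], Ref T70 [], Ref T74 [], Ref T16 []])]"

definition "certs4 = [
  (T36, [
    Ref T68 [], Ref T27 [La], Ref T16 [La,S3], Ref T70 [La], Ref T75 [], Ref T16 [La]]),
  (T37, [
    Ref T60 [Ra,La], Ref T39 [Ra,S2], Ref T76 [Ra], Ref T39 [Ra], Ref T17 [], Ref T76 [Ra,S1]]),
  (T38, [
    SplitL (Ref T59 []) (Ref T76 []), Ref T65 [], SplitL (SplitL (Ref T18 []) (Ref T58 [S1])) (Ref T39 []),
    Ref T77 [], SplitL (SplitL (Ref T34 []) (Ref T78 [])) (Ref T77 []), Ref T79 []]),
  (T39, [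
    Ref T39 [La], Ref T31 [La], Ref T38 [La], SplitL (SplitL (Ref T18 []) (Ref T58 [S1])) (Ref T39 []),
    SplitL (SplitL (Ref T37 []) (Ref T80 [])) (Ref T60 []), Ref T38 [La,S1]]),
  (T40, [
    Ref T20 [], Ref T43 [Ro], Ref T46 [Ro,Ro], Ref T19 [], Ref T81 [], Ref T81 [Re,S1,S2,S3]]),
  (T41, [
    Ref T82 [], Ref T49 [Re], Ref T34 [], Ref T44 [], Ref T20 [], Ref T83 [Re]]),
  (T42, [
    SplitL (Ref T82 [Re,S1,S2,S3]) (Ref T84 []), Ref T23 [], Ref T68 [], Ref T47 [], Ref T83 [S1,S2,S3],
    SplitL (Ref T20 []) (Ref T23 [])]),
  (T43, [
    Ref T21 [], Ref T40 [Ro,Ro,S3], Ref T25 [Ro,Ro], Ref T85 [], Ref T40 [Ro,Ro], Ref T86 []]),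
  (T44, [
    Ref T87 [], Ref T41 [S1], Ref T62 [], Ref T21 [], Ref T41 [], Ref T88 [Re]])]"

definition "certs5 = [
  (T45, [
    Ref T89 [], Ref T22 [S1], Ref T21 [S2], Ref T90 [], Ref T22 [], Ref T21 []]),
  (T46, [
    Ref T22 [], Ref T35 [Ro], Ref T40 [Ro,S3], Ref T85 [Re,S2,S3], Ref T86 [Re,S2,S3], Ref T40 [Ro]]),
  (T47, [
    SplitL (Ref T87 [Re,S2,S3]) (SplitL (Ref T91 []) (Ref T92 [])), Ref T26 [], Ref T42 [S2],
    SplitL (Ref T22 []) (SplitL (Ref T25 []) (Ref T26 [])), Ref T88 [S1,S3], Ref T42 []]),
  (T48, [
    Ref T50 [La,Re], Ref T51 [], Ref T34 [La], Ref T93 [La,Re], Ref T23 [], Ref T94 []]),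
  (T49, [
    SplitL (Ref T24 [Re]) (Ref T79 [La,Re]), SplitL (Ref T41 [Re,S1]) (Ref T72 [S3]), Ref T59 [Re],
    Ref T95 [], SplitL (Ref T41 [Re]) (Ref T72 []), Ref T96 []]),
  (T50, [

    SplitL (SplitL (SplitL (Ref T24 [Ra,Re]) (Ref T79 [La,Ra,Re])) (SplitL (SplitL (SplitL (Ref T24 [Ra,Ra,Re]) (Ref T79 [La,Ra,Ra,Re])) (SplitL (SplitR (Ref T24 [Ra,Ra,Ra,Re]) (Ref T79 [Ra,Ra,Ra,Re])) (Ref T79 [La,Ra,Ra,Re]))) (Ref T79 [La,Ra,Re]))) (Ref T79 [La,Re]),
    SplitL (SplitL (SplitL (Ref T48 [Re,S1]) (Ref T97 [La,Re])) (SplitL (SplitL (SplitL (Ref T48 [Ra,Re,S1]) (Ref T97 [La,Ra,Re])) (SplitL (SplitR (Ref T48 [Ra,Ra,Re,S1]) (Ref T97 [Ra,Ra,Re])) (Ref T97 [La,Ra,Re]))) (Ref T97 [La,Re]))) (Ref T73 [S3]),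
    Ref T59 [Re], Ref T98 [],
    SplitL (SplitL (SplitL (Ref T48 [Re]) (Ref T97 [La,Re,S1])) (SplitL (SplitL (SplitL (Ref T48 [Ra,Re]) (Ref T97 [La,Ra,Re,S1])) (SplitL (SplitR (Ref T48 [Ra,Ra,Re]) (Ref T97 [Ra,Ra,Re,S1])) (Ref T97 [La,Ra,Re,S1]))) (Ref T97 [La,Re,S1]))) (Ref T73 []),
    Ref T99 []]),
  (T51, [
    Ref T100 [], SplitL (Ref T48 [S1]) (Ref T97 []), Ref T62 [La], SplitL (Ref T24 []) (Ref T79 []),
    SplitL (Ref T48 []) (Ref T97 [S1]), Ref T101 [La,Re]]),
  (T52, [
    Ref T102 [], Ref T25 [S1], Ref T24 [S3], Ref T103 [Re], Ref T25 [], Ref T24 []]),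
  (T53, [
    Ref T104 [], Ref T26 [S1], Ref T24 [La,S3], Ref T105 [La,Re], Ref T26 [], Ref T24 [La]])]"

definition "certs6 = [
  (T54, [
    Ref T55 [Ra], Ref T55 [Ra,S1], Ref T62 [Ra], Ref T61 [Ra,Ra], Ref T27 [], Ref T62 [Ra,S2]]),
  (T55, [
    SplitL (SplitL (Ref T28 []) (Ref T55 [])) (Ref T67 [S2]), Ref T32 [Ra], Ref T56 [Ra], Ref T55 [Ra],
    SplitL (SplitL (Ref T54 []) (Ref T61 [])) (Ref T106 []), Ref T56 [Ra,S2]]),
  (T56, [
    Ref T78 [], Ref T66 [], SplitL (SplitL (Ref T28 []) (Ref T55 [])) (Ref T67 [S2]),
    SplitL (Ref T62 []) (Ref T107 []), SplitL (SplitL (Ref T34 []) (Ref T78 [])) (Ref T77 []), Ref T108 []]),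
  (T57, [
    Ref T29 [], Ref T65 [S1], Ref T79 [], Ref T106 [], Ref T65 [], Ref T79 [S3]]),
  (T58, [
    Ref T66 [S1], Ref T29 [], Ref T38 [Ra,S3], Ref T39 [Ra,S3], Ref T31 [Ra], Ref T38 [Ra,S1,S3]]),
  (T59, [

    SplitL (SplitL (Ref T49 [Re]) (Ref T50 [La,Re])) (SplitL (SplitL (SplitL (Ref T49 [Ra,Re]) (Ref T50 [La,Ra,Re])) (SplitL (SplitR (Ref T49 [Ra,Ra,Re]) (Ref T50 [Ra,Ra,Re])) (Ref T50 [La,Ra,Re]))) (Ref T50 [La,Re])),
    Ref T38 [Ra,S3], Ref T29 [], Ref T109 [Ra], Ref T38 [Ra],
    SplitL (SplitL (Ref T110 [Re]) (Ref T111 [La,Re])) (SplitL (SplitL (SplitL (Ref T110 [Ra,Re]) (Ref T111 [La,Ra,Re])) (SplitL (SplitR (Ref T110 [Ra,Ra,Re]) (Ref T111 [Ra,Ra,Re])) (Ref T111 [La,Ra,Re]))) (Ref T111 [La,Re]))]),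
  (T60, [
    Ref T60 [La,La], Ref T39 [La,S2], Ref T76 [La],
    SplitL (Ref T29 []) (SplitL (SplitL (Ref T37 []) (Ref T80 [])) (Ref T60 [])), Ref T39 [La],
    Ref T76 [La,S1]]),
  (T61, [
    SplitL (SplitL (Ref T30 []) (SplitL (SplitL (Ref T54 []) (Ref T61 [])) (Ref T106 []))) (Ref T112 []),
    Ref T55 [Ra,S1], Ref T62 [Ra], Ref T61 [Ra,Ra], Ref T55 [Ra], Ref T62 [Ra,S2]]),
  (T62, [

    SplitL (SplitL (Ref T113 [Re]) (Ref T114 [La,Re])) (SplitL (SplitL (SplitL (Ref T113 [Ra,Re]) (Ref T114 [La,Ra,Re])) (SplitL (SplitR (Ref T113 [Ra,Ra,Re]) (Ref T114 [Ra,Ra,Re])) (Ref T114 [La,Ra,Re]))) (Ref T114 [La,Re])),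
    Ref T56 [Ra,S3], SplitL (Ref T30 []) (SplitL (SplitL (Ref T54 []) (Ref T61 [])) (Ref T106 [])),
    SplitL (SplitL (Ref T44 []) (Ref T51 [])) (SplitL (SplitL (SplitL (Ref T74 []) (Ref T75 [])) (SplitL (SplitR (Ref T113 [Re]) (Ref T114 [Re])) (Ref T115 []))) (Ref T51 [])),
    Ref T56 [Ra], Ref T116 [Ra]])]"

definition "certs7 = [
  (T63, [
    Ref T31 [Ra], Ref T32 [S1], Ref T32 [Ra], Ref T31 [Ra,S2], Ref T32 [], Ref T32 [Ra,S1]]),
  (T64, [
    Ref T31 [La], Ref T31 [S2], Ref T32 [La], Ref T31 [La,S2], Ref T31 [], Ref T32 [La,S1]]),
  (T65, [
    Ref T66 [], Ref T38 [S3], Ref T31 [], Ref T67 [S2], Ref T38 [], Ref T57 []]),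
  (T66, [
    Ref T32 [], Ref T56 [S3], Ref T65 [], Ref T117 [], Ref T56 [], Ref T58 [S1]]),
  (T67, [
    Ref T56 [La,S3], Ref T32 [La], Ref T65 [S2], Ref T56 [La,S2,S3], Ref T112 [], Ref T55 [La,S3]]),
  (T68, [
    Ref T33 [], Ref T42 [S2], Ref T36 [], Ref T42 [], Ref T95 [S1,S3], Ref T96 [S1,S3]]),
  (T69, [
    Ref T100 [Re,S2,S3], Ref T71 [Ra,S2], Ref T76 [Ra], Ref T71 [Ra], Ref T33 [], Ref T101 [Ra,S1,S3]]),
  (T70, [
    SplitL (Ref T102 [Re,S2]) (Ref T118 []), SplitL (Ref T35 [S2]) (Ref T36 [S3]), Ref T33 [S3],
    SplitL (Ref T35 []) (Ref T36 []), Ref T103 [S1], Ref T33 []]),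
  (T71, [
    SplitL (Ref T94 [Re,S1,S2,S3]) (Ref T119 []), Ref T120 [], Ref T77 [],
    SplitL (SplitL (Ref T34 []) (Ref T78 [])) (Ref T77 []),
    SplitL (SplitL (Ref T69 []) (Ref T121 [])) (Ref T109 []), Ref T93 [S1,S2,S3]])]"

definition "certs8 = [
  (T72, [
    Ref T84 [S1,S2,S3], Ref T78 [La,Re], Ref T49 [La], Ref T83 [La], SplitL (Ref T74 [Re]) (Ref T113 []),
    SplitL (Ref T34 [Re]) (Ref T78 [La,Re])]),
  (T73, [
    Ref T119 [S1,S2,S3], Ref T78 [La,Re], Ref T50 [La], Ref T93 [La],
    SplitL (SplitL (SplitL (Ref T75 [Re]) (Ref T115 [La,Re])) (SplitL (SplitL (SplitL (Ref T75 [Ra,Re]) (Ref T115 [La,Ra,Re])) (SplitL (SplitR (Ref T75 [Ra,Ra,Re]) (Ref T115 [Ra,Ra,Re])) (Ref T115 [La,Ra,Re]))) (Ref T115 [La,Re]))) (Ref T114 []),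
    SplitL (SplitL (SplitL (Ref T34 [Ra,Re]) (Ref T78 [La,Ra,Re])) (SplitL (SplitL (SplitL (Ref T34 [Ra,Ra,Re]) (Ref T78 [La,Ra,Ra,Re])) (SplitL (SplitR (Ref T34 [Ra,Ra,Ra,Re]) (Ref T78 [Ra,Ra,Ra,Re])) (Ref T78 [La,Ra,Ra,Re]))) (Ref T78 [La,Ra,Re]))) (Ref T78 [La,Re])]),
  (T74, [
    Ref T91 [Re,S1,S2], Ref T62 [Ra], Ref T72 [Re,S3], Ref T88 [Ra,Re], Ref T35 [], Ref T72 [Re]]),
  (T75, [
    Ref T122 [], Ref T62 [La,Ra], Ref T73 [La,Re,S3], Ref T101 [La,Ra,Re], Ref T36 [], Ref T73 [La,Re]]),
  (T76, [
    Ref T109 [La], Ref T38 [La,S3], SplitL (SplitL (Ref T37 []) (Ref T80 [])) (Ref T60 []), Ref T38 [La],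
    SplitL (SplitL (Ref T69 []) (Ref T121 [])) (Ref T109 []), Ref T123 []]),
  (T77, [
    Ref T71 [La], Ref T56 [La], Ref T38 [La], Ref T38 [], Ref T71 [], Ref T97 [S1]]),
  (T78, [

    SplitL (SplitL (SplitL (Ref T72 [Re]) (Ref T73 [La,Re])) (SplitL (SplitL (SplitL (Ref T72 [Ra,Re]) (Ref T73 [La,Ra,Re])) (SplitL (SplitR (Ref T72 [Ra,Ra,Re]) (Ref T73 [Ra,Ra,Re])) (Ref T73 [La,Ra,Re]))) (Ref T73 [La,Re]))) (Ref T97 [S1]),
    Ref T56 [Ra], Ref T56 [], Ref T71 [Ra], Ref T38 [Ra],
    SplitL (SplitL (SplitL (Ref T72 [Ra,Re]) (Ref T73 [La,Ra,Re])) (SplitL (SplitL (SplitL (Ref T72 [Ra,Ra,Re]) (Ref T73 [La,Ra,Ra,Re])) (SplitL (SplitR (Ref T72 [Ra,Ra,Ra,Re]) (Ref T73 [Ra,Ra,Ra,Re])) (Ref T73 [La,Ra,Ra,Re]))) (Ref T73 [La,Ra,Re]))) (Ref T73 [La,Re])]),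
  (T79, [

    SplitL (SplitL (SplitL (Ref T110 [Re]) (Ref T111 [La,Re])) (SplitL (SplitL (SplitL (Ref T110 [Ra,Re]) (Ref T111 [La,Ra,Re])) (SplitL (SplitR (Ref T110 [Ra,Ra,Re]) (Ref T111 [Ra,Ra,Re])) (Ref T111 [La,Ra,Re]))) (Ref T111 [La,Re]))) (Ref T123 []),
    Ref T57 [], Ref T38 [S1], Ref T51 [],
    SplitL (SplitL (SplitL (Ref T49 [Ra,Re]) (Ref T50 [La,Ra,Re])) (SplitL (SplitL (SplitL (Ref T49 [Ra,Ra,Re]) (Ref T50 [La,Ra,Ra,Re])) (SplitL (SplitR (Ref T49 [Ra,Ra,Ra,Re]) (Ref T50 [Ra,Ra,Ra,Re])) (Ref T50 [La,Ra,Ra,Re]))) (Ref T50 [La,Ra,Re]))) (Ref T50 [La,Re]),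
    Ref T38 []]),
  (T80, [
    Ref T60 [Ra,La], Ref T39 [Ra,S2], Ref T76 [Ra], Ref T117 [], Ref T39 [Ra], Ref T76 [Ra,S1]])]"

definition "certs9 = [
  (T81, [
    Ref T82 [], Ref T86 [Ro], Ref T85 [Ro,Ro,Re,S2,S3], Ref T81 [Ro,Ro,Re,S1,S2,S3], Ref T40 [],
    Ref T40 [Re,S1,S2,S3]]),
  (T82, [
    Ref T41 [], Ref T96 [Re], Ref T84 [Re,S1,S2,S3], Ref T87 [], Ref T81 [], Ref T42 [Re,S1,S2,S3]]),
  (T83, [
    Ref T42 [S1,S2,S3], Ref T95 [], Ref T94 [S1,S2,S3], Ref T88 [],
    SplitL (Ref T83 [Re,S1,S2,S3]) (Ref T93 [La,Re,S1,S2,S3]), SplitL (Ref T41 [Re]) (Ref T72 [])]),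
  (T84, [
    Ref T42 [La], Ref T84 [La], Ref T96 [La,S1,S3], SplitL (Ref T91 []) (Ref T92 []), Ref T72 [S1,S2,S3],
    SplitL (Ref T82 [Re,S1,S2,S3]) (Ref T84 [])]),
  (T85, [
    Ref T87 [], Ref T81 [Ro,Ro,Re,S1,S2], Ref T91 [Ro,Ro], Ref T43 [], Ref T81 [Ro,Ro,Re,S1,S2,S3],
    Ref T46 [Re,S1,S3]]),
  (T86, [
    Ref T89 [], Ref T81 [Ro,Ro,S3], Ref T102 [Ro,Ro], Ref T46 [Re,S1,S3], Ref T81 [Ro,Ro], Ref T43 []]),
  (T87, [
    Ref T44 [], Ref T82 [S1], Ref T92 [Re,S1,S3], Ref T85 [], Ref T82 [], Ref T47 [Re,S1,S3]]),
  (T88, [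
    Ref T47 [S1,S3], Ref T83 [S2], Ref T104 [S3],
    SplitL (Ref T90 [Re]) (SplitL (Ref T103 [Re,S1]) (Ref T105 [La,Re,S1])), Ref T83 [],
    SplitL (Ref T44 [Re]) (SplitL (Ref T74 [Re]) (Ref T113 []))]),
  (T89, [
    Ref T45 [], Ref T86 [Re,S3], Ref T86 [S2], Ref T45 [Re,S3], Ref T86 [Re,S2,S3], Ref T86 []])]"

definition "certs10 = [
  (T90, [
    Ref T45 [Re,S3], Ref T88 [S3], Ref T88 [Re,S1], Ref T45 [], Ref T88 [S1,S3], Ref T88 [Re]]),
  (T91, [
    Ref T47 [La], Ref T92 [La], Ref T84 [S3], Ref T85 [Ro], Ref T74 [Re,S1,S2], Ref T84 []]),
  (T92, [
    Ref T47 [La,La], Ref T92 [La,La], Ref T84 [La,S3],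
    SplitL (Ref T87 [Re,S2,S3]) (SplitL (Ref T91 []) (Ref T92 [])), Ref T113 [S1,S3], Ref T84 [La]]),
  (T93, [
    Ref T98 [], Ref T101 [], Ref T94 [S1,S2,S3],
    SplitL (SplitL (SplitL (Ref T48 [Re]) (Ref T97 [La,Re,S1])) (SplitL (SplitL (SplitL (Ref T48 [Ra,Re]) (Ref T97 [La,Ra,Re,S1])) (SplitL (SplitR (Ref T48 [Ra,Ra,Re]) (Ref T97 [Ra,Ra,Re,S1])) (Ref T97 [La,Ra,Re,S1]))) (Ref T97 [La,Re,S1]))) (Ref T73 []),
    SplitL (SplitL (SplitL (Ref T83 [Ra,Re,S1,S2,S3]) (Ref T93 [La,Ra,Re,S1,S2,S3])) (SplitL (SplitL (SplitL (Ref T83 [Ra,Ra,Re,S1,S2,S3]) (Ref T93 [La,Ra,Ra,Re,S1,S2,S3])) (SplitL (SplitR (Ref T83 [Ra,Ra,Ra,Re,S1,S2,S3]) (Ref T93 [Ra,Ra,Ra,Re,S1,S2,S3])) (Ref T93 [La,Ra,Ra,Re,S1,S2,S3]))) (Ref T93 [La,Ra,Re,S1,S2,S3]))) (Ref T93 [La,Re,S1,S2,S3]),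
    Ref T71 [S1,S2,S3]]),
  (T94, [
    Ref T99 [La,Re], Ref T100 [], Ref T119 [La,Re,S1,S2,S3], Ref T71 [La,Re,S1,S2,S3],
    SplitL (Ref T83 [S1,S2,S3]) (Ref T93 [S1,S2,S3]), SplitL (Ref T48 []) (Ref T97 [S1])]),
  (T95, [
    Ref T100 [Re], Ref T83 [S2], Ref T122 [S1,S3], Ref T49 [], Ref T83 [], Ref T68 [S1,S3]]),
  (T96, [
    SplitL (Ref T102 [Re]) (Ref T118 [S1]), SplitL (Ref T82 [Re,S1]) (Ref T84 [S1,S2]), Ref T118 [S1],
    Ref T68 [S1,S3], SplitL (Ref T82 [Re]) (Ref T84 [S1,S2,S3]), Ref T49 []]),
  (T97, [
    Ref T77 [S1], Ref T50 [La,Re], Ref T78 [La,S1], Ref T93 [La,Re,S2], Ref T51 [], Ref T94 [S1]]),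
  (T98, [
    Ref T100 [Re], Ref T93 [S2], Ref T122 [S1,S3], Ref T50 [], Ref T93 [], Ref T120 [S1,S3]])]"

definition "certs11 = [
  (T99, [
    SplitL (Ref T104 [Re]) (Ref T124 []), SplitL (Ref T94 [Re,S1]) (Ref T119 [S1,S2]), Ref T124 [],
    Ref T120 [S1,S3], SplitL (Ref T94 [Re]) (Ref T119 [S1,S2,S3]), Ref T50 []]),
  (T100, [
    Ref T51 [], Ref T94 [S1], Ref T125 [La,Re],
    SplitL (SplitL (Ref T95 [Re]) (Ref T98 [La,Re])) (SplitL (SplitL (SplitL (Ref T95 [Ra,Re]) (Ref T98 [La,Ra,Re])) (SplitL (SplitR (Ref T95 [Ra,Ra,Re]) (Ref T98 [Ra,Ra,Re])) (Ref T98 [La,Ra,Re]))) (Ref T98 [La,Re])),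
    Ref T94 [],
    SplitL (SplitL (Ref T69 [Re,S1,S3]) (Ref T121 [La,Re,S1,S3])) (SplitL (SplitL (SplitL (Ref T69 [Ra,Re,S1,S3]) (Ref T121 [La,Ra,Re,S1,S3])) (SplitL (SplitR (Ref T69 [Ra,Ra,Re,S1,S3]) (Ref T121 [Ra,Ra,Re,S1,S3])) (Ref T121 [La,Ra,Re,S1,S3]))) (Ref T121 [La,Re,S1,S3]))]),
  (T101, [
    SplitL (SplitL (Ref T69 [S1,S3]) (Ref T121 [S1,S3])) (Ref T109 [S1,S2]), Ref T93 [S2], Ref T104 [S3],
    SplitL (SplitL (Ref T103 []) (Ref T105 [])) (SplitL (SplitL (SplitL (Ref T103 [Ra,Re,S1]) (Ref T105 [La,Ra,Re,S1])) (SplitL (SplitR (Ref T103 [Ra,Ra,Re,S1]) (Ref T105 [Ra,Ra,Re,S1])) (Ref T105 [La,Ra,Re,S1]))) (Ref T105 [La,Re,S1])),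
    Ref T93 [],
    SplitL (Ref T51 [Re]) (SplitL (SplitL (SplitL (Ref T75 [Re]) (Ref T115 [La,Re])) (SplitL (SplitR (Ref T75 [Ra,Re]) (Ref T115 [Ra,Re])) (Ref T115 [La,Re]))) (Ref T114 []))]),
  (T102, [
    Ref T52 [], Ref T86 [Ro,S2], Ref T96 [Re,S3], Ref T70 [Re,S1], Ref T86 [Ro], Ref T96 [Re]]),
  (T103, [
    Ref T70 [S1], SplitL (Ref T88 [Ra,Re,S3]) (Ref T101 [La,Ra,Re,S3]), Ref T101 [Ra,S1],
    SplitL (Ref T52 [Re]) (Ref T110 []), SplitL (Ref T88 [Ra,Re,S1,S3]) (Ref T101 [La,Ra,Re,S1,S3]),
    Ref T101 [Ra]]),
  (T104, [
    SplitL (Ref T53 []) (Ref T123 []), SplitL (Ref T88 [S3]) (Ref T101 [S3]), Ref T99 [La,Re,S3],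
    Ref T116 [La,Re,S1], SplitL (Ref T88 [S1,S3]) (Ref T101 [S1,S3]), Ref T99 [La,Re]]),
  (T105, [
    Ref T116 [S1],
    SplitL (SplitL (SplitL (Ref T88 [Ra,Ra,Re,S3]) (Ref T101 [La,Ra,Ra,Re,S3])) (SplitL (SplitL (SplitL (Ref T88 [Ra,Ra,Ra,Re,S3]) (Ref T101 [La,Ra,Ra,Ra,Re,S3])) (SplitL (SplitR (Ref T88 [Ra,Ra,Ra,Ra,Re,S3]) (Ref T101 [Ra,Ra,Ra,Ra,Re,S3])) (Ref T101 [La,Ra,Ra,Ra,Re,S3]))) (Ref T101 [La,Ra,Ra,Re,S3]))) (Ref T101 [La,Ra,Re,S3]),
    Ref T101 [Ra,S1],
    SplitL (SplitL (SplitL (Ref T53 [Re]) (Ref T123 [La,Re])) (SplitL (SplitL (SplitL (Ref T53 [Ra,Re]) (Ref T123 [La,Ra,Re])) (SplitL (SplitR (Ref T53 [Ra,Ra,Re]) (Ref T123 [Ra,Ra,Re])) (Ref T123 [La,Ra,Re]))) (Ref T123 [La,Re]))) (Ref T111 []),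
    SplitL (SplitL (SplitL (Ref T88 [Ra,Ra,Re,S1,S3]) (Ref T101 [La,Ra,Ra,Re,S1,S3])) (SplitL (SplitL (SplitL (Ref T88 [Ra,Ra,Ra,Re,S1,S3]) (Ref T101 [La,Ra,Ra,Ra,Re,S1,S3])) (SplitL (SplitR (Ref T88 [Ra,Ra,Ra,Ra,Re,S1,S3]) (Ref T101 [Ra,Ra,Ra,Ra,Re,S1,S3])) (Ref T101 [La,Ra,Ra,Ra,Re,S1,S3]))) (Ref T101 [La,Ra,Ra,Re,S1,S3]))) (Ref T101 [La,Ra,Re,S1,S3]),
    Ref T101 [Ra]]),
  (T106, [
    SplitL (Ref T11 [La]) (Ref T57 []), SplitL (Ref T28 [La,S1]) (Ref T55 [La,S1]), Ref T62 [La],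
    Ref T61 [La,Ra], SplitL (Ref T28 [La]) (Ref T55 [La]), Ref T62 [La,S2]]),
  (T107, [
    Ref T115 [], Ref T56 [La,S3], Ref T112 [], Ref T56 [La], Ref T120 [], Ref T116 [La]])]"

definition "certs12 = [
  (T108, [
    Ref T121 [], Ref T117 [], Ref T56 [S2], Ref T116 [], Ref T120 [], Ref T56 []]),
  (T109, [
    SplitL (Ref T122 [Re,S1,S3]) (Ref T125 [S1,S3]), Ref T71 [La,S2], Ref T76 [La],
    SplitL (Ref T59 []) (Ref T76 []), Ref T71 [La], Ref T101 [La,S1,S3]]),
  (T110, [
    Ref T118 [S1], Ref T79 [La,Re,S3], Ref T59 [Re,S3], Ref T103 [La], Ref T79 [La,Re], Ref T59 [Re]]),
  (T111, [
    Ref T124 [], Ref T79 [La,Re,S3], Ref T59 [Re,S3], Ref T105 [La], Ref T79 [La,Re], Ref T59 [Re]]),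
  (T112, [
    Ref T61 [La], Ref T67 [], Ref T107 [], Ref T117 [], Ref T67 [S2], Ref T107 [S3]]),
  (T113, [
    Ref T62 [Re], Ref T72 [La,S3], Ref T62 [La,La,Re], Ref T92 [S1,S3], Ref T72 [La], Ref T88 [La,La]]),
  (T114, [
    Ref T62 [Re], Ref T73 [La,S3], Ref T62 [La,La,Re], Ref T125 [], Ref T73 [La], Ref T101 [La,La]]),
  (T115, [
    Ref T122 [], Ref T73 [La,Re,S3], Ref T107 [], Ref T62 [La,Ra], Ref T73 [La,Re], Ref T101 [La,Ra,Re]]),
  (T116, [
    Ref T105 [S1], Ref T108 [S3], SplitL (Ref T62 [S2]) (Ref T107 [S3]),
    SplitL (Ref T104 [Re,S3]) (Ref T124 [S1]), Ref T108 [], SplitL (Ref T62 []) (Ref T107 [])])]"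

definition "certs13 = [
  (T117, [
    Ref T66 [S2], Ref T108 [S3], Ref T112 [], Ref T66 [], Ref T108 [], Ref T80 []]),
  (T118, [
    Ref T70 [La], Ref T96 [S1], Ref T96 [La,S1], Ref T96 [S1,S3], Ref T110 [S1], Ref T96 [La,S1,S3]]),
  (T119, [
    Ref T71 [La], Ref T99 [La,S1,S3], Ref T119 [La], SplitL (Ref T94 [Re,S1,S2,S3]) (Ref T119 []),
    SplitL (Ref T122 [Re,S1,S3]) (Ref T125 [S1,S3]), Ref T73 [S1,S2,S3]]),
  (T120, [
    Ref T99 [S1,S3], Ref T71 [], Ref T107 [], Ref T108 [], Ref T71 [S2], Ref T98 [S1,S3]]),
  (T121, [
    Ref T100 [Re,S2,S3], Ref T71 [Ra,S2], Ref T76 [Ra], Ref T108 [], Ref T71 [Ra], Ref T101 [Ra,S1,S3]]),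
  (T122, [
    SplitL (Ref T75 []) (Ref T115 []), Ref T125 [La,Ra,Re], Ref T119 [La,Re,S1,S2], Ref T109 [La,Re,S1,S2],
    SplitL (Ref T95 [S1,S3]) (Ref T98 [S1,S3]), Ref T119 [La,Re,S1,S2,S3]]),
  (T123, [
    Ref T105 [La,Re], Ref T79 [La,S3], Ref T76 [S1], Ref T79 [La], Ref T104 [], Ref T76 []]),
  (T124, [
    Ref T99 [La], Ref T99 [S3], Ref T99 [La,S3], Ref T116 [La,S1], Ref T99 [], Ref T111 []]),
  (T125, [
    Ref T114 [], Ref T119 [La,S1,S2], SplitL (Ref T100 [Re]) (SplitL (Ref T122 [Re]) (Ref T125 [])),
    Ref T125 [La,La], Ref T119 [La,S1,S2,S3], Ref T109 [La,S1,S2]])]"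

text \<open>
  The finite check at the heart of the proof: the families are closed under mutation, the vector at
  the mutated position lies in the cone of the kind up to sign, and the degrees have the right shape.
\<close>

lemma closed_certs0: "list_all closed_family certs0" by code_simp
lemma closed_certs1: "list_all closed_family certs1" by code_simp
lemma closed_certs2: "list_all closed_family certs2" by code_simp
lemma closed_certs3: "list_all closed_family certs3" by code_simp
lemma closed_certs4: "list_all closed_family certs4" by code_simp
lemma closed_certs5: "list_all closed_family certs5" by code_simp
lemma closed_certs6: "list_all closed_family certs6" by code_simp
lemma closed_certs7: "list_all closed_family certs7" by code_simp
lemma closed_certs8: "list_all closed_family certs8" by code_simp
lemma closed_certs9: "list_all closed_family certs9" by code_simp
lemma closed_certs10: "list_all closed_family certs10" by code_simp
lemma closed_certs11: "list_all closed_family certs11" by code_simp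
lemma closed_certs12: "list_all closed_family certs12" by code_simp
lemma closed_certs13: "list_all closed_family certs13" by code_simp

section \<open>Mutation of multisets of pairs\<close>

type_synonym vec_pair = "v6 \<times> v6"

definition weight :: "int \<Rightarrow> vec_pair \<Rightarrow> vec_pair \<Rightarrow> int" where
  "weight e p q = max (e * omega (fst p) (fst q)) 0"

definition mutate_mset :: "int \<Rightarrow> vec_pair \<Rightarrow> vec_pair multiset \<Rightarrow> vec_pair multiset" where
  "mutate_mset e p M = add_mset (- fst p, (\<Sum>q\<in>#M. smul (weight e p q) (snd q)) - snd p)
     (image_mset (\<lambda>q. (fst q + smul (weight e p q) (fst p), snd q)) (M - {#p#}))"

lemma mset_mutate_list:
  assumes "k < length ps"
  shows "mset (mutate_list e k ps) = mutate_mset e (ps ! k) (mset ps)"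
proof -
  obtain c g where vec_pair: "ps ! k = (c, g)" by (cases "ps ! k")
  let ?F = "\<lambda>q. (fst q + smul (weight e (ps ! k) q) (fst (ps ! k)), snd q)"
  have eq: "mutate_list e k ps = (map ?F ps)[k := (- c, sum_list (map (\<lambda>q. smul (weight e (ps ! k) q) (snd q)) ps) - g)]"
    by (simp add: mutate_list_def vec_pair weight_def case_prod_unfold comp_def Let_def)
  have "{#ps ! k#} \<subseteq># mset ps" using assms by simp
  then have "mset (map ?F ps) - {#?F (ps ! k)#} = image_mset ?F (mset ps - {#ps ! k#})"
    by (subst image_mset_Diff) simp_all
  then show ?thesis
    unfolding eq mutate_mset_def using assms
    by (simp add: mset_update vec_pair flip: sum_mset_sum_list)
qed

lemma perm_eq_mset: "perm_eq xs ys \<Longrightarrow> mset xs = mset ys"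
  by (induction xs ys rule: perm_eq.induct) auto

definition letter_sign :: "letter \<Rightarrow> int" where
  "letter_sign x = (if x = Re then -1 else 1)"

fun px :: "v6 \<Rightarrow> int" where "px (V a1 a2 a3 a4 a5 a6) = a1 + a4 - a3 - a6"
fun py :: "v6 \<Rightarrow> int" where "py (V a1 a2 a3 a4 a5 a6) = a2 + a5 - a3 - a6"

lemma omega_eq: "omega c c' = py c * px c' - px c * py c'"
  by (cases c; cases c') simp

text \<open>
  On the two coordinates that \<open>omega\<close> sees, the letters act with determinant \<open>1\<close>, except for \<open>Re\<close>.
\<close>

lemma px_py_actc:
  "px (actc x c) = (case x of La \<Rightarrow> px c + py c | Ra \<Rightarrow> px c | Ro \<Rightarrow> py c - px c | Re \<Rightarrow> - py c | _ \<Rightarrow> px c)"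
  "py (actc x c) = (case x of La \<Rightarrow> py c | Ra \<Rightarrow> px c + py c | Ro \<Rightarrow> - px c | Re \<Rightarrow> - px c | _ \<Rightarrow> py c)"
  by (cases x; cases c; simp)+

lemma omega_actc: "omega (actc x c) (actc x c') = letter_sign x * omega c c'"
  unfolding omega_eq px_py_actc letter_sign_def by (cases x) (simp_all add: ring_distribs)

lemma actc_add: "actc x (c + c') = actc x c + actc x c'"
  by (cases x; cases c; cases c') simp_all

lemma actc_smul: "actc x (smul m c) = smul m (actc x c)"
  by (cases x; cases c) (simp_all add: algebra_simps)

lemma actc_minus: "actc x (- c) = - actc x c"
  by (cases x; cases c) simp_all

lemma actg_add: "actg x (c + c') = actg x c + actg x c'"
  by (cases x; cases c; cases c') simp_all

lemma actg_smul: "actg x (smul m c) = smul m (actg x c)"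
  by (cases x; cases c) (simp_all add: algebra_simps)

lemma actg_minus: "actg x (- c) = - actg x c"
  by (cases x; cases c) simp_all

lemma actg_diff: "actg x (c - c') = actg x c - actg x c'"
  unfolding minus_v6_def actg_add actg_minus ..

lemma actg_zero: "actg x 0 = 0"
  by (cases x) (simp_all add: zero_v6_def)

lemma actg_sum: "actg x (\<Sum>q\<in>#M. f q) = (\<Sum>q\<in>#M. actg x (f q))"
  by (induction M) (simp_all add: actg_zero actg_add)

lemma weight_act_letter: "weight (letter_sign x * e) (act_letter x p) (act_letter x q) = weight e p q"
  by (simp add: weight_def act_letter_def omega_actc letter_sign_def)

text \<open>
  Letters are linear and multiply \<open>omega\<close> by a sign, so they commute with mutation if \<open>e\<close> is adjusted.
\<close>

lemma mutate_mset_act_letter: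
  assumes "p \<in># M"
  shows "mutate_mset (letter_sign x * e) (act_letter x p) (image_mset (act_letter x) M) = image_mset (act_letter x) (mutate_mset e p M)"
proof -
  have "image_mset (act_letter x) M - {#act_letter x p#} = image_mset (act_letter x) (M - {#p#})"
    using assms by (subst image_mset_Diff) simp_all
  then show ?thesis
    unfolding mutate_mset_def
    by (simp add: weight_act_letter multiset.map_comp comp_def)
      (simp add: act_letter_def actc_minus actg_diff actg_sum actg_smul actc_add actc_smul)
qed

lemma act_simps: "act [] = id" "act (x # w) = act_letter x \<circ> act w" "act (u @ w) = act u \<circ> act w"
  by (rule ext, simp add: act_def)+

lemma image_act:
  "image_mset (act []) M = M"
  "image_mset (act (x # w)) M = image_mset (act_letter x) (image_mset (act w) M)"
  "image_mset (act (u @ w)) M = image_mset (act u) (image_mset (act w) M)"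
  by (simp_all add: act_simps multiset.map_comp del: image_mset.comp multiset.map_comp flip: multiset.map_comp)

lemma mutate_mset_act:
  assumes "p \<in># M" "Re \<notin> set w"
  shows "mutate_mset e (act w p) (image_mset (act w) M) = image_mset (act w) (mutate_mset e p M)"
  using assms(2)
proof (induction w)
  case Nil
  then show ?case by (simp add: act_simps)
next
  case (Cons x w)
  have "letter_sign x = 1" using Cons.prems by (auto simp: letter_sign_def)
  then have "mutate_mset e (act_letter x (act w p)) (image_mset (act_letter x) (image_mset (act w) M)) =
      image_mset (act_letter x) (mutate_mset e (act w p) (image_mset (act w) M))"
    using mutate_mset_act_letter[of "act w p" "image_mset (act w) M" x e] assms(1) by simp
  then show ?case using Cons by (simp add: image_act) (simp add: act_simps)
qed

section \<open>Soundness of the certificates\<close>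

fun lang :: "kind \<Rightarrow> letter list \<Rightarrow> bool" where
  "lang K0 w \<longleftrightarrow> w = []"
| "lang KL w \<longleftrightarrow> set w \<subseteq> {La}"
| "lang KR w \<longleftrightarrow> set w \<subseteq> {Ra}"
| "lang KM w \<longleftrightarrow> set w \<subseteq> {La, Ra} \<and> Ra \<in> set w"
| "lang KN w \<longleftrightarrow> set w \<subseteq> {La, Ra} \<and> La \<in> set w"
| "lang KF w \<longleftrightarrow> set w \<subseteq> {La, Ra}"

lemma lang_letters: "lang k w \<Longrightarrow> set w \<subseteq> {La, Ra}"
  by (cases k) auto

lemma lang_no_Re: "lang k w \<Longrightarrow> Re \<notin> set w"
  using lang_letters by blast

definition all_certs :: "((unit \<Rightarrow> family) \<times> cert list) list" where
  "all_certs = certs0 @ certs1 @ certs2 @ certs3 @ certs4 @ certs5 @ certs6 @ certs7 @ certs8 @ certs9 @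
     certs10 @ certs11 @ certs12 @ certs13"

definition tables :: "(unit \<Rightarrow> family) set" where
  "tables = fst ` set all_certs"

lemma closed_all: "list_all closed_family all_certs"
  by (simp add: all_certs_def closed_certs0 closed_certs1 closed_certs2 closed_certs3 closed_certs4 closed_certs5
      closed_certs6 closed_certs7 closed_certs8 closed_certs9 closed_certs10 closed_certs11 closed_certs12 closed_certs13)

inductive patterned :: "vec_pair multiset \<Rightarrow> bool" where
  base: "t \<in> tables \<Longrightarrow> t () = (k, s) \<Longrightarrow> lang k w \<Longrightarrow> patterned (image_mset (act w) (mset s))"
| sym: "patterned M \<Longrightarrow> x \<in> {Ro, S1, S2, S3, Re} \<Longrightarrow> patterned (image_mset (act_letter x) M)"

definition stable :: "kind \<Rightarrow> vec_pair multiset \<Rightarrow> bool" where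
  "stable k M \<longleftrightarrow> (\<forall>w. lang k w \<longrightarrow> patterned (image_mset (act w) M))"

text \<open>\<open>La\<close> and \<open>Ra\<close> normalise the group generated by the swaps.\<close>

lemma swap_letter:
  assumes "a \<in> {La, Ra}" "x \<in> {S1, S2, S3}"
  shows "\<exists>y\<in>{S1, S2, S3}. act_letter a \<circ> act_letter x = act_letter y \<circ> act_letter a"
proof -
  have [simp]: "actc La (actc S1 c) = actc S1 (actc La c)" "actg La (actg S1 c) = actg S1 (actg La c)"
    "actc La (actc S2 c) = actc S3 (actc La c)" "actg La (actg S2 c) = actg S3 (actg La c)"
    "actc La (actc S3 c) = actc S2 (actc La c)" "actg La (actg S3 c) = actg S2 (actg La c)"
    "actc Ra (actc S1 c) = actc S3 (actc Ra c)" "actg Ra (actg S1 c) = actg S3 (actg Ra c)"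
    "actc Ra (actc S2 c) = actc S2 (actc Ra c)" "actg Ra (actg S2 c) = actg S2 (actg Ra c)"
    "actc Ra (actc S3 c) = actc S1 (actc Ra c)" "actg Ra (actg S3 c) = actg S1 (actg Ra c)" for c
    by (cases c; simp add: add.commute)+
  show ?thesis
    using assms by (auto simp: fun_eq_iff act_letter_def simp del: actc.simps actg.simps)
qed

lemma swap_word:
  assumes "set w \<subseteq> {La, Ra}" "x \<in> {S1, S2, S3}"
  shows "\<exists>y\<in>{S1, S2, S3}. act w \<circ> act_letter x = act_letter y \<circ> act w"
  using assms
proof (induction w)
  case Nil
  then show ?case by (auto simp: act_simps)
next
  case (Cons a w)
  then obtain y where y: "y \<in> {S1, S2, S3}" "act w \<circ> act_letter x = act_letter y \<circ> act w"
    by (metis insert_subset list.simps(15))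
  with Cons.prems obtain z where z: "z \<in> {S1, S2, S3}" "act_letter a \<circ> act_letter y = act_letter z \<circ> act_letter a"
    using swap_letter[of a y] by auto
  have "act (a # w) \<circ> act_letter x = act_letter a \<circ> act_letter y \<circ> act w"
    using y by (simp add: act_simps comp_assoc)
  also have "\<dots> = act_letter z \<circ> act (a # w)"
    unfolding z by (simp add: act_simps comp_assoc)
  finally show ?case using z by blast
qed

fun flip_letter :: "letter \<Rightarrow> letter" where
  "flip_letter La = Ra" | "flip_letter Ra = La" | "flip_letter x = x"

text \<open>Conjugation by \<open>Re\<close> exchanges \<open>La\<close> and \<open>Ra\<close>.\<close>

lemma flip_word:
  assumes "set w \<subseteq> {La, Ra}"
  shows "act w \<circ> act_letter Re = act_letter Re \<circ> act (map flip_letter w)"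
  using assms
proof (induction w)
  case Nil
  then show ?case by (auto simp: act_simps)
next
  case (Cons a w)
  have "actc La (actc Re c) = actc Re (actc Ra c)" "actg La (actg Re c) = actg Re (actg Ra c)"
       "actc Ra (actc Re c) = actc Re (actc La c)" "actg Ra (actg Re c) = actg Re (actg La c)" for c
    by (cases c; simp)+
  then have a: "act_letter a \<circ> act_letter Re = act_letter Re \<circ> act_letter (flip_letter a)"
    using Cons.prems by (auto simp: fun_eq_iff act_letter_def simp del: actc.simps actg.simps)
  have "act (a # w) \<circ> act_letter Re = (act_letter a \<circ> act_letter Re) \<circ> act (map flip_letter w)"
    using Cons.IH Cons.prems by (metis act_simps(2) comp_assoc insert_subset list.simps(15))
  also have "\<dots> = act_letter Re \<circ> act (map flip_letter (a # w))"
    unfolding a by (simp add: act_simps comp_assoc)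
  finally show ?case .
qed

lemma lang_flip:
  assumes "lang k w"
  shows "lang (rev_kind k) (map flip_letter w)"
proof -
  have "La \<in> set w \<Longrightarrow> Ra \<in> flip_letter ` set w" "Ra \<in> set w \<Longrightarrow> La \<in> flip_letter ` set w"
    by force+
  with assms show ?thesis by (cases k) auto
qed

lemma stable_image:
  assumes "\<And>w. lang k w \<Longrightarrow> lang k' (w @ [x])" "stable k' M"
  shows "stable k (image_mset (act_letter x) M)"
  unfolding stable_def
proof safe
  fix w assume "lang k w"
  with assms have "patterned (image_mset (act (w @ [x])) M)" by (simp add: stable_def)
  then show "patterned (image_mset (act w) (image_mset (act_letter x) M))" by (simp only: image_act)
qed

lemma stable_swap:
  assumes "stable k M" "x \<in> {S1, S2, S3}"
  shows "stable k (image_mset (act_letter x) M)"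
  unfolding stable_def
proof safe
  fix w assume w: "lang k w"
  obtain y where y: "y \<in> {S1, S2, S3}" "act w \<circ> act_letter x = act_letter y \<circ> act w"
    using swap_word[OF lang_letters[OF w] assms(2)] by blast
  have "patterned (image_mset (act_letter y) (image_mset (act w) M))"
    using assms(1) w y(1) by (intro patterned.sym) (auto simp: stable_def)
  then show "patterned (image_mset (act w) (image_mset (act_letter x) M))"
    by (simp add: multiset.map_comp y)
qed

lemma stable_flip:
  assumes "stable (rev_kind k) M"
  shows "stable k (image_mset (act_letter Re) M)"
  unfolding stable_def
proof safe
  fix w assume w: "lang k w"
  have "patterned (image_mset (act_letter Re) (image_mset (act (map flip_letter w)) M))"
    using assms lang_flip[OF w] by (intro patterned.sym) (auto simp: stable_def)
  then show "patterned (image_mset (act w) (image_mset (act_letter Re) M))"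
    by (simp add: multiset.map_comp flip_word[OF lang_letters[OF w]])
qed

text \<open>Moving the letters of \<open>u\<close> past the words of the language, as described at \<open>word_ok\<close>.\<close>

lemma stable_word_ok:
  assumes "word_ok k u k'" "stable k' M"
  shows "stable k (image_mset (act u) M)"
  using assms
proof (induction k u k' rule: word_ok.induct)
  case (1 k k')
  have "lang k' w" if "lang k w" for w
    using 1(1) that lang_letters[OF that] by auto
  with 1 show ?case by (auto simp: stable_def image_act)
next
  case (2 k w k')
  have lang: "lang KN (v @ [La])" "k = K0 \<or> k = KL \<Longrightarrow> lang KL (v @ [La])" "k = KM \<Longrightarrow> lang KM (v @ [La])"
    if "lang k v" for v using that lang_letters[OF that] by auto
  obtain k'' where "stable k'' (image_mset (act w) M)" "\<And>v. lang k v \<Longrightarrow> lang k'' (v @ [La])"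
    using 2 lang by (metis word_ok.simps(2))
  then show ?case unfolding image_act by (rule stable_image[rotated])
next
  case (3 k w k')
  have lang: "lang KM (v @ [Ra])" "k = K0 \<or> k = KR \<Longrightarrow> lang KR (v @ [Ra])" "k = KN \<Longrightarrow> lang KN (v @ [Ra])"
    if "lang k v" for v using that lang_letters[OF that] by auto
  obtain k'' where "stable k'' (image_mset (act w) M)" "\<And>v. lang k v \<Longrightarrow> lang k'' (v @ [Ra])"
    using 3 lang by (metis word_ok.simps(3))
  then show ?case unfolding image_act by (rule stable_image[rotated])
next
  case (8 k w k')
  then have "patterned (image_mset (act w) M)" by (auto simp: stable_def image_act)
  from patterned.sym[OF this, of Ro] 8 show ?case
    by (auto simp: stable_def image_act)
qed (simp_all add: image_act stable_swap stable_flip)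

fun refs :: "cert \<Rightarrow> (unit \<Rightarrow> family) list" where
  "refs (Ref t w) = [t]"
| "refs (SplitL a b) = refs a @ refs b"
| "refs (SplitR a b) = refs a @ refs b"

lemma stable_table: "t \<in> tables \<Longrightarrow> t () = (k, s) \<Longrightarrow> stable k (mset s)"
  by (auto simp: stable_def intro: patterned.base)

text \<open>The two ways of dividing a language that certificates use.\<close>

lemma stable_split:
  assumes "\<And>w. lang k w \<Longrightarrow> (lang k1 w \<and> stable k1 M) \<or>
     (\<exists>u x. w = u @ [x] \<and> (\<exists>k'. lang k' u \<and> stable k' (image_mset (act_letter x) M)))"
  shows "stable k M"
  unfolding stable_def
proof safe
  fix w assume "lang k w"
  from assms[OF this] show "patterned (image_mset (act w) M)"
    by (auto simp: stable_def image_act)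
qed

lemma stable_covers:
  assumes "covers c k X" "set (refs c) \<subseteq> tables"
  shows "stable k (mset X)"
  using assms
proof (induction c k X rule: covers.induct)
  case (1 t u k X)
  obtain k' s where t: "t () = (k', s)" by (cases "t ()")
  with 1 have "word_ok k u k'" "mset X = image_mset (act u) (mset s)"
    using perm_eq_mset by fastforce+
  with 1 t show ?case using stable_word_ok stable_table by auto
next
  case (2 a b k X)
  show ?case
  proof (cases k)
    case KL
    show ?thesis
    proof (rule stable_split[where ?k1.0 = K0])
      fix w assume "lang k w"
      then show "lang K0 w \<and> stable K0 (mset X) \<or>
          (\<exists>u x. w = u @ [x] \<and> (\<exists>k'. lang k' u \<and> stable k' (image_mset (act_letter x) (mset X))))"
        using 2 KL by (cases w rule: rev_cases) (auto intro: exI[of _ KL])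
    qed
  next
    case KR
    show ?thesis
    proof (rule stable_split[where ?k1.0 = K0])
      fix w assume "lang k w"
      then show "lang K0 w \<and> stable K0 (mset X) \<or>
          (\<exists>u x. w = u @ [x] \<and> (\<exists>k'. lang k' u \<and> stable k' (image_mset (act_letter x) (mset X))))"
        using 2 KR by (cases w rule: rev_cases) (auto intro: exI[of _ KR])
    qed
  next
    case KM
    show ?thesis
    proof (rule stable_split[where ?k1.0 = K0])
      fix w assume w: "lang k w"
      then obtain u x where ux: "w = u @ [x]" using KM by (cases w rule: rev_cases) auto
      have "stable KF (image_mset (act_letter Ra) (mset X))" "stable KM (image_mset (act_letter La) (mset X))"
        using 2 KM by auto
      moreover have "x = Ra \<and> lang KF u \<or> x = La \<and> lang KM u" using w KM ux by auto
      ultimately show "lang K0 w \<and> stable K0 (mset X) \<or>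
          (\<exists>u x. w = u @ [x] \<and> (\<exists>k'. lang k' u \<and> stable k' (image_mset (act_letter x) (mset X))))"
        using ux by blast
    qed
  next
    case KN
    show ?thesis
    proof (rule stable_split[where ?k1.0 = K0])
      fix w assume w: "lang k w"
      then obtain u x where ux: "w = u @ [x]" using KN by (cases w rule: rev_cases) auto
      have "stable KF (image_mset (act_letter La) (mset X))" "stable KN (image_mset (act_letter Ra) (mset X))"
        using 2 KN by auto
      moreover have "x = La \<and> lang KF u \<or> x = Ra \<and> lang KN u" using w KN ux by auto
      ultimately show "lang K0 w \<and> stable K0 (mset X) \<or>
          (\<exists>u x. w = u @ [x] \<and> (\<exists>k'. lang k' u \<and> stable k' (image_mset (act_letter x) (mset X))))"
        using ux by blast
    qed
  next
    case KF
    then have "stable KL (mset X)" "stable KM (mset X)" using 2 by auto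
    moreover have "lang KL w \<or> lang KM w" if "lang KF w" for w using that by auto
    ultimately show ?thesis unfolding KF stable_def by blast
  qed (use 2 in auto)
next
  case (3 a b k X)
  then have k: "k = KF" and "stable KR (mset X)" "stable KN (mset X)" by auto
  moreover have "lang KR w \<or> lang KN w" if "lang KF w" for w using that by auto
  ultimately show ?case unfolding k stable_def by blast
qed

text \<open>
  Letters are applied from the right end of the word, and each one maps the cone of a language into
  the cone of the language of the remaining words.  For \<open>KM\<close> the first \<open>Ra\<close> leads to the cone of \<open>KF\<close>.
\<close>

lemma nonneg_if_cone:
  assumes "lang k w" "cone k c"
  shows "nonneg (foldr actc w c)"
  using assms
proof (induction w arbitrary: k c rule: rev_induct)
  case Nil
  then show ?case by (cases k; cases c) auto
next
  case (snoc x w)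
  have "\<exists>k'. lang k' w \<and> cone k' (actc x c)"
  proof (cases k)
    case K0
    then show ?thesis using snoc.prems by simp
  next
    case KL
    then show ?thesis using snoc.prems by (intro exI[of _ KL]) (cases c; auto)
  next
    case KR
    then show ?thesis using snoc.prems by (intro exI[of _ KR]) (cases c; auto)
  next
    case KF
    then show ?thesis using snoc.prems by (intro exI[of _ KF]) (cases c; auto)
  next
    case KM
    then have "x = La \<and> lang KM w \<and> cone KM (actc x c) \<or> x = Ra \<and> lang KF w \<and> cone KF (actc x c)"
      using snoc.prems by (cases c) auto
    then show ?thesis by blast
  next
    case KN
    then have "x = Ra \<and> lang KN w \<and> cone KN (actc x c) \<or> x = La \<and> lang KF w \<and> cone KF (actc x c)"
      using snoc.prems by (cases c) auto
    then show ?thesis by blast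
  qed
  then show ?case using snoc.IH by auto
qed

lemma fst_act: "fst (act w p) = foldr actc w (fst p)"
  by (induction w) (simp_all add: act_simps act_letter_def)

lemma snd_act: "snd (act w p) = foldr actg w (snd p)"
  by (induction w) (simp_all add: act_simps act_letter_def)

lemma foldr_actc_smul: "foldr actc w (smul m c) = smul m (foldr actc w c)"
  by (induction w) (simp_all add: actc_smul)

lemma smul_minus_one: "smul (-1) c = - c" and smul_one: "smul 1 c = c"
  by (cases c, simp)+

lemma nonneg_cone_sign:
  assumes "lang k w" "cone_sign k (fst p) = e" "e \<noteq> 0"
  shows "nonneg (smul e (fst (act w p)))" "e = 1 \<or> e = -1"
proof -
  show e: "e = 1 \<or> e = -1" using assms by (auto simp: cone_sign_def split: if_splits)
  have "cone k (smul e (fst p))"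
    using assms by (auto simp: cone_sign_def smul_minus_one smul_one split: if_splits)
  then show "nonneg (smul e (fst (act w p)))"
    using nonneg_if_cone[OF assms(1)] by (simp add: fst_act flip: foldr_actc_smul)
qed

lemma covers_fromD:
  assumes "covers_from cs i (k, s)" "j < length cs"
  shows "cone_sign k (fst (s ! (i + j))) \<noteq> 0"
    "covers (cs ! j) k (mutate_list (cone_sign k (fst (s ! (i + j)))) (i + j) s)"
  using assms
proof (induction cs i "(k, s)" arbitrary: j rule: covers_from.induct)
  case (2 c cs i)
  { case 1
    with "2.hyps" show ?case by (cases j) (auto simp: Let_def)
  next
    case 2
    with "2.hyps" show ?case by (cases j) (auto simp: Let_def) }
qed auto

text \<open>
  Certificates may refer only to families that have certificates themselves.  The list of families
  is determined first, without unfolding any of them.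
\<close>

lemma map_fst_certs:
  "map fst certs0 = [T0, T1, T2, T3, T4, T5, T6, T7, T8]"
  "map fst certs1 = [T9, T10, T11, T12, T13, T14, T15, T16, T17]"
  "map fst certs2 = [T18, T19, T20, T21, T22, T23, T24, T25, T26]"
  "map fst certs3 = [T27, T28, T29, T30, T31, T32, T33, T34, T35]"
  "map fst certs4 = [T36, T37, T38, T39, T40, T41, T42, T43, T44]"
  "map fst certs5 = [T45, T46, T47, T48, T49, T50, T51, T52, T53]"
  "map fst certs6 = [T54, T55, T56, T57, T58, T59, T60, T61, T62]"
  "map fst certs7 = [T63, T64, T65, T66, T67, T68, T69, T70, T71]"
  "map fst certs8 = [T72, T73, T74, T75, T76, T77, T78, T79, T80]"
  "map fst certs9 = [T81, T82, T83, T84, T85, T86, T87, T88, T89]"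
  "map fst certs10 = [T90, T91, T92, T93, T94, T95, T96, T97, T98]"
  "map fst certs11 = [T99, T100, T101, T102, T103, T104, T105, T106, T107]"
  "map fst certs12 = [T108, T109, T110, T111, T112, T113, T114, T115, T116]"
  "map fst certs13 = [T117, T118, T119, T120, T121, T122, T123, T124, T125]"
  by (simp_all only: certs0_def certs1_def certs2_def certs3_def certs4_def certs5_def certs6_def certs7_def certs8_def certs9_def certs10_def certs11_def certs12_def certs13_def list.map fst_conv)

lemma tables_eq: "tables = {T0, T1, T2, T3, T4, T5, T6, T7, T8, T9, T10, T11, T12, T13, T14, T15, T16, T17, T18, T19, T20, T21, T22, T23, T24, T25, T26, T27, T28, T29, T30, T31, T32, T33, T34, T35, T36, T37, T38, T39, T40, T41, T42, T43, T44, T45, T46, T47, T48, T49, T50, T51, T52, T53, T54, T55, T56, T57, T58, T59, T60, T61, T62, T63, T64, T65, T66, T67, T68, T69, T70, T71, T72, T73, T74, T75, T76, T77, T78, T79, T80, T81, T82, T83, T84, T85, T86, T87, T88, T89, T90, T91, T92, T93, T94, T95, T96, T97, T98, T99, T100, T101, T102, T103, T104, T105, T106, T107, T108, T109, T110, T111, T112, T113, T114, T115, T116, T117, T118, T119, T120, T121, T122, T123, T124, T125}"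
  unfolding tables_def set_map[symmetric] all_certs_def map_append map_fst_certs by simp

lemma tables_memI:
  "T0 \<in> tables" "T1 \<in> tables" "T2 \<in> tables" "T3 \<in> tables" "T4 \<in> tables" "T5 \<in> tables" "T6 \<in> tables" "T7 \<in> tables" "T8 \<in> tables" "T9 \<in> tables" "T10 \<in> tables" "T11 \<in> tables" "T12 \<in> tables" "T13 \<in> tables" "T14 \<in> tables" "T15 \<in> tables" "T16 \<in> tables" "T17 \<in> tables" "T18 \<in> tables" "T19 \<in> tables" "T20 \<in> tables" "T21 \<in> tables" "T22 \<in> tables" "T23 \<in> tables" "T24 \<in> tables" "T25 \<in> tables" "T26 \<in> tables" "T27 \<in> tables" "T28 \<in> tables" "T29 \<in> tables" "T30 \<in> tables" "T31 \<in> tables" "T32 \<in> tables" "T33 \<in> tables" "T34 \<in> tables" "T35 \<in> tables" "T36 \<in> tables" "T37 \<in> tables" "T38 \<in> tables" "T39 \<in> tables" "T40 \<in> tables" "T41 \<in> tables" "T42 \<in> tables" "T43 \<in> tables" "T44 \<in> tables" "T45 \<in> tables" "T46 \<in> tables" "T47 \<in> tables" "T48 \<in> tables" "T49 \<in> tables" "T50 \<in> tables" "T51 \<in> tables" "T52 \<in> tables" "T53 \<in> tables" "T54 \<in> tables" "T55 \<in> tables" "T56 \<in> tables" "T57 \<in> tables" "T58 \<in> tables" "T59 \<in> tables" "T60 \<in> tables" "T61 \<in> tables" "T62 \<in> tables" "T63 \<in> tables" "T64 \<in> tables" "T65 \<in> tables" "T66 \<in> tables" "T67 \<in> tables" "T68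 \<in> tables" "T69 \<in> tables" "T70 \<in> tables" "T71 \<in> tables" "T72 \<in> tables" "T73 \<in> tables" "T74 \<in> tables" "T75 \<in> tables" "T76 \<in> tables" "T77 \<in> tables" "T78 \<in> tables" "T79 \<in> tables" "T80 \<in> tables" "T81 \<in> tables" "T82 \<in> tables" "T83 \<in> tables" "T84 \<in> tables" "T85 \<in> tables" "T86 \<in> tables" "T87 \<in> tables" "T88 \<in> tables" "T89 \<in> tables" "T90 \<in> tables" "T91 \<in> tables" "T92 \<in> tables" "T93 \<in> tables" "T94 \<in> tables" "T95 \<in> tables" "T96 \<in> tables" "T97 \<in> tables" "T98 \<in> tables" "T99 \<in> tables" "T100 \<in> tables" "T101 \<in> tables" "T102 \<in> tables" "T103 \<in> tables" "T104 \<in> tables" "T105 \<in> tables" "T106 \<in> tables" "T107 \<in> tables" "T108 \<in> tables" "T109 \<in> tables" "T110 \<in> tables" "T111 \<in> tables" "T112 \<in> tables" "T113 \<in> tables" "T114 \<in> tables" "T115 \<in> tables" "T116 \<in> tables" "T117 \<in> tables" "T118 \<in> tables" "T119 \<in> tables" "T120 \<in> tables" "T121 \<in> tables" "T122 \<in> tables" "T123 \<in> tables" "T124 \<in> tables" "T125 \<in> tables"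
  unfolding tables_eq by (simp_all only: insert_iff simp_thms)

lemma refs_certs:
  "list_all (\<lambda>(t, cs). list_all (\<lambda>c. list_all (\<lambda>t. t \<in> tables) (refs c)) cs) certs0"
  "list_all (\<lambda>(t, cs). list_all (\<lambda>c. list_all (\<lambda>t. t \<in> tables) (refs c)) cs) certs1"
  "list_all (\<lambda>(t, cs). list_all (\<lambda>c. list_all (\<lambda>t. t \<in> tables) (refs c)) cs) certs2"
  "list_all (\<lambda>(t, cs). list_all (\<lambda>c. list_all (\<lambda>t. t \<in> tables) (refs c)) cs) certs3"
  "list_all (\<lambda>(t, cs). list_all (\<lambda>c. list_all (\<lambda>t. t \<in> tables) (refs c)) cs) certs4"
  "list_all (\<lambda>(t, cs). list_all (\<lambda>c. list_all (\<lambda>t. t \<in> tables) (refs c)) cs) certs5"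
  "list_all (\<lambda>(t, cs). list_all (\<lambda>c. list_all (\<lambda>t. t \<in> tables) (refs c)) cs) certs6"
  "list_all (\<lambda>(t, cs). list_all (\<lambda>c. list_all (\<lambda>t. t \<in> tables) (refs c)) cs) certs7"
  "list_all (\<lambda>(t, cs). list_all (\<lambda>c. list_all (\<lambda>t. t \<in> tables) (refs c)) cs) certs8"
  "list_all (\<lambda>(t, cs). list_all (\<lambda>c. list_all (\<lambda>t. t \<in> tables) (refs c)) cs) certs9"
  "list_all (\<lambda>(t, cs). list_all (\<lambda>c. list_all (\<lambda>t. t \<in> tables) (refs c)) cs) certs10"
  "list_all (\<lambda>(t, cs). list_all (\<lambda>c. list_all (\<lambda>t. t \<in> tables) (refs c)) cs) certs11"
  "list_all (\<lambda>(t, cs). list_all (\<lambda>c. list_all (\<lambda>t. t \<in> tables) (refs c)) cs) certs12"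
  "list_all (\<lambda>(t, cs). list_all (\<lambda>c. list_all (\<lambda>t. t \<in> tables) (refs c)) cs) certs13"
  by (simp_all only: certs0_def certs1_def certs2_def certs3_def certs4_def certs5_def certs6_def certs7_def certs8_def certs9_def certs10_def certs11_def certs12_def certs13_def list.pred_inject prod.case refs.simps append.simps simp_thms tables_memI)

lemma refs_tables: "list_all (\<lambda>(t, cs). list_all (\<lambda>c. set (refs c) \<subseteq> tables) cs) all_certs"
  using refs_certs by (simp only: all_certs_def list_all_append simp_thms list_all_iff[of _ "refs _"] subset_eq)

lemma table_closed:
  assumes "t \<in> tables" "t () = (k, s)"
  shows "length s = 6" "list_all (\<lambda>p. gvec_kind k (snd p)) s"
    "j < 6 \<Longrightarrow> cone_sign k (fst (s ! j)) \<noteq> 0"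
    "j < 6 \<Longrightarrow> stable k (mset (mutate_list (cone_sign k (fst (s ! j))) j s))"
proof -
  obtain cs where cs: "(t, cs) \<in> set all_certs" using assms(1) by (auto simp: tables_def)
  then have "closed_family (t, cs)" "list_all (\<lambda>c. set (refs c) \<subseteq> tables) cs"
    using closed_all refs_tables unfolding list_all_iff by blast+
  then have c: "length cs = 6" "covers_from cs 0 (k, s)" "\<forall>c\<in>set cs. set (refs c) \<subseteq> tables"
    and s: "length s = 6" "list_all (\<lambda>p. gvec_kind k (snd p)) s"
    using assms(2) by (auto simp: closed_family_def list_all_iff)
  show "length s = 6" "list_all (\<lambda>p. gvec_kind k (snd p)) s" by fact+
  show "cone_sign k (fst (s ! j)) \<noteq> 0" if "j < 6"
    using covers_fromD(1)[OF c(2), of j] c(1) that by simp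
  show "stable k (mset (mutate_list (cone_sign k (fst (s ! j))) j s))" if "j < 6"
    using covers_fromD(2)[OF c(2), of j] c that by (intro stable_covers[of "cs ! j"]) auto
qed

lemma nonneg_actc:
  assumes "x \<in> {Ro, S1, S2, S3, Re}" "nonneg (smul e c)"
  shows "nonneg (smul (letter_sign x * e) (actc x c))"
  using assms by (cases c) (auto simp: letter_sign_def)

text \<open>
  Sign-coherence and closure under mutation.  For a member of a family the check at the representative
  is transported by \<open>mutate_mset_act\<close>, and symmetries only change the sign of \<open>e\<close>.
\<close>

theorem patterned_mutation:
  assumes "patterned M" "p \<in># M"
  shows "\<exists>e\<in>{1, -1}. nonneg (smul e (fst p)) \<and> patterned (mutate_mset e p M)"
  using assms
proof (induction arbitrary: p rule: patterned.induct)
  case (base t k s w)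
  note t = table_closed[OF base.hyps(1,2)]
  obtain j where j: "j < 6" "p = act w (s ! j)"
    using base.prems t(1) by (auto simp: in_set_conv_nth)
  define e where "e = cone_sign k (fst (s ! j))"
  have "patterned (image_mset (act w) (mset (mutate_list e j s)))"
    using t(4)[OF j(1)] base.hyps(3) by (simp add: stable_def e_def)
  also have "mset (mutate_list e j s) = mutate_mset e (s ! j) (mset s)" using j t(1) by (simp add: mset_mutate_list)
  also have "image_mset (act w) \<dots> = mutate_mset e p (image_mset (act w) (mset s))"
    unfolding j(2) using j t(1) base.hyps(3) by (subst mutate_mset_act) (auto dest: lang_no_Re)
  finally show ?case
    using nonneg_cone_sign[OF base.hyps(3) e_def[symmetric]] t(3)[OF j(1)] j(2) by (auto simp: e_def)
next
  case (sym M x)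
  from sym.prems obtain q where q: "q \<in># M" "p = act_letter x q" by auto
  from sym.IH[OF q(1)] obtain e where e: "e \<in> {1, -1}" "nonneg (smul e (fst q))" "patterned (mutate_mset e q M)"
    by blast
  have "patterned (image_mset (act_letter x) (mutate_mset e q M))" using e sym.hyps by (intro patterned.sym)
  also have "image_mset (act_letter x) (mutate_mset e q M) = mutate_mset (letter_sign x * e) p (image_mset (act_letter x) M)"
    using mutate_mset_act_letter[OF q(1), of x e] q(2) by simp
  finally show ?case
    using nonneg_actc[OF sym.hyps(2) e(2)] e(1) q(2)
    by (intro bexI[of _ "letter_sign x * e"]) (auto simp: act_letter_def letter_sign_def)
qed

declare actg.simps(3-7) [simp del]

section \<open>Shape of the degrees\<close>

fun height :: "v6 \<Rightarrow> int" where "height (V g1 g2 g3 g4 g5 g6) = g1 + g2 + g3 + g4 + g5 + g6"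
fun slope_a :: "v6 \<Rightarrow> int" where "slope_a (V g1 g2 g3 g4 g5 g6) = g2 + g5 - (g1 + g2 + g3 + g4 + g5 + g6)"
fun slope_b :: "v6 \<Rightarrow> int" where "slope_b (V g1 g2 g3 g4 g5 g6) = g2 + g3 + g5 + g6"
fun balanced :: "v6 \<Rightarrow> bool" where
  "balanced (V g1 g2 g3 g4 g5 g6) \<longleftrightarrow> \<bar>g1 - g4\<bar> \<le> 1 \<and> \<bar>g2 - g5\<bar> \<le> 1 \<and> \<bar>g3 - g6\<bar> \<le> 1"

lemma weak_gvec_eq: "weak_gvec g \<longleftrightarrow> \<bar>height g\<bar> \<le> 1 \<and> balanced g \<and> coprime (slope_a g) (slope_b g) \<and>
    0 \<le> slope_a g \<and> 0 \<le> slope_b g \<and> \<not> (slope_a g = 0 \<and> height g = -1)"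
proof (cases g)
  case (V g1 g2 g3 g4 g5 g6)
  have "g1 + g2 + g3 + g4 + g5 + g6 - (g1 + g4) = g2 + g3 + g5 + g6" by simp
  then show ?thesis unfolding V by (simp only: weak_gvec.simps Let_def height.simps slope_a.simps slope_b.simps balanced.simps conj_assoc)
qed

lemma std_gvec_eq: "std_gvec g \<longleftrightarrow> weak_gvec g \<and> \<not> (slope_b g = 0 \<and> height g = 1)"
proof (cases g)
  case (V g1 g2 g3 g4 g5 g6)
  have "g1 + g2 + g3 + g4 + g5 + g6 - (g1 + g4) = g2 + g3 + g5 + g6" by simp
  then show ?thesis unfolding V weak_gvec_eq
    by (simp only: std_gvec.simps Let_def height.simps slope_a.simps slope_b.simps balanced.simps) blast
qed

lemma act_height: "x \<in> {La, Ra, Ro, S1, S2, S3} \<Longrightarrow> height (actg x g) = height g" "height (actg Re g) = - height g"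
  by (cases g; auto simp: actg.simps)+

lemma act_slope:
  "slope_a (actg La g) = slope_a g + slope_b g" "slope_b (actg La g) = slope_b g"
  "slope_a (actg Ra g) = slope_a g" "slope_b (actg Ra g) = slope_a g + slope_b g"
  "x \<in> {S1, S2, S3} \<Longrightarrow> slope_a (actg x g) = slope_a g" "x \<in> {S1, S2, S3} \<Longrightarrow> slope_b (actg x g) = slope_b g"
  "slope_a (actg Re g) = slope_b g" "slope_b (actg Re g) = slope_a g"
  by (cases g; auto simp: actg.simps)+

lemma act_balanced: "balanced (actg x g) = balanced g"
  by (cases x; cases g) (auto simp: actg.simps)

text \<open>
  \<open>La\<close> and \<open>Ra\<close> change \<open>(a, b)\<close> by Euclid's subtractive steps, so that coprimality is preserved, and
  they permute the three differences of opposite coordinates up to sign.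
\<close>

lemma std_gvec_LaRa:
  "std_gvec g \<Longrightarrow> std_gvec (actg La g)" "std_gvec g \<Longrightarrow> std_gvec (actg Ra g)" "weak_gvec g \<Longrightarrow> weak_gvec (actg La g)" "weak_gvec g \<Longrightarrow> std_gvec (actg Ra g)"
  by (auto simp: std_gvec_eq weak_gvec_eq act_height act_slope act_balanced add_nonneg_eq_0_iff coprime_iff_gcd_eq_1)

lemma std_gvec_sym: "x \<in> {S1, S2, S3, Re} \<Longrightarrow> std_gvec (actg x g) = std_gvec g"
  by (auto simp: std_gvec_eq weak_gvec_eq act_height act_slope act_balanced coprime_commute)

lemma Ro_cube: "actg Ro (actg Ro (actg Ro g)) = g"
  by (cases g) (simp add: actg.simps)

lemma gvec_Ro: "gvec (actg Ro g) = gvec g"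
  by (auto simp: gvec_def Ro_cube)

lemma Ro_sym:
  "actg Ro (actg S1 g) = actg S3 (actg Ro g)" "actg Ro (actg S2 g) = actg S1 (actg Ro g)"
  "actg Ro (actg S3 g) = actg S2 (actg Ro g)" "actg Ro (actg Re g) = actg Re (actg Ro (actg Ro g))"
  by (cases g; simp add: actg.simps)+

lemma gvec_sym: "x \<in> {Ro, S1, S2, S3, Re} \<Longrightarrow> gvec (actg x g) = gvec g"
  by (auto simp: gvec_Ro) (auto simp: gvec_def Ro_sym std_gvec_sym Ro_cube)

lemma std_gvec_word: "set w \<subseteq> {La, Ra} \<Longrightarrow> std_gvec g \<Longrightarrow> std_gvec (foldr actg w g)"
  by (induction w) (auto simp: std_gvec_LaRa)

lemma weak_gvec_word: "set w \<subseteq> {La, Ra} \<Longrightarrow> Ra \<in> set w \<Longrightarrow> weak_gvec g \<Longrightarrow> std_gvec (foldr actg w g)"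
proof (induction w arbitrary: g rule: rev_induct)
  case (snoc x w)
  then show ?case by (cases "x = Ra") (auto simp: std_gvec_LaRa intro!: std_gvec_word)
qed simp

lemma gvec_word:
  assumes "gvec_kind k g" "lang k w"
  shows "gvec (foldr actg w g)"
proof (cases k)
  case KL
  have La_fix: "foldr actg w (V 1 0 0 0 0 0) = V 1 0 0 0 0 0" "foldr actg w (V 0 0 0 1 0 0) = V 0 0 0 1 0 0"
    if "set w \<subseteq> {La}" for w using that by (induction w) auto
  have La_std_gvec: "gvec (foldr actg w g)" if "set w \<subseteq> {La}" "g \<in> {V 0 0 1 0 0 0, V 0 0 0 0 0 1}" for w g
  proof (cases w rule: rev_cases)
    case Nil
    with that show ?thesis by (auto simp: gvec_def Let_def actg.simps)
  next
    case (snoc u x)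
    with that have "x = La" "set u \<subseteq> {La, Ra}" by auto
    moreover have "std_gvec (actg La g)" using that(2) by (auto simp: Let_def)
    ultimately show ?thesis using std_gvec_word[of u] by (simp add: snoc gvec_def)
  qed
  have "gvec (V 1 0 0 0 0 0)" "gvec (V 0 0 0 1 0 0)" by (auto simp: gvec_def Let_def actg.simps)
  moreover have "std_gvec g \<Longrightarrow> gvec (foldr actg w g)" using std_gvec_word[OF lang_letters[OF assms(2)], of g] by (simp add: gvec_def)
  moreover have w: "set w \<subseteq> {La}" using assms KL by simp
  moreover have "std_gvec g \<or> g \<in> {V 0 0 1 0 0 0, V 0 0 0 0 0 1} \<or> g = V 1 0 0 0 0 0 \<or> g = V 0 0 0 1 0 0"
    using assms KL by auto
  ultimately show ?thesis using La_fix[OF w] La_std_gvec[OF w, of g] by metis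
qed (use assms std_gvec_word weak_gvec_word in \<open>auto simp: gvec_def[of "foldr actg w g"]\<close>)

text \<open>The check at the representatives carries over to all images under words and symmetries.\<close>

theorem patterned_gvec:
  assumes "patterned M" "p \<in># M"
  shows "gvec (snd p)"
  using assms
proof (induction arbitrary: p rule: patterned.induct)
  case (base t k s w)
  note t = table_closed[OF base.hyps(1,2)]
  from base.prems obtain q where "q \<in> set s" "p = act w q" by auto
  then show ?case using t(2) base.hyps(3) gvec_word by (auto simp: list_all_iff snd_act)
next
  case (sym M x)
  then show ?case by (auto simp: act_letter_def gvec_sym)
qed

section \<open>Which degrees occur\<close>

definition start :: "vec_pair multiset" where "start = mset (snd (T0 ()))"

text \<open>
  The sign \<open>e\<close> in a step is determined by the vector \<open>fst p\<close> unless that vanishes, in which case it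
  does not matter (\<open>mutate_mset_zero\<close>).
\<close>

inductive reach :: "vec_pair multiset \<Rightarrow> bool" where
  start: "reach start"
| step: "reach M \<Longrightarrow> p \<in># M \<Longrightarrow> e \<in> {1, -1} \<Longrightarrow> nonneg (smul e (fst p)) \<Longrightarrow> reach (mutate_mset e p M)"

lemma mutate_mset_zero: "fst p = 0 \<Longrightarrow> mutate_mset e p M = mutate_mset e' p M"
proof -
  have "omega 0 c = 0" for c unfolding zero_v6_def by (cases c) simp
  then show "fst p = 0 \<Longrightarrow> mutate_mset e p M = mutate_mset e' p M" by (simp add: mutate_mset_def weight_def)
qed

lemma reach_patterned: "reach M \<Longrightarrow> patterned M"
proof (induction rule: reach.induct)
  case start
  have "T0 () = (K0, snd (T0 ()))" by (simp add: T0_def)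
  from patterned.base[OF tables_memI(1) this, of "[]"] show ?case
    by (simp add: start_def act_simps)
next
  case (step M p e)
  obtain e' where e': "e' \<in> {1, -1}" "nonneg (smul e' (fst p))" "patterned (mutate_mset e' p M)"
    using patterned_mutation[OF step.IH step.hyps(2)] by blast
  have "fst p = 0" if "e \<noteq> e'"
    using that e'(1,2) step.hyps(3,4) by (cases "fst p") (auto simp: zero_v6_def)
  then have "mutate_mset e p M = mutate_mset e' p M" using mutate_mset_zero by blast
  with e' show ?case by simp
qed

text \<open>
  The initial multiset is invariant under permutations of the coordinates, so that every permutation
  of an attained degree is attained.
\<close>

lemma start_sym:
  assumes "x \<in> {Ro, S1, S2, S3}"
  shows "image_mset (act_letter x) start = start"
proof -
  have "perm_eq (map (act_letter Ro) (snd (T0 ()))) (snd (T0 ()))" by code_simp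
  moreover have "perm_eq (map (act_letter S1) (snd (T0 ()))) (snd (T0 ()))" by code_simp
  moreover have "perm_eq (map (act_letter S2) (snd (T0 ()))) (snd (T0 ()))" by code_simp
  moreover have "perm_eq (map (act_letter S3) (snd (T0 ()))) (snd (T0 ()))" by code_simp
  ultimately show ?thesis
    using assms by (auto simp: start_def dest!: perm_eq_mset)
qed

lemma reach_sym:
  assumes "reach M" "x \<in> {Ro, S1, S2, S3}"
  shows "reach (image_mset (act_letter x) M)"
  using assms
proof (induction rule: reach.induct)
  case start
  then show ?case by (simp add: start_sym reach.start)
next
  case (step M p e)
  have "nonneg (smul e (fst (act_letter x p)))"
    using nonneg_actc[of x e "fst p"] step.hyps(4) step.prems by (auto simp: act_letter_def letter_sign_def)
  then have "reach (mutate_mset e (act_letter x p) (image_mset (act_letter x) M))"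
    using step by (intro reach.step) auto
  then show ?case
    using mutate_mset_act_letter[OF step.hyps(2), of x e] step.prems by (auto simp: letter_sign_def)
qed

text \<open>
  Mutations along a list of positions, each with a sign that is valid for the whole language of the kind;
  the result is undefined if there is no such sign.
\<close>

fun walk :: "kind \<Rightarrow> nat list \<Rightarrow> vec_pair list \<Rightarrow> vec_pair list option" where
  "walk k [] s = Some s"
| "walk k (j # js) s = (let e = cone_sign k (fst (s ! j)) in
     if e = 0 \<or> length s \<le> j then None else walk k js (mutate_list e j s))"

text \<open>A valid walk can be carried out after any word of the language has been applied.\<close>

lemma reach_walk:
  assumes "walk k js s = Some s'" "lang k w" "reach (image_mset (act w) (mset s))"
  shows "reach (image_mset (act w) (mset s'))"
  using assms
proof (induction k js s rule: walk.induct)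
  case (2 k j js s)
  define e where "e = cone_sign k (fst (s ! j))"
  have e: "e \<noteq> 0" and j: "j < length s" and w: "walk k js (mutate_list e j s) = Some s'"
    using 2(2) by (auto simp: Let_def e_def split: if_splits)
  note ns = nonneg_cone_sign[OF 2(3) e_def[symmetric] e]
  have "reach (mutate_mset e (act w (s ! j)) (image_mset (act w) (mset s)))"
    using ns j by (intro reach.step 2(4)) auto
  also have "mutate_mset e (act w (s ! j)) (image_mset (act w) (mset s)) = image_mset (act w) (mset (mutate_list e j s))"
    using j 2(3) by (subst mutate_mset_act) (auto simp: mset_mutate_list dest: lang_no_Re)
  finally show ?case using 2(1)[OF e_def] e j w 2(3) by simp
qed simp

text \<open>
  A multiset of kind \<open>KF\<close> that is connected to its images under both \<open>La\<close> and \<open>Ra\<close>.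
\<close>

definition hub :: "vec_pair list" where "hub = snd (T51 ())"

definition leads_to :: "kind \<Rightarrow> nat list \<Rightarrow> vec_pair list \<Rightarrow> vec_pair list \<Rightarrow> bool" where
  "leads_to k js s s' = (case walk k js s of None \<Rightarrow> False | Some s'' \<Rightarrow> perm_eq s'' s')"

lemma reach_leads_to:
  assumes "leads_to k js s s'" "lang k w" "reach (image_mset (act w) (mset s))"
  shows "reach (image_mset (act w) (mset s'))"
proof -
  obtain s'' where "walk k js s = Some s''" "mset s'' = mset s'"
    using assms(1) by (auto simp: leads_to_def perm_eq_mset split: option.splits)
  then show ?thesis using reach_walk[OF _ assms(2,3)] by metis
qed

text \<open>
  Walks from the initial multiset to the hub, and from the hub to its images.  The required signs are available
  for each of the three kinds only along different routes.
\<close>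

lemma walks:
  "leads_to K0 [2, 1, 5, 0, 3, 4] (snd (T0 ())) hub"
  "leads_to K0 [1, 4, 3, 5] hub (map (act_letter La) hub)"
  "leads_to K0 [3, 0, 2, 4, 5, 3] hub (map (act_letter Ra) hub)"
  "leads_to KM [1, 4, 3, 5] hub (map (act_letter La) hub)"
  "leads_to KM [3, 2, 0, 2, 4, 5, 3] hub (map (act_letter Ra) hub)"
  "leads_to KN [5, 1, 4, 3, 5] hub (map (act_letter La) hub)"
  "leads_to KN [0, 3, 0, 2, 4, 5, 0] hub (map (act_letter Ra) hub)"
  by code_simp+

text \<open>
  To add an innermost letter \<open>a\<close> to \<open>w\<close>, take a walk from the hub to its image under \<open>a\<close> and apply \<open>w\<close> to
  it.  Which of the walks is valid depends on whether \<open>w\<close> is empty, contains \<open>Ra\<close>, or contains \<open>La\<close>.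
\<close>

lemma reach_hub:
  assumes "set w \<subseteq> {La, Ra}"
  shows "reach (image_mset (act w) (mset hub))"
  using assms
proof (induction w rule: rev_induct)
  case Nil
  have "lang K0 []" by simp
  from reach_leads_to[OF walks(1) this] show ?case
    using reach.start by (simp add: start_def act_simps)
next
  case (snoc a w)
  then have a: "a = La \<or> a = Ra" and w: "set w \<subseteq> {La, Ra}" by auto
  consider "lang K0 w" | "lang KM w" | "lang KN w" using w by (cases w) auto
  then obtain k js where "lang k w" "leads_to k js hub (map (act_letter a) hub)"
    using a walks by metis
  from reach_leads_to[OF this(2,1)] snoc w show ?case by (simp add: image_act)
qed

definition reach_g :: "v6 \<Rightarrow> bool" where
  "reach_g g \<longleftrightarrow> (\<exists>M p. reach M \<and> p \<in># M \<and> snd p = g)"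

lemma reach_gI: "reach M \<Longrightarrow> g \<in> snd ` set_mset M \<Longrightarrow> reach_g g"
  unfolding reach_g_def by (metis imageE)

lemma reach_g_sym:
  assumes "reach_g g" "x \<in> {Ro, S1, S2, S3}"
  shows "reach_g (actg x g)"
proof -
  obtain M p where "reach M" "p \<in># M" "snd p = g" using assms by (auto simp: reach_g_def)
  then show ?thesis
    using reach_sym[OF _ assms(2)] by (intro reach_gI[of "image_mset (act_letter x) M"]) (auto simp: act_letter_def image_iff)
qed

lemma reach_g_sym_iff:
  assumes "x \<in> {S1, S2, S3}"
  shows "reach_g (actg x g) = reach_g g"
proof -
  have "actg x (actg x g) = g" using assms by (cases g) (auto simp: actg.simps)
  with assms show ?thesis using reach_g_sym[of g x] reach_g_sym[of "actg x g" x] by auto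
qed

lemma reach_g_swap:
  "reach_g (V g4 g2 g3 g1 g5 g6) = reach_g (V g1 g2 g3 g4 g5 g6)"
  "reach_g (V g1 g5 g3 g4 g2 g6) = reach_g (V g1 g2 g3 g4 g5 g6)"
  "reach_g (V g1 g2 g6 g4 g5 g3) = reach_g (V g1 g2 g3 g4 g5 g6)"
  using reach_g_sym_iff[of S1 "V g1 g2 g3 g4 g5 g6"] reach_g_sym_iff[of S2 "V g1 g2 g3 g4 g5 g6"]
    reach_g_sym_iff[of S3 "V g1 g2 g3 g4 g5 g6"] by (simp_all add: actg.simps)

lemma reach_g_rotate: "reach_g (V g1 g2 g3 g4 g5 g6) = reach_g (V g2 g3 g1 g5 g6 g4)"
  using reach_g_sym[of "V g1 g2 g3 g4 g5 g6" Ro] reach_g_sym[of "V g2 g3 g1 g5 g6 g4" Ro]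
    reach_g_sym[of "V g3 g1 g2 g6 g4 g5" Ro] by (auto simp: actg.simps)

lemma actg_swap_letter:
  assumes "a \<in> {La, Ra}" "x \<in> {S1, S2, S3}"
  shows "\<exists>y\<in>{S1, S2, S3}. \<forall>g. actg a (actg x g) = actg y (actg a g)"
proof -
  obtain y where y: "y \<in> {S1, S2, S3}" "act_letter a \<circ> act_letter x = act_letter y \<circ> act_letter a"
    using swap_letter[OF assms] by blast
  from y(2) have "actg a (actg x g) = actg y (actg a g)" for g
    by (auto simp: fun_eq_iff act_letter_def)
  with y(1) show ?thesis by blast
qed

definition reach_words :: "v6 \<Rightarrow> bool" where
  "reach_words g \<longleftrightarrow> (\<forall>w. set w \<subseteq> {La, Ra} \<longrightarrow> reach_g (foldr actg w g))"

text \<open>Swaps can be moved past words, so that it suffices to treat one vector of each orbit.\<close>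

lemma reach_words_sym:
  assumes "reach_words g" "x \<in> {S1, S2, S3}"
  shows "reach_words (actg x g)"
  unfolding reach_words_def
proof safe
  fix w assume w: "set w \<subseteq> {La, Ra}"
  then have "\<exists>y\<in>{S1, S2, S3}. foldr actg w (actg x g) = actg y (foldr actg w g)"
  proof (induction w)
    case (Cons a w)
    then obtain y where y: "y \<in> {S1, S2, S3}" "foldr actg w (actg x g) = actg y (foldr actg w g)"
      by auto
    moreover obtain z where "z \<in> {S1, S2, S3}" "\<And>h. actg a (actg y h) = actg z (actg a h)"
      using actg_swap_letter[of a y] Cons.prems y(1) by auto
    ultimately show ?case by auto
  qed (use assms(2) in auto)
  with w assms(1) show "reach_g (foldr actg w (actg x g))"
    using reach_g_sym_iff by (auto simp: reach_words_def)
qed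

lemma reach_words_swap:
  assumes "reach_words (V g1 g2 g3 g4 g5 g6)"
  shows "reach_words (V g4 g2 g3 g1 g5 g6)" "reach_words (V g1 g5 g3 g4 g2 g6)" "reach_words (V g1 g2 g6 g4 g5 g3)"
  using reach_words_sym[OF assms, of S1] reach_words_sym[OF assms, of S2] reach_words_sym[OF assms, of S3]
  by (simp_all add: actg.simps)

lemma reach_words_walk:
  assumes "walk KF js hub = Some s" "g \<in> snd ` set s"
  shows "reach_words g"
  unfolding reach_words_def
proof safe
  fix w assume w: "set w \<subseteq> {La, Ra}"
  then have "reach (image_mset (act w) (mset s))"
    using reach_walk[OF assms(1) _ reach_hub[OF w]] by simp
  moreover obtain p where "p \<in> set s" "g = snd p" using assms(2) by auto
  ultimately show "reach_g (foldr actg w g)"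
    by (intro reach_gI[of "image_mset (act w) (mset s)"]) (auto simp: image_iff snd_act intro!: bexI[of _ p])
qed

lemma ex_Some_eq: "(\<exists>s. x = Some s \<and> P s) = (case x of None \<Rightarrow> False | Some s \<Rightarrow> P s)"
  by (auto split: option.split)

lemma reach_words_unit_slope:
  "reach_words (V (-1) 0 0 0 1 0)" "reach_words (V 0 1 (-1) 0 1 0)" "reach_words (V (-1) 0 0 (-1) 0 1)"
proof -
  have "\<exists>s. walk KF [] hub = Some s \<and> list_all (\<lambda>g. g \<in> set (map snd s)) [V (-1) 0 0 0 1 0, V 0 1 (-1) 0 1 0]"
    unfolding ex_Some_eq by code_simp
  then show "reach_words (V (-1) 0 0 0 1 0)" "reach_words (V 0 1 (-1) 0 1 0)"
    using reach_words_walk by (metis list.pred_inject(2) set_map)+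
  have "\<exists>s. walk KF [0] hub = Some s \<and> V (-1) 0 0 (-1) 0 1 \<in> set (map snd s)"
    unfolding ex_Some_eq by code_simp
  then show "reach_words (V (-1) 0 0 (-1) 0 1)"
    using reach_words_walk by (metis set_map)
qed

lemma reach_g_init: "reach_g (V 1 0 0 0 0 0)"
  using reach.start by (rule reach_gI) (simp add: start_def T0_def)

lemma reach_g_walk:
  assumes "walk K0 js (snd (T0 ())) = Some s" "g \<in> snd ` set s"
  shows "reach_g g"
proof -
  have "lang K0 []" by simp
  from reach_walk[OF assms(1) this] have "reach (mset s)"
    using reach.start by (simp add: start_def act_simps)
  then show ?thesis using assms(2) by (intro reach_gI[of "mset s"]) (simp_all only: set_mset_mset)
qed

lemma reach_g_boundary: "reach_g (V (-1) 0 0 0 0 0)" "reach_g (V (-1) 0 1 0 0 0)"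
proof -
  have "\<exists>s. walk K0 [0, 1, 2, 0, 4, 5] (snd (T0 ())) = Some s \<and> V (-1) 0 0 0 0 0 \<in> set (map snd s)"
    unfolding ex_Some_eq by code_simp
  then show "reach_g (V (-1) 0 0 0 0 0)" using reach_g_walk by (metis set_map)
  have "\<exists>s. walk K0 [0, 5] (snd (T0 ())) = Some s \<and> V (-1) 0 1 0 0 0 \<in> set (map snd s)"
    unfolding ex_Some_eq by code_simp
  then show "reach_g (V (-1) 0 1 0 0 0)" using reach_g_walk by (metis set_map)
qed

lemma two_split:
  fixes g g' s :: int
  assumes "g + g' = s" "\<bar>g - g'\<bar> \<le> 1"
  shows "(g = s div 2 \<and> g' = (s + 1) div 2) \<or> (g = (s + 1) div 2 \<and> g' = s div 2)"
proof -
  have "g = g' \<or> g = g' + 1 \<or> g' = g + 1" using assms(2) by linarith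
  with assms(1) show ?thesis by auto
qed

lemma unit_slope_reach_words:
  assumes "std_gvec g" "slope_a g = 1" "slope_b g = 1"
  shows "reach_words g"
proof (cases g)
  case (V g1 g2 g3 g4 g5 g6)
  have s: "height g \<in> {-1, 0, 1}" "g1 + g4 = height g - 1" "g2 + g5 = 1 + height g" "g3 + g6 = - height g"
    and d: "\<bar>g1 - g4\<bar> \<le> 1" "\<bar>g2 - g5\<bar> \<le> 1" "\<bar>g3 - g6\<bar> \<le> 1"
    using assms by (auto simp: std_gvec_eq weak_gvec_eq V)
  note u = reach_words_unit_slope
  from s(1) consider "height g = -1" | "height g = 0" | "height g = 1" by auto
  then have "reach_words (V g1 g2 g3 g4 g5 g6)"
  proof cases
    case 1
    with two_split[OF s(2) d(1)] two_split[OF s(3) d(2)] two_split[OF s(4) d(3)] show ?thesis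
      using u(3) reach_words_swap(3)[OF u(3)] by auto
  next
    case 2
    note v = reach_words_swap(1)[OF u(1)]
    from 2 two_split[OF s(2) d(1)] two_split[OF s(3) d(2)] two_split[OF s(4) d(3)] show ?thesis
      using u(1) v reach_words_swap(2)[OF u(1)] reach_words_swap(2)[OF v] by auto
  next
    case 3
    with two_split[OF s(2) d(1)] two_split[OF s(3) d(2)] two_split[OF s(4) d(3)] show ?thesis
      using u(2) reach_words_swap(3)[OF u(2)] by auto
  qed
  then show ?thesis by (simp add: V)
qed

text \<open>Euclid's algorithm, with the inverses of \<open>La\<close> and \<open>Ra\<close> as steps.\<close>

lemma std_gvec_descent:
  assumes "std_gvec g" "0 < slope_a g" "0 < slope_b g"
  shows "\<exists>w h. set w \<subseteq> {La, Ra} \<and> g = foldr actg w h \<and> std_gvec h \<and> slope_a h = 1 \<and> slope_b h = 1"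
  using assms
proof (induction "nat (slope_a g + slope_b g)" arbitrary: g rule: less_induct)
  case less
  obtain g1 g2 g3 g4 g5 g6 where V: "g = V g1 g2 g3 g4 g5 g6" by (cases g)
  have cop: "coprime (slope_a g) (slope_b g)" using less.prems by (simp add: std_gvec_eq weak_gvec_eq)
  consider "slope_a g = slope_b g" | "slope_b g < slope_a g" | "slope_a g < slope_b g" by linarith
  then show ?case
  proof cases
    case 1
    then show ?thesis using less.prems cop by (intro exI[of _ "[]"] exI[of _ g]) auto
  next
    case 2
    \<comment> \<open>the preimage of \<open>g\<close> under \<open>La\<close>\<close>
    define h where "h = V g1 (- g6) (g2 + g3 + g6) g4 (- g3) (g3 + g5 + g6)"
    have g: "g = actg La h" by (simp add: h_def V)
    note sl = act_slope(1,2)[of h, folded g]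
    have "std_gvec h" using less.prems 2
      by (auto simp: std_gvec_eq weak_gvec_eq g act_slope act_height act_balanced coprime_iff_gcd_eq_1)
    from less.hyps[OF _ this] obtain w k where "set w \<subseteq> {La, Ra}" "h = foldr actg w k" "std_gvec k" "slope_a k = 1" "slope_b k = 1"
      using 2 less.prems sl by auto
    then show ?thesis using g by (intro exI[of _ "La # w"] exI[of _ k]) auto
  next
    case 3
    \<comment> \<open>the preimage of \<open>g\<close> under \<open>Ra\<close>\<close>
    define h where "h = V (- g6) g2 (g1 + g3 + g6) (- g3) g5 (g3 + g4 + g6)"
    have g: "g = actg Ra h" by (simp add: h_def V)
    note sl = act_slope(3,4)[of h, folded g]
    have "std_gvec h" using less.prems 3
      by (auto simp: std_gvec_eq weak_gvec_eq g act_slope act_height act_balanced coprime_iff_gcd_eq_1)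
    from less.hyps[OF _ this] obtain w k where "set w \<subseteq> {La, Ra}" "h = foldr actg w k" "std_gvec k" "slope_a k = 1" "slope_b k = 1"
      using 3 less.prems sl by auto
    then show ?thesis using g by (intro exI[of _ "Ra # w"] exI[of _ k]) auto
  qed
qed

text \<open>
  Positive slopes are reached from slope \<open>1/1\<close>; the boundary slopes leave only a few vectors, which are permutations
  of \<open>e\<^sub>1\<close>, \<open>- e\<^sub>1\<close> and \<open>e\<^sub>3 - e\<^sub>1\<close>.
\<close>

lemma reach_g_if_std_gvec:
  assumes "std_gvec g"
  shows "reach_g g"
proof -
  obtain g1 g2 g3 g4 g5 g6 where V: "g = V g1 g2 g3 g4 g5 g6" by (cases g)
  have cop: "coprime (slope_a g) (slope_b g)" and ge: "0 \<le> slope_a g" "0 \<le> slope_b g"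
    and "\<bar>height g\<bar> \<le> 1" and bal: "balanced g"
    using assms by (auto simp: std_gvec_eq weak_gvec_eq)
  then have h: "height g \<in> {-1, 0, 1}" by auto
  have d: "\<bar>g1 - g4\<bar> \<le> 1" "\<bar>g2 - g5\<bar> \<le> 1" "\<bar>g3 - g6\<bar> \<le> 1"
    using bal by (simp_all add: V)
  have s: "g1 + g4 = height g - slope_b g" "g2 + g5 = slope_a g + height g" "g3 + g6 = slope_b g - slope_a g - height g"
    by (simp_all add: V)
  note two = two_split[OF s(1) d(1)] two_split[OF s(2) d(2)] two_split[OF s(3) d(3)]
  consider "0 < slope_a g" "0 < slope_b g" | "slope_a g = 0" | "slope_b g = 0" using ge by linarith
  then have "reach_g (V g1 g2 g3 g4 g5 g6)"
  proof cases
    case 1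
    from std_gvec_descent[OF assms this] show ?thesis
      using unit_slope_reach_words by (auto simp: reach_words_def simp flip: V)
  next
    case 2
    then have b: "slope_b g = 1" using cop ge by simp
    have e2: "reach_g (V 0 1 0 0 0 0)"
      using reach_g_init by (subst reach_g_rotate[of 0 1 0 0 0 0]) simp
    show ?thesis
    proof (cases "height g = 0")
      case True
      have "reach_g (V (-1) 0 0 0 0 1)" "reach_g (V 0 0 1 (-1) 0 0)" "reach_g (V 0 0 0 (-1) 0 1)"
        using reach_g_boundary(2) reach_g_swap(1)[of "-1" 0 1 0 0 0] reach_g_swap(1)[of "-1" 0 0 0 0 1]
          reach_g_swap(3)[of "-1" 0 1 0 0 0] by auto
      then show ?thesis using 2 b two True reach_g_boundary(2) by auto
    next
      case False
      then have "height g = 1" using assms h 2 by (auto simp: std_gvec_eq weak_gvec_eq)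
      then show ?thesis using 2 b two e2 reach_g_swap(2)[of 0 1 0 0 0 0] by auto
    qed
  next
    case 3
    then have a: "slope_a g = 1" using cop ge by simp
    show ?thesis
    proof (cases "height g = 0")
      case True
      have e: "reach_g (V 0 1 (-1) 0 0 0)"
        using reach_g_boundary(2) reach_g_rotate[of "-1" 0 1 0 0 0] reach_g_rotate[of 0 1 "-1" 0 0 0] by simp
      then have "reach_g (V 0 1 0 0 0 (-1))" "reach_g (V 0 0 (-1) 0 1 0)" "reach_g (V 0 0 0 0 1 (-1))"
        using reach_g_swap(2)[of 0 1 "-1" 0 0 0] reach_g_swap(2)[of 0 1 0 0 0 "-1"]
          reach_g_swap(3)[of 0 1 "-1" 0 0 0] by auto
      then show ?thesis using 3 a two True e by auto
    next
      case False
      then have "height g = -1" using assms h 3 by (auto simp: std_gvec_eq weak_gvec_eq)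
      then show ?thesis using 3 a two reach_g_boundary(1) reach_g_swap(1)[of "-1" 0 0 0 0 0] by auto
    qed
  qed
  then show ?thesis by (simp add: V)
qed

theorem reach_g_eq_gvec: "reach_g g \<longleftrightarrow> gvec g"
proof
  show "reach_g g \<Longrightarrow> gvec g" using patterned_gvec reach_patterned unfolding reach_g_def by blast
  have "reach_g (actg Ro g) = reach_g g" for g
    by (cases g) (simp add: actg.simps reach_g_rotate[symmetric])
  then show "gvec g \<Longrightarrow> reach_g g" using reach_g_if_std_gvec by (auto simp: gvec_def)
qed

section \<open>From seeds to multisets of pairs\<close>

abbreviation C_mat :: "int ^ 6 ^ 6" where
  "C_mat \<equiv> Finite_Cartesian_Product.transpose B_mat"

lemma exhaust_6:
  fixes x :: 6
  shows "x = 1 \<or> x = 2 \<or> x = 3 \<or> x = 4 \<or> x = 5 \<or> x = 6"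
proof (induct x)
  case (of_int z)
  then have "0 \<le> z" and "z < 6" by simp_all
  then have "z = 0 \<or> z = 1 \<or> z = 2 \<or> z = 3 \<or> z = 4 \<or> z = 5" by arith
  then show ?case by auto
qed

lemma forall_6: "(\<forall>i::6. P i) \<longleftrightarrow> P 1 \<and> P 2 \<and> P 3 \<and> P 4 \<and> P 5 \<and> P 6"
  by (metis exhaust_6)

lemma UNIV_6: "UNIV = {1, 2, 3, 4, 5, 6 :: 6}"
  using exhaust_6 by auto

lemma vector_6:
  "(vector [a, b, c, d, e, f] :: int ^ 6) $ 1 = a" "(vector [a, b, c, d, e, f] :: int ^ 6) $ 2 = b"
  "(vector [a, b, c, d, e, f] :: int ^ 6) $ 3 = c" "(vector [a, b, c, d, e, f] :: int ^ 6) $ 4 = d"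
  "(vector [a, b, c, d, e, f] :: int ^ 6) $ 5 = e" "(vector [a, b, c, d, e, f] :: int ^ 6) $ 6 = f"
  unfolding vector_def by simp_all

lemma rows_6:
  "(vector [a, b, c, d, e, f] :: int ^ 6 ^ 6) $ 1 = a" "(vector [a, b, c, d, e, f] :: int ^ 6 ^ 6) $ 2 = b"
  "(vector [a, b, c, d, e, f] :: int ^ 6 ^ 6) $ 3 = c" "(vector [a, b, c, d, e, f] :: int ^ 6 ^ 6) $ 4 = d"
  "(vector [a, b, c, d, e, f] :: int ^ 6 ^ 6) $ 5 = e" "(vector [a, b, c, d, e, f] :: int ^ 6 ^ 6) $ 6 = f"
  unfolding vector_def by simp_all

definition to_v6 :: "int ^ 6 \<Rightarrow> v6" where
  "to_v6 v = V (v $ 1) (v $ 2) (v $ 3) (v $ 4) (v $ 5) (v $ 6)"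

lemma to_v6_linear:
  "to_v6 (u + v) = to_v6 u + to_v6 v" "to_v6 (m *s u) = smul m (to_v6 u)" "to_v6 (- u) = - to_v6 u"
  "to_v6 (u - v) = to_v6 u - to_v6 v" "to_v6 0 = 0"
  by (simp_all add: to_v6_def zero_v6_def minus_v6_def)

lemma to_v6_sum: "finite A \<Longrightarrow> to_v6 (\<Sum>i\<in>A. f i) = (\<Sum>i\<in>A. to_v6 (f i))"
  by (induction A rule: finite_induct) (simp_all add: to_v6_linear)

lemma to_v6_eq_iff: "to_v6 u = to_v6 v \<longleftrightarrow> u = v"
  by (simp add: to_v6_def vec_eq_iff forall_6)

lemma to_v6_vector: "to_v6 (vector [a, b, c, d, e, f]) = V a b c d e f"
  by (simp only: to_v6_def vector_6)

lemma nonneg_to_v6: "nonneg (to_v6 u) \<longleftrightarrow> (\<forall>j. 0 \<le> u $ j)"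
  by (simp add: to_v6_def forall_6)

lemma to_v6_axis:
  "to_v6 (axis 1 1) = V 1 0 0 0 0 0" "to_v6 (axis 2 1) = V 0 1 0 0 0 0" "to_v6 (axis 3 1) = V 0 0 1 0 0 0"
  "to_v6 (axis 4 1) = V 0 0 0 1 0 0" "to_v6 (axis 5 1) = V 0 0 0 0 1 0" "to_v6 (axis 6 1) = V 0 0 0 0 0 1"
  by (simp_all add: to_v6_def axis_def)

text \<open>The matrix has rank two, and \<open>omega\<close> is the bilinear form that it defines.\<close>

lemma C_mat_omega: "C_mat $ i $ j = omega (to_v6 (axis i 1)) (to_v6 (axis j 1))"
proof -
  have "\<forall>i j. C_mat $ i $ j = omega (to_v6 (axis i 1)) (to_v6 (axis j 1))"
    unfolding forall_6 transpose_def B_mat_def to_v6_axis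
    by (simp only: vec_lambda_beta rows_6 vector_6 omega.simps) simp
  then show ?thesis by blast
qed

lemma omega_skew: "omega c c' = - omega c' c"
  by (simp add: omega_eq)

lemma omega_add_smul:
  "omega (c + smul m d) c' = omega c c' + m * omega d c'" "omega c' (c + smul m d) = omega c' c + m * omega c' d"
proof -
  have "px (c + smul m d) = px c + m * px d" "py (c + smul m d) = py c + m * py d"
    by (cases c; cases d; simp add: algebra_simps)+
  then show "omega (c + smul m d) c' = omega c c' + m * omega d c'" "omega c' (c + smul m d) = omega c' c + m * omega c' d"
    by (simp_all add: omega_eq algebra_simps)
qed

lemma omega_minus: "omega (- c) c' = - omega c c'" "omega c' (- c) = - omega c' c"
  by (cases c; cases c'; simp add: algebra_simps)+

lemma omega_same: "omega c c = 0"
  by (simp add: omega_eq)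

lemma skew_C_mat: "skew C_mat"
  unfolding skew_def C_mat_omega using omega_skew by blast

text \<open>
  The exchange matrix of a seed is determined by its coefficients.
\<close>

definition compatible :: "6 seed \<Rightarrow> bool" where
  "compatible s \<longleftrightarrow> (\<forall>i j. exch_mat s $ i $ j = omega (to_v6 (coeffs s i)) (to_v6 (coeffs s j)))"

definition seed_mset :: "6 seed \<Rightarrow> (6 \<Rightarrow> int ^ 6) \<Rightarrow> vec_pair multiset" where
  "seed_mset s G = image_mset (\<lambda>i. (to_v6 (coeffs s i), to_v6 (G i))) (mset_set UNIV)"

text \<open>
  With \<open>c\<^sub>i' = c\<^sub>i + [e b\<^sub>k\<^sub>i]\<^sub>+ c\<^sub>k\<close> one gets \<open>\<omega>(c\<^sub>i', c\<^sub>j') = b\<^sub>i\<^sub>j + [e b\<^sub>k\<^sub>j]\<^sub>+ b\<^sub>i\<^sub>k + [e b\<^sub>k\<^sub>i]\<^sub>+ b\<^sub>k\<^sub>j\<close> from \<open>\<omega>(c\<^sub>k, c\<^sub>k) = 0\<close>,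
  which is matrix mutation.  The rest is the rule for \<open>c\<close> and \<open>g\<close> in terms of pairs.
\<close>

lemma seed_mset_mutate:
  assumes s: "s \<in> seeds C_mat" and G: "graded_seed C_mat s G" and comp: "compatible s"
    and e: "e = 1 \<or> e = -1" and sign: "nonneg (smul e (to_v6 (coeffs s k)))"
  shows "\<exists>G'. graded_seed C_mat (mutate k s) G' \<and> compatible (mutate k s) \<and>
    seed_mset (mutate k s) G' = mutate_mset e (to_v6 (coeffs s k), to_v6 (G k)) (seed_mset s G)"
proof -
  let ?c = "\<lambda>i. to_v6 (coeffs s i)" and ?b = "exch_mat s"
  let ?p = "(?c k, to_v6 (G k))"
  define G' where "G' = G(k := (\<Sum>i\<in>UNIV. [e * ?b $ k $ i]\<^sub>+ *s G i) - G k)"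
  have "0 \<le> e * coeffs s k $ j" for j
    using sign unfolding to_v6_linear(2)[symmetric] nonneg_to_v6 by simp
  note gm = graded_mutate[OF s skew_C_mat G e this, folded G'_def]
  have b: "?b $ i $ j = omega (?c i) (?c j)" for i j using comp by (simp add: compatible_def)
  have c': "to_v6 (coeffs (mutate k s) j) = (if j = k then - ?c k else ?c j + smul [e * ?b $ k $ j]\<^sub>+ (?c k))" for j
    unfolding gm(2) by (simp add: to_v6_linear)
  have compat: "compatible (mutate k s)"
    unfolding compatible_def
  proof safe
    fix i j
    show "exch_mat (mutate k s) $ i $ j = omega (to_v6 (coeffs (mutate k s) i)) (to_v6 (coeffs (mutate k s) j))"
    proof (cases "i = k \<or> j = k")
      case True
      then show ?thesis
        by (auto simp: c' mutate_simps(1) mutate_mat_nth b omega_minus omega_add_smul omega_same)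
    next
      case False
      have ki: "?b $ k $ i = - (?b $ i $ k)" using b omega_skew by metis
      have "omega (to_v6 (coeffs (mutate k s) i)) (to_v6 (coeffs (mutate k s) j)) =
          ?b $ i $ j + [e * ?b $ k $ j]\<^sub>+ * ?b $ i $ k + [e * ?b $ k $ i]\<^sub>+ * ?b $ k $ j"
        using False by (simp add: c' omega_add_smul omega_same flip: b)
      also have "\<dots> = ?b $ i $ j + (?b $ i $ k * [?b $ k $ j]\<^sub>+ + ?b $ k $ j * [- (?b $ i $ k)]\<^sub>+)"
        using e unfolding ki by (auto simp: pos_part_def max_def algebra_simps)
      finally show ?thesis
        using False by (simp add: mutate_simps(1) mutate_mat_nth mutate_mat_entry_eq)
    qed
  qed
  let ?F = "\<lambda>i. (?c i, to_v6 (G i))"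
  have w: "weight e ?p (?F i) = [e * ?b $ k $ i]\<^sub>+" for i
    by (simp add: weight_def pos_part_def b)
  have U: "mset_set (UNIV :: 6 set) = add_mset k (mset_set (UNIV - {k}))"
    by (metis finite_code insert_Diff_single insert_UNIV mset_set.insert_remove)
  have "seed_mset (mutate k s) G' = add_mset (- ?c k, to_v6 (G' k))
      (image_mset (\<lambda>i. (?c i + smul [e * ?b $ k $ i]\<^sub>+ (?c k), to_v6 (G i))) (mset_set (UNIV - {k})))"
    unfolding seed_mset_def U by (auto simp: c' G'_def intro!: image_mset_cong)
  also have "to_v6 (G' k) = (\<Sum>i\<in>UNIV. smul [e * ?b $ k $ i]\<^sub>+ (to_v6 (G i))) - to_v6 (G k)"
    by (simp add: G'_def to_v6_linear to_v6_sum)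
  also have "add_mset (- ?c k, (\<Sum>i\<in>UNIV. smul [e * ?b $ k $ i]\<^sub>+ (to_v6 (G i))) - to_v6 (G k))
      (image_mset (\<lambda>i. (?c i + smul [e * ?b $ k $ i]\<^sub>+ (?c k), to_v6 (G i))) (mset_set (UNIV - {k}))) =
      mutate_mset e ?p (seed_mset s G)"
  proof -
    have "seed_mset s G - {#?p#} = image_mset ?F (mset_set (UNIV - {k}))"
      unfolding seed_mset_def U by simp
    moreover have "(\<Sum>q\<in>#seed_mset s G. smul (weight e ?p q) (snd q)) = (\<Sum>i\<in>UNIV. smul [e * ?b $ k $ i]\<^sub>+ (to_v6 (G i)))"
      unfolding seed_mset_def by (simp add: multiset.map_comp comp_def w sum_unfold_sum_mset)
    ultimately show ?thesis
      unfolding mutate_mset_def by (simp add: multiset.map_comp comp_def w)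
  qed
  finally show ?thesis using gm(1) compat by blast
qed

definition modelled :: "vec_pair multiset \<Rightarrow> 6 seed \<Rightarrow> bool" where
  "modelled M s \<longleftrightarrow> (\<exists>G. graded_seed C_mat s G \<and> compatible s \<and> M = seed_mset s G)"

lemma modelled_initial: "modelled start (initial_seed C_mat)"
proof -
  have U: "mset_set (UNIV :: 6 set) = {#1, 2, 3, 4, 5, 6#}"
    unfolding UNIV_6 by simp
  have "compatible (initial_seed C_mat)"
    by (simp add: compatible_def initial_seed_simps C_mat_omega)
  moreover have "start = seed_mset (initial_seed C_mat) (\<lambda>i. axis i 1)"
    unfolding seed_mset_def U by (simp add: initial_seed_simps to_v6_axis start_def T0_def)
  ultimately show ?thesis using graded_initial_seed[of C_mat] unfolding modelled_def by blast
qed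

text \<open>Sign-coherence, known for the multiset, makes the mutation rule applicable to the seed.\<close>

lemma modelled_mutate:
  assumes "s \<in> seeds C_mat" "modelled M s" "reach M"
  shows "\<exists>M'. reach M' \<and> modelled M' (mutate k s)"
proof -
  obtain G where G: "graded_seed C_mat s G" "compatible s" "M = seed_mset s G"
    using assms(2) by (auto simp: modelled_def)
  let ?p = "(to_v6 (coeffs s k), to_v6 (G k))"
  have p: "?p \<in># M" by (simp add: G(3) seed_mset_def)
  obtain e where e: "e \<in> {1, -1}" "nonneg (smul e (fst ?p))"
    using patterned_mutation[OF reach_patterned[OF assms(3)] p] by blast
  then obtain G' where "graded_seed C_mat (mutate k s) G'" "compatible (mutate k s)"
      "seed_mset (mutate k s) G' = mutate_mset e ?p M"
    using seed_mset_mutate[OF assms(1) G(1,2), of e k] G(3) by auto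
  with reach.step[OF assms(3) p e] show ?thesis unfolding modelled_def by metis
qed

lemma modelled_reach: "reach M \<Longrightarrow> \<exists>s\<in>seeds C_mat. modelled M s"
proof (induction rule: reach.induct)
  case start
  then show ?case using modelled_initial seeds.initial by blast
next
  case (step M p e)
  then obtain s G where s: "s \<in> seeds C_mat" and G: "graded_seed C_mat s G" "compatible s" "M = seed_mset s G"
    by (auto simp: modelled_def)
  from step.hyps(2) obtain k where k: "p = (to_v6 (coeffs s k), to_v6 (G k))"
    by (auto simp: G(3) seed_mset_def)
  obtain G' where "graded_seed C_mat (mutate k s) G'" "compatible (mutate k s)" "seed_mset (mutate k s) G' = mutate_mset e p M"
    using seed_mset_mutate[OF s G(1,2), of e k] step.hyps(3,4) k G(3) by auto
  then show ?case using seeds.mutation[OF s, of k] unfolding modelled_def by metis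
qed

lemma reach_modelled: "s \<in> seeds C_mat \<Longrightarrow> \<exists>M. reach M \<and> modelled M s"
proof (induction rule: seeds.induct)
  case initial
  then show ?case using modelled_initial reach.start by blast
next
  case (mutation s k)
  then show ?case using modelled_mutate by blast
qed

lemma modelled_g_vectors:
  assumes "s \<in> seeds C_mat" "modelled M s"
  shows "snd ` set_mset M = {to_v6 (g_vector C_mat (cluster s i)) | i. True}"
proof -
  obtain G where G: "graded_seed C_mat s G" "M = seed_mset s G"
    using assms(2) by (auto simp: modelled_def)
  have "g_vector C_mat (cluster s i) = G i" for i
    by (rule g_vector_graded_seed[OF assms(1) skew_C_mat G(1)])
  then show ?thesis by (auto simp: G(2) seed_mset_def image_iff)
qed

theorem to_v6_g_vectors: "g \<in> g_vector C_mat ` cluster_variables C_mat \<longleftrightarrow> gvec (to_v6 g)"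
proof -
  have "g \<in> g_vector C_mat ` cluster_variables C_mat \<longleftrightarrow>
      (\<exists>s\<in>seeds C_mat. \<exists>i. to_v6 g = to_v6 (g_vector C_mat (cluster s i)))"
    unfolding to_v6_eq_iff cluster_variables_def by auto
  also have "\<dots> \<longleftrightarrow> (\<exists>M. reach M \<and> to_v6 g \<in> snd ` set_mset M)"
    using modelled_g_vectors modelled_reach reach_modelled by blast
  also have "\<dots> \<longleftrightarrow> reach_g (to_v6 g)" unfolding reach_g_def image_iff by metis
  finally show ?thesis by (simp add: reach_g_eq_gvec)
qed

section \<open>The list of vectors\<close>

definition formulas :: "int \<Rightarrow> int \<Rightarrow> (int ^ 6) set" where
  "formulas b a = {vector [- ((b - 1) div 2), a div 2 + 1, (b - a) div 2,
                    - (b div 2), (a + 1) div 2, (b - a - 1) div 2],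
            vector [- (a div 2) - 1, (b - 1) div 2, (a - b + 1) div 2,
                    - ((a + 1) div 2), b div 2, (a - b) div 2 + 1],
            vector [- (b div 2), (a + 1) div 2, (b - a + 1) div 2,
                    - ((b + 1) div 2), a div 2, (b - a) div 2]}"

definition listed :: "(int ^ 6) set" where
  "listed = {permute_coords \<sigma> v | \<sigma> v a b. \<sigma> \<in> perm_group \<and> standard_form b a \<and> positive_slope b a \<and> v \<in> formulas b a}"

lemma standard_positive: "standard_form b a \<and> positive_slope b a \<longleftrightarrow> 0 \<le> a \<and> 0 < b \<and> coprime a b"
proof (cases "a = 0")
  case True
  then show ?thesis by (auto simp: standard_form_def positive_slope_def)
next
  case False
  have "0 < rat_of_int b / rat_of_int a \<longleftrightarrow> 0 < b" if "0 < a"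
    using that by (simp add: zero_less_divide_iff)
  with False show ?thesis by (auto simp: standard_form_def positive_slope_def coprime_iff_gcd_eq_1)
qed

text \<open>These rules express all halves by those of \<open>a\<close>, \<open>b\<close>, \<open>a - b\<close> and \<open>b - a\<close>, with bounds for linear arithmetic.\<close>

lemma half:
  "(x + 1) div 2 = x - x div 2" "(x - 1) div 2 = x - 1 - x div 2" "0 \<le> x - 2 * (x div 2)" "x - 2 * (x div 2) \<le> 1"
  for x :: int by presburger+

lemma formulas_gvec:
  assumes "0 \<le> a" "0 < b" "coprime a b" "v \<in> formulas b a"
  shows "gvec (to_v6 v)"
proof -
  note halves = half(3,4)[of a] half(3,4)[of b] half(3,4)[of "a - b"] half(3,4)[of "b - a"]
  from assms(4) consider
      (1) "to_v6 v = V (- (b - 1 - b div 2)) (a div 2 + 1) ((b - a) div 2) (- (b div 2)) (a - a div 2) (b - a - 1 - (b - a) div 2)"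
    | (2) "to_v6 v = V (- (a div 2) - 1) (b - 1 - b div 2) (a - b - (a - b) div 2) (- (a - a div 2)) (b div 2) ((a - b) div 2 + 1)"
    | (3) "to_v6 v = V (- (b div 2)) (a - a div 2) (b - a - (b - a) div 2) (- (b - b div 2)) (a div 2) ((b - a) div 2)"
    by (auto simp: formulas_def to_v6_vector half)
  then have "std_gvec (to_v6 v)"
  proof cases
    case 1
    have "height (to_v6 v) = 1" "slope_a (to_v6 v) = a" "slope_b (to_v6 v) = b" "balanced (to_v6 v)"
      unfolding 1 using halves by (simp_all add: abs_le_iff)
    then show ?thesis using assms by (simp add: std_gvec_eq weak_gvec_eq)
  next
    case 2
    have "height (to_v6 v) = -1" "slope_a (to_v6 v) = b" "slope_b (to_v6 v) = a" "balanced (to_v6 v)"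
      unfolding 2 using halves by (simp_all add: abs_le_iff)
    then show ?thesis using assms by (simp add: std_gvec_eq weak_gvec_eq coprime_commute)
  next
    case 3
    have "height (to_v6 v) = 0" "slope_a (to_v6 v) = a" "slope_b (to_v6 v) = b" "balanced (to_v6 v)"
      unfolding 3 using halves by (simp_all add: abs_le_iff)
    then show ?thesis using assms by (simp add: std_gvec_eq weak_gvec_eq)
  qed
  then show ?thesis by (simp add: gvec_def)
qed

definition perm_generators :: "(6 \<Rightarrow> 6) set" where
  "perm_generators = {cycle_of_list [1, 4], cycle_of_list [2, 5], cycle_of_list [3, 6],
      cycle_of_list [1, 2, 3] \<circ> cycle_of_list [4, 5, 6]}"

lemma perm_group_eq: "perm_group = generate (BijGroup UNIV) perm_generators"
  by (simp only: perm_group_def perm_generators_def)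

lemma permute_generators:
  "to_v6 (permute_coords (cycle_of_list [1, 4]) v) = actc S1 (to_v6 v)"
  "to_v6 (permute_coords (cycle_of_list [2, 5]) v) = actc S2 (to_v6 v)"
  "to_v6 (permute_coords (cycle_of_list [3, 6]) v) = actc S3 (to_v6 v)"
  "to_v6 (permute_coords (cycle_of_list [1, 2, 3] \<circ> cycle_of_list [4, 5, 6]) v) = actc Ro (to_v6 v)"
  by (simp_all add: permute_coords_def to_v6_def Transposition.transpose_def)

lemma permute_coords_comp: "permute_coords (\<sigma> \<circ> \<tau>) v = permute_coords \<tau> (permute_coords \<sigma> v)"
  by (simp add: permute_coords_def)

lemma permute_coords_id: "permute_coords id v = v"
  by (simp add: permute_coords_def)

lemma carrier_BijGroup_UNIV: "carrier (BijGroup UNIV) = {f. bij f}"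
  by (simp add: BijGroup_def Bij_def)

lemma mult_BijGroup_UNIV: "bij f \<Longrightarrow> bij g \<Longrightarrow> f \<otimes>\<^bsub>BijGroup UNIV\<^esub> g = f \<circ> g"
  by (auto simp: BijGroup_def Bij_def compose_def fun_eq_iff)

lemma one_BijGroup_UNIV: "\<one>\<^bsub>BijGroup UNIV\<^esub> = id"
  by (auto simp: BijGroup_def)

lemma perm_generators_bij: "\<sigma> \<in> perm_generators \<Longrightarrow> bij \<sigma>"
  by (auto simp: perm_generators_def intro!: bij_comp)

lemma perm_group_bij: "\<sigma> \<in> perm_group \<Longrightarrow> bij \<sigma>"
  using group.generate_in_carrier[OF group_BijGroup, of perm_generators UNIV \<sigma>] perm_generators_bij
  by (auto simp: perm_group_eq carrier_BijGroup_UNIV)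

lemma perm_group_comp: "\<sigma> \<in> perm_group \<Longrightarrow> \<tau> \<in> perm_generators \<Longrightarrow> \<sigma> \<circ> \<tau> \<in> perm_group"
  using generate.eng[of \<sigma> "BijGroup UNIV" perm_generators \<tau>] generate.incl[of \<tau> perm_generators "BijGroup UNIV"]
    mult_BijGroup_UNIV[of \<sigma> \<tau>] perm_group_bij[of \<sigma>] perm_generators_bij[of \<tau>]
  by (simp add: perm_group_eq)

lemma gvec_generators:
  assumes "\<sigma> \<in> perm_generators"
  shows "gvec (to_v6 (permute_coords \<sigma> v)) = gvec (to_v6 v)"
proof -
  have "gvec (actc x g) = gvec g" if "x \<in> {Ro, S1, S2, S3}" for x g
    using gvec_sym[of x g] that by (auto simp: actg.simps)
  then show ?thesis using assms by (auto simp: perm_generators_def permute_generators simp del: actc.simps cycle_of_list.simps)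
qed

text \<open>
  The shape is invariant under the generators in both directions, which covers their inverses.
\<close>

lemma gvec_permute:
  assumes "\<sigma> \<in> perm_group"
  shows "gvec (to_v6 (permute_coords \<sigma> v)) = gvec (to_v6 v)"
  using assms unfolding perm_group_eq
proof (induction arbitrary: v rule: generate.induct)
  case one
  then show ?case unfolding one_BijGroup_UNIV permute_coords_id ..
next
  case (incl h)
  then show ?case by (rule gvec_generators)
next
  case (inv h)
  let ?i = "inv\<^bsub>BijGroup UNIV\<^esub> h"
  have h: "bij h" by (rule perm_generators_bij[OF inv])
  have i: "bij ?i"
    using group.inv_closed[OF group_BijGroup, of h UNIV] h by (simp add: carrier_BijGroup_UNIV)
  have "?i \<circ> h = id"
    using group.l_inv[OF group_BijGroup, of h UNIV] h i
    by (simp add: carrier_BijGroup_UNIV mult_BijGroup_UNIV one_BijGroup_UNIV)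
  then have "permute_coords h (permute_coords ?i v) = v"
    by (simp flip: permute_coords_comp add: permute_coords_id)
  then show ?case using gvec_generators[OF inv, of "permute_coords ?i v"] by simp
next
  case (eng h1 h2)
  have "bij h1" "bij h2" using eng.hyps perm_group_bij by (auto simp: perm_group_eq)
  show ?case unfolding mult_BijGroup_UNIV[OF \<open>bij h1\<close> \<open>bij h2\<close>] permute_coords_comp eng.IH ..
qed

abbreviation listed6 :: "v6 \<Rightarrow> bool" where
  "listed6 g \<equiv> g \<in> to_v6 ` listed"

lemma listed6_generator:
  assumes "listed6 g" "x \<in> {Ro, S1, S2, S3}"
  shows "listed6 (actc x g)"
proof -
  obtain v where v: "v \<in> listed" "g = to_v6 v" using assms(1) by blast
  have "permute_coords \<tau> v \<in> listed" if "\<tau> \<in> perm_generators" for \<tau>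
  proof -
    from v(1) obtain \<sigma> u a b where u: "v = permute_coords \<sigma> u" "\<sigma> \<in> perm_group"
      "standard_form b a \<and> positive_slope b a \<and> u \<in> formulas b a" by (auto simp: listed_def)
    then have "permute_coords \<tau> v = permute_coords (\<sigma> \<circ> \<tau>) u" by (simp add: permute_coords_comp)
    with u that perm_group_comp show ?thesis unfolding listed_def by blast
  qed
  moreover obtain \<tau> where "\<tau> \<in> perm_generators" "to_v6 (permute_coords \<tau> v) = actc x (to_v6 v)"
    using assms(2) permute_generators[of v] unfolding perm_generators_def by blast
  ultimately show ?thesis using v(2) by (metis imageI)
qed

lemma listed6_swaps:
  assumes "listed6 (V g1 g2 g3 g4 g5 g6)"
    "(x1, x4) = (g1, g4) \<or> (x1, x4) = (g4, g1)" "(x2, x5) = (g2, g5) \<or> (x2, x5) = (g5, g2)"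
    "(x3, x6) = (g3, g6) \<or> (x3, x6) = (g6, g3)"
  shows "listed6 (V x1 x2 x3 x4 x5 x6)"
proof -
  have 1: "listed6 (V x1 g2 g3 x4 g5 g6)"
    using assms(1,2) listed6_generator[OF assms(1), of S1] by auto
  have 2: "listed6 (V x1 x2 g3 x4 x5 g6)"
    using 1 assms(3) listed6_generator[OF 1, of S2] by auto
  show ?thesis
    using 2 assms(4) listed6_generator[OF 2, of S3] by auto
qed

lemma listed6_formulas:
  assumes "0 \<le> a" "0 < b" "coprime a b"
  shows "listed6 (V (- (b - 1 - b div 2)) (a div 2 + 1) ((b - a) div 2) (- (b div 2)) (a - a div 2) (b - a - 1 - (b - a) div 2))"
    "listed6 (V (- (a div 2) - 1) (b - 1 - b div 2) (a - b - (a - b) div 2) (- (a - a div 2)) (b div 2) ((a - b) div 2 + 1))"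
    "listed6 (V (- (b div 2)) (a - a div 2) (b - a - (b - a) div 2) (- (b - b div 2)) (a div 2) ((b - a) div 2))"
proof -
  have "id \<in> perm_group"
    using generate.one[of "BijGroup UNIV" perm_generators] by (simp add: perm_group_eq one_BijGroup_UNIV)
  then have L: "to_v6 v \<in> to_v6 ` listed" if "v \<in> formulas b a" for v
  proof -
    have "permute_coords id v \<in> listed"
      using that assms standard_positive[of b a] \<open>id \<in> perm_group\<close> unfolding listed_def by blast
    then show ?thesis by (simp only: permute_coords_id imageI)
  qed
  have "\<forall>v\<in>formulas b a. listed6 (to_v6 v)" using L by blast
  then show
    "listed6 (V (- (b - 1 - b div 2)) (a div 2 + 1) ((b - a) div 2) (- (b div 2)) (a - a div 2) (b - a - 1 - (b - a) div 2))"
    "listed6 (V (- (a div 2) - 1) (b - 1 - b div 2) (a - b - (a - b) div 2) (- (a - a div 2)) (b div 2) ((a - b) div 2 + 1))"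
    "listed6 (V (- (b div 2)) (a - a div 2) (b - a - (b - a) div 2) (- (b - b div 2)) (a div 2) ((b - a) div 2))"
    by (simp_all only: formulas_def ball_simps half to_v6_vector)
qed

text \<open>Two integers that differ by at most one are determined by their sum, up to order.\<close>

lemma same_split:
  fixes g g' x x' :: int
  assumes "g + g' = x + x'" "\<bar>g - g'\<bar> \<le> 1" "\<bar>x - x'\<bar> \<le> 1"
  shows "(g, g') = (x, x') \<or> (g, g') = (x', x)"
proof -
  have "g = x \<or> g = x'" using assms by linarith
  with assms(1) show ?thesis by auto
qed

text \<open>
  The height selects the formula.  For height \<open>-1\<close> the second formula is used with \<open>a\<close> and \<open>b\<close> exchanged.
  For slope \<open>0\<close> and height \<open>0\<close> the vector \<open>e\<^sub>2 - e\<^sub>3\<close> is a rotation of the vector \<open>e\<^sub>3 - e\<^sub>1\<close> at slope \<open>\<infinity>\<close>.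
\<close>

lemma listed6_if_std_gvec:
  assumes "std_gvec g"
  shows "listed6 g"
proof -
  obtain g1 g2 g3 g4 g5 g6 where V: "g = V g1 g2 g3 g4 g5 g6" by (cases g)
  define a b where "a = slope_a g" and "b = slope_b g"
  have cop: "coprime a b" and ge: "0 \<le> a" "0 \<le> b" and h: "\<bar>height g\<bar> \<le> 1" and bal: "balanced g"
    using assms by (auto simp: std_gvec_eq weak_gvec_eq a_def b_def)
  have d: "\<bar>g1 - g4\<bar> \<le> 1" "\<bar>g2 - g5\<bar> \<le> 1" "\<bar>g3 - g6\<bar> \<le> 1"
    using bal by (simp_all add: V)
  have s: "g1 + g4 = height g - b" "g2 + g5 = a + height g" "g3 + g6 = b - a - height g"
    by (simp_all add: V a_def b_def)
  define p q r t where pqrt: "p = a div 2" "q = b div 2" "r = (b - a) div 2" "t = (a - b) div 2"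
  note halves = half(3,4)[of a] half(3,4)[of b] half(3,4)[of "a - b"] half(3,4)[of "b - a"]
  note halves = halves[folded pqrt]
  consider "height g = 0" | "height g = 1" | "height g = -1" using h by linarith
  then have "listed6 (V g1 g2 g3 g4 g5 g6)"
  proof cases
    case 1
    show ?thesis
    proof (cases "b = 0")
      case True
      then have a: "a = 1" using cop ge by simp
      have "listed6 (V (- 1) 0 1 0 0 0)"
        by (rule listed6_swaps[OF listed6_formulas(3)[of 0 1]]) simp_all
      from listed6_generator[OF this, of Ro] have "listed6 (V 0 1 (- 1) 0 0 0)" by simp
      then show ?thesis
        by (rule listed6_swaps) (use s d 1 True a in auto)
    next
      case False
      then have "0 < b" using ge by simp
      from listed6_formulas(3)[OF ge(1) this cop, folded pqrt] show ?thesis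
        by (rule listed6_swaps) (rule same_split; (use s 1 in linarith | use d in blast | use halves in linarith))+
    qed
  next
    case 2
    then have "b \<noteq> 0" using assms by (auto simp: std_gvec_eq b_def)
    then have "0 < b" using ge by simp
    from listed6_formulas(1)[OF ge(1) this cop, folded pqrt] show ?thesis
      by (rule listed6_swaps) (rule same_split; (use s 2 in linarith | use d in blast | use halves in linarith))+
  next
    case 3
    then have "a \<noteq> 0" using assms by (auto simp: std_gvec_eq weak_gvec_eq a_def)
    then have "0 < a" using ge by simp
    from listed6_formulas(2)[OF ge(2) this coprime_commute[THEN iffD1, OF cop], folded pqrt] show ?thesis
      by (rule listed6_swaps) (rule same_split; (use s 3 in linarith | use d in blast | use halves in linarith))+
  qed
  then show ?thesis by (simp add: V)
qed

lemma listed6_eq_gvec: "listed6 g \<longleftrightarrow> gvec g"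
proof
  assume "listed6 g"
  then obtain \<sigma> v a b where "g = to_v6 (permute_coords \<sigma> v)" "\<sigma> \<in> perm_group"
      "standard_form b a \<and> positive_slope b a" "v \<in> formulas b a"
    unfolding listed_def by blast
  then show "gvec g"
    unfolding standard_positive by (metis gvec_permute formulas_gvec)
next
  assume "gvec g"
  then consider "listed6 g" | "listed6 (actc Ro g)" | "listed6 (actc Ro (actc Ro g))"
    unfolding gvec_def actg.simps using listed6_if_std_gvec by blast
  then show "listed6 g"
  proof cases
    case 2
    from listed6_generator[OF listed6_generator[OF this, of Ro], of Ro] show ?thesis by (cases g) simp
  next
    case 3
    from listed6_generator[OF this, of Ro] show ?thesis by (cases g) simp
  qed
qed

theorem theorem1p4:
  shows "g_vector (Finite_Cartesian_Product.transpose B_mat) `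
           cluster_variables (Finite_Cartesian_Product.transpose B_mat) =
    {permute_coords \<sigma> v | (\<sigma> :: 6 \<Rightarrow> 6) (v :: int ^ 6) (a :: int) (b :: int).
       \<sigma> \<in> perm_group \<and> standard_form b a \<and> positive_slope b a \<and>
       v \<in> {vector [- ((b - 1) div 2), a div 2 + 1, (b - a) div 2,
                    - (b div 2), (a + 1) div 2, (b - a - 1) div 2],
            vector [- (a div 2) - 1, (b - 1) div 2, (a - b + 1) div 2,
                    - ((a + 1) div 2), b div 2, (a - b) div 2 + 1],
            vector [- (b div 2), (a + 1) div 2, (b - a + 1) div 2,
                    - ((b + 1) div 2), a div 2, (b - a) div 2]}}"
proof -
  have "g_vector C_mat ` cluster_variables C_mat = listed"
  proof (rule Set.set_eqI)
    fix g
    have "g \<in> g_vector C_mat ` cluster_variables C_mat \<longleftrightarrow> listed6 (to_v6 g)"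
      by (simp only: to_v6_g_vectors listed6_eq_gvec)
    then show "g \<in> g_vector C_mat ` cluster_variables C_mat \<longleftrightarrow> g \<in> listed"
      by (simp add: image_iff to_v6_eq_iff)
  qed
  then show ?thesis unfolding listed_def formulas_def .
qed

end
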